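(* Let $0<\alpha<1$, $\mu\in{}^{-\alpha}H(0,T)$, and $f,\theta\in L^2(\Omega)$ with $$\int_\Omega\theta(x)f(x)\,dx\ne0.$$ Let $u\in L^2(0,T;L^2(\Omega))\cap{}^{-\alpha}H(0,T;H^2(\Omega)\cap H^1_0(\Omega))$ be the (unique) solution of $$\partial_t^\alpha u+Au=\mu(t)f(x)\quad\text{in }{}^{-\alpha}H(0,T;L^2(\Omega)).$$ If $$\int_\Omega\theta(x)u(x,t)\,dx=0,\quad 0<t<T,$$ then $\mu=0$ in ${}^{-\alpha}H(0,T)$.
   Context: Let $T>0$ and let $\Omega\subset\mathbb{R}^d$ be a bounded domain with smooth boundary. The operator $A$ in $L^2(\Omega)$ is $$-Av(x)=\sum_{i,j=1}^d\partial_i(a_{ij}(x)\partial_jv(x))+\sum_{j=1}^db_j(x)\partial_jv(x)+c(x)v(x),\qquad \mathcal{D}(A)=H^2(\Omega)\cap H^1_0(\Omega),$$ with $a_{ij}=a_{ji}$, $b_j$, $c\in C^1(\overline\Omega)$, $c\le0$ on $\Omega$, and there is $\kappa>0$ with $\sum_{i,j}a_{ij}(x)\xi_i\xi_j\ge\kappa\sum_j|\xi_j|^2$ for all $x\in\Omega$, $\xi\in\mathbb{R}^d$. For a Hilbert space $X$ and $0<\alpha<1$, let $(J^\alpha w)(t)=\frac1{\Gamma(\alpha)}\int_0^t(t-s)^{\alpha-1}w(s)ds$ for $w\in L^2(0,T;X)$. The space ${}^{-\alpha}H(0,T;X)$ is the completion of $L^2(0,T;X)$ in the norm $\|v\|_{{}^{-\alpha}H(0,T;X)}:=\|J^\alpha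 v\|_{L^2(0,T;X)}$; the extension of $J^\alpha$ by continuity is denoted $J_\alpha':{}^{-\alpha}H(0,T;X)\to L^2(0,T;X)$ and is an isometric isomorphism onto. ${}^{-\alpha}H(0,T):={}^{-\alpha}H(0,T;\mathbb{R})$; this is the dual, with pivot space $L^2(0,T)$, of ${}^{\alpha}H(0,T)=J_\alpha L^2(0,T)$, where $(J_\alpha v)(t)=\frac{1}{\Gamma(\alpha)}\int_t^T(\xi-t)^{\alpha-1}v(\xi)d\xi$, and $J_\alpha'$ is the dual operator of $J_\alpha$. The fractional derivative is $\partial_t^\alpha:=(J_\alpha')^{-1}:L^2(0,T;X)\to{}^{-\alpha}H(0,T;X)$. The element $\mu f\in{}^{-\alpha}H(0,T;L^2(\Omega))$ is defined by $J_\alpha'(\mu f)=(J_\alpha'\mu)f$, and for $u\in{}^{-\alpha}H(0,T;H^2(\Omega)\cap H^1_0(\Omega))$, $Au\in{}^{-\alpha}H(0,T;L^2(\Omega))$ is defined by $J_\alpha'(Au)=A(J_\alpha'u)$. It is known that the solution $u$ in the stated class exists and is unique. *)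

theory Defs
  imports "HOL-Analysis.Analysis"
begin

subsection \<open>The Hilbert space of square integrable functions\<close>


definition sq_integrable :: "('a::euclidean_space \<Rightarrow> real) \<Rightarrow> bool" where
  "sq_integrable f \<longleftrightarrow> f \<in> borel_measurable lebesgue \<and> integrable lebesgue (\<lambda>x. (f x)\<^sup>2)"

lemma sq_integrable_mult:
  assumes "sq_integrable f" "sq_integrable g"
  shows "integrable lebesgue (\<lambda>x. f x * g x)"
proof (rule Bochner_Integration.integrable_bound)
  show "integrable lebesgue (\<lambda>x. (f x)\<^sup>2 + (g x)\<^sup>2)"
    using assms by (auto simp: sq_integrable_def)
  show "(\<lambda>x. f x * g x) \<in> borel_measurable lebesgue"
    using assms by (auto simp: sq_integrable_def)
  have "\<bar>a * b\<bar> \<le> a\<^sup>2 + b\<^sup>2" for a b :: real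
  proof -
    have "2 * \<bar>a * b\<bar> \<le> a\<^sup>2 + b\<^sup>2"
      using sum_squares_bound[of "\<bar>a\<bar>" "\<bar>b\<bar>"] by (simp add: abs_mult)
    then show ?thesis by linarith
  qed
  then show "AE x in lebesgue. norm (f x * g x) \<le> norm ((f x)\<^sup>2 + (g x)\<^sup>2)"
    by auto
qed

lemma sq_integrable_dominated:
  assumes f: "sq_integrable f" and g: "g \<in> borel_measurable lebesgue"
    and le: "AE x in lebesgue. \<bar>g x\<bar> \<le> C * \<bar>f x\<bar>"
  shows "sq_integrable g"
  unfolding sq_integrable_def
proof
  show "integrable lebesgue (\<lambda>x. (g x)\<^sup>2)"
  proof (rule Bochner_Integration.integrable_bound)
    show "integrable lebesgue (\<lambda>x. C\<^sup>2 * (f x)\<^sup>2)"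
      using f by (auto simp: sq_integrable_def)
    show "AE x in lebesgue. norm ((g x)\<^sup>2) \<le> norm (C\<^sup>2 * (f x)\<^sup>2)"
      using le
    proof eventually_elim
      case (elim x)
      have "(g x)\<^sup>2 \<le> (C * \<bar>f x\<bar>)\<^sup>2" using power_mono[OF elim, of 2] by simp
      then show ?case by (simp add: power_mult_distrib)
    qed
  qed (use g in auto)
qed (rule g)

lemma sq_integrable_zero: "sq_integrable (\<lambda>x. 0)"
  by (simp add: sq_integrable_def)

lemma sq_integrable_add:
  assumes "sq_integrable f" "sq_integrable g"
  shows "sq_integrable (\<lambda>x. f x + g x)"
proof -
  have "integrable lebesgue (\<lambda>x. (f x)\<^sup>2 + (g x)\<^sup>2 + 2 * (f x * g x))"
    using assms sq_integrable_mult[OF assms] by (auto simp: sq_integrable_def)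
  then show ?thesis
    using assms by (auto simp: sq_integrable_def power2_sum mult.assoc)
qed

lemma sq_integrable_scale:
  assumes "sq_integrable f"
  shows "sq_integrable (\<lambda>x. r * f x)"
  using assms by (auto simp: sq_integrable_def power_mult_distrib)

lemma sq_integrable_diff:
  assumes "sq_integrable f" "sq_integrable g"
  shows "sq_integrable (\<lambda>x. f x - g x)"
  using sq_integrable_add[OF assms(1) sq_integrable_scale[OF assms(2), of "-1"]] by simp

text \<open>Square integrable functions up to equality almost everywhere, as a separable Hilbert space
  type, so that the Bochner integral of the library applies to functions with values in it.\<close>

quotient_type (overloaded) 'a L2 = "'a::euclidean_space \<Rightarrow> real" /
  partial: "\<lambda>f g. sq_integrable f \<and> sq_integrable g \<and> (AE x in lebesgue. f x = g x)"
proof (rule part_equivpI)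
  show "\<exists>f::'a \<Rightarrow> real. sq_integrable f \<and> sq_integrable f \<and> (AE x in lebesgue. f x = f x)"
    using sq_integrable_zero by auto
  show "symp (\<lambda>f g::'a \<Rightarrow> real. sq_integrable f \<and> sq_integrable g \<and> (AE x in lebesgue. f x = g x))"
    by (rule sympI) (auto elim: AE_mp)
  show "transp (\<lambda>f g::'a \<Rightarrow> real. sq_integrable f \<and> sq_integrable g \<and> (AE x in lebesgue. f x = g x))"
    by (rule transpI) (auto elim: AE_mp)
qed

instantiation L2 :: (euclidean_space) real_vector
begin

lift_definition zero_L2 :: "'a L2" is "\<lambda>x. 0"
  by (simp add: sq_integrable_zero)

lift_definition plus_L2 :: "'a L2 \<Rightarrow> 'a L2 \<Rightarrow> 'a L2" is "\<lambda>f g x. f x + g x"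
  by (auto intro: sq_integrable_add elim!: AE_mp)

lift_definition minus_L2 :: "'a L2 \<Rightarrow> 'a L2 \<Rightarrow> 'a L2" is "\<lambda>f g x. f x - g x"
  by (auto intro: sq_integrable_diff elim!: AE_mp)

lift_definition uminus_L2 :: "'a L2 \<Rightarrow> 'a L2" is "\<lambda>f x. - f x"
  using sq_integrable_scale[where r="-1"] by (auto elim!: AE_mp)

lift_definition scaleR_L2 :: "real \<Rightarrow> 'a L2 \<Rightarrow> 'a L2" is "\<lambda>r f x. r * f x"
  by (auto intro: sq_integrable_scale elim!: AE_mp)

instance
proof
  fix f g h :: "'a L2" and r s :: real
  show "f + g + h = f + (g + h)"
    by transfer (auto intro: sq_integrable_add simp: add.assoc)
  show "f + g = g + f"
    by transfer (auto intro: sq_integrable_add simp: add.commute)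
  show "0 + f = f" by transfer auto
  show "- f + f = 0" by transfer (auto simp: sq_integrable_zero)
  show "f - g = f + - g" 
    by transfer (use sq_integrable_diff in auto)
  show "r *\<^sub>R (f + g) = r *\<^sub>R f + r *\<^sub>R g"
    by transfer (auto intro!: sq_integrable_scale sq_integrable_add simp: distrib_left 
        simp flip: distrib_left)
  show "(r + s) *\<^sub>R f = r *\<^sub>R f + s *\<^sub>R f"
    by transfer (auto simp flip: distrib_right intro: sq_integrable_scale)
  show "r *\<^sub>R s *\<^sub>R f = (r * s) *\<^sub>R f"
    by transfer (auto simp: mult.assoc[symmetric] intro: sq_integrable_scale)
  show "1 *\<^sub>R f = f" by transfer auto
qed

end

instantiation L2 :: (euclidean_space) real_inner
begin

lift_definition inner_L2 :: "'a L2 \<Rightarrow> 'a L2 \<Rightarrow> real" is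
  "\<lambda>f g. LINT x|lebesgue. f x * g x"
  by (rule integral_cong_AE) (auto simp: sq_integrable_def)

definition norm_L2 :: "'a L2 \<Rightarrow> real" where
  "norm_L2 f = sqrt (inner f f)"

definition dist_L2 :: "'a L2 \<Rightarrow> 'a L2 \<Rightarrow> real" where
  "dist_L2 f g = norm (f - g)"

definition sgn_L2 :: "'a L2 \<Rightarrow> 'a L2" where
  "sgn_L2 f = f /\<^sub>R norm f"

definition uniformity_L2 :: "('a L2 \<times> 'a L2) filter" where
  "uniformity_L2 = (INF e\<in>{0 <..}. principal {(f, g). dist f g < e})"

definition open_L2 :: "'a L2 set \<Rightarrow> bool" where
  "open_L2 U \<longleftrightarrow> (\<forall>f\<in>U. \<forall>\<^sub>F (f', g) in uniformity. f' = f \<longrightarrow> g \<in> U)"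

instance
proof
  fix f g h :: "'a L2" and r :: real
  show "inner f g = inner g f"
    by transfer (simp add: mult.commute)
  show "inner (f + g) h = inner f h + inner g h"
    by transfer (simp add: distrib_right sq_integrable_mult)
  show "inner (r *\<^sub>R f) g = r * inner f g"
    by transfer (simp add: mult.assoc)
  show "0 \<le> inner f f"
    by transfer simp
  show "inner f f = 0 \<longleftrightarrow> f = 0"
  proof transfer
    fix f :: "'a \<Rightarrow> real"
    assume "sq_integrable f \<and> sq_integrable f \<and> (AE x in lebesgue. f x = f x)"
    then show "((LINT x|lebesgue. f x * f x) = 0) \<longleftrightarrow>
        (sq_integrable f \<and> sq_integrable (\<lambda>x. 0) \<and> (AE x in lebesgue. f x = 0))"
      using integral_nonneg_eq_0_iff_AE[of lebesgue "\<lambda>x. f x * f x"]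
      by (auto simp: sq_integrable_mult sq_integrable_zero)
  qed
qed (simp_all only: norm_L2_def dist_L2_def sgn_L2_def uniformity_L2_def open_L2_def)

end

lemma rep_L2_sq_integrable: "sq_integrable (rep_L2 f)"
  using Quotient_rep_reflp[OF Quotient_L2, of f] by auto

lemma abs_rep_L2 [simp]: "abs_L2 (rep_L2 f) = f"
  by (rule Quotient_abs_rep[OF Quotient_L2])

lemma abs_L2_eqI:
  "sq_integrable f \<Longrightarrow> sq_integrable g \<Longrightarrow> AE x in lebesgue. f x = g x \<Longrightarrow> abs_L2 f = abs_L2 g"
  using Quotient_rel_abs[OF Quotient_L2, of f g] by simp

lemma rep_abs_L2_AE:
  assumes "sq_integrable f"
  shows "AE x in lebesgue. rep_L2 (abs_L2 f) x = f x"
  using Quotient_rep_abs[OF Quotient_L2] assms by blast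

lemma inner_L2_eq: "inner f g = (LINT x|lebesgue. rep_L2 f x * rep_L2 g x)"
  using inner_L2.abs_eq[of "rep_L2 f" "rep_L2 g"] rep_L2_sq_integrable[of f] rep_L2_sq_integrable[of g]
  by (simp add: inner_L2.abs_eq flip: inner_L2.abs_eq)

lemma norm_L2_sq: "(norm f)\<^sup>2 = (LINT x|lebesgue. (rep_L2 f x)\<^sup>2)"
  unfolding power2_norm_eq_inner inner_L2_eq by (simp add: power2_eq_square)

lemma norm_abs_L2:
  assumes "sq_integrable f"
  shows "(norm (abs_L2 f))\<^sup>2 = (LINT x|lebesgue. (f x)\<^sup>2)"
  unfolding power2_norm_eq_inner using assms by (simp add: inner_L2.abs_eq power2_eq_square)

lemma abs_L2_diff:
  assumes "sq_integrable f" "sq_integrable g"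
  shows "abs_L2 f - abs_L2 g = abs_L2 (\<lambda>x. f x - g x)"
  using assms by (simp add: minus_L2.abs_eq)

lemma abs_L2_add:
  assumes "sq_integrable f" "sq_integrable g"
  shows "abs_L2 f + abs_L2 g = abs_L2 (\<lambda>x. f x + g x)"
  using assms by (simp add: plus_L2.abs_eq)

lemma abs_L2_scaleR:
  assumes "sq_integrable f"
  shows "r *\<^sub>R abs_L2 f = abs_L2 (\<lambda>x. r * f x)"
  using assms by (simp add: scaleR_L2.abs_eq)

lemma abs_L2_dominated_convergence:
  assumes s: "\<And>n::nat. sq_integrable (s n)" and f: "sq_integrable f" and w: "sq_integrable w"
    and lim: "AE x in lebesgue. (\<lambda>n. s n x) \<longlonglongrightarrow> f x"
    and bound: "\<And>n. AE x in lebesgue. \<bar>s n x\<bar> \<le> w x"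
  shows "(\<lambda>n. abs_L2 (s n :: 'a::euclidean_space \<Rightarrow> real)) \<longlonglongrightarrow> abs_L2 f"
proof -
  have "(\<lambda>n. LINT x|lebesgue. (s n x - f x)\<^sup>2) \<longlonglongrightarrow> (LINT x::'a|lebesgue. (0::real))"
  proof (rule integral_dominated_convergence[where w="\<lambda>x. 4 * (w x)\<^sup>2" and M=lebesgue and f="\<lambda>x. 0" and s="\<lambda>n x. (s n x - f x)\<^sup>2"])
    show "integrable lebesgue (\<lambda>x. 4 * (w x)\<^sup>2)"
      using w by (auto simp: sq_integrable_def)
    show "AE x in lebesgue. (\<lambda>n. (s n x - f x)\<^sup>2) \<longlonglongrightarrow> 0"
      using lim
    proof eventually_elim
      case (elim x)
      then have "(\<lambda>n. (s n x - f x)\<^sup>2) \<longlonglongrightarrow> (f x - f x)\<^sup>2"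
        by (intro tendsto_intros)
      then show ?case by simp
    qed
    fix n
    have "AE x in lebesgue. \<forall>n. \<bar>s n x\<bar> \<le> w x"
      using bound by (simp add: AE_all_countable)
    then show "AE x in lebesgue. norm ((s n x - f x)\<^sup>2) \<le> 4 * (w x)\<^sup>2"
      using lim
    proof eventually_elim
      case (elim x)
      have "\<bar>f x\<bar> \<le> w x"
        by (rule LIMSEQ_le_const2[OF tendsto_rabs[OF elim(2)]]) (use elim in auto)
      then have "\<bar>s n x - f x\<bar> \<le> 2 * w x"
        using elim(1)[rule_format, of n] by linarith
      then have "\<bar>s n x - f x\<bar>\<^sup>2 \<le> (2 * w x)\<^sup>2"
        by (intro power_mono) auto
      then show ?case by (simp add: power_mult_distrib)
    qed
  qed (use s f in \<open>auto simp: sq_integrable_def intro!: borel_measurable_power borel_measurable_diff\<close>)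
  then have "(\<lambda>n. (norm (abs_L2 (s n) - abs_L2 f))\<^sup>2) \<longlonglongrightarrow> 0"
    using s f by (simp add: abs_L2_diff norm_abs_L2 sq_integrable_diff)
  then have "(\<lambda>n. sqrt ((norm (abs_L2 (s n) - abs_L2 f))\<^sup>2)) \<longlonglongrightarrow> sqrt 0"
    by (rule tendsto_real_sqrt)
  then show ?thesis
    by (simp add: LIM_zero_iff tendsto_norm_zero_iff)
qed

instance L2 :: (euclidean_space) complete_space
proof
  fix X :: "nat \<Rightarrow> 'a L2"
  assume "Cauchy X"
  then have "\<exists>N. \<forall>m\<ge>N. \<forall>n\<ge>N. norm (X m - X n) < (1/4) ^ k" for k :: nat
    by (auto simp: Cauchy_def dist_norm)
  then obtain N where N: "\<And>k m n. m \<ge> N k \<Longrightarrow> n \<ge> N k \<Longrightarrow> norm (X m - X n) < (1/4) ^ k"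
    by metis
  define r where "r k = (\<Sum>i\<le>k. N i)" for k
  have r_ge: "N k \<le> r m" if "k \<le> m" for k m
    unfolding r_def by (rule member_le_sum) (use that in auto)
  define f where "f k = rep_L2 (X (r k))" for k
  have sq: "sq_integrable (f k)" for k
    by (simp add: f_def rep_L2_sq_integrable)
  have meas[measurable]: "f k \<in> borel_measurable lebesgue" for k
    using sq by (simp add: sq_integrable_def)
  have nn: "(\<integral>\<^sup>+x. ennreal ((f m x - f k x)\<^sup>2) \<partial>lebesgue) \<le> ennreal ((1/16) ^ k)" if "k \<le> m" for k m
  proof -
    have "(\<integral>\<^sup>+x. ennreal ((f m x - f k x)\<^sup>2) \<partial>lebesgue) = ennreal (LINT x|lebesgue. (f m x - f k x)\<^sup>2)"
      using sq_integrable_diff[OF sq sq, of m k]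
      by (intro nn_integral_eq_integral) (auto simp: sq_integrable_def)
    also have "(LINT x|lebesgue. (f m x - f k x)\<^sup>2) = (norm (X (r m) - X (r k)))\<^sup>2"
      using norm_abs_L2[OF sq_integrable_diff[OF sq sq, of m k]] 
      by (simp flip: abs_L2_diff[OF sq sq]) (simp add: f_def)
    also have "\<dots> \<le> ((1/4) ^ k)\<^sup>2"
      using N[OF r_ge[OF that] r_ge[of k k]] by (intro power_mono) auto
    also have "((1/4) ^ k)\<^sup>2 = (1/16 :: real) ^ k"
      by (simp add: power2_eq_square flip: power_mult_distrib)
    finally show ?thesis by (simp add: ennreal_leI)
  qed
  define a where "a k x = 4 ^ k * (f (Suc k) x - f k x)\<^sup>2" for k x
  have "(\<integral>\<^sup>+x. (\<Sum>k. ennreal (a k x)) \<partial>lebesgue) = (\<Sum>k. \<integral>\<^sup>+x. ennreal (a k x) \<partial>lebesgue)"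
    unfolding a_def by (rule nn_integral_suminf) measurable
  also have "\<dots> \<le> (\<Sum>k. ennreal ((1/4) ^ k))"
  proof (rule suminf_le)
    fix k
    have "(\<integral>\<^sup>+x. ennreal (a k x) \<partial>lebesgue)
        = ennreal (4 ^ k) * (\<integral>\<^sup>+x. ennreal ((f (Suc k) x - f k x)\<^sup>2) \<partial>lebesgue)"
      unfolding a_def by (simp add: ennreal_mult nn_integral_cmult)
    also have "\<dots> \<le> ennreal (4 ^ k) * ennreal ((1/16) ^ k)"
      by (intro mult_left_mono nn) auto
    also have "\<dots> = ennreal ((1/4) ^ k)"
      by (simp flip: ennreal_mult power_mult_distrib)
    finally show "(\<integral>\<^sup>+x. ennreal (a k x) \<partial>lebesgue) \<le> ennreal ((1/4) ^ k)" .
  qed auto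
  also have "\<dots> < \<infinity>"
    by (subst suminf_ennreal2) (auto intro: summable_geometric)
  finally have "AE x in lebesgue. (\<Sum>k. ennreal (a k x)) \<noteq> \<infinity>"
    by (intro nn_integral_PInf_AE) (auto simp: a_def)
  then have conv: "AE x in lebesgue. (\<lambda>k. f k x) \<longlonglongrightarrow> lim (\<lambda>k. f k x)"
  proof eventually_elim
    case (elim x)
    have a0: "0 \<le> a k x" for k by (simp add: a_def)
    have sm: "summable (\<lambda>k. a k x)"
      using elim a0 by (intro summable_suminf_not_top) auto
    define S where "S = (\<Sum>k. a k x)"
    have "a k x \<le> S" for k
      using sum_le_suminf[OF sm, of "{k}"] a0 by (simp add: S_def)
    then have bd: "\<bar>f (Suc k) x - f k x\<bar> \<le> sqrt S * (1/2) ^ k" for k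
    proof -
      have "(2 ^ k * \<bar>f (Suc k) x - f k x\<bar>)\<^sup>2 = a k x"
      proof -
        have "(2 ^ k)\<^sup>2 = (4 :: real) ^ k"
          by (simp add: power2_eq_square flip: power_mult_distrib)
        then show ?thesis by (simp add: a_def power_mult_distrib)
      qed
      then have "2 ^ k * \<bar>f (Suc k) x - f k x\<bar> \<le> sqrt S"
        using \<open>a k x \<le> S\<close> by (intro real_le_rsqrt) simp
      then show ?thesis by (simp add: field_simps)
    qed
    have "summable (\<lambda>k. f (Suc k) x - f k x)"
      by (rule summable_comparison_test'[where N = 0 and g = "\<lambda>k. sqrt S * (1/2) ^ k"])
        (use bd in \<open>auto intro!: summable_mult summable_geometric\<close>)
    then have "convergent (\<lambda>n. \<Sum>k<n. f (Suc k) x - f k x)"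
      by (simp add: summable_iff_convergent)
    then have "convergent (\<lambda>n. f n x - f 0 x)"
      using sum_lessThan_telescope[of "\<lambda>k. f k x"] by simp
    then have "convergent (\<lambda>n. (f n x - f 0 x) + f 0 x)"
      by (intro convergent_add convergent_const)
    then show ?case by (simp add: convergent_LIMSEQ_iff)
  qed
  define g where "g x = lim (\<lambda>k. f k x)" for x
  have g_meas[measurable]: "g \<in> borel_measurable lebesgue"
    unfolding g_def by measurable
  have fatou: "(\<integral>\<^sup>+x. ennreal ((g x - f k x)\<^sup>2) \<partial>lebesgue) \<le> ennreal ((1/16) ^ k)" for k
  proof -
    have "(\<integral>\<^sup>+x. ennreal ((g x - f k x)\<^sup>2) \<partial>lebesgue)
        = (\<integral>\<^sup>+x. liminf (\<lambda>m. ennreal ((f m x - f k x)\<^sup>2)) \<partial>lebesgue)"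
    proof (rule nn_integral_cong_AE)
      show "AE x in lebesgue. ennreal ((g x - f k x)\<^sup>2) = liminf (\<lambda>m. ennreal ((f m x - f k x)\<^sup>2))"
        using conv
      proof eventually_elim
        case (elim x)
        then have "(\<lambda>m. ennreal ((f m x - f k x)\<^sup>2)) \<longlonglongrightarrow> ennreal ((g x - f k x)\<^sup>2)"
          unfolding g_def by (intro tendsto_intros)
        then show ?case
          by (intro lim_imp_Liminf[symmetric]) auto
      qed
    qed
    also have "\<dots> \<le> liminf (\<lambda>m. \<integral>\<^sup>+x. ennreal ((f m x - f k x)\<^sup>2) \<partial>lebesgue)"
      by (rule nn_integral_liminf) measurable
    also have "\<dots> \<le> ennreal ((1/16) ^ k)"
      by (rule Liminf_le) (use nn in \<open>auto simp: eventually_sequentially\<close>)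
    finally show ?thesis .
  qed
  have gf: "sq_integrable (\<lambda>x. g x - f k x)" for k
    unfolding sq_integrable_def
    using fatou[of k] by (auto intro!: integrableI_bounded intro: le_less_trans)
  have sqg: "sq_integrable g"
    using sq_integrable_add[OF gf[of 0] sq[of 0]] by simp
  have est: "norm (abs_L2 g - X (r k)) \<le> (1/4) ^ k" for k
  proof -
    have "(norm (abs_L2 g - X (r k)))\<^sup>2 = (LINT x|lebesgue. (g x - f k x)\<^sup>2)"
      using norm_abs_L2[OF gf] by (simp flip: abs_L2_diff[OF sqg sq]) (simp add: f_def)
    moreover have "ennreal (LINT x|lebesgue. (g x - f k x)\<^sup>2) \<le> ennreal ((1/16) ^ k)"
      using gf[of k] fatou[of k]
      by (subst nn_integral_eq_integral[symmetric]) (auto simp: sq_integrable_def)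
    moreover have "(1/16 :: real) ^ k = ((1/4) ^ k)\<^sup>2"
      by (simp add: power2_eq_square flip: power_mult_distrib)
    ultimately show ?thesis
      by (auto intro: power2_le_imp_le)
  qed
  have "X \<longlonglongrightarrow> abs_L2 g"
  proof (rule LIMSEQ_I)
    fix e :: real assume "e > 0"
    then obtain k where k: "(1/4 :: real) ^ k < e / 2"
      using real_arch_pow_inv[of "e / 2" "1/4"] by auto
    show "\<exists>no. \<forall>n\<ge>no. norm (X n - abs_L2 g) < e"
    proof (intro exI[of _ "N k"] allI impI)
      fix n assume n: "n \<ge> N k"
      have "norm (X n - abs_L2 g) \<le> norm (X n - X (r k)) + norm (abs_L2 g - X (r k))"
        using norm_triangle_ineq4[of "X n - X (r k)" "abs_L2 g - X (r k)"] by simp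
      also have "\<dots> < e"
        using N[OF n r_ge[of k k]] est[of k] k by simp
      finally show "norm (X n - abs_L2 g) < e" .
    qed
  qed
  then show "convergent X" by (rule convergentI)
qed

instance L2 :: (euclidean_space) banach ..

lemma sq_integrable_indicator:
  assumes "S \<in> lmeasurable"
  shows "sq_integrable (indicator S :: _ \<Rightarrow> real)"
proof -
  have "(\<lambda>x. (indicator S x :: real)\<^sup>2) = indicator S"
    by (auto simp: indicator_def)
  then show ?thesis
    using assms by (auto simp: sq_integrable_def fmeasurable_def)
qed

lemma L2_separable: "\<exists>D :: 'a::euclidean_space L2 set. countable D \<and> closure D = UNIV"
proof -
  obtain B :: "'a set set" where B: "countable B" "topological_basis B"
    using ex_countable_basis by blast
  define U where "U = Union ` {F. finite F \<and> F \<subseteq> B} \<inter> lmeasurable"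
  define c where "c = (\<lambda>xs. \<Sum>(q, V)\<leftarrow>xs. of_rat q *\<^sub>R abs_L2 (indicator V :: 'a \<Rightarrow> real))"
  define D where "D = c ` lists (UNIV \<times> U)"
  have "countable {F. finite F \<and> F \<subseteq> B}"
    by (rule countable_Collect_finite_subset[OF B(1)])
  then have "countable U" by (auto simp: U_def)
  then have cD: "countable D" by (auto simp: D_def)
  have D_add: "x + y \<in> D" if "x \<in> D" "y \<in> D" for x y
  proof -
    from that obtain xs ys where "xs \<in> lists (UNIV \<times> U)" "ys \<in> lists (UNIV \<times> U)" "x = c xs" "y = c ys"
      by (auto simp: D_def)
    then have "x + y = c (xs @ ys)" "xs @ ys \<in> lists (UNIV \<times> U)" by (auto simp: c_def)
    then show ?thesis by (auto simp: D_def)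
  qed
  have D_scale: "of_rat q *\<^sub>R x \<in> D" if "x \<in> D" for x q
  proof -
    from that obtain xs where xs: "xs \<in> lists (UNIV \<times> U)" "x = c xs"
      by (auto simp: D_def)
    have "of_rat q *\<^sub>R c xs = c (map (\<lambda>(p, V). (q * p, V)) xs)"
      by (induction xs) (auto simp: c_def scaleR_add_right of_rat_mult)
    moreover have "map (\<lambda>(p, V). (q * p, V)) xs \<in> lists (UNIV \<times> U)"
      using xs(1) by (induction xs) auto
    ultimately show ?thesis using xs(2) by (auto simp: D_def)
  qed
  let ?K = "closure D"
  have K_add: "x + y \<in> ?K" if xy: "x \<in> ?K" "y \<in> ?K" for x y
  proof -
    obtain a b where "\<And>n. a n \<in> D" "a \<longlonglongrightarrow> x" "\<And>n. b n \<in> D" "b \<longlonglongrightarrow> y"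
      using xy unfolding closure_sequential by blast
    then have "\<And>n. a n + b n \<in> D" "(\<lambda>n. a n + b n) \<longlonglongrightarrow> x + y"
      by (auto intro: D_add tendsto_add)
    then show ?thesis unfolding closure_sequential by (intro exI[of _ "\<lambda>n. a n + b n"]) auto
  qed
  have K_scale: "t *\<^sub>R x \<in> ?K" if x: "x \<in> ?K" for x t
  proof -
    obtain a where a: "\<And>n. a n \<in> D" "a \<longlonglongrightarrow> x"
      using x unfolding closure_sequential by blast
    have "\<exists>q. \<bar>of_rat q - t\<bar> < 1 / real (Suc n)" for n
    proof -
      obtain q where "t < of_rat q" "of_rat q < t + 1 / real (Suc n)"
        using of_rat_dense[of t "t + 1 / real (Suc n)"] by auto
      then show ?thesis by (intro exI[of _ q]) auto
    qed
    then obtain q where q: "\<And>n. \<bar>of_rat (q n) - t\<bar> < 1 / real (Suc n)" by metis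
    have "(\<lambda>n. of_rat (q n)) \<longlonglongrightarrow> t"
    proof (rule LIM_zero_cancel, rule Lim_null_comparison)
      show "\<forall>\<^sub>F n in sequentially. norm (of_rat (q n) - t) \<le> 1 / real (Suc n)"
        using q by (auto intro!: always_eventually less_imp_le)
      show "(\<lambda>n. 1 / real (Suc n)) \<longlonglongrightarrow> 0"
        using LIMSEQ_inverse_real_of_nat by (simp add: inverse_eq_divide)
    qed
    then have "(\<lambda>n. of_rat (q n) *\<^sub>R a n) \<longlonglongrightarrow> t *\<^sub>R x"
      using a by (intro tendsto_scaleR)
    then show ?thesis
      unfolding closure_sequential using a D_scale by (intro exI[of _ "\<lambda>n. of_rat (q n) *\<^sub>R a n"]) auto
  qed
  have K_zero: "0 \<in> ?K"
  proof -
    have "c [] \<in> D" unfolding D_def by (rule imageI) simp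
    then show ?thesis using closure_subset[of D] by (auto simp: c_def)
  qed
  have K_lim: "x \<in> ?K" if "\<And>n. a n \<in> ?K" "a \<longlonglongrightarrow> x" for a x
    using closed_sequentially[OF closed_closure] that by blast
  have K_open: "abs_L2 (indicator V) \<in> ?K" if V: "open V" "V \<in> lmeasurable" for V
  proof -
    obtain B' where B': "B' \<subseteq> B" "\<Union>B' = V"
      using B(2) V(1) unfolding topological_basis_def by blast
    define C where "C = insert {} B'"
    have C: "countable C" "C \<noteq> {}" "\<Union>C = V" "\<And>F. F \<in> C \<Longrightarrow> open F"
      using B' B countable_subset topological_basis_open[OF B(2)] by (auto simp: C_def)
    define W where "W n = (\<Union>i\<le>n. from_nat_into C i)" for n
    have W_open: "open (W n)" for n
      unfolding W_def using C from_nat_into[OF C(2)] by auto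
    have W_sub: "W n \<subseteq> V" for n
      unfolding W_def using C(3) from_nat_into[OF C(2)] by blast
    have W_meas: "W n \<in> lmeasurable" for n
      using fmeasurableI2[OF V(2) W_sub] W_open by auto
    have W_U: "W n \<in> U" for n
    proof -
      have "W n = \<Union>(from_nat_into C ` {..n} - {{}})" by (auto simp: W_def)
      moreover have "from_nat_into C ` {..n} - {{}} \<subseteq> B"
        using from_nat_into[OF C(2)] B'(1) by (auto simp: C_def)
      moreover have "finite (from_nat_into C ` {..n} - {{}})" by simp
      ultimately have "W n \<in> Union ` {F. finite F \<and> F \<subseteq> B}" by blast
      then show ?thesis using W_meas unfolding U_def by blast
    qed
    have "abs_L2 (indicator (W n)) \<in> D" for n
    proof -
      have "c [(1, W n)] \<in> D" unfolding D_def using W_U by (intro imageI) auto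
      then show ?thesis by (simp add: c_def)
    qed
    moreover have "(\<lambda>n. abs_L2 (indicator (W n))) \<longlonglongrightarrow> abs_L2 (indicator V)"
    proof (rule abs_L2_dominated_convergence[where w="indicator V"])
      show "AE x in lebesgue. (\<lambda>n. indicator (W n) x) \<longlonglongrightarrow> (indicator V x :: real)"
      proof (intro AE_I2 tendsto_eventually)
        fix x
        show "\<forall>\<^sub>F n in sequentially. indicator (W n) x = (indicator V x :: real)"
        proof (cases "x \<in> V")
          case True
          then obtain F where "F \<in> C" "x \<in> F" using C(3) by auto
          then obtain m where m: "x \<in> from_nat_into C m"
            using from_nat_into_surj[OF C(1)] by metis
          then have "x \<in> W n" if "n \<ge> m" for n
            unfolding W_def using that by auto
          then show ?thesis
            using True unfolding eventually_sequentially by (auto simp: indicator_def)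
        next
          case False
          then have "x \<notin> W n" for n using W_sub by blast
          then show ?thesis using False by (simp add: indicator_def)
        qed
      qed
    qed (use W_sub in \<open>auto intro!: sq_integrable_indicator W_meas V simp: indicator_def\<close>)
    ultimately show ?thesis
      using K_lim[of "\<lambda>n. abs_L2 (indicator (W n))"] closure_subset[of D] by blast
  qed
  have K_ind: "abs_L2 (indicator S) \<in> ?K" if S: "S \<in> lmeasurable" for S
  proof -
    have "\<exists>V. open V \<and> S \<subseteq> V \<and> V - S \<in> lmeasurable \<and> emeasure lebesgue (V - S) < ennreal (1 / Suc n)" for n
      using sets_lebesgue_outer_open[of S "1 / Suc n"] S by (metis fmeasurableD of_nat_0_less_iff zero_less_Suc zero_less_divide_1_iff)
    then obtain V where V: "\<And>n. open (V n)" "\<And>n. S \<subseteq> V n" "\<And>n. V n - S \<in> lmeasurable"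
        "\<And>n. emeasure lebesgue (V n - S) < ennreal (1 / Suc n)"
      by metis
    have Vm: "V n \<in> lmeasurable" for n
    proof -
      have "V n = S \<union> (V n - S)" using V(2) by auto
      then show ?thesis using S V(3) by (metis fmeasurable.Un)
    qed
    have "norm (abs_L2 (indicator (V n)) - abs_L2 (indicator S)) \<le> sqrt (1 / Suc n)" for n
    proof -
      have "(norm (abs_L2 (indicator (V n)) - abs_L2 (indicator S)))\<^sup>2
          = (LINT x|lebesgue. (indicator (V n) x - indicator S x :: real)\<^sup>2)"
        using Vm S by (simp add: abs_L2_diff sq_integrable_indicator norm_abs_L2 sq_integrable_diff)
      also have "(\<lambda>x. (indicator (V n) x - indicator S x :: real)\<^sup>2) = indicator (V n - S)"
        using V(2)[of n] by (auto simp: fun_eq_iff indicator_def)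
      also have "(LINT x|lebesgue. indicator (V n - S) x :: real) = measure lebesgue (V n - S)"
        using V(3)[of n] by (simp add: fmeasurable_def)
      also have "\<dots> \<le> 1 / Suc n"
        using V(4)[of n] V(3)[of n] by (simp add: emeasure_eq_measure2 ennreal_less_iff)
      finally show ?thesis by (rule real_le_rsqrt)
    qed
    note le = this
    have "(\<lambda>n. abs_L2 (indicator (V n)) - abs_L2 (indicator S)) \<longlonglongrightarrow> 0"
    proof (rule Lim_null_comparison)
      show "\<forall>\<^sub>F n in sequentially. norm (abs_L2 (indicator (V n)) - abs_L2 (indicator S)) \<le> sqrt (1 / Suc n)"
        by (intro always_eventually allI le)
      have "(\<lambda>n. sqrt (1 / Suc n)) \<longlonglongrightarrow> sqrt 0"
        using LIMSEQ_inverse_real_of_nat by (intro tendsto_real_sqrt) (simp add: inverse_eq_divide)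
      then show "(\<lambda>n. sqrt (1 / Suc n)) \<longlonglongrightarrow> 0" by simp
    qed
    then have "(\<lambda>n. abs_L2 (indicator (V n))) \<longlonglongrightarrow> abs_L2 (indicator S)"
      by (rule LIM_zero_cancel)
    then show ?thesis
      by (rule K_lim[rotated]) (use K_open V Vm in auto)
  qed
  have "x \<in> ?K" for x
  proof -
    define f where "f = rep_L2 x"
    have sqf: "sq_integrable f" by (simp add: f_def rep_L2_sq_integrable)
    then have fm: "f \<in> borel_measurable lebesgue" by (simp add: sq_integrable_def)
    from borel_measurable_implies_sequence_metric[OF fm, of 0]
    obtain s where s: "\<And>i. simple_function lebesgue (s i)"
      "\<And>x. (\<lambda>i. s i x) \<longlonglongrightarrow> f x"
      "\<And>i x. dist (s i x) 0 \<le> 2 * dist (f x) 0"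
      by (auto simp: space_completion)
    have sq: "sq_integrable (s i)" for i
      by (rule sq_integrable_dominated[OF sqf borel_measurable_simple_function[OF s(1)], of _ 2])
        (use s(3) in auto)
    have "abs_L2 (s i) \<in> ?K" for i
    proof -
      define Y where "Y = s i ` UNIV - {0}"
      have finY: "finite Y"
        using s(1)[of i] by (auto simp: Y_def simple_function_def)
      define E where "E y = s i -` {y}" for y
      have Em: "E y \<in> lmeasurable" if y: "y \<in> Y" for y
      proof -
        have Es: "E y \<in> sets lebesgue"
          using s(1)[of i] y by (auto simp: simple_function_def E_def Y_def)
        have "integrable lebesgue (\<lambda>x. (s i x)\<^sup>2 / y\<^sup>2)"
          using sq[of i] by (auto simp: sq_integrable_def)
        then have "integrable lebesgue (indicator (E y) :: 'a \<Rightarrow> real)"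
          by (rule Bochner_Integration.integrable_bound)
            (use Es y in \<open>auto simp: E_def Y_def indicator_def\<close>)
        then show ?thesis using Es by (simp add: fmeasurable_def integrable_indicator_iff)
      qed
      have sum: "sq_integrable (\<lambda>x. \<Sum>y\<in>Z. y * indicator (E y) x) \<and>
          abs_L2 (\<lambda>x. \<Sum>y\<in>Z. y * indicator (E y) x) \<in> ?K" if "finite Z" "Z \<subseteq> Y" for Z
        using that
      proof (induction Z rule: finite_induct)
        case empty
        then show ?case using K_zero by (simp add: sq_integrable_zero zero_L2_def)
      next
        case (insert y Z)
        have 1: "sq_integrable (\<lambda>x. y * indicator (E y) x)"
          using insert Em by (intro sq_integrable_scale sq_integrable_indicator) auto
        have "abs_L2 (\<lambda>x. y * indicator (E y) x) = y *\<^sub>R abs_L2 (indicator (E y))"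
          using insert Em by (intro abs_L2_scaleR[symmetric] sq_integrable_indicator) auto
        then have 2: "abs_L2 (\<lambda>x. y * indicator (E y) x) \<in> ?K"
          using insert Em by (auto intro: K_scale K_ind)
        have 3: "sq_integrable (\<lambda>x. \<Sum>y\<in>Z. y * indicator (E y) x)"
            "abs_L2 (\<lambda>x. \<Sum>y\<in>Z. y * indicator (E y) x) \<in> ?K"
          using insert by auto
        show ?case
          using sq_integrable_add[OF 1 3(1)] K_add[OF 2 3(2), unfolded abs_L2_add[OF 1 3(1)]]
          unfolding sum.insert[OF insert(1,2)] by (rule conjI)
      qed
      have "s i = (\<lambda>x. \<Sum>y\<in>Y. y * indicator (E y) x)"
      proof
        fix x
        have "(\<Sum>y\<in>Y. y * indicator (E y) x) = (\<Sum>y\<in>Y. if s i x = y then y else 0)"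
          by (intro sum.cong) (auto simp: E_def indicator_def)
        also have "\<dots> = s i x" using finY by (auto simp: Y_def)
        finally show "s i x = (\<Sum>y\<in>Y. y * indicator (E y) x)" by simp
      qed
      then show ?thesis using sum[OF finY] by auto
    qed
    moreover have "(\<lambda>i. abs_L2 (s i)) \<longlonglongrightarrow> abs_L2 f"
    proof (rule abs_L2_dominated_convergence[where w="\<lambda>x. 2 * \<bar>f x\<bar>"])
      show "sq_integrable (\<lambda>x. 2 * \<bar>f x\<bar>)"
        by (rule sq_integrable_dominated[OF sqf, of _ 2]) (use fm in auto)
    qed (use sq sqf s in auto)
    ultimately have "abs_L2 f \<in> ?K" by (rule K_lim)
    then show ?thesis by (simp add: f_def)
  qed
  then show ?thesis using cD by auto
qed

instance L2 :: (euclidean_space) second_countable_topology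
proof
  obtain D :: "'a L2 set" where D: "countable D" "closure D = UNIV"
    using L2_separable by blast
  define Bs where "Bs = (\<lambda>(d, n). ball d (1 / real (Suc n))) ` (D \<times> UNIV)"
  have "topological_basis Bs"
  proof (rule topological_basisI)
    show "open V" if "V \<in> Bs" for V using that by (auto simp: Bs_def)
  next
    fix V :: "'a L2 set" and x assume V: "open V" "x \<in> V"
    then obtain e where e: "e > 0" "ball x e \<subseteq> V" by (meson open_contains_ball)
    obtain n where n: "1 / real (Suc n) < e / 2"
      using nat_approx_posE[of "e / 2"] e by (metis half_gt_zero)
    have "x \<in> closure D" using D by auto
    then obtain d where d: "d \<in> D" "dist d x < 1 / real (Suc n)"
      unfolding closure_approachable by (metis of_nat_0_less_iff zero_less_Suc zero_less_divide_1_iff)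
    have "ball d (1 / real (Suc n)) \<subseteq> ball x e"
    proof
      fix y assume "y \<in> ball d (1 / real (Suc n))"
      then show "y \<in> ball x e"
        using d n dist_triangle[of x y d] by (auto simp: dist_commute)
    qed
    then show "\<exists>V'\<in>Bs. x \<in> V' \<and> V' \<subseteq> V"
      using d e by (intro bexI[of _ "ball d (1 / real (Suc n))"]) (auto simp: Bs_def)
  qed
  moreover have "countable Bs" using D by (auto simp: Bs_def)
  ultimately show "\<exists>B :: 'a L2 set set. countable B \<and> open = generate_topology B"
    using topological_basis_imp_subbasis by blast
qed


subsection \<open>Classical differentiability and domains\<close>

definition pdv :: "'n \<Rightarrow> (real ^ 'n \<Rightarrow> real) \<Rightarrow> real ^ 'n \<Rightarrow> real" where
  "pdv i f x = frechet_derivative f (at x) (axis i 1)"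

text \<open>Only used for open \<^term>\<open>S\<close>.\<close>

primrec Ck_on :: "nat \<Rightarrow> (real ^ 'n) set \<Rightarrow> (real ^ 'n \<Rightarrow> real) \<Rightarrow> bool" where
  "Ck_on 0 S f \<longleftrightarrow> continuous_on S f"
| "Ck_on (Suc k) S f \<longleftrightarrow> (\<forall>x\<in>S. f differentiable (at x)) \<and> (\<forall>i. Ck_on k S (pdv i f))"

definition smooth_on :: "(real ^ 'n) set \<Rightarrow> (real ^ 'n \<Rightarrow> real) \<Rightarrow> bool" where
  "smooth_on S f \<longleftrightarrow> (\<forall>k. Ck_on k S f)"

text \<open>\<open>C\<^sup>1\<close> up to the boundary: the function and its first partial derivatives extend
  continuously from \<open>\<Omega>\<close> to its closure.\<close>

definition C1_closure :: "(real ^ 'n) set \<Rightarrow> (real ^ 'n \<Rightarrow> real) \<Rightarrow> bool" where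
  "C1_closure \<Omega> g \<longleftrightarrow> continuous_on (closure \<Omega>) g \<and> (\<forall>x\<in>\<Omega>. g differentiable (at x)) \<and>
     (\<forall>i. \<exists>h. continuous_on (closure \<Omega>) h \<and> (\<forall>x\<in>\<Omega>. pdv i g x = h x))"

text \<open>Near each boundary point, \<open>\<Omega>\<close> is the region strictly above the graph of a smooth function.
  The unit vector \<open>e\<close> is the vertical direction of the rotated coordinates; \<open>\<gamma>\<close> is only
  evaluated on the hyperplane orthogonal to \<open>e\<close>.\<close>

definition smooth_boundary :: "(real ^ 'n) set \<Rightarrow> bool" where
  "smooth_boundary \<Omega> \<longleftrightarrow>
     (\<forall>p\<in>frontier \<Omega>. \<exists>r>0. \<exists>e \<gamma>. norm e = 1 \<and> smooth_on UNIV \<gamma> \<and>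
        \<Omega> \<inter> ball p r = {x \<in> ball p r. x \<bullet> e > \<gamma> (x - (x \<bullet> e) *\<^sub>R e)})"

definition bounded_smooth_domain :: "(real ^ 'n) set \<Rightarrow> bool" where
  "bounded_smooth_domain \<Omega> \<longleftrightarrow>
     open \<Omega> \<and> connected \<Omega> \<and> \<Omega> \<noteq> {} \<and> bounded \<Omega> \<and> smooth_boundary \<Omega>"


subsection \<open>Sobolev spaces on \<open>\<Omega>\<close>\<close>

text \<open>\<open>L\<^sup>2(\<Omega>)\<close> is identified, through extension by zero, with a closed subspace of \<open>L\<^sup>2(\<real>\<^sup>d)\<close>.\<close>

definition L2_on :: "'a::euclidean_space set \<Rightarrow> 'a L2 set" where
  "L2_on \<Omega> = {v. AE x in lebesgue. x \<notin> \<Omega> \<longrightarrow> rep_L2 v x = 0}"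

definition test_functions :: "(real ^ 'n) set \<Rightarrow> (real ^ 'n \<Rightarrow> real) set" where
  "test_functions \<Omega> =
     {\<phi>. smooth_on UNIV \<phi> \<and> compact (closure {x. \<phi> x \<noteq> 0}) \<and> closure {x. \<phi> x \<noteq> 0} \<subseteq> \<Omega>}"

definition has_weak_pdv ::
    "(real ^ 'n) set \<Rightarrow> 'n \<Rightarrow> (real ^ 'n) L2 \<Rightarrow> (real ^ 'n) L2 \<Rightarrow> bool" where
  "has_weak_pdv \<Omega> i v w \<longleftrightarrow> w \<in> L2_on \<Omega> \<and>
     (\<forall>\<phi>\<in>test_functions \<Omega>.
        (LINT x:\<Omega>|lebesgue. rep_L2 v x * pdv i \<phi> x) = - (LINT x:\<Omega>|lebesgue. rep_L2 w x * \<phi> x))"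

definition weak_pdv :: "(real ^ 'n) set \<Rightarrow> 'n \<Rightarrow> (real ^ 'n) L2 \<Rightarrow> (real ^ 'n) L2" where
  "weak_pdv \<Omega> i v = (THE w. has_weak_pdv \<Omega> i v w)"

definition H1 :: "(real ^ 'n) set \<Rightarrow> (real ^ 'n) L2 set" where
  "H1 \<Omega> = {v \<in> L2_on \<Omega>. \<forall>i. \<exists>w. has_weak_pdv \<Omega> i v w}"

definition H1_norm :: "(real ^ 'n) set \<Rightarrow> (real ^ 'n) L2 \<Rightarrow> real" where
  "H1_norm \<Omega> v = sqrt ((norm v)\<^sup>2 + (\<Sum>i\<in>UNIV. (norm (weak_pdv \<Omega> i v))\<^sup>2))"

definition H10 :: "(real ^ 'n) set \<Rightarrow> (real ^ 'n) L2 set" where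
  "H10 \<Omega> = {v \<in> H1 \<Omega>. \<exists>\<phi>. (\<forall>k::nat. \<phi> k \<in> test_functions \<Omega>) \<and>
     (\<lambda>k. H1_norm \<Omega> (abs_L2 (\<phi> k) - v)) \<longlonglongrightarrow> 0}"

definition H2 :: "(real ^ 'n) set \<Rightarrow> (real ^ 'n) L2 set" where
  "H2 \<Omega> = {v \<in> H1 \<Omega>. \<forall>i. weak_pdv \<Omega> i v \<in> H1 \<Omega>}"

text \<open>Mixed derivatives are counted twice; this is one of the usual equivalent norms.\<close>

definition H2_norm :: "(real ^ 'n) set \<Rightarrow> (real ^ 'n) L2 \<Rightarrow> real" where
  "H2_norm \<Omega> v = sqrt ((norm v)\<^sup>2 + (\<Sum>i\<in>UNIV. (norm (weak_pdv \<Omega> i v))\<^sup>2)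
     + (\<Sum>i\<in>UNIV. \<Sum>j\<in>UNIV. (norm (weak_pdv \<Omega> i (weak_pdv \<Omega> j v)))\<^sup>2))"


subsection \<open>The elliptic operator\<close>

definition mult_on :: "'a::euclidean_space set \<Rightarrow> ('a \<Rightarrow> real) \<Rightarrow> 'a L2 \<Rightarrow> 'a L2" where
  "mult_on \<Omega> g v = abs_L2 (\<lambda>x. indicator \<Omega> x * (g x * rep_L2 v x))"

definition elliptic_op ::
    "(real ^ 'n) set \<Rightarrow> ('n \<Rightarrow> 'n \<Rightarrow> real ^ 'n \<Rightarrow> real) \<Rightarrow> ('n \<Rightarrow> real ^ 'n \<Rightarrow> real) \<Rightarrow>
     (real ^ 'n \<Rightarrow> real) \<Rightarrow> (real ^ 'n) L2 \<Rightarrow> (real ^ 'n) L2" where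
  "elliptic_op \<Omega> a b c v =
     - ((\<Sum>i\<in>UNIV. \<Sum>j\<in>UNIV. weak_pdv \<Omega> i (mult_on \<Omega> (a i j) (weak_pdv \<Omega> j v)))
        + (\<Sum>j\<in>UNIV. mult_on \<Omega> (b j) (weak_pdv \<Omega> j v))
        + mult_on \<Omega> c v)"


subsection \<open>Square integrable functions of time with values in a Hilbert space\<close>

text \<open>The spaces \<open>X\<close> of values depend on \<open>\<Omega>\<close> and so cannot be types. A Hilbert space \<open>X\<close> is given
  by its carrier and its norm, inside an ambient Banach space type into which it embeds
  continuously; the Bochner integral in \<open>X\<close> is then the one of the ambient type. Elements of
  \<open>L\<^sup>2(0,T;X)\<close> are represented by functions, to be identified when they agree almost everywhere
  on \<open>(0,T)\<close>.\<close>

record 'h hspace =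
  hcarrier :: "'h set"
  hnorm :: "'h \<Rightarrow> real"

definition real_space :: "real hspace" where
  "real_space = \<lparr>hcarrier = UNIV, hnorm = abs\<rparr>"

definition L2_space :: "(real ^ 'n) set \<Rightarrow> (real ^ 'n) L2 hspace" where
  "L2_space \<Omega> = \<lparr>hcarrier = L2_on \<Omega>, hnorm = norm\<rparr>"

definition H2_H10_space :: "(real ^ 'n) set \<Rightarrow> (real ^ 'n) L2 hspace" where
  "H2_H10_space \<Omega> = \<lparr>hcarrier = H2 \<Omega> \<inter> H10 \<Omega>, hnorm = H2_norm \<Omega>\<rparr>"

abbreviation time_measure :: "real \<Rightarrow> real measure" where
  "time_measure T \<equiv> lebesgue_on {0<..<T}"

definition strongly_measurable ::
    "real \<Rightarrow> 'h::real_normed_vector hspace \<Rightarrow> (real \<Rightarrow> 'h) \<Rightarrow> bool" where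
  "strongly_measurable T X w \<longleftrightarrow>
     (\<exists>s. (\<forall>k::nat. simple_function (time_measure T) (s k) \<and> (\<forall>t\<in>{0<..<T}. s k t \<in> hcarrier X)) \<and>
          (AE t in time_measure T. (\<lambda>k. hnorm X (s k t - w t)) \<longlonglongrightarrow> 0))"

definition L2T :: "real \<Rightarrow> 'h::real_normed_vector hspace \<Rightarrow> (real \<Rightarrow> 'h) set" where
  "L2T T X = {w. (AE t in time_measure T. w t \<in> hcarrier X) \<and> strongly_measurable T X w \<and>
     integrable (time_measure T) (\<lambda>t. (hnorm X (w t))\<^sup>2)}"

definition L2T_norm :: "real \<Rightarrow> 'h::real_normed_vector hspace \<Rightarrow> (real \<Rightarrow> 'h) \<Rightarrow> real" where
  "L2T_norm T X w = sqrt (LINT t|time_measure T. (hnorm X (w t))\<^sup>2)"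

definition frac_int ::
    "real \<Rightarrow> (real \<Rightarrow> 'h::{banach, second_countable_topology}) \<Rightarrow> real \<Rightarrow> 'h" where
  "frac_int \<alpha> w t = (1 / Gamma \<alpha>) *\<^sub>R (LINT s:{0..t}|lebesgue. (t - s) powr (\<alpha> - 1) *\<^sub>R w s)"


subsection \<open>The spaces of negative order\<close>

text \<open>The completion is the usual one: Cauchy sequences in \<open>L\<^sup>2(0,T;X)\<close> for the norm
  \<open>\<parallel>J\<^sup>\<alpha> v\<parallel>\<close>, modulo sequences whose difference tends to \<open>0\<close> in that norm.\<close>

definition negH_norm ::
    "real \<Rightarrow> real \<Rightarrow> 'h::{banach, second_countable_topology} hspace \<Rightarrow> (real \<Rightarrow> 'h) \<Rightarrow> real" where
  "negH_norm \<alpha> T X v = L2T_norm T X (frac_int \<alpha> v)"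

definition negH_cauchy ::
    "real \<Rightarrow> real \<Rightarrow> 'h::{banach, second_countable_topology} hspace \<Rightarrow> (nat \<Rightarrow> real \<Rightarrow> 'h) set" where
  "negH_cauchy \<alpha> T X = {v. (\<forall>n. v n \<in> L2T T X) \<and>
     (\<forall>e>0. \<exists>N. \<forall>m\<ge>N. \<forall>n\<ge>N. negH_norm \<alpha> T X (\<lambda>t. v m t - v n t) < e)}"

definition negH_rel ::
    "real \<Rightarrow> real \<Rightarrow> 'h::{banach, second_countable_topology} hspace \<Rightarrow> (nat \<Rightarrow> real \<Rightarrow> 'h) rel" where
  "negH_rel \<alpha> T X = {(v, w). v \<in> negH_cauchy \<alpha> T X \<and> w \<in> negH_cauchy \<alpha> T X \<and>
     (\<lambda>n. negH_norm \<alpha> T X (\<lambda>t. v n t - w n t)) \<longlonglongrightarrow> 0}"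

type_synonym 'h negH = "(nat \<Rightarrow> real \<Rightarrow> 'h) set"

definition negH ::
    "real \<Rightarrow> real \<Rightarrow> 'h::{banach, second_countable_topology} hspace \<Rightarrow> 'h negH set" where
  "negH \<alpha> T X = negH_cauchy \<alpha> T X // negH_rel \<alpha> T X"

definition negH_of ::
    "real \<Rightarrow> real \<Rightarrow> 'h::{banach, second_countable_topology} hspace \<Rightarrow> (real \<Rightarrow> 'h) \<Rightarrow> 'h negH" where
  "negH_of \<alpha> T X v = negH_rel \<alpha> T X `` {\<lambda>n. v}"

definition negH_zero ::
    "real \<Rightarrow> real \<Rightarrow> 'h::{banach, second_countable_topology} hspace \<Rightarrow> 'h negH" where
  "negH_zero \<alpha> T X = negH_of \<alpha> T X (\<lambda>t. 0)"

definition negH_add ::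
    "real \<Rightarrow> real \<Rightarrow> 'h::{banach, second_countable_topology} hspace \<Rightarrow> 'h negH \<Rightarrow> 'h negH \<Rightarrow> 'h negH"
  where
  "negH_add \<alpha> T X V W = negH_rel \<alpha> T X `` {(\<lambda>n t. v n t + w n t) | v w. v \<in> V \<and> w \<in> W}"

text \<open>For \<open>Y\<close> continuously embedded in \<open>X\<close>, the canonical map sending an element of the completion
  for \<open>Y\<close> to the element of the completion for \<open>X\<close> with the same approximating sequences.\<close>

definition negH_incl ::
    "real \<Rightarrow> real \<Rightarrow> 'h::{banach, second_countable_topology} hspace \<Rightarrow> 'h negH \<Rightarrow> 'h negH" where
  "negH_incl \<alpha> T X V = negH_rel \<alpha> T X `` V"

text \<open>The extension \<open>J\<^sub>\<alpha>'\<close> of \<open>J\<^sup>\<alpha>\<close> by continuity. Its value is an element of \<open>L\<^sup>2(0,T;X)\<close>, so the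
  representing function is determined only almost everywhere.\<close>

definition frac_int_ext ::
    "real \<Rightarrow> real \<Rightarrow> 'h::{banach, second_countable_topology} hspace \<Rightarrow> 'h negH \<Rightarrow> real \<Rightarrow> 'h" where
  "frac_int_ext \<alpha> T X V = (SOME w. w \<in> L2T T X \<and>
     (\<forall>v\<in>V. (\<lambda>n. L2T_norm T X (\<lambda>t. frac_int \<alpha> (v n) t - w t)) \<longlonglongrightarrow> 0))"

definition frac_int_ext_inv ::
    "real \<Rightarrow> real \<Rightarrow> 'h::{banach, second_countable_topology} hspace \<Rightarrow> (real \<Rightarrow> 'h) \<Rightarrow> 'h negH" where
  "frac_int_ext_inv \<alpha> T X w =
     (THE V. V \<in> negH \<alpha> T X \<and> (AE t in time_measure T. frac_int_ext \<alpha> T X V t = w t))"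

definition frac_deriv ::
    "real \<Rightarrow> real \<Rightarrow> 'h::{banach, second_countable_topology} hspace \<Rightarrow> (real \<Rightarrow> 'h) \<Rightarrow> 'h negH" where
  "frac_deriv \<alpha> T X u = frac_int_ext_inv \<alpha> T X u"

text \<open>\<open>\<mu> f\<close> for \<open>\<mu>\<close> in the scalar space of negative order and \<open>f\<close> in \<open>X\<close>.\<close>

definition negH_tensor ::
    "real \<Rightarrow> real \<Rightarrow> 'h::{banach, second_countable_topology} hspace \<Rightarrow> real negH \<Rightarrow> 'h \<Rightarrow> 'h negH" where
  "negH_tensor \<alpha> T X \<mu> f =
     frac_int_ext_inv \<alpha> T X (\<lambda>t. frac_int_ext \<alpha> T real_space \<mu> t *\<^sub>R f)"

definition negH_apply ::
    "real \<Rightarrow> real \<Rightarrow> 'h::{banach, second_countable_topology} hspace \<Rightarrow> 'h hspace \<Rightarrow>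
     ('h \<Rightarrow> 'h) \<Rightarrow> 'h negH \<Rightarrow> 'h negH" where
  "negH_apply \<alpha> T Y X A U = frac_int_ext_inv \<alpha> T X (\<lambda>t. A (frac_int_ext \<alpha> T Y U t))"

end

theory Submission
  imports Defs
begin

text \<open>Apply the extended fractional integral, written \<open>J\<close> here, to the equation. With \<open>v = J u\<close> and with
  \<open>g\<close> the image of \<open>\<mu>\<close> it becomes an identity \<open>u + A v = g f\<close> between square integrable functions of time,
  where \<open>v t\<close> lies in \<open>H2 \<Omega> \<inter> H10 \<Omega>\<close> for almost every \<open>t\<close>. Since \<open>J\<close> is injective on the space of negative
  order, the claim is that \<open>g\<close> vanishes almost everywhere.

  Take Laplace transforms over the finite interval \<open>(0,T)\<close> at real \<open>l > 0\<close>, marked by a prime: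
  \<open>u' + A v' = g' f\<close>. As \<open>J\<close> is the convolution with \<open>t powr (\<alpha> - 1) / Gamma \<alpha>\<close>, whose full Laplace
  transform is \<open>l powr (- \<alpha>)\<close>, one has \<open>v' = l powr (- \<alpha>) u' - R\<close>, where \<open>R\<close> is what the truncation at \<open>T\<close>
  costs; its norm is at most a constant times \<open>exp (- l T) l powr (- \<alpha>)\<close>
  (\<open>laplace_frac_int\<close>, \<open>laplace_frac_int_vector\<close>). With \<open>p = l powr \<alpha>\<close> this reads
  \<open>p v' + A v' = g' f - p R\<close>. The observation makes \<open>u'\<close> orthogonal to \<open>\<theta>\<close>, so the scalar product of \<open>\<theta>\<close>
  and \<open>A v'\<close> is \<open>g'\<close> times that of \<open>\<theta>\<close> and \<open>f\<close>. On the other hand the scalar product of \<open>\<theta>\<close> and \<open>A z\<close>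
  is small compared with the norm of \<open>p z + A z\<close>, uniformly in \<open>z\<close>, once \<open>p\<close> is large
  (\<open>elliptic_resolvent_bound\<close>): this expresses that \<open>p\<close> times the resolvent of \<open>- A\<close> at \<open>p\<close> tends strongly
  to the identity, and it follows from the energy estimate \<open>garding\<close> and the density of the test
  functions. Because \<open>\<theta>\<close> and \<open>f\<close> are not orthogonal, the term with \<open>g'\<close> on the right can be absorbed, and
  \<open>\<bar>g'\<bar>\<close> is at most a constant times \<open>exp (- l T)\<close> for all large \<open>l\<close> (\<open>source_eq_zero\<close>). A function on
  \<open>(0,T)\<close> whose finite Laplace transform is that small is zero, by an elementary argument of Mikusinski
  that replaces the convolution theorem of Titchmarsh (\<open>bounded_exp_moments_imp_AE_zero\<close>).

  Two translations make this rigorous. First, \<open>H2 \<Omega> \<inter> H10 \<Omega>\<close> is identified, with its norm, with the graph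
  \<open>H2_graph\<close> of all derivatives up to second order, a closed subspace of a product of copies of \<open>L2\<close> on which
  \<open>A\<close> is the restriction of a bounded linear map (\<open>elliptic_op_eq_jet\<close>); the product rule for weak
  derivatives that this requires rests on smooth approximation of continuously differentiable
  functions. Second, in the locale \<open>hspace_model\<close> the elements of a space of negative order are identified
  with their images under \<open>J\<close> (\<open>limit_class\<close>): such an image exists because square integrable functions
  of time form a complete space, and every function occurs as one because the range of the fractional
  integral is dense (\<open>frac_int_range_dense\<close>).\<close>

section \<open>Smooth functions of several variables\<close>

lemma pdv_eqI: "(f has_derivative f') (at x) \<Longrightarrow> pdv i f x = f' (axis i 1)"
  unfolding pdv_def by (metis frechet_derivative_at)

lemma Ck_on_const: "Ck_on k UNIV (\<lambda>x::real ^ 'a. c)"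
proof (induction k arbitrary: c)
  case (Suc k)
  have "pdv i (\<lambda>x::real ^ 'a. c) = (\<lambda>x. 0)" for i
    by (rule ext, subst pdv_eqI[where f'="\<lambda>h. 0"]) auto
  then show ?case using Suc by simp
qed simp

lemma Ck_on_SucD: "Ck_on (Suc k) UNIV f \<Longrightarrow> Ck_on k UNIV f"
proof (induction k arbitrary: f)
  case 0
  then show ?case
    by (auto intro!: continuous_at_imp_continuous_on differentiable_imp_continuous_within)
qed auto

lemma Ck_on_add:
  assumes "Ck_on k UNIV f" "Ck_on k UNIV g"
  shows "Ck_on k UNIV (\<lambda>x. f x + g x)"
  using assms
proof (induction k arbitrary: f g)
  case 0
  then show ?case by (auto intro: continuous_on_add)
next
  case (Suc k)
  have "pdv i (\<lambda>x. f x + g x) = (\<lambda>x. pdv i f x + pdv i g x)" for i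
  proof
    fix x
    have "f differentiable (at x)" "g differentiable (at x)" using Suc.prems by auto
    then have "(f has_derivative frechet_derivative f (at x)) (at x)"
       "(g has_derivative frechet_derivative g (at x)) (at x)" by (auto simp: frechet_derivative_works)
    from has_derivative_add[OF this] show "pdv i (\<lambda>x. f x + g x) x = pdv i f x + pdv i g x"
      by (subst pdv_eqI) (auto simp: pdv_def)
  qed
  then show ?case using Suc by (auto intro: differentiable_add)
qed

lemma pdv_mult:
  assumes "f differentiable (at x)" "g differentiable (at x)"
  shows "pdv i (\<lambda>x. f x * g x) x = pdv i f x * g x + f x * pdv i g x"
proof -
  have "(f has_derivative frechet_derivative f (at x)) (at x)"
     "(g has_derivative frechet_derivative g (at x)) (at x)" using assms by (auto simp: frechet_derivative_works)
  from pdv_eqI[OF has_derivative_mult[OF this], of i] show ?thesis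
    by (simp add: pdv_def)
qed

lemma Ck_on_mult:
  assumes "Ck_on k UNIV f" "Ck_on k UNIV g"
  shows "Ck_on k UNIV (\<lambda>x. f x * g x)"
  using assms
proof (induction k arbitrary: f g)
  case 0
  then show ?case by (auto intro: continuous_on_mult)
next
  case (Suc k)
  have "pdv i (\<lambda>x. f x * g x) = (\<lambda>x. pdv i f x * g x + f x * pdv i g x)" for i
    by (rule ext, rule pdv_mult) (use Suc.prems in auto)
  moreover have "Ck_on k UNIV (\<lambda>x. pdv i f x * g x + f x * pdv i g x)" for i
    using Suc Ck_on_SucD[OF Suc.prems(1)] Ck_on_SucD[OF Suc.prems(2)] by (intro Ck_on_add) auto
  ultimately show ?case using Suc by (auto intro: differentiable_mult)
qed

text \<open>A function of one variable is smooth if it starts a sequence of functions each of which is the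
  derivative of its predecessor; this form is what makes the induction on the order go through.\<close>

lemma Ck_on_compose:
  assumes F: "\<And>m s. (F m has_real_derivative F (Suc m) s) (at s)"
    and q: "Ck_on k UNIV q"
  shows "Ck_on k UNIV (\<lambda>x. F m (q x))"
  using q
proof (induction k arbitrary: m)
  case 0
  have "continuous_on UNIV (F m)"
    by (rule DERIV_continuous_on, rule has_field_derivative_at_within, rule F)
  then show ?case using 0
    by simp (rule continuous_on_compose2[where t=UNIV], auto)
next
  case (Suc k)
  have d: "((\<lambda>x. F m (q x)) has_derivative (\<lambda>h. frechet_derivative q (at x) h * F (Suc m) (q x))) (at x)" for x
  proof -
    have "(q has_derivative frechet_derivative q (at x)) (at x)"
      using Suc.prems by (auto simp: frechet_derivative_works[symmetric])
    from DERIV_compose_FDERIV[OF F this] show ?thesis .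
  qed
  have "pdv i (\<lambda>x. F m (q x)) = (\<lambda>x. pdv i q x * F (Suc m) (q x))" for i
    by (rule ext, subst pdv_eqI[OF d]) (simp add: pdv_def)
  moreover have "Ck_on k UNIV (\<lambda>x. pdv i q x * F (Suc m) (q x))" for i
    using Suc Ck_on_SucD[OF Suc.prems(1)] by (intro Ck_on_mult) auto
  moreover have "(\<lambda>x. F m (q x)) differentiable (at x)" for x
    using d unfolding differentiable_def by blast
  ultimately show ?case by auto
qed

lemma smooth_const: "smooth_on UNIV (\<lambda>x. c)"
  by (simp add: smooth_on_def Ck_on_const)

lemma smooth_add: "smooth_on UNIV f \<Longrightarrow> smooth_on UNIV g \<Longrightarrow> smooth_on UNIV (\<lambda>x. f x + g x)"
  by (simp add: smooth_on_def Ck_on_add)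

lemma smooth_mult: "smooth_on UNIV f \<Longrightarrow> smooth_on UNIV g \<Longrightarrow> smooth_on UNIV (\<lambda>x. f x * g x)"
  by (simp add: smooth_on_def Ck_on_mult)

lemma smooth_diff: "smooth_on UNIV f \<Longrightarrow> smooth_on UNIV g \<Longrightarrow> smooth_on UNIV (\<lambda>x. f x - g x)"
  using smooth_add[of f "\<lambda>x. -1 * g x"] smooth_mult[OF smooth_const, of g "-1"] by simp

lemma smooth_sum: "(\<And>i. i \<in> I \<Longrightarrow> smooth_on UNIV (f i)) \<Longrightarrow> smooth_on UNIV (\<lambda>x. \<Sum>i\<in>I. f i x)"
  by (induction I rule: infinite_finite_induct) (auto intro: smooth_add smooth_const)

lemma smooth_bounded_linear:
  assumes "bounded_linear f"
  shows "smooth_on UNIV f"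
  unfolding smooth_on_def
proof
  fix k
  have d: "(f has_derivative f) (at x)" for x
    by (rule bounded_linear_imp_has_derivative[OF assms])
  have "pdv i f = (\<lambda>x. f (axis i 1))" for i by (rule ext, rule pdv_eqI[OF d])
  then show "Ck_on k UNIV f"
    using d by (cases k) (auto simp: Ck_on_const differentiable_def intro: continuous_on_subset
        linear_continuous_on assms)
qed

lemma smooth_compose:
  assumes "\<And>m s. (F m has_real_derivative F (Suc m) s) (at s)" "smooth_on UNIV q"
  shows "smooth_on UNIV (\<lambda>x. F m (q x))"
  unfolding smooth_on_def
  by (rule allI, rule Ck_on_compose[where F=F, OF assms(1)]) (use assms(2) in \<open>simp add: smooth_on_def\<close>)

lemma smooth_exp: "smooth_on UNIV q \<Longrightarrow> smooth_on UNIV (\<lambda>x. exp (q x))"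
  using smooth_compose[of "\<lambda>m. exp" q] by auto

lemma smooth_real_polynomial_function:
  assumes "real_polynomial_function p"
  shows "smooth_on UNIV p"
  using assms by induction (auto intro: smooth_bounded_linear smooth_const smooth_add smooth_mult)

lemma smooth_differentiable: "smooth_on UNIV f \<Longrightarrow> f differentiable (at x)"
  unfolding smooth_on_def by (metis Ck_on.simps(2) UNIV_I)

lemma smooth_pdv: "smooth_on UNIV f \<Longrightarrow> smooth_on UNIV (pdv i f)"
  unfolding smooth_on_def by (metis Ck_on.simps(2))

lemma smooth_continuous: "smooth_on UNIV f \<Longrightarrow> continuous_on A f"
  unfolding smooth_on_def by (metis Ck_on.simps(1) continuous_on_subset subset_UNIV)

section \<open>A smooth function vanishing exactly outside a ball\<close>

text \<open>The functions \<open>poly p (1 / t) * exp (- (1 / t))\<close>, extended by zero to \<open>t \<le> 0\<close>. They are closed under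
  differentiation, which proves at one stroke that \<open>exp (- (1 / t))\<close> is smooth at \<open>0\<close>.\<close>

definition flat :: "real poly \<Rightarrow> real \<Rightarrow> real" where
  "flat p t = (if t > 0 then poly p (1 / t) * exp (- (1 / t)) else 0)"

lemma poly_times_exp_tendsto_0: "((\<lambda>s. poly p s * exp (- s)) \<longlongrightarrow> (0::real)) at_top"
proof -
  have "((\<lambda>s. \<Sum>i\<le>degree p. coeff p i * (s ^ i / exp s)) \<longlongrightarrow> (\<Sum>i\<le>degree p. coeff p i * 0)) at_top"
    by (intro tendsto_sum tendsto_mult tendsto_const tendsto_power_div_exp_0)
  then show ?thesis
    by (simp add: poly_altdef exp_minus field_simps sum_distrib_left)
qed

lemma flat_has_derivative:
  "(flat p has_real_derivative flat ([:0, 0, 1:] * (p - pderiv p)) t) (at t)"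
proof -
  consider "t > 0" | "t < 0" | "t = 0" by linarith
  then show ?thesis
  proof cases
    case 1
    have "((\<lambda>t. poly p (1 / t) * exp (- (1 / t))) has_real_derivative
        flat ([:0, 0, 1:] * (p - pderiv p)) t) (at t)"
      using 1 by (auto intro!: derivative_eq_intros simp: flat_def field_simps power2_eq_square)
    then show ?thesis
    proof (rule DERIV_cong_ev[THEN iffD1, rotated -1, OF _ refl _ refl])
      show "\<forall>\<^sub>F x in nhds t. poly p (1 / x) * exp (- (1 / x)) = flat p x"
        using eventually_nhds_in_open[of "{0<..}" t] 1
        by (auto simp: flat_def elim!: eventually_mono)
    qed
  next
    case 2
    have "((\<lambda>t. 0) has_real_derivative flat ([:0, 0, 1:] * (p - pderiv p)) t) (at t)"
      using 2 by (simp add: flat_def)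
    then show ?thesis
    proof (rule DERIV_cong_ev[THEN iffD1, rotated -1, OF _ refl _ refl])
      show "\<forall>\<^sub>F x in nhds t. 0 = flat p x"
        using eventually_nhds_in_open[of "{..<0}" t] 2
        by (auto simp: flat_def elim!: eventually_mono)
    qed
  next
    case 3
    have "((\<lambda>h. (flat p (0 + h) - flat p 0) / h) \<longlongrightarrow> 0) (at 0)"
    proof (rule filterlim_split_at)
      show "((\<lambda>h. (flat p (0 + h) - flat p 0) / h) \<longlongrightarrow> 0) (at_left 0)"
        by (rule tendsto_eventually) (auto simp: flat_def eventually_at_filter)
      have "((\<lambda>h. poly ([:0, 1:] * p) (inverse h) * exp (- inverse h)) \<longlongrightarrow> 0) (at_right 0)"
        by (rule filterlim_compose[OF poly_times_exp_tendsto_0 filterlim_inverse_at_top_right])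
      then show "((\<lambda>h. (flat p (0 + h) - flat p 0) / h) \<longlongrightarrow> 0) (at_right 0)"
        by (rule Lim_transform_eventually)
          (auto simp: flat_def eventually_at_filter field_simps)
    qed
    then show ?thesis using 3 by (simp add: DERIV_def flat_def)
  qed
qed

lemma smooth_flat_compose:
  assumes "smooth_on UNIV q"
  shows "smooth_on UNIV (\<lambda>x. flat p (q x))"
proof -
  define P where "P m = ((\<lambda>p. [:0, 0, 1:] * (p - pderiv p)) ^^ m) p" for m
  have "(flat (P m) has_real_derivative flat (P (Suc m)) s) (at s)" for m s
    using flat_has_derivative[of "P m" s] by (simp add: P_def)
  from smooth_compose[of "\<lambda>m. flat (P m)", OF this assms, of 0] show ?thesis
    by (simp add: P_def)
qed

definition bump :: "real ^ 'n \<Rightarrow> real \<Rightarrow> real ^ 'n \<Rightarrow> real" where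
  "bump c r x = flat 1 (r\<^sup>2 - (norm (x - c))\<^sup>2)"

lemma smooth_bump: "smooth_on UNIV (bump c r)"
proof -
  have *: "(norm (x - c))\<^sup>2 = (\<Sum>i\<in>UNIV. (x $ i - c $ i) * (x $ i - c $ i))" for x
    by (simp add: power2_norm_eq_inner inner_vec_def)
  have "smooth_on UNIV (\<lambda>x. r\<^sup>2 - (norm (x - c))\<^sup>2)"
    unfolding *
    by (intro smooth_diff smooth_sum smooth_mult smooth_const smooth_bounded_linear bounded_linear_vec_nth)
  then show ?thesis
    unfolding bump_def by (rule smooth_flat_compose)
qed

lemma bump_nonneg: "bump c r x \<ge> 0"
  by (simp add: bump_def flat_def)

lemma bump_pos_iff:
  assumes "r > 0"
  shows "bump c r x \<noteq> 0 \<longleftrightarrow> dist c x < r"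
proof -
  have "bump c r x \<noteq> 0 \<longleftrightarrow> (norm (x - c))\<^sup>2 < r\<^sup>2"
    by (simp add: bump_def flat_def)
  also have "\<dots> \<longleftrightarrow> norm (x - c) < r"
    using assms power_less_imp_less_base[of "norm (x - c)" 2 r] power_strict_mono[of "norm (x - c)" r 2]
    by auto
  finally show ?thesis by (simp add: dist_norm norm_minus_commute)
qed

text \<open>A finite sum of bumps. Being positive on \<open>K\<close> is all that is asked of a cutoff: a function supported
  in \<open>K\<close> can then be divided by it, approximated, and multiplied back.\<close>

lemma exists_cutoff:
  assumes "open \<Omega>" "compact K" "K \<subseteq> \<Omega>"
  obtains \<zeta> where "\<zeta> \<in> test_functions \<Omega>" "\<And>x. \<zeta> x \<ge> 0" "\<And>x. x \<in> K \<Longrightarrow> \<zeta> x > 0"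
proof -
  have "\<forall>x\<in>K. \<exists>r>0. cball x r \<subseteq> \<Omega>"
    using assms by (meson open_contains_cball subsetD)
  then obtain r where r: "\<And>x. x \<in> K \<Longrightarrow> r x > 0" "\<And>x. x \<in> K \<Longrightarrow> cball x (r x) \<subseteq> \<Omega>"
    by metis
  have "K \<subseteq> (\<Union>x\<in>K. ball x (r x))" using r by force
  then obtain C where C: "C \<subseteq> K" "finite C" "K \<subseteq> (\<Union>x\<in>C. ball x (r x))"
    using compactE_image[OF assms(2), of K "\<lambda>x. ball x (r x)"] by blast
  define \<zeta> where "\<zeta> x = (\<Sum>c\<in>C. bump c (r c) x)" for x
  have nz: "\<zeta> x \<noteq> 0 \<longleftrightarrow> (\<exists>c\<in>C. dist c x < r c)" for x
    using C r unfolding \<zeta>_def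
    by (subst sum_nonneg_eq_0_iff) (auto simp: bump_nonneg bump_pos_iff subset_iff)
  have "{x. \<zeta> x \<noteq> 0} \<subseteq> (\<Union>c\<in>C. cball c (r c))" using nz by (auto simp: less_imp_le)
  moreover have cl: "compact (\<Union>c\<in>C. cball c (r c))" using C by auto
  ultimately have sub: "closure {x. \<zeta> x \<noteq> 0} \<subseteq> (\<Union>c\<in>C. cball c (r c))"
    by (meson closure_minimal compact_imp_closed)
  have "compact (closure {x. \<zeta> x \<noteq> 0})"
    using compact_Int_closed[OF cl closed_closure, of "{x. \<zeta> x \<noteq> 0}"] sub by (simp add: Int_absorb1)
  moreover have "closure {x. \<zeta> x \<noteq> 0} \<subseteq> \<Omega>" using sub r C by blast
  moreover have "smooth_on UNIV \<zeta>" unfolding \<zeta>_def by (intro smooth_sum smooth_bump)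
  ultimately have "\<zeta> \<in> test_functions \<Omega>" by (simp add: test_functions_def)
  moreover have nn: "\<zeta> x \<ge> 0" for x unfolding \<zeta>_def by (intro sum_nonneg bump_nonneg)
  moreover have "\<zeta> x > 0" if "x \<in> K" for x
  proof -
    have "\<zeta> x \<noteq> 0" using nz[of x] subsetD[OF C(3) that] by auto
    then show ?thesis using nn[of x] by simp
  qed
  ultimately show ?thesis using that by blast
qed

section \<open>Test functions\<close>

lemma test_functions_smooth: "\<phi> \<in> test_functions \<Omega> \<Longrightarrow> smooth_on UNIV \<phi>"
  by (simp add: test_functions_def)

lemma pdv_zero_nhds:
  assumes "open S" "x \<in> S" "\<And>y. y \<in> S \<Longrightarrow> f y = 0"
  shows "pdv i f x = 0"
proof -
  have "(f has_derivative (\<lambda>h. 0)) (at x)"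
    by (rule has_derivative_transform_within_open[where f="\<lambda>x. 0", OF _ assms(1,2)]) (use assms in auto)
  from pdv_eqI[OF this] show ?thesis by simp
qed

lemma test_functions_support:
  assumes "\<phi> \<in> test_functions \<Omega>"
  obtains K where "compact K" "K \<subseteq> \<Omega>" "\<And>x. x \<notin> K \<Longrightarrow> \<phi> x = 0" "\<And>i x. x \<notin> K \<Longrightarrow> pdv i \<phi> x = 0"
proof -
  define K where "K = closure {x. \<phi> x \<noteq> 0}"
  have z: "\<phi> x = 0" if "x \<notin> K" for x
    using that closure_subset[of "{x. \<phi> x \<noteq> 0}"] unfolding K_def by blast
  have "pdv i \<phi> x = 0" if "x \<notin> K" for i x
  proof (rule pdv_zero_nhds)
    show "open (- K)" by (simp add: K_def open_Compl)
  qed (use z that in auto)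
  moreover have "compact K" "K \<subseteq> \<Omega>" using assms by (auto simp: test_functions_def K_def)
  ultimately show ?thesis using that z by blast
qed

lemma test_functionsI:
  assumes "smooth_on UNIV \<phi>" "compact K" "K \<subseteq> \<Omega>" "\<And>x. x \<notin> K \<Longrightarrow> \<phi> x = 0"
  shows "\<phi> \<in> test_functions \<Omega>"
proof -
  have "closure {x. \<phi> x \<noteq> 0} \<subseteq> K"
    by (rule closure_minimal) (use assms compact_imp_closed in auto)
  moreover from this have "compact (closure {x. \<phi> x \<noteq> 0})"
    using compact_Int_closed[OF assms(2) closed_closure, of "{x. \<phi> x \<noteq> 0}"] by (simp add: Int_absorb1)
  ultimately show ?thesis using assms by (auto simp: test_functions_def)
qed

lemma test_functions_mult:
  assumes "\<zeta> \<in> test_functions \<Omega>" "smooth_on UNIV p"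
  shows "(\<lambda>x. \<zeta> x * p x) \<in> test_functions \<Omega>"
proof -
  obtain K where "compact K" "K \<subseteq> \<Omega>" "\<And>x. x \<notin> K \<Longrightarrow> \<zeta> x = 0"
    using test_functions_support[OF assms(1)] by metis
  then show ?thesis
    by (intro test_functionsI[of _ K] smooth_mult test_functions_smooth[OF assms(1)] assms(2)) auto
qed

lemma continuous_compact_support_bounded:
  fixes f :: "'a::euclidean_space \<Rightarrow> real"
  assumes "continuous_on UNIV f" "compact K" "\<And>x. x \<notin> K \<Longrightarrow> f x = 0"
  obtains C where "C \<ge> 0" "\<And>x. \<bar>f x\<bar> \<le> C * indicator K x"
proof -
  have "compact (f ` K)" by (intro compact_continuous_image continuous_on_subset[OF assms(1)] assms) auto
  then have "bounded (f ` K)" by (rule compact_imp_bounded)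
  then obtain C where "\<forall>y\<in>f ` K. norm y \<le> C" by (meson bounded_iff)
  then show ?thesis using assms(3)
    by (intro that[of "max C 0"]) (auto simp: indicator_def split: if_splits)
qed

lemma continuous_compact_support_sq_integrable:
  fixes f :: "'a::euclidean_space \<Rightarrow> real"
  assumes "continuous_on UNIV f" "compact K" "\<And>x. x \<notin> K \<Longrightarrow> f x = 0"
  shows "sq_integrable f"
proof -
  obtain C where C: "\<And>x. \<bar>f x\<bar> \<le> C * indicator K x"
    using continuous_compact_support_bounded[OF assms] by metis
  show ?thesis
  proof (rule sq_integrable_dominated)
    show "sq_integrable (indicator K :: 'a \<Rightarrow> real)"
      by (rule sq_integrable_indicator[OF lmeasurable_compact[OF assms(2)]])
    show "f \<in> borel_measurable lebesgue"
      by (intro measurable_completion) (simp add: borel_measurable_continuous_onI[OF assms(1)])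
    show "AE x in lebesgue. \<bar>f x\<bar> \<le> C * \<bar>indicator K x\<bar>" using C by auto
  qed
qed

lemma test_functions_sq_integrable:
  assumes "\<phi> \<in> test_functions \<Omega>"
  shows "sq_integrable \<phi>" "sq_integrable (pdv i \<phi>)"
proof -
  obtain K where K: "compact K" "K \<subseteq> \<Omega>" "\<And>x. x \<notin> K \<Longrightarrow> \<phi> x = 0" "\<And>i x. x \<notin> K \<Longrightarrow> pdv i \<phi> x = 0"
    using test_functions_support[OF assms] by metis
  have s: "smooth_on UNIV \<phi>" by (rule test_functions_smooth[OF assms])
  show "sq_integrable \<phi>" "sq_integrable (pdv i \<phi>)"
    by (auto intro!: continuous_compact_support_sq_integrable[OF _ K(1)] smooth_continuous s smooth_pdv K)
qed

section \<open>Elements of \<open>L2\<close> and their representatives\<close>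

lemma rep_L2_measurable [measurable]: "rep_L2 v \<in> borel_measurable lebesgue"
  using rep_L2_sq_integrable[of v] by (simp add: sq_integrable_def)

lemma inner_abs_L2:
  assumes "sq_integrable g"
  shows "inner v (abs_L2 g) = (LINT x|lebesgue. rep_L2 v x * g x)"
  unfolding inner_L2_eq
proof (rule integral_cong_AE)
  show "AE x in lebesgue. rep_L2 v x * rep_L2 (abs_L2 g) x = rep_L2 v x * g x"
    using rep_abs_L2_AE[OF assms] by eventually_elim simp
qed (use assms in \<open>auto simp: sq_integrable_def\<close>)

lemma set_integral_eq_inner:
  assumes "sq_integrable g" "\<And>x. x \<notin> \<Omega> \<Longrightarrow> g x = 0"
  shows "(LINT x:\<Omega>|lebesgue. rep_L2 v x * g x) = inner v (abs_L2 g)"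
  unfolding inner_abs_L2[OF assms(1)] set_lebesgue_integral_def
  by (rule Bochner_Integration.integral_cong) (use assms(2) in \<open>auto simp: indicator_def\<close>)

lemma norm_abs_L2_le:
  assumes "sq_integrable f" "sq_integrable g" "AE x in lebesgue. \<bar>f x\<bar> \<le> e * \<bar>g x\<bar>" "e \<ge> 0"
  shows "norm (abs_L2 f) \<le> e * norm (abs_L2 g)"
proof -
  have "(LINT x|lebesgue. (f x)\<^sup>2) \<le> (LINT x|lebesgue. e\<^sup>2 * (g x)\<^sup>2)"
  proof (rule integral_mono_AE)
    show "AE x in lebesgue. (f x)\<^sup>2 \<le> e\<^sup>2 * (g x)\<^sup>2"
      using assms(3)
    proof eventually_elim
      case (elim x)
      then have "\<bar>f x\<bar>\<^sup>2 \<le> (e * \<bar>g x\<bar>)\<^sup>2" by (intro power_mono) auto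
      then show ?case by (simp add: power_mult_distrib)
    qed
  qed (use assms in \<open>auto simp: sq_integrable_def\<close>)
  then have "(norm (abs_L2 f))\<^sup>2 \<le> (e * norm (abs_L2 g))\<^sup>2"
    using assms by (simp add: norm_abs_L2 power_mult_distrib)
  then show ?thesis using assms(4) by (auto intro: power2_le_imp_le)
qed

lemma L2_on_iff_abs:
  assumes "sq_integrable f"
  shows "abs_L2 f \<in> L2_on \<Omega> \<longleftrightarrow> (AE x in lebesgue. x \<notin> \<Omega> \<longrightarrow> f x = 0)"
proof -
  note * = rep_abs_L2_AE[OF assms]
  have "(AE x in lebesgue. x \<notin> \<Omega> \<longrightarrow> rep_L2 (abs_L2 f) x = 0) \<longleftrightarrow> (AE x in lebesgue. x \<notin> \<Omega> \<longrightarrow> f x = 0)"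
  proof
    assume "AE x in lebesgue. x \<notin> \<Omega> \<longrightarrow> rep_L2 (abs_L2 f) x = 0"
    with * show "AE x in lebesgue. x \<notin> \<Omega> \<longrightarrow> f x = 0" by eventually_elim simp
  next
    assume "AE x in lebesgue. x \<notin> \<Omega> \<longrightarrow> f x = 0"
    with * show "AE x in lebesgue. x \<notin> \<Omega> \<longrightarrow> rep_L2 (abs_L2 f) x = 0" by eventually_elim simp
  qed
  then show ?thesis by (simp add: L2_on_def)
qed

lemma L2_on_add: "v \<in> L2_on \<Omega> \<Longrightarrow> w \<in> L2_on \<Omega> \<Longrightarrow> v + w \<in> L2_on \<Omega>"
proof -
  assume "v \<in> L2_on \<Omega>" "w \<in> L2_on \<Omega>"
  then have "AE x in lebesgue. x \<notin> \<Omega> \<longrightarrow> rep_L2 v x + rep_L2 w x = 0"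
    unfolding L2_on_def mem_Collect_eq by eventually_elim auto
  then show ?thesis
    using L2_on_iff_abs[OF sq_integrable_add[OF rep_L2_sq_integrable[of v] rep_L2_sq_integrable[of w]]]
    by (simp add: abs_L2_add[symmetric] rep_L2_sq_integrable)
qed

lemma L2_on_scaleR: "v \<in> L2_on \<Omega> \<Longrightarrow> r *\<^sub>R v \<in> L2_on \<Omega>"
proof -
  assume "v \<in> L2_on \<Omega>"
  then have "AE x in lebesgue. x \<notin> \<Omega> \<longrightarrow> r * rep_L2 v x = 0"
    unfolding L2_on_def mem_Collect_eq by eventually_elim auto
  then show ?thesis
    using L2_on_iff_abs[OF sq_integrable_scale[OF rep_L2_sq_integrable[of v]], of r]
    by (simp add: abs_L2_scaleR[symmetric] rep_L2_sq_integrable)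
qed

lemma L2_on_zero: "0 \<in> L2_on \<Omega>"
  using L2_on_iff_abs[OF sq_integrable_zero] by (simp add: zero_L2_def)

lemma subspace_L2_on: "subspace (L2_on \<Omega>)"
  by (simp add: subspace_def L2_on_add L2_on_scaleR L2_on_zero)

text \<open>\<open>L2_on\<close> is the orthogonal complement of the functions supported off \<open>\<Omega>\<close>, hence closed.\<close>

lemma closed_L2_on:
  assumes "\<Omega> \<in> sets lebesgue"
  shows "closed (L2_on \<Omega>)"
proof -
  define r where "r g = (\<lambda>x. indicator (- \<Omega>) x * rep_L2 g x)" for g
  have C: "- \<Omega> \<in> sets lebesgue" using assms by (simp add: Compl_in_sets_lebesgue)
  have sq: "sq_integrable (r g)" for g
  proof (rule sq_integrable_dominated[OF rep_L2_sq_integrable[of g], of _ 1])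
    show "r g \<in> borel_measurable lebesgue" unfolding r_def using C by measurable
    show "AE x in lebesgue. \<bar>r g x\<bar> \<le> 1 * \<bar>rep_L2 g x\<bar>" by (auto simp: r_def indicator_def)
  qed
  have "L2_on \<Omega> = (\<Inter>g. {v. inner v (abs_L2 (r g)) = 0})"
  proof (intro equalityI subsetI INT_I CollectI)
    fix v g assume v: "v \<in> L2_on \<Omega>"
    have "AE x in lebesgue. rep_L2 v x * r g x = 0"
      using v unfolding L2_on_def mem_Collect_eq by eventually_elim (auto simp: r_def indicator_def)
    then have "(LINT x|lebesgue. rep_L2 v x * r g x) = 0" by (rule integral_eq_zero_AE)
    then show "inner v (abs_L2 (r g)) = 0" by (simp add: inner_abs_L2[OF sq])
  next
    fix v assume "v \<in> (\<Inter>g. {v. inner v (abs_L2 (r g)) = 0})"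
    then have "inner v (abs_L2 (r v)) = 0" by auto
    then have "(LINT x|lebesgue. rep_L2 v x * r v x) = 0" by (simp add: inner_abs_L2[OF sq])
    moreover have "integrable lebesgue (\<lambda>x. rep_L2 v x * r v x)"
      by (rule sq_integrable_mult[OF rep_L2_sq_integrable sq])
    moreover have "AE x in lebesgue. 0 \<le> rep_L2 v x * r v x"
      by (auto simp: r_def indicator_def)
    ultimately have "AE x in lebesgue. rep_L2 v x * r v x = 0"
      by (metis integral_nonneg_eq_0_iff_AE)
    then show "v \<in> L2_on \<Omega>"
      unfolding L2_on_def mem_Collect_eq by eventually_elim (auto simp: r_def indicator_def split: if_splits)
  qed
  moreover have "closed {v. inner v (abs_L2 (r g)) = 0}" for g
    by (intro closed_Collect_eq continuous_intros)
  ultimately show ?thesis by auto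
qed

section \<open>Density of test functions\<close>

text \<open>A measurable function is almost everywhere a limit of continuous ones; truncation at the bound of \<open>g\<close> and
  the theorem of Stone and Weierstrass turn these into polynomials without losing boundedness, so that
  dominated convergence applies to the result.\<close>

lemma bounded_measurable_polynomial_approx:
  fixes g :: "'a::euclidean_space \<Rightarrow> real"
  assumes g: "g \<in> borel_measurable lebesgue" "\<And>x. \<bar>g x\<bar> \<le> D" and L: "compact L"
  obtains p where "\<And>n::nat. real_polynomial_function (p n)" "\<And>n x. x \<in> L \<Longrightarrow> \<bar>p n x\<bar> \<le> D + 1"
    "AE x in lebesgue. x \<in> L \<longrightarrow> (\<lambda>n. p n x) \<longlonglongrightarrow> g x"
proof -
  have D0: "D \<ge> 0" using g(2)[of undefined] by linarith
  obtain N h where N: "negligible N" "\<And>n::nat. continuous_on UNIV (h n)"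
      "\<And>x. x \<notin> N \<Longrightarrow> (\<lambda>n. h n x) \<longlonglongrightarrow> g x"
    using lebesgue_measurable_imp_measurable_on_real[OF g(1), of UNIV] unfolding measurable_on_def by auto
  define h' where "h' n x = max (- D) (min D (h n x))" for n x
  have h'c: "continuous_on L (h' n)" for n
    unfolding h'_def by (intro continuous_intros continuous_on_subset[OF N(2)]) auto
  have h'lim: "(\<lambda>n. h' n x) \<longlonglongrightarrow> g x" if "x \<notin> N" for x
  proof -
    have "(\<lambda>n. h' n x) \<longlonglongrightarrow> max (- D) (min D (g x))"
      unfolding h'_def by (intro tendsto_intros N that)
    moreover have "max (- D) (min D (g x)) = g x" using g(2)[of x] by (auto simp: abs_le_iff)
    ultimately show ?thesis by simp
  qed
  have "\<exists>p. real_polynomial_function p \<and> (\<forall>x\<in>L. \<bar>h' n x - p x\<bar> < 1 / real (Suc n))" for n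
    using Stone_Weierstrass_real_polynomial_function[OF L h'c, of "1 / real (Suc n)"]
    by (metis of_nat_0_less_iff zero_less_Suc zero_less_divide_1_iff)
  then obtain p where p: "\<And>n. real_polynomial_function (p n)"
    "\<And>n x. x \<in> L \<Longrightarrow> \<bar>h' n x - p n x\<bar> < 1 / real (Suc n)" by metis
  show ?thesis
  proof (rule that[OF p(1)])
    show "\<bar>p n x\<bar> \<le> D + 1" if "x \<in> L" for n x
    proof -
      have "\<bar>h' n x\<bar> \<le> D" using D0 unfolding h'_def by linarith
      moreover have "1 / real (Suc n) \<le> 1" by simp
      ultimately show ?thesis using p(2)[OF that, of n] by linarith
    qed
    have "AE x in lebesgue. x \<notin> N" using N(1) by (simp add: AE_not_in negligible_iff_null_sets)
    then show "AE x in lebesgue. x \<in> L \<longrightarrow> (\<lambda>n. p n x) \<longlonglongrightarrow> g x"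
    proof eventually_elim
      case (elim x)
      show ?case
      proof
        assume x: "x \<in> L"
        have "(\<lambda>n. h' n x - p n x) \<longlonglongrightarrow> 0"
          by (rule Lim_null_comparison[OF always_eventually LIMSEQ_inverse_real_of_nat])
            (use p(2)[OF x] in \<open>auto simp: inverse_eq_divide intro: less_imp_le\<close>)
        from tendsto_diff[OF h'lim[OF elim] this] show "(\<lambda>n. p n x) \<longlonglongrightarrow> g x" by simp
      qed
    qed
  qed
qed

text \<open>On a compact set the quotient by a cutoff reduces the claim to uniform approximation by polynomials.\<close>

lemma bounded_compact_support_in_closure:
  fixes f :: "real ^ 'n \<Rightarrow> real"
  assumes \<Omega>: "open \<Omega>" and K: "compact K" "K \<subseteq> \<Omega>"
    and f: "f \<in> borel_measurable lebesgue" "\<And>x. \<bar>f x\<bar> \<le> B" "\<And>x. x \<notin> K \<Longrightarrow> f x = 0"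
  shows "abs_L2 f \<in> closure (abs_L2 ` test_functions \<Omega>)"
proof -
  obtain \<zeta> where \<zeta>: "\<zeta> \<in> test_functions \<Omega>" "\<And>x. \<zeta> x \<ge> 0" "\<And>x. x \<in> K \<Longrightarrow> \<zeta> x > 0"
    using exists_cutoff[OF \<Omega> K] by blast
  obtain L where L: "compact L" "L \<subseteq> \<Omega>" "\<And>x. x \<notin> L \<Longrightarrow> \<zeta> x = 0"
    using test_functions_support[OF \<zeta>(1)] by metis
  have cont: "continuous_on A \<zeta>" for A using \<zeta>(1) test_functions_smooth smooth_continuous by blast
  have \<zeta>m: "\<zeta> \<in> borel_measurable lebesgue"
    using test_functions_sq_integrable[OF \<zeta>(1)] by (simp add: sq_integrable_def)
  obtain \<delta> where \<delta>: "\<delta> > 0" "\<And>x. x \<in> K \<Longrightarrow> \<delta> \<le> \<zeta> x"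
  proof (cases "K = {}")
    case False
    from continuous_attains_inf[OF K(1) False cont] obtain x where "x \<in> K" "\<forall>y\<in>K. \<zeta> x \<le> \<zeta> y" by blast
    then show ?thesis using that \<zeta>(3) by blast
  qed (use that[of 1] in auto)
  define g where "g x = f x / \<zeta> x" for x
  define D where "D = B / \<delta>"
  have B0: "B \<ge> 0" using f(2)[of undefined] by linarith
  have gB: "\<bar>g x\<bar> \<le> D" for x
  proof (cases "x \<in> K")
    case True
    then have "\<bar>f x\<bar> / \<zeta> x \<le> B / \<delta>" using f(2)[of x] \<delta> \<zeta>(3) by (intro frac_le) auto
    then show ?thesis using \<zeta>(3)[OF True] by (simp add: g_def D_def)
  qed (use f(3) B0 \<delta>(1) in \<open>simp add: g_def D_def\<close>)
  have gf: "\<zeta> x * g x = f x" for x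
    using f(3)[of x] \<zeta>(3)[of x] by (cases "x \<in> K") (auto simp: g_def)
  have gm: "g \<in> borel_measurable lebesgue" unfolding g_def using f(1) \<zeta>m by measurable
  obtain p where p: "\<And>n::nat. real_polynomial_function (p n)" "\<And>n x. x \<in> L \<Longrightarrow> \<bar>p n x\<bar> \<le> D + 1"
    "AE x in lebesgue. x \<in> L \<longrightarrow> (\<lambda>n. p n x) \<longlonglongrightarrow> g x"
    by (rule bounded_measurable_polynomial_approx[OF gm gB L(1)]) (rule that)
  \<comment> \<open>the polynomials approximate \<open>f / \<zeta>\<close>, so multiplying by the cutoff recovers \<open>f\<close>\<close>
  define q where "q n x = \<zeta> x * p n x" for n x
  have q: "q n \<in> test_functions \<Omega>" for n
    unfolding q_def by (intro test_functions_mult \<zeta> smooth_real_polynomial_function p)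
  have "(\<lambda>n. abs_L2 (q n)) \<longlonglongrightarrow> abs_L2 f"
  proof (rule abs_L2_dominated_convergence[where w="\<lambda>x. (D + 1) * \<zeta> x"])
    show "sq_integrable (q n)" for n by (rule test_functions_sq_integrable[OF q])
    show w: "sq_integrable (\<lambda>x. (D + 1) * \<zeta> x)"
      by (intro sq_integrable_scale test_functions_sq_integrable[OF \<zeta>(1)])
    show "sq_integrable f"
    proof (rule sq_integrable_dominated[OF test_functions_sq_integrable(1)[OF \<zeta>(1)] f(1), of D])
      have "\<bar>f x\<bar> \<le> D * \<bar>\<zeta> x\<bar>" for x
        using mult_left_mono[OF gB[of x], of "\<bar>\<zeta> x\<bar>"] by (simp add: gf[symmetric] abs_mult mult.commute)
      then show "AE x in lebesgue. \<bar>f x\<bar> \<le> D * \<bar>\<zeta> x\<bar>" by simp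
    qed
    show "AE x in lebesgue. \<bar>q n x\<bar> \<le> (D + 1) * \<zeta> x" for n
    proof (rule AE_I2)
      fix x
      show "\<bar>q n x\<bar> \<le> (D + 1) * \<zeta> x"
      proof (cases "x \<in> L")
        case True
        have "\<bar>p n x\<bar> \<le> D + 1" by (rule p(2)[OF True])
        then show ?thesis using \<zeta>(2)[of x] by (simp add: q_def abs_mult mult.commute mult_left_mono)
      qed (simp add: q_def L(3))
    qed
    show "AE x in lebesgue. (\<lambda>n. q n x) \<longlonglongrightarrow> f x"
      using p(3)
    proof eventually_elim
      case (elim x)
      show ?case
      proof (cases "x \<in> L")
        case True
        then have "(\<lambda>n. p n x) \<longlonglongrightarrow> g x" using elim by blast
        then have "(\<lambda>n. q n x) \<longlonglongrightarrow> \<zeta> x * g x" unfolding q_def by (intro tendsto_intros)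
        then show ?thesis by (simp add: gf)
      next
        case False
        then show ?thesis using gf[of x] L(3) by (simp add: q_def)
      qed
    qed
  qed
  then show ?thesis
    unfolding closure_sequential using q by (intro exI[of _ "\<lambda>n. abs_L2 (q n)"]) auto
qed

text \<open>Truncate the function in size and in space, so that the previous lemma applies.\<close>

lemma test_functions_dense:
  fixes \<theta> :: "(real ^ 'n) L2"
  assumes "open \<Omega>" "\<theta> \<in> L2_on \<Omega>"
  shows "\<theta> \<in> closure (abs_L2 ` test_functions \<Omega>)"
proof -
  obtain C where C: "\<And>n::nat. compact (C n)" "\<And>n. C n \<subseteq> \<Omega>" "\<And>n. C n \<subseteq> interior (C (Suc n))" "\<Union>(range C) = \<Omega>"
    "\<And>K. compact K \<Longrightarrow> K \<subseteq> \<Omega> \<Longrightarrow> \<exists>N. \<forall>n\<ge>N. K \<subseteq> C n"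
    using open_Union_compact_subsets[OF assms(1)] by metis
  define f where "f = rep_L2 \<theta>"
  define g where "g n x = indicator (C n) x * max (- real n) (min (real n) (f x))" for n x
  have sf: "sq_integrable f" by (simp add: f_def rep_L2_sq_integrable)
  have fm[measurable]: "f \<in> borel_measurable lebesgue" unfolding f_def by measurable
  have Cm[measurable]: "C n \<in> sets lebesgue" for n using lmeasurable_compact[OF C(1)] by blast
  have gm: "g n \<in> borel_measurable lebesgue" for n unfolding g_def by measurable
  have gle: "\<bar>g n x\<bar> \<le> \<bar>f x\<bar>" for n x by (auto simp: g_def indicator_def)
  have sg: "sq_integrable (g n)" for n
    by (rule sq_integrable_dominated[OF sf gm, of _ 1]) (use gle in auto)
  have "abs_L2 (g n) \<in> closure (abs_L2 ` test_functions \<Omega>)" for n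
    by (rule bounded_compact_support_in_closure[OF assms(1) C(1) C(2) gm, where B="real n"])
      (auto simp: g_def indicator_def)
  moreover have "(\<lambda>n. abs_L2 (g n)) \<longlonglongrightarrow> abs_L2 f"
  proof (rule abs_L2_dominated_convergence[OF sg sf])
    show "sq_integrable (\<lambda>x. \<bar>f x\<bar>)" by (rule sq_integrable_dominated[OF sf, of _ 1]) auto
    show "AE x in lebesgue. (\<lambda>n. g n x) \<longlonglongrightarrow> f x"
      using assms(2) unfolding L2_on_def mem_Collect_eq
    proof eventually_elim
      case (elim x)
      show ?case
      proof (cases "x \<in> \<Omega>")
        case True
        then obtain N where N: "\<forall>n\<ge>N. x \<in> C n" using C(5)[of "{x}"] by auto
        obtain M where M: "\<bar>f x\<bar> \<le> real M" using real_arch_simple by blast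
        have "g n x = f x" if "n \<ge> max N M" for n
          using N M that by (auto simp: g_def abs_le_iff)
        then show ?thesis
          by (intro tendsto_eventually eventually_sequentiallyI[of "max N M"])
      next
        case False
        then have "g n x = f x" for n using C(2) elim by (auto simp: g_def f_def indicator_def)
        then show ?thesis by simp
      qed
    qed
    show "AE x in lebesgue. \<bar>g n x\<bar> \<le> \<bar>f x\<bar>" for n using gle by auto
  qed
  ultimately have "abs_L2 f \<in> closure (abs_L2 ` test_functions \<Omega>)"
    by (rule closed_sequentially[OF closed_closure])
  then show ?thesis by (simp add: f_def)
qed

lemma L2_on_eq_zeroI:
  assumes "open \<Omega>" "v \<in> L2_on \<Omega>" "\<And>\<phi>. \<phi> \<in> test_functions \<Omega> \<Longrightarrow> inner v (abs_L2 \<phi>) = 0"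
  shows "v = 0"
proof -
  have "closure (abs_L2 ` test_functions \<Omega>) \<subseteq> {w. inner v w = 0}"
    by (rule closure_minimal) (use assms(3) in \<open>auto intro!: closed_Collect_eq continuous_intros\<close>)
  then have "inner v v = 0" using test_functions_dense[OF assms(1,2)] by auto
  then show ?thesis by simp
qed

section \<open>Integration by parts\<close>

lemma has_real_derivative_along_axis:
  assumes "f differentiable (at (x + t *\<^sub>R axis i 1))"
  shows "((\<lambda>t. f (x + t *\<^sub>R axis i 1)) has_real_derivative pdv i f (x + t *\<^sub>R axis i 1)) (at t)"
proof -
  let ?D = "frechet_derivative f (at (x + t *\<^sub>R axis i 1))"
  have D: "(f has_derivative ?D) (at (x + t *\<^sub>R axis i 1))"
    using assms by (simp add: frechet_derivative_works[symmetric])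
  have "((\<lambda>t. x + t *\<^sub>R axis i 1) has_derivative (\<lambda>h. h *\<^sub>R axis i 1)) (at t)"
    by (auto intro!: derivative_eq_intros)
  from has_derivative_compose[OF this D]
  have "((\<lambda>t. f (x + t *\<^sub>R axis i 1)) has_derivative (\<lambda>h. ?D (h *\<^sub>R axis i 1))) (at t)" .
  moreover have "?D (h *\<^sub>R axis i 1) = h * pdv i f (x + t *\<^sub>R axis i 1)" for h
    using linear_scale[OF has_derivative_linear[OF D], of h "axis i 1"] by (simp add: pdv_def)
  moreover have "(\<lambda>h. h * pdv i f (x + t *\<^sub>R axis i 1)) = (*) (pdv i f (x + t *\<^sub>R axis i 1))"
    by (auto simp: mult.commute)
  ultimately show ?thesis by (simp add: has_field_derivative_def)
qed

lemma diff_along_axis_le: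
  assumes f: "\<And>s. s \<in> {0..t} \<Longrightarrow> f differentiable (at (x + s *\<^sub>R axis i 1))"
    and L: "\<And>s. s \<in> {0..t} \<Longrightarrow> \<bar>pdv i f (x + s *\<^sub>R axis i 1)\<bar> \<le> L" and t: "0 \<le> t"
  shows "\<bar>f (x + t *\<^sub>R axis i 1) - f x\<bar> \<le> L * t"
proof -
  have "norm (f (x + t *\<^sub>R axis i 1) - f (x + 0 *\<^sub>R axis i 1)) \<le> L * norm (t - 0)"
  proof (rule field_differentiable_bound[where S="{0..t}"])
    show "((\<lambda>t. f (x + t *\<^sub>R axis i 1)) has_field_derivative pdv i f (x + s *\<^sub>R axis i 1)) (at s within {0..t})"
      if "s \<in> {0..t}" for s
      by (rule has_field_derivative_at_within[OF has_real_derivative_along_axis[OF f[OF that]]])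
  qed (use L t in auto)
  then show ?thesis using t by simp
qed

lemma integral_translation:
  fixes f :: "'a::euclidean_space \<Rightarrow> real"
  assumes "f \<in> borel_measurable borel"
  shows "(LINT x|lebesgue. f (x + c)) = (LINT x|lebesgue. f x)"
proof -
  have "(LINT x|lebesgue. f x) = (LINT x|lborel. f x)"
    by (rule integral_completion) (use assms in simp)
  also have "\<dots> = (LINT x|distr lborel borel ((+) c). f x)" by (simp add: lborel_distr_plus)
  also have "\<dots> = (LINT x|lborel. f (c + x))" by (rule integral_distr) (use assms in auto)
  also have "\<dots> = (LINT x|lebesgue. f (c + x))"
    by (rule integral_completion[symmetric]) (use assms in measurable)
  finally show ?thesis by (simp add: add.commute)
qed

text \<open>Integrals of difference quotients vanish because the measure is translation invariant.\<close>

lemma integral_pdv_test_function: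
  assumes "\<phi> \<in> test_functions \<Omega>"
  shows "(LINT x|lebesgue. pdv i \<phi> x) = 0"
proof -
  obtain K where K: "compact K" "\<And>x. x \<notin> K \<Longrightarrow> \<phi> x = 0" "\<And>x. x \<notin> K \<Longrightarrow> pdv i \<phi> x = 0"
    using test_functions_support[OF assms] by metis
  have s: "smooth_on UNIV \<phi>" by (rule test_functions_smooth[OF assms])
  obtain L where L: "L \<ge> 0" "\<And>x. \<bar>pdv i \<phi> x\<bar> \<le> L * indicator K x"
    using continuous_compact_support_bounded[OF smooth_continuous[OF smooth_pdv[OF s]] K(1) K(3)] by metis
  obtain R where "\<forall>x\<in>K. norm x \<le> R" using compact_imp_bounded[OF K(1)] by (meson bounded_iff)
  then have R: "K \<subseteq> cball 0 R" by auto
  define q where "q n x = (\<phi> (x + (1 / real (Suc n)) *\<^sub>R axis i 1) - \<phi> x) * real (Suc n)" for n x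
  have \<phi>b: "\<phi> \<in> borel_measurable borel"
    by (rule borel_measurable_continuous_onI[OF smooth_continuous[OF s]])
  have qb: "q n \<in> borel_measurable borel" for n unfolding q_def using \<phi>b by measurable
  have int: "integrable lebesgue \<phi>"
  proof -
    obtain C where "\<And>x. \<bar>\<phi> x\<bar> \<le> C * indicator K x"
      using continuous_compact_support_bounded[OF smooth_continuous[OF s] K(1) K(2)] by metis
    then show ?thesis
      using lmeasurable_compact[OF K(1)]
      by (intro Bochner_Integration.integrable_bound[where g=\<phi> and f="\<lambda>x. C * indicator K x"])
        (auto intro!: measurable_completion simp: \<phi>b fmeasurable_def intro: order_trans[OF _ abs_ge_self])
  qed
  have intt: "integrable lebesgue (\<lambda>x. \<phi> (x + c))" for c
  proof -
    have "integrable lborel \<phi>" using int \<phi>b by (simp add: integrable_completion)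
    then have "integrable (distr lborel borel ((+) c)) \<phi>" by (simp add: lborel_distr_plus)
    then have "integrable lborel (\<lambda>x. \<phi> (c + x))" by (subst (asm) integrable_distr_eq) (use \<phi>b in auto)
    then show ?thesis using \<phi>b by (simp add: integrable_completion add.commute)
  qed
  have "(LINT x|lebesgue. q n x) = 0" for n
    using integral_translation[OF \<phi>b] unfolding q_def by (simp add: int intt)
  moreover have "(\<lambda>n. LINT x|lebesgue. q n x) \<longlonglongrightarrow> (LINT x|lebesgue. pdv i \<phi> x)"
  proof (rule integral_dominated_convergence[where w="\<lambda>x. L * indicator (cball 0 (R + 1)) x"])
    show "pdv i \<phi> \<in> borel_measurable lebesgue" "q n \<in> borel_measurable lebesgue" for n
      using test_functions_sq_integrable(2)[OF assms, of i] qb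
      by (auto simp: sq_integrable_def intro!: measurable_completion)
    show "integrable lebesgue (\<lambda>x. L * indicator (cball 0 (R + 1)) x)"
      using lmeasurable_cball[of 0 "R + 1"] by (intro integrable_mult_right) (auto simp: fmeasurable_def)
    show "AE x in lebesgue. (\<lambda>n. q n x) \<longlonglongrightarrow> pdv i \<phi> x"
    proof (rule AE_I2)
      fix x
      have "((\<lambda>t. \<phi> (x + t *\<^sub>R axis i 1)) has_real_derivative pdv i \<phi> x) (at 0)"
        using has_real_derivative_along_axis[of \<phi> x 0 i] smooth_differentiable[OF s] by simp
      then have "((\<lambda>h. (\<phi> (x + h *\<^sub>R axis i 1) - \<phi> x) / h) \<longlongrightarrow> pdv i \<phi> x) (at 0)"
        by (simp add: DERIV_def)
      moreover have "filterlim (\<lambda>n. 1 / real (Suc n)) (at 0) sequentially"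
        using LIMSEQ_inverse_real_of_nat by (auto simp: filterlim_at inverse_eq_divide)
      ultimately have "(\<lambda>n. (\<phi> (x + (1 / real (Suc n)) *\<^sub>R axis i 1) - \<phi> x) / (1 / real (Suc n))) \<longlonglongrightarrow> pdv i \<phi> x"
        by (rule filterlim_compose)
      then show "(\<lambda>n. q n x) \<longlonglongrightarrow> pdv i \<phi> x" by (simp add: q_def)
    qed
    fix n
    have "\<bar>q n x\<bar> \<le> L * indicator (cball 0 (R + 1)) x" for x
    proof (cases "x \<in> cball 0 (R + 1)")
      case True
      have "\<bar>\<phi> (x + (1 / real (Suc n)) *\<^sub>R axis i 1) - \<phi> x\<bar> \<le> L * (1 / real (Suc n))"
      proof (rule diff_along_axis_le)
        show "\<bar>pdv i \<phi> y\<bar> \<le> L" for y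
          using L(2)[of y] L(1) by (cases "y \<in> K") auto
      qed (use smooth_differentiable[OF s] in auto)
      from mult_right_mono[OF this, of "real (Suc n)"]
      have "\<bar>q n x\<bar> \<le> L" by (simp add: q_def abs_mult del: of_nat_Suc)
      then show ?thesis using True by simp
    next
      case False
      have "norm x \<le> norm (x + (1 / real (Suc n)) *\<^sub>R axis i 1) + norm ((1 / real (Suc n)) *\<^sub>R axis i 1 :: real ^ 'a)"
        using norm_triangle_ineq4[of "x + (1 / real (Suc n)) *\<^sub>R axis i 1" "(1 / real (Suc n)) *\<^sub>R axis i 1"] by simp
      moreover have "norm ((1 / real (Suc n)) *\<^sub>R axis i 1 :: real ^ 'a) \<le> 1" by simp
      ultimately have "norm x \<le> norm (x + (1 / real (Suc n)) *\<^sub>R axis i 1) + 1" by linarith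
      moreover have "norm y \<le> R" if "y \<in> K" for y using R that by auto
      ultimately have "x \<notin> K" "x + (1 / real (Suc n)) *\<^sub>R axis i 1 \<notin> K"
        using False by fastforce+
      then show ?thesis using K(2) False by (simp add: q_def)
    qed
    then show "AE x in lebesgue. norm (q n x) \<le> L * indicator (cball 0 (R + 1)) x" by simp
  qed
  ultimately show ?thesis by (simp add: LIMSEQ_const_iff)
qed

section \<open>Weak derivatives\<close>

text \<open>Test functions vanish off \<open>\<Omega>\<close>, so integrals over \<open>\<Omega>\<close> are scalar products in \<open>L2\<close>. In this form linearity,
  closedness and uniqueness of weak derivatives are facts about scalar products.\<close>

lemma has_weak_pdv_iff_inner:
  "has_weak_pdv \<Omega> i v w \<longleftrightarrow> w \<in> L2_on \<Omega> \<and>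
     (\<forall>\<phi>\<in>test_functions \<Omega>. inner v (abs_L2 (pdv i \<phi>)) = - inner w (abs_L2 \<phi>))"
proof -
  have "(LINT x:\<Omega>|lebesgue. rep_L2 v x * pdv i \<phi> x) = inner v (abs_L2 (pdv i \<phi>)) \<and>
        (LINT x:\<Omega>|lebesgue. rep_L2 w x * \<phi> x) = inner w (abs_L2 \<phi>)" if \<phi>: "\<phi> \<in> test_functions \<Omega>" for \<phi>
  proof -
    obtain K where "K \<subseteq> \<Omega>" "\<And>x. x \<notin> K \<Longrightarrow> \<phi> x = 0" "\<And>i x. x \<notin> K \<Longrightarrow> pdv i \<phi> x = 0"
      using test_functions_support[OF \<phi>] by metis
    then show ?thesis
      using test_functions_sq_integrable[OF \<phi>] by (intro conjI set_integral_eq_inner) auto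
  qed
  then show ?thesis unfolding has_weak_pdv_def by auto
qed

lemma has_weak_pdv_unique:
  assumes "open \<Omega>" "has_weak_pdv \<Omega> i v w" "has_weak_pdv \<Omega> i v w'"
  shows "w = w'"
proof -
  have "w - w' = 0"
  proof (rule L2_on_eq_zeroI[OF assms(1)])
    show "w - w' \<in> L2_on \<Omega>"
      using assms by (intro subspace_diff[OF subspace_L2_on]) (simp_all add: has_weak_pdv_iff_inner)
    show "inner (w - w') (abs_L2 \<phi>) = 0" if "\<phi> \<in> test_functions \<Omega>" for \<phi>
      using assms that by (simp add: has_weak_pdv_iff_inner inner_diff_left)
  qed
  then show ?thesis by simp
qed

lemma weak_pdv_eq: "open \<Omega> \<Longrightarrow> has_weak_pdv \<Omega> i v w \<Longrightarrow> weak_pdv \<Omega> i v = w"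
  unfolding weak_pdv_def by (rule the_equality) (auto intro: has_weak_pdv_unique)

lemma has_weak_pdv_add:
  "has_weak_pdv \<Omega> i v w \<Longrightarrow> has_weak_pdv \<Omega> i v' w' \<Longrightarrow> has_weak_pdv \<Omega> i (v + v') (w + w')"
  by (simp add: has_weak_pdv_iff_inner inner_add_left L2_on_add)

lemma has_weak_pdv_scaleR: "has_weak_pdv \<Omega> i v w \<Longrightarrow> has_weak_pdv \<Omega> i (r *\<^sub>R v) (r *\<^sub>R w)"
  by (simp add: has_weak_pdv_iff_inner L2_on_scaleR)

lemma has_weak_pdv_diff:
  "has_weak_pdv \<Omega> i v w \<Longrightarrow> has_weak_pdv \<Omega> i v' w' \<Longrightarrow> has_weak_pdv \<Omega> i (v - v') (w - w')"
  using has_weak_pdv_add[of \<Omega> i v w "-1 *\<^sub>R v'" "-1 *\<^sub>R w'"] has_weak_pdv_scaleR[of \<Omega> i v' w' "-1"] by simp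

lemma closed_has_weak_pdv:
  assumes "\<Omega> \<in> sets lebesgue"
  shows "closed {z. has_weak_pdv \<Omega> i (fst z) (snd z)}"
proof -
  have "{z. has_weak_pdv \<Omega> i (fst z) (snd z)} = snd -` L2_on \<Omega> \<inter>
     (\<Inter>\<phi>\<in>test_functions \<Omega>. {z. inner (fst z) (abs_L2 (pdv i \<phi>)) = - inner (snd z) (abs_L2 \<phi>)})"
    by (auto simp: has_weak_pdv_iff_inner)
  then show ?thesis
    by (simp only:) (intro closed_Int closed_INT ballI closed_vimage closed_L2_on assms
        closed_Collect_eq continuous_intros)
qed

lemma test_function_in_L2_on:
  assumes "\<phi> \<in> test_functions \<Omega>"
  shows "abs_L2 \<phi> \<in> L2_on \<Omega>" "abs_L2 (pdv i \<phi>) \<in> L2_on \<Omega>"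
proof -
  obtain K where "K \<subseteq> \<Omega>" "\<And>x. x \<notin> K \<Longrightarrow> \<phi> x = 0" "\<And>i x. x \<notin> K \<Longrightarrow> pdv i \<phi> x = 0"
    using test_functions_support[OF assms] by metis
  then have "x \<notin> \<Omega> \<Longrightarrow> \<phi> x = 0" "x \<notin> \<Omega> \<Longrightarrow> pdv i \<phi> x = 0" for x by auto
  then show "abs_L2 \<phi> \<in> L2_on \<Omega>" "abs_L2 (pdv i \<phi>) \<in> L2_on \<Omega>"
    by (auto simp: L2_on_iff_abs test_functions_sq_integrable[OF assms])
qed

text \<open>Integration by parts: the integral of the derivative of a product of test functions is zero.\<close>

lemma has_weak_pdv_test_function:
  assumes "\<phi> \<in> test_functions \<Omega>"
  shows "has_weak_pdv \<Omega> i (abs_L2 \<phi>) (abs_L2 (pdv i \<phi>))"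
  unfolding has_weak_pdv_iff_inner
proof (intro conjI ballI test_function_in_L2_on[OF assms])
  fix \<psi> assume \<psi>: "\<psi> \<in> test_functions \<Omega>"
  note sq = test_functions_sq_integrable[OF assms] test_functions_sq_integrable[OF \<psi>]
  have "pdv i (\<lambda>x. \<phi> x * \<psi> x) = (\<lambda>x. pdv i \<phi> x * \<psi> x + \<phi> x * pdv i \<psi> x)"
    by (rule ext, rule pdv_mult) (auto intro!: smooth_differentiable test_functions_smooth assms \<psi>)
  then have "(LINT x|lebesgue. pdv i \<phi> x * \<psi> x + \<phi> x * pdv i \<psi> x) = 0"
    using integral_pdv_test_function[OF test_functions_mult[OF assms test_functions_smooth[OF \<psi>]], of i] by simp
  then have "(LINT x|lebesgue. pdv i \<phi> x * \<psi> x) + (LINT x|lebesgue. \<phi> x * pdv i \<psi> x) = 0"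
    by (simp add: sq_integrable_mult sq)
  then show "inner (abs_L2 \<phi>) (abs_L2 (pdv i \<psi>)) = - inner (abs_L2 (pdv i \<phi>)) (abs_L2 \<psi>)"
    by (simp add: inner_L2.abs_eq sq)
qed

section \<open>Continuously differentiable test functions\<close>

text \<open>Linear combinations of exponentials form an algebra that separates points and, unlike an abstract
  algebra of polynomials, has obvious antiderivatives along each coordinate axis.\<close>

inductive exp_sum :: "(real ^ 'n \<Rightarrow> real) \<Rightarrow> bool" where
  exp_sum_exp: "exp_sum (\<lambda>x. c * exp (inner x y))"
| exp_sum_add: "exp_sum f \<Longrightarrow> exp_sum g \<Longrightarrow> exp_sum (\<lambda>x. f x + g x)"

lemma exp_sum_mult:
  assumes "exp_sum f" "exp_sum g"
  shows "exp_sum (\<lambda>x. f x * g x)"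
  using assms(1)
proof induction
  case (exp_sum_exp c y)
  from assms(2) show ?case
  proof induction
    case (exp_sum_exp d z)
    have "(\<lambda>x. c * exp (inner x y) * (d * exp (inner x z))) = (\<lambda>x. (c * d) * exp (inner x (y + z)))"
      by (auto simp: inner_add_right exp_add)
    then show ?case using exp_sum.exp_sum_exp by metis
  next
    case (exp_sum_add f g)
    then show ?case using exp_sum.exp_sum_add by (simp add: distrib_left)
  qed
next
  case (exp_sum_add f h)
  then show ?case using exp_sum.exp_sum_add by (simp add: distrib_right)
qed

lemma continuous_on_exp_sum: "exp_sum f \<Longrightarrow> continuous_on S f"
  by (induction rule: exp_sum.induct) (auto intro!: continuous_intros)

lemma pdv_add:
  assumes "f differentiable (at x)" "g differentiable (at x)"
  shows "pdv i (\<lambda>x. f x + g x) x = pdv i f x + pdv i g x"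
proof -
  have "(f has_derivative frechet_derivative f (at x)) (at x)"
     "(g has_derivative frechet_derivative g (at x)) (at x)" using assms by (auto simp: frechet_derivative_works)
  from pdv_eqI[OF has_derivative_add[OF this], of i] show ?thesis
    by (simp add: pdv_def)
qed

text \<open>The antiderivative is normalised to vanish on a hyperplane orthogonal to the axis; there a compactly
  supported function that it is to approximate vanishes too.\<close>

lemma exp_sum_antiderivative:
  fixes i :: "'n::finite"
  assumes "exp_sum p"
  shows "\<exists>q. smooth_on UNIV q \<and> (\<forall>x. x $ i = m \<longrightarrow> q x = 0) \<and> (\<forall>x. pdv i q x = p x)"
  using assms
proof induction
  case (exp_sum_exp c y)
  have sx: "smooth_on UNIV (\<lambda>x::real ^ 'n. inner x z)" for z
    by (intro smooth_bounded_linear bounded_linear_inner_left)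
  show ?case
  proof (cases "y $ i = 0")
    case True
    define q where "q x = c * ((x $ i - m) * exp (inner x y))" for x :: "real ^ 'n"
    have "smooth_on UNIV q"
      unfolding q_def
      by (intro smooth_mult smooth_exp sx smooth_const smooth_diff smooth_bounded_linear bounded_linear_vec_nth)
    moreover have "pdv i q x = c * exp (inner x y)" for x
    proof -
      have "(q has_derivative (\<lambda>h. c * (h $ i * exp (inner x y) + (x $ i - m) * (exp (inner x y) * inner h y)))) (at x)"
        unfolding q_def by (auto intro!: derivative_eq_intros bounded_linear.has_derivative[OF bounded_linear_vec_nth] simp: algebra_simps)
      from pdv_eqI[OF this, of i] show ?thesis using True
        by (simp add: inner_axis')
    qed
    moreover have "q x = 0" if "x $ i = m" for x using that by (simp add: q_def)
    ultimately show ?thesis by blast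
  next
    case False
    define y' where "y' = y - (y $ i) *\<^sub>R axis i 1"
    define q where "q x = (c / y $ i) * (exp (inner x y) - exp (m * y $ i) * exp (inner x y'))" for x :: "real ^ 'n"
    have "smooth_on UNIV q"
      unfolding q_def by (intro smooth_mult smooth_exp sx smooth_const smooth_diff)
    moreover have "pdv i q x = c * exp (inner x y)" for x
    proof -
      have "(q has_derivative (\<lambda>h. (c / y $ i) * (exp (inner x y) * inner h y - exp (m * y $ i) * (exp (inner x y') * inner h y')))) (at x)"
        unfolding q_def using False by (auto intro!: derivative_eq_intros simp: algebra_simps)
      from pdv_eqI[OF this, of i] show ?thesis using False
        by (simp add: inner_axis' inner_axis_axis inner_diff_right y'_def)
    qed
    moreover have "q x = 0" if "x $ i = m" for x
    proof -
      have "inner x y = m * y $ i + inner x y'"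
        using that by (simp add: y'_def inner_diff_right inner_axis)
      then show ?thesis by (simp add: q_def exp_add)
    qed
    ultimately show ?thesis by blast
  qed
next
  case (exp_sum_add f g)
  then obtain q r where "smooth_on UNIV q" "\<forall>x. x $ i = m \<longrightarrow> q x = 0" "\<forall>x. pdv i q x = f x"
      "smooth_on UNIV r" "\<forall>x. x $ i = m \<longrightarrow> r x = 0" "\<forall>x. pdv i r x = g x" by blast
  then show ?case
    by (intro exI[of _ "\<lambda>x. q x + r x"]) (auto simp: smooth_add pdv_add smooth_differentiable)
qed

lemma exp_sum_dense:
  fixes f :: "real ^ 'n \<Rightarrow> real"
  assumes "compact S" "continuous_on S f" "e > 0"
  shows "\<exists>g. exp_sum g \<and> (\<forall>x\<in>S. \<bar>f x - g x\<bar> < e)"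
proof (rule Stone_Weierstrass_HOL[OF assms(1) _ _ _ _ _ assms(2,3)])
  show "exp_sum (\<lambda>x. c)" for c using exp_sum_exp[of c 0] by simp
  fix x y :: "real ^ 'n" assume "x \<in> S \<and> y \<in> S \<and> x \<noteq> y"
  then have "inner (x - y) (x - y) \<noteq> 0" by auto
  then have "1 * exp (inner x (x - y)) \<noteq> 1 * exp (inner y (x - y))" by (simp add: inner_diff_left)
  then show "\<exists>f. exp_sum f \<and> f x \<noteq> f y" using exp_sum_exp[of 1 "x - y"] by blast
qed (auto intro: continuous_on_exp_sum exp_sum_add exp_sum_mult)

text \<open>Approximate the derivative first and integrate back along the axis: this keeps the function and
  its derivative uniformly close at the same time.\<close>

lemma C1_approximation:
  fixes \<psi> :: "real ^ 'n \<Rightarrow> real"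
  assumes \<psi>: "\<And>x. \<psi> differentiable (at x)" "continuous_on UNIV (pdv i \<psi>)"
    and m: "\<And>x. x $ i = - m \<Longrightarrow> \<psi> x = 0" and m0: "m > 0" and e: "e > 0"
  obtains q where "smooth_on UNIV q" "\<And>x. (\<And>j. \<bar>x $ j\<bar> \<le> m) \<Longrightarrow> \<bar>\<psi> x - q x\<bar> \<le> e"
    "\<And>x. (\<And>j. \<bar>x $ j\<bar> \<le> m) \<Longrightarrow> \<bar>pdv i \<psi> x - pdv i q x\<bar> \<le> e"
proof -
  define S :: "(real ^ 'n) set" where "S = cbox (- vec m) (vec m)"
  have S: "x \<in> S \<longleftrightarrow> (\<forall>j. \<bar>x $ j\<bar> \<le> m)" for x by (simp add: S_def mem_box_cart abs_le_iff minus_le_iff) blast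
  \<comment> \<open>integrating along an axis across the cube multiplies the error by its side length \<open>2 * m\<close>\<close>
  define d where "d = min e (e / (2 * m))"
  have d: "d > 0" "d \<le> e" "d * (2 * m) \<le> e"
    using e m0 by (auto simp: d_def min_def field_simps)
  have "compact S" "continuous_on S (pdv i \<psi>)"
    by (auto simp: S_def intro: continuous_on_subset[OF \<psi>(2)])
  from exp_sum_dense[OF this d(1)] obtain p where p: "exp_sum p" "\<And>x. x \<in> S \<Longrightarrow> \<bar>pdv i \<psi> x - p x\<bar> < d"
    by blast
  obtain q where q: "smooth_on UNIV q" "\<And>x. x $ i = - m \<Longrightarrow> q x = 0" "\<And>x. pdv i q x = p x"
    using exp_sum_antiderivative[OF p(1), of i "- m"] by blast
  show ?thesis
  proof (rule that[OF q(1)])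
    fix x :: "real ^ 'n" assume "\<And>j. \<bar>x $ j\<bar> \<le> m"
    then have x: "x \<in> S" by (simp add: S)
    show "\<bar>pdv i \<psi> x - pdv i q x\<bar> \<le> e" using p(2)[OF x] d q(3) by auto
    define x0 where "x0 = x - (x $ i + m) *\<^sub>R axis i 1"
    define r where "r x = \<psi> x + (-1) * q x" for x
    have qd: "q differentiable (at y)" for y using q(1) smooth_differentiable by blast
    have qm: "(\<lambda>x. (-1) * q x) differentiable (at y)" for y using qd by (intro differentiable_mult) auto
    have rd: "r differentiable (at y)" for y
      unfolding r_def by (intro differentiable_add \<psi>(1) qm)
    have rp: "pdv i r y = pdv i \<psi> y - p y" for y
    proof -
      have "pdv i (\<lambda>x. (-1) * q x) y = - p y"
        using pdv_mult[of "\<lambda>x. -1" y q i] qd pdv_eqI[of "\<lambda>x. -1" "\<lambda>h. 0" y i] q(3) by simp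
      then show ?thesis unfolding r_def using pdv_add[OF \<psi>(1) qm, of i y] by simp
    qed
    have x0i: "x0 $ i = - m" by (simp add: x0_def axis_def)
    have "\<bar>r (x0 + (x $ i + m) *\<^sub>R axis i 1) - r x0\<bar> \<le> d * (x $ i + m)"
    proof (rule diff_along_axis_le[OF rd])
      have xi: "\<bar>x $ i\<bar> \<le> m" using x by (auto simp: S)
      then show "0 \<le> x $ i + m" by linarith
      fix s assume s: "s \<in> {0..x $ i + m}"
      have "(x0 + s *\<^sub>R axis i 1) $ j = (if j = i then s - m else x $ j)" for j
        by (simp add: x0_def axis_def)
      moreover have "\<bar>s - m\<bar> \<le> m" using s xi by auto
      ultimately have "x0 + s *\<^sub>R axis i 1 \<in> S" using x by (auto simp: S)
      then show "\<bar>pdv i r (x0 + s *\<^sub>R axis i 1)\<bar> \<le> d" using p(2) by (simp add: rp less_imp_le)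
    qed
    moreover have "r x0 = 0" using m[OF x0i] q(2)[OF x0i] by (simp add: r_def)
    ultimately have "\<bar>r x\<bar> \<le> d * (x $ i + m)" by (simp add: x0_def)
    also have "\<dots> \<le> d * (2 * m)" using x d by (intro mult_left_mono) (auto simp: S abs_le_iff)
    finally show "\<bar>\<psi> x - q x\<bar> \<le> e" using d by (simp add: r_def)
  qed
qed

text \<open>The definition of a weak derivative only tests with smooth functions; approximation extends it
  to continuously differentiable ones, which is what products with the coefficients require.\<close>

lemma has_weak_pdv_C1_test:
  assumes \<Omega>: "open \<Omega>" and v: "has_weak_pdv \<Omega> i v w"
    and \<psi>: "\<And>x. \<psi> differentiable (at x)" "continuous_on UNIV (pdv i \<psi>)"
    and K: "compact K" "K \<subseteq> \<Omega>" "\<And>x. x \<notin> K \<Longrightarrow> \<psi> x = 0"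
  shows "inner v (abs_L2 (pdv i \<psi>)) = - inner w (abs_L2 \<psi>)"
proof -
  obtain \<zeta> where \<zeta>: "\<zeta> \<in> test_functions \<Omega>" "\<And>x. \<zeta> x \<ge> 0" "\<And>x. x \<in> K \<Longrightarrow> \<zeta> x > 0"
    using exists_cutoff[OF \<Omega> K(1,2)] by blast
  obtain L where L: "compact L" "L \<subseteq> \<Omega>" "\<And>x. x \<notin> L \<Longrightarrow> \<zeta> x = 0" "\<And>i x. x \<notin> L \<Longrightarrow> pdv i \<zeta> x = 0"
    using test_functions_support[OF \<zeta>(1)] by metis
  have KL: "K \<subseteq> L" using L(3) \<zeta>(3) by fastforce
  obtain m where m: "m > 0" "\<And>x. x \<in> L \<Longrightarrow> norm x < m"
    using compact_imp_bounded[OF L(1)] by (auto simp: bounded_pos_less)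
  have s\<zeta>: "smooth_on UNIV \<zeta>" by (rule test_functions_smooth[OF \<zeta>(1)])
  have d\<zeta>: "\<zeta> differentiable (at x)" for x by (rule smooth_differentiable[OF s\<zeta>])
  \<comment> \<open>where \<open>\<zeta>\<close> vanishes so does \<open>\<psi>\<close>, and the quotient is \<open>0\<close> by the convention for division\<close>
  define \<eta> where "\<eta> x = \<psi> x / \<zeta> x" for x
  have \<eta>K: "\<eta> x = 0" if "x \<notin> K" for x using that K(3) by (simp add: \<eta>_def)
  have \<zeta>\<eta>: "\<psi> x = \<zeta> x * \<eta> x" for x
    using \<zeta>(3)[of x] K(3)[of x] by (cases "x \<in> K") (auto simp: \<eta>_def)
  have oK: "open (- K)" using K(1) by (simp add: compact_imp_closed open_Compl)
  have D0: "(\<eta> has_derivative (\<lambda>h. 0)) (at x)" if "x \<notin> K" for x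
    by (rule has_derivative_transform_within_open[where f="\<lambda>x. 0", OF _ oK]) (use \<eta>K that in auto)
  have D1: "(\<eta> has_derivative (\<lambda>h. (frechet_derivative \<psi> (at x) h * \<zeta> x - \<psi> x * frechet_derivative \<zeta> (at x) h) / (\<zeta> x * \<zeta> x))) (at x)"
    if "\<zeta> x \<noteq> 0" for x
  proof -
    have "(\<psi> has_derivative frechet_derivative \<psi> (at x)) (at x)"
      "(\<zeta> has_derivative frechet_derivative \<zeta> (at x)) (at x)"
      using \<psi>(1) d\<zeta> by (auto simp: frechet_derivative_works[symmetric])
    from has_derivative_divide'[OF this that] show ?thesis unfolding \<eta>_def .
  qed
  have cover: "{x. \<zeta> x \<noteq> 0} \<union> - K = UNIV" using \<zeta>(3) by force
  have \<eta>d: "\<eta> differentiable (at x)" for x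
    using D0[of x] D1[of x] cover unfolding differentiable_def by blast
  have p1: "pdv i \<eta> x = (pdv i \<psi> x * \<zeta> x - \<psi> x * pdv i \<zeta> x) / (\<zeta> x * \<zeta> x)" if "\<zeta> x \<noteq> 0" for x
    by (subst pdv_eqI[OF D1[OF that]]) (simp add: pdv_def)
  have o\<zeta>: "open {x. \<zeta> x \<noteq> 0}"
    by (intro open_Collect_neq smooth_continuous[OF s\<zeta>] continuous_on_const)
  have "continuous_on {x. \<zeta> x \<noteq> 0} (pdv i \<eta>)"
  proof (rule continuous_on_eq)
    show "continuous_on {x. \<zeta> x \<noteq> 0} (\<lambda>x. (pdv i \<psi> x * \<zeta> x - \<psi> x * pdv i \<zeta> x) / (\<zeta> x * \<zeta> x))"
      by (intro continuous_intros smooth_continuous s\<zeta> smooth_pdv continuous_on_subset[OF \<psi>(2)]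
          continuous_at_imp_continuous_on ballI differentiable_imp_continuous_within \<psi>(1)) auto
  qed (use p1 in auto)
  moreover have "continuous_on (- K) (pdv i \<eta>)"
    by (rule continuous_on_eq[of _ "\<lambda>x. 0"]) (use pdv_eqI[OF D0, of _ i] in auto)
  ultimately have \<eta>c: "continuous_on UNIV (pdv i \<eta>)"
    using continuous_on_open_Un[OF o\<zeta> oK] cover by simp
  have p\<psi>: "pdv i \<psi> x = pdv i \<zeta> x * \<eta> x + \<zeta> x * pdv i \<eta> x" for x
  proof -
    have "\<psi> = (\<lambda>x. \<zeta> x * \<eta> x)" using \<zeta>\<eta> by auto
    then show ?thesis using pdv_mult[OF d\<zeta> \<eta>d] by simp
  qed
  have zm: "\<eta> x = 0" if "x $ i = - m" for x
  proof (rule \<eta>K)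
    have "m \<le> norm x" using component_le_norm_cart[of x i] that m(1) by simp
    then show "x \<notin> K" using m(2) KL by force
  qed
  have "\<exists>q. smooth_on UNIV q \<and> (\<forall>x\<in>L. \<bar>\<eta> x - q x\<bar> \<le> 1 / real (Suc n) \<and> \<bar>pdv i \<eta> x - pdv i q x\<bar> \<le> 1 / real (Suc n))" for n
  proof -
    obtain q where q: "smooth_on UNIV q" "\<And>x. (\<And>j. \<bar>x $ j\<bar> \<le> m) \<Longrightarrow> \<bar>\<eta> x - q x\<bar> \<le> 1 / real (Suc n)"
      "\<And>x. (\<And>j. \<bar>x $ j\<bar> \<le> m) \<Longrightarrow> \<bar>pdv i \<eta> x - pdv i q x\<bar> \<le> 1 / real (Suc n)"
      using C1_approximation[OF \<eta>d \<eta>c zm m(1), of "1 / real (Suc n)"] by auto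
    have "\<bar>x $ j\<bar> \<le> m" if "x \<in> L" for x j
      using component_le_norm_cart[of x j] m(2)[OF that] by linarith
    then show ?thesis using q by blast
  qed
  then obtain q where q: "\<And>n. smooth_on UNIV (q n)"
    "\<And>n x. x \<in> L \<Longrightarrow> \<bar>\<eta> x - q n x\<bar> \<le> 1 / real (Suc n)"
    "\<And>n x. x \<in> L \<Longrightarrow> \<bar>pdv i \<eta> x - pdv i (q n) x\<bar> \<le> 1 / real (Suc n)" by metis
  define \<phi> where "\<phi> n x = \<zeta> x * q n x" for n x
  have \<phi>: "\<phi> n \<in> test_functions \<Omega>" for n
    unfolding \<phi>_def by (rule test_functions_mult[OF \<zeta>(1) q(1)])
  have p\<phi>: "pdv i (\<phi> n) x = pdv i \<zeta> x * q n x + \<zeta> x * pdv i (q n) x" for n x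
    unfolding \<phi>_def by (rule pdv_mult[OF d\<zeta> smooth_differentiable[OF q(1)]])
  have s\<psi>: "sq_integrable \<psi>"
    by (rule continuous_compact_support_sq_integrable[OF _ K(1) K(3)])
      (auto intro!: continuous_at_imp_continuous_on differentiable_imp_continuous_within \<psi>(1))
  have sp\<psi>: "sq_integrable (pdv i \<psi>)"
    by (rule continuous_compact_support_sq_integrable[OF \<psi>(2) K(1)])
      (rule pdv_zero_nhds[OF oK], use K(3) in auto)
  note s\<phi> = test_functions_sq_integrable[OF \<phi>]
  note sz = test_functions_sq_integrable[OF \<zeta>(1)]
  have lim0: "(\<lambda>n. (1 / real (Suc n)) * c) \<longlonglongrightarrow> 0" for c :: real
    using tendsto_mult_left_zero[OF LIMSEQ_inverse_real_of_nat, of c] by (simp add: inverse_eq_divide)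
  have "(\<lambda>n. abs_L2 (\<phi> n)) \<longlonglongrightarrow> abs_L2 \<psi>"
  proof (rule LIM_zero_cancel, rule Lim_null_comparison[OF always_eventually lim0], rule allI)
    fix n
    have "\<bar>\<phi> n x - \<psi> x\<bar> \<le> (1 / real (Suc n)) * \<bar>\<zeta> x\<bar>" for x
    proof (cases "x \<in> L")
      case True
      have "\<bar>\<phi> n x - \<psi> x\<bar> = \<bar>\<zeta> x\<bar> * \<bar>\<eta> x - q n x\<bar>"
        by (simp add: \<phi>_def \<zeta>\<eta> abs_mult[symmetric] algebra_simps abs_minus_commute)
      then show ?thesis using mult_left_mono[OF q(2)[OF True, of n], of "\<bar>\<zeta> x\<bar>"] by (simp add: mult.commute)
    qed (simp add: \<phi>_def \<zeta>\<eta> L(3))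
    then show "norm (abs_L2 (\<phi> n) - abs_L2 \<psi>) \<le> (1 / real (Suc n)) * norm (abs_L2 \<zeta>)"
      unfolding abs_L2_diff[OF s\<phi>(1) s\<psi>]
      by (intro norm_abs_L2_le sz sq_integrable_diff s\<phi> s\<psi>) auto
  qed
  moreover have "(\<lambda>n. abs_L2 (pdv i (\<phi> n))) \<longlonglongrightarrow> abs_L2 (pdv i \<psi>)"
  proof (rule LIM_zero_cancel, rule Lim_null_comparison[OF always_eventually lim0], rule allI)
    fix n
    let ?g = "\<lambda>x. \<bar>pdv i \<zeta> x\<bar> + \<bar>\<zeta> x\<bar>"
    have sg: "sq_integrable ?g"
      by (intro sq_integrable_add sq_integrable_dominated[OF sz(2)[of i], of _ 1] sq_integrable_dominated[OF sz(1), of _ 1])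
        (use sz(1) sz(2)[of i] in \<open>auto simp: sq_integrable_def\<close>)
    have "\<bar>pdv i (\<phi> n) x - pdv i \<psi> x\<bar> \<le> (1 / real (Suc n)) * \<bar>?g x\<bar>" for x
    proof (cases "x \<in> L")
      case True
      have "\<bar>pdv i (\<phi> n) x - pdv i \<psi> x\<bar> = \<bar>pdv i \<zeta> x * (\<eta> x - q n x) + \<zeta> x * (pdv i \<eta> x - pdv i (q n) x)\<bar>"
        unfolding p\<phi> p\<psi> by (subst abs_minus_commute) (simp add: algebra_simps)
      also have "\<dots> \<le> \<bar>pdv i \<zeta> x\<bar> * \<bar>\<eta> x - q n x\<bar> + \<bar>\<zeta> x\<bar> * \<bar>pdv i \<eta> x - pdv i (q n) x\<bar>"
        unfolding abs_mult[symmetric] by (rule abs_triangle_ineq)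
      also have "\<dots> \<le> \<bar>pdv i \<zeta> x\<bar> * (1 / real (Suc n)) + \<bar>\<zeta> x\<bar> * (1 / real (Suc n))"
        by (intro add_mono mult_left_mono q True) auto
      finally show ?thesis by (simp add: algebra_simps)
    qed (simp add: p\<phi> p\<psi> L(3,4))
    then show "norm (abs_L2 (pdv i (\<phi> n)) - abs_L2 (pdv i \<psi>)) \<le> (1 / real (Suc n)) * norm (abs_L2 ?g)"
      unfolding abs_L2_diff[OF s\<phi>(2) sp\<psi>]
      by (intro norm_abs_L2_le sg sq_integrable_diff s\<phi> sp\<psi>) auto
  qed
  ultimately have "(\<lambda>n. - inner w (abs_L2 (\<phi> n))) \<longlonglongrightarrow> - inner w (abs_L2 \<psi>)"
     "(\<lambda>n. inner v (abs_L2 (pdv i (\<phi> n)))) \<longlonglongrightarrow> inner v (abs_L2 (pdv i \<psi>))"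
    by (auto intro!: tendsto_intros)
  moreover have "inner v (abs_L2 (pdv i (\<phi> n))) = - inner w (abs_L2 (\<phi> n))" for n
    using v \<phi> by (simp add: has_weak_pdv_iff_inner)
  ultimately show ?thesis using LIMSEQ_unique by auto
qed

section \<open>Multiplication by bounded functions\<close>

text \<open>Only the values of the coefficients on \<open>\<Omega>\<close> matter, and outside \<open>\<Omega>\<close> the partial derivatives need not
  even be measurable; hence the indicator function.\<close>

definition bounded_coeff :: "(real ^ 'n) set \<Rightarrow> (real ^ 'n \<Rightarrow> real) \<Rightarrow> real \<Rightarrow> bool" where
  "bounded_coeff \<Omega> g B \<longleftrightarrow> (\<lambda>x. indicator \<Omega> x * g x) \<in> borel_measurable lebesgue \<and> (\<forall>x\<in>\<Omega>. \<bar>g x\<bar> \<le> B)"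

lemma bounded_coeff_sq_integrable:
  assumes g: "bounded_coeff \<Omega> g B" and f: "sq_integrable f"
  shows "sq_integrable (\<lambda>x. indicator \<Omega> x * (g x * f x))"
proof (rule sq_integrable_dominated[OF f, of _ "\<bar>B\<bar>"])
  have m: "(\<lambda>x. indicator \<Omega> x * g x) \<in> borel_measurable lebesgue" "f \<in> borel_measurable lebesgue"
    using g f by (simp_all add: bounded_coeff_def sq_integrable_def)
  have "(\<lambda>x. (indicator \<Omega> x * g x) * f x) \<in> borel_measurable lebesgue"
    by (rule borel_measurable_times[OF m])
  then show "(\<lambda>x. indicator \<Omega> x * (g x * f x)) \<in> borel_measurable lebesgue" by (simp add: mult.assoc)
  have "\<bar>indicator \<Omega> x * (g x * f x)\<bar> \<le> \<bar>B\<bar> * \<bar>f x\<bar>" for x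
  proof (cases "x \<in> \<Omega>")
    case True
    then have "\<bar>g x\<bar> \<le> \<bar>B\<bar>" using g by (force simp: bounded_coeff_def)
    then show ?thesis using True by (simp add: abs_mult mult_right_mono)
  qed simp
  then show "AE x in lebesgue. \<bar>indicator \<Omega> x * (g x * f x)\<bar> \<le> \<bar>B\<bar> * \<bar>f x\<bar>" by simp
qed

lemma mult_on_abs_L2:
  assumes g: "bounded_coeff \<Omega> g B" and f: "sq_integrable f"
  shows "mult_on \<Omega> g (abs_L2 f) = abs_L2 (\<lambda>x. indicator \<Omega> x * (g x * f x))"
  unfolding mult_on_def
proof (rule abs_L2_eqI)
  show "AE x in lebesgue. indicator \<Omega> x * (g x * rep_L2 (abs_L2 f) x) = indicator \<Omega> x * (g x * f x)"
    using rep_abs_L2_AE[OF f] by eventually_elim simp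
qed (intro bounded_coeff_sq_integrable[OF g] rep_L2_sq_integrable f)+

lemma norm_mult_on_le:
  assumes g: "bounded_coeff \<Omega> g B"
  shows "norm (mult_on \<Omega> g v) \<le> \<bar>B\<bar> * norm v"
proof -
  have "\<bar>indicator \<Omega> x * (g x * rep_L2 v x)\<bar> \<le> \<bar>B\<bar> * \<bar>rep_L2 v x\<bar>" for x
  proof (cases "x \<in> \<Omega>")
    case True
    then have "\<bar>g x\<bar> \<le> \<bar>B\<bar>" using g by (force simp: bounded_coeff_def)
    then show ?thesis using True by (simp add: abs_mult mult_right_mono)
  qed simp
  then have "norm (mult_on \<Omega> g v) \<le> \<bar>B\<bar> * norm (abs_L2 (rep_L2 v))"
    unfolding mult_on_def
    by (intro norm_abs_L2_le bounded_coeff_sq_integrable[OF g] rep_L2_sq_integrable) auto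
  then show ?thesis by simp
qed

lemma bounded_linear_mult_on:
  assumes g: "bounded_coeff \<Omega> g B"
  shows "bounded_linear (mult_on \<Omega> g)"
proof (rule bounded_linear_intro)
  note sq = bounded_coeff_sq_integrable[OF g rep_L2_sq_integrable]
  show "mult_on \<Omega> g (v + w) = mult_on \<Omega> g v + mult_on \<Omega> g w" for v w
  proof -
    have "mult_on \<Omega> g (v + w) = mult_on \<Omega> g (abs_L2 (\<lambda>x. rep_L2 v x + rep_L2 w x))"
      by (simp add: abs_L2_add[symmetric] rep_L2_sq_integrable)
    also have "\<dots> = abs_L2 (\<lambda>x. indicator \<Omega> x * (g x * (rep_L2 v x + rep_L2 w x)))"
      by (intro mult_on_abs_L2[OF g] sq_integrable_add rep_L2_sq_integrable)
    also have "\<dots> = mult_on \<Omega> g v + mult_on \<Omega> g w"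
      unfolding mult_on_def abs_L2_add[OF sq sq] by (simp add: algebra_simps)
    finally show ?thesis .
  qed
  show "mult_on \<Omega> g (r *\<^sub>R v) = r *\<^sub>R mult_on \<Omega> g v" for r v
  proof -
    have "mult_on \<Omega> g (r *\<^sub>R v) = mult_on \<Omega> g (abs_L2 (\<lambda>x. r * rep_L2 v x))"
      by (simp add: abs_L2_scaleR[symmetric] rep_L2_sq_integrable)
    also have "\<dots> = abs_L2 (\<lambda>x. indicator \<Omega> x * (g x * (r * rep_L2 v x)))"
      by (intro mult_on_abs_L2[OF g] sq_integrable_scale rep_L2_sq_integrable)
    also have "\<dots> = r *\<^sub>R mult_on \<Omega> g v"
      unfolding mult_on_def abs_L2_scaleR[OF sq] by (simp add: algebra_simps)
    finally show ?thesis .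
  qed
  show "norm (mult_on \<Omega> g v) \<le> norm v * \<bar>B\<bar>" for v
    using norm_mult_on_le[OF g] by (simp add: mult.commute)
qed

lemma mult_on_in_L2_on:
  assumes g: "bounded_coeff \<Omega> g B"
  shows "mult_on \<Omega> g v \<in> L2_on \<Omega>"
  unfolding mult_on_def
  by (subst L2_on_iff_abs[OF bounded_coeff_sq_integrable[OF g rep_L2_sq_integrable]]) simp

lemma inner_mult_on:
  assumes g: "bounded_coeff \<Omega> g B" and f: "sq_integrable f"
  shows "inner (mult_on \<Omega> g v) (abs_L2 f) = inner v (abs_L2 (\<lambda>x. indicator \<Omega> x * (g x * f x)))"
proof -
  have "inner (mult_on \<Omega> g v) (abs_L2 f) = (LINT x|lebesgue. indicator \<Omega> x * (g x * rep_L2 v x) * f x)"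
    unfolding mult_on_def
    by (rule inner_L2.abs_eq) (use bounded_coeff_sq_integrable[OF g rep_L2_sq_integrable] f in auto)
  also have "\<dots> = inner v (abs_L2 (\<lambda>x. indicator \<Omega> x * (g x * f x)))"
    unfolding inner_abs_L2[OF bounded_coeff_sq_integrable[OF g f]] by (simp add: algebra_simps)
  finally show ?thesis .
qed

lemma bounded_coeffI:
  assumes "open \<Omega>" "bounded \<Omega>" "continuous_on (closure \<Omega>) h" "\<And>x. x \<in> \<Omega> \<Longrightarrow> g x = h x"
  shows "\<exists>B. bounded_coeff \<Omega> g B"
proof -
  have "compact (h ` closure \<Omega>)" by (intro compact_continuous_image assms) (simp add: assms)
  then obtain B where B: "\<forall>y\<in>h ` closure \<Omega>. norm y \<le> B" by (meson compact_imp_bounded bounded_iff)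
  have "continuous_on \<Omega> g"
    by (rule continuous_on_eq[OF continuous_on_subset[OF assms(3) closure_subset]]) (simp add: assms(4))
  then have "(\<lambda>x. indicator \<Omega> x *\<^sub>R g x) \<in> borel_measurable borel"
    by (intro borel_measurable_continuous_on_indicator) (simp add: assms(1))
  then have "(\<lambda>x. indicator \<Omega> x * g x) \<in> borel_measurable lebesgue"
    by (intro measurable_completion) simp
  moreover have "\<bar>g x\<bar> \<le> B" if "x \<in> \<Omega>" for x
    using B assms(4)[OF that] closure_subset[of \<Omega>] that by auto
  ultimately show ?thesis by (auto simp: bounded_coeff_def)
qed

lemma C1_closure_bounded_coeff:
  assumes "open \<Omega>" "bounded \<Omega>" "C1_closure \<Omega> g"
  shows "\<exists>B. bounded_coeff \<Omega> g B" "\<exists>B. bounded_coeff \<Omega> (pdv i g) B"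
proof -
  show "\<exists>B. bounded_coeff \<Omega> g B"
    using assms by (intro bounded_coeffI[of _ g]) (auto simp: C1_closure_def)
  obtain h where "continuous_on (closure \<Omega>) h" "\<forall>x\<in>\<Omega>. pdv i g x = h x"
    using assms(3) unfolding C1_closure_def by blast
  then show "\<exists>B. bounded_coeff \<Omega> (pdv i g) B" using assms by (intro bounded_coeffI[of _ h]) auto
qed

text \<open>The product rule. Transferring \<open>g\<close> to the test function \<open>\<phi>\<close> gives the product of \<open>g\<close> and \<open>\<phi>\<close>, which is
  continuously differentiable but not smooth.\<close>

lemma has_weak_pdv_mult_on:
  assumes \<Omega>: "open \<Omega>" "bounded \<Omega>" and g: "C1_closure \<Omega> g" and v: "has_weak_pdv \<Omega> i v w"
  shows "has_weak_pdv \<Omega> i (mult_on \<Omega> g v) (mult_on \<Omega> g w + mult_on \<Omega> (pdv i g) v)"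
proof -
  obtain B B' where B: "bounded_coeff \<Omega> g B" and B': "bounded_coeff \<Omega> (pdv i g) B'"
    using C1_closure_bounded_coeff[OF \<Omega> g] by blast
  show ?thesis
    unfolding has_weak_pdv_iff_inner
  proof (intro conjI ballI L2_on_add mult_on_in_L2_on[OF B] mult_on_in_L2_on[OF B'])
    fix \<phi> assume \<phi>: "\<phi> \<in> test_functions \<Omega>"
    obtain K where K: "compact K" "K \<subseteq> \<Omega>" "\<And>x. x \<notin> K \<Longrightarrow> \<phi> x = 0" "\<And>i x. x \<notin> K \<Longrightarrow> pdv i \<phi> x = 0"
      using test_functions_support[OF \<phi>] by metis
    have oK: "open (- K)" using K(1) by (simp add: compact_imp_closed open_Compl)
    note sq = test_functions_sq_integrable[OF \<phi>]
    have s\<phi>: "smooth_on UNIV \<phi>" by (rule test_functions_smooth[OF \<phi>])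
    define \<psi> where "\<psi> x = indicator \<Omega> x * (g x * \<phi> x)" for x
    have \<psi>K: "\<psi> x = 0" if "x \<notin> K" for x using K(3)[OF that] by (simp add: \<psi>_def)
    have gd: "g differentiable (at x)" if "x \<in> \<Omega>" for x using g that by (auto simp: C1_closure_def)
    have D0: "(\<psi> has_derivative (\<lambda>h. 0)) (at x)" if "x \<notin> K" for x
      by (rule has_derivative_transform_within_open[where f="\<lambda>x. 0", OF _ oK]) (use \<psi>K that in auto)
    have D1: "(\<psi> has_derivative (\<lambda>h. g x * frechet_derivative \<phi> (at x) h + frechet_derivative g (at x) h * \<phi> x)) (at x)"
      if "x \<in> \<Omega>" for x
    proof (rule has_derivative_transform_within_open[OF _ \<Omega>(1) that])
      have "(g has_derivative frechet_derivative g (at x)) (at x)"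
        "(\<phi> has_derivative frechet_derivative \<phi> (at x)) (at x)"
        using gd[OF that] smooth_differentiable[OF s\<phi>] by (auto simp: frechet_derivative_works[symmetric])
      from has_derivative_mult[OF this]
      show "((\<lambda>x. g x * \<phi> x) has_derivative (\<lambda>h. g x * frechet_derivative \<phi> (at x) h + frechet_derivative g (at x) h * \<phi> x)) (at x)" .
    qed (auto simp: \<psi>_def)
    have cover: "\<Omega> \<union> - K = UNIV" using K(2) by auto
    have p\<psi>: "pdv i \<psi> x = indicator \<Omega> x * (pdv i g x * \<phi> x) + indicator \<Omega> x * (g x * pdv i \<phi> x)" for x
    proof (cases "x \<in> \<Omega>")
      case True
      then show ?thesis using pdv_eqI[OF D1[OF True], of i] by (simp add: pdv_def)
    next
      case False
      then have "x \<notin> K" using K(2) by auto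
      then show ?thesis using pdv_eqI[OF D0, of x i] False by simp
    qed
    have "inner v (abs_L2 (pdv i \<psi>)) = - inner w (abs_L2 \<psi>)"
    proof (rule has_weak_pdv_C1_test[OF \<Omega>(1) v _ _ K(1,2) \<psi>K])
      show "\<psi> differentiable (at x)" for x
        using D0[of x] D1[of x] cover unfolding differentiable_def by blast
      obtain h where h: "continuous_on (closure \<Omega>) h" "\<forall>x\<in>\<Omega>. pdv i g x = h x"
        using g unfolding C1_closure_def by blast
      have "continuous_on \<Omega> (pdv i \<psi>)"
      proof (rule continuous_on_eq)
        show "continuous_on \<Omega> (\<lambda>x. h x * \<phi> x + g x * pdv i \<phi> x)"
          by (intro continuous_intros smooth_continuous s\<phi> smooth_pdv
              continuous_on_subset[OF h(1) closure_subset]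
              continuous_at_imp_continuous_on ballI differentiable_imp_continuous_within gd)
      qed (use h(2) p\<psi> in auto)
      moreover have "continuous_on (- K) (pdv i \<psi>)"
        by (rule continuous_on_eq[of _ "\<lambda>x. 0"]) (use pdv_eqI[OF D0, of _ i] in auto)
      ultimately show "continuous_on UNIV (pdv i \<psi>)"
        using continuous_on_open_Un[OF \<Omega>(1) oK] cover by simp
    qed
    moreover have "abs_L2 (pdv i \<psi>) = abs_L2 (\<lambda>x. indicator \<Omega> x * (pdv i g x * \<phi> x)) + abs_L2 (\<lambda>x. indicator \<Omega> x * (g x * pdv i \<phi> x))"
      unfolding abs_L2_add[OF bounded_coeff_sq_integrable[OF B' sq(1)] bounded_coeff_sq_integrable[OF B sq(2)]]
      by (simp add: p\<psi>[abs_def])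
    moreover have "\<psi> = (\<lambda>x. indicator \<Omega> x * (g x * \<phi> x))" by (simp add: \<psi>_def[abs_def])
    ultimately show "inner (mult_on \<Omega> g v) (abs_L2 (pdv i \<phi>)) = - inner (mult_on \<Omega> g w + mult_on \<Omega> (pdv i g) v) (abs_L2 \<phi>)"
      by (simp add: inner_mult_on[OF B sq(1)] inner_mult_on[OF B sq(2)] inner_mult_on[OF B' sq(1)]
          inner_add_left inner_add_right)
  qed
qed

section \<open>The graph of the derivatives up to second order\<close>

text \<open>Bochner integration in the product of the spaces of derivatives requires a countable base.\<close>

instance vec :: ("{metric_space, second_countable_topology}", finite) second_countable_topology
proof
  obtain B :: "'a set set" where B: "countable B" "topological_basis B"
    using ex_countable_basis by blast
  define box where "box f = {x::'a ^ 'b. \<forall>i. x $ i \<in> f i}" for f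
  define C where "C = box ` (UNIV \<rightarrow>\<^sub>E B)"
  have "countable C" unfolding C_def by (intro countable_image countable_PiE) (auto intro: B)
  moreover have "topological_basis C"
  proof (rule topological_basisI)
    fix S assume "S \<in> C"
    then obtain f where f: "S = box f" "\<And>i. f i \<in> B" by (auto simp: C_def)
    have "open (f i)" for i using f(2) topological_basis_open[OF B(2)] by blast
    then show "open S" unfolding open_vec_def f(1) box_def by blast
  next
    fix S :: "('a ^ 'b) set" and x assume S: "open S" "x \<in> S"
    obtain A where A: "\<And>i. open (A i)" "\<And>i. x $ i \<in> A i" "\<And>y. (\<And>i. y $ i \<in> A i) \<Longrightarrow> y \<in> S"
      using S unfolding open_vec_def by metis
    have "\<forall>i. \<exists>b\<in>B. x $ i \<in> b \<and> b \<subseteq> A i"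
      using topological_basisE[OF B(2) A(1) A(2)] by metis
    then obtain f where f: "\<And>i. f i \<in> B" "\<And>i. x $ i \<in> f i" "\<And>i. f i \<subseteq> A i" by metis
    show "\<exists>S'\<in>C. x \<in> S' \<and> S' \<subseteq> S"
    proof (intro bexI conjI)
      show "box f \<in> C" unfolding C_def using f(1) by auto
    qed (use f A(3) in \<open>auto simp: box_def subset_iff\<close>)
  qed
  ultimately show "\<exists>B::('a ^ 'b) set set. countable B \<and> open = generate_topology B"
    using topological_basis_imp_subbasis by blast
qed

type_synonym 'n jet1 = "(real ^ 'n) L2 \<times> ((real ^ 'n) L2 ^ 'n)"
type_synonym 'n jet2 = "(real ^ 'n) L2 \<times> (((real ^ 'n) L2 ^ 'n) \<times> ((real ^ 'n) L2 ^ 'n ^ 'n))"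

text \<open>A test function with its gradient; the closure of these pairs is the graph of the gradient on \<open>H10\<close>.\<close>

definition test_jet :: "(real ^ 'n \<Rightarrow> real) \<Rightarrow> 'n jet1" where
  "test_jet \<phi> = (abs_L2 \<phi>, \<chi> i. abs_L2 (pdv i \<phi>))"

definition H10_graph :: "(real ^ 'n) set \<Rightarrow> 'n jet1 set" where
  "H10_graph \<Omega> = closure (test_jet ` test_functions \<Omega>)"

definition H2_graph :: "(real ^ 'n) set \<Rightarrow> 'n jet2 set" where
  "H2_graph \<Omega> = {z. (fst z, fst (snd z)) \<in> H10_graph \<Omega> \<and>
     (\<forall>i j. has_weak_pdv \<Omega> i (fst (snd z) $ j) (snd (snd z) $ i $ j))}"

lemma test_functions_add:
  assumes "\<phi> \<in> test_functions \<Omega>" "\<psi> \<in> test_functions \<Omega>"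
  shows "(\<lambda>x. \<phi> x + \<psi> x) \<in> test_functions \<Omega>"
proof -
  obtain K where K: "compact K" "K \<subseteq> \<Omega>" "\<And>x. x \<notin> K \<Longrightarrow> \<phi> x = 0"
    using test_functions_support[OF assms(1)] by metis
  obtain L where L: "compact L" "L \<subseteq> \<Omega>" "\<And>x. x \<notin> L \<Longrightarrow> \<psi> x = 0"
    using test_functions_support[OF assms(2)] by metis
  show ?thesis
    by (rule test_functionsI[of _ "K \<union> L"])
      (use K L in \<open>auto intro: smooth_add test_functions_smooth assms\<close>)
qed

lemma test_functions_scale: "\<phi> \<in> test_functions \<Omega> \<Longrightarrow> (\<lambda>x. r * \<phi> x) \<in> test_functions \<Omega>"
  using test_functions_mult[OF _ smooth_const[of r], of \<phi> \<Omega>] by (simp add: mult.commute)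

lemma test_jet_add:
  assumes "\<phi> \<in> test_functions \<Omega>" "\<psi> \<in> test_functions \<Omega>"
  shows "test_jet \<phi> + test_jet \<psi> = test_jet (\<lambda>x. \<phi> x + \<psi> x)"
proof -
  have "pdv i (\<lambda>x. \<phi> x + \<psi> x) = (\<lambda>x. pdv i \<phi> x + pdv i \<psi> x)" for i
    by (rule ext, rule pdv_add) (auto intro!: smooth_differentiable test_functions_smooth assms)
  then show ?thesis
    by (simp add: test_jet_def abs_L2_add test_functions_sq_integrable[OF assms(1)]
        test_functions_sq_integrable[OF assms(2)] vec_eq_iff)
qed

lemma test_jet_scaleR:
  assumes "\<phi> \<in> test_functions \<Omega>"
  shows "r *\<^sub>R test_jet \<phi> = test_jet (\<lambda>x. r * \<phi> x)"
proof -
  have "pdv i (\<lambda>x. r * \<phi> x) = (\<lambda>x. r * pdv i \<phi> x)" for i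
  proof
    fix x
    show "pdv i (\<lambda>x. r * \<phi> x) x = r * pdv i \<phi> x"
      using pdv_mult[of "\<lambda>x. r" x \<phi> i] smooth_differentiable[OF test_functions_smooth[OF assms]]
        pdv_eqI[of "\<lambda>x. r" "\<lambda>h. 0" x i] by simp
  qed
  then show ?thesis
    by (simp add: test_jet_def abs_L2_scaleR test_functions_sq_integrable[OF assms] vec_eq_iff)
qed

lemma subspace_closure:
  fixes S :: "'a::real_normed_vector set"
  assumes S: "subspace S"
  shows "subspace (closure S)"
proof (rule subspaceI)
  show "0 \<in> closure S" using subspace_0[OF S] closure_subset by blast
  show "x + y \<in> closure S" if xy: "x \<in> closure S" "y \<in> closure S" for x y
  proof -
    obtain a b where "\<And>n. a n \<in> S" "a \<longlonglongrightarrow> x" "\<And>n. b n \<in> S" "b \<longlonglongrightarrow> y"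
      using xy unfolding closure_sequential by metis
    then show ?thesis
      unfolding closure_sequential using subspace_add[OF S]
      by (intro exI[of _ "\<lambda>n. a n + b n"]) (auto intro: tendsto_add)
  qed
  show "r *\<^sub>R x \<in> closure S" if x: "x \<in> closure S" for r x
  proof -
    obtain a where "\<And>n. a n \<in> S" "a \<longlonglongrightarrow> x" using x unfolding closure_sequential by blast
    then show ?thesis
      unfolding closure_sequential using subspace_scale[OF S]
      by (intro exI[of _ "\<lambda>n. r *\<^sub>R a n"]) (auto intro: tendsto_scaleR)
  qed
qed

lemma subspace_H10_graph: "subspace (H10_graph \<Omega>)"
  unfolding H10_graph_def
proof (rule subspace_closure, rule subspaceI)
  have "(\<lambda>x. 0) \<in> test_functions \<Omega>" by (rule test_functionsI[of _ "{}"]) (auto intro: smooth_const)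
  from imageI[OF test_functions_scale[OF this, of 0], of test_jet] test_jet_scaleR[OF this, of 0]
  show "0 \<in> test_jet ` test_functions \<Omega>" by simp
qed (auto simp: test_jet_add test_jet_scaleR intro!: imageI test_functions_add test_functions_scale)

text \<open>Having a given weak derivative is a closed condition that holds for test functions.\<close>

lemma H10_graph_has_weak_pdv:
  assumes "\<Omega> \<in> sets lebesgue" "z \<in> H10_graph \<Omega>"
  shows "fst z \<in> L2_on \<Omega>" "has_weak_pdv \<Omega> i (fst z) (snd z $ i)"
proof -
  have "closed ((\<lambda>z. (fst z, snd z $ i)) -` {z. has_weak_pdv \<Omega> i (fst z) (snd z)})"
    by (intro closed_vimage closed_has_weak_pdv assms continuous_intros)
  moreover have "closed (fst -` L2_on \<Omega> :: 'a jet1 set)"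
    by (intro closed_vimage closed_L2_on assms continuous_intros)
  ultimately have "H10_graph \<Omega> \<subseteq> (\<lambda>z. (fst z, snd z $ i)) -` {z. has_weak_pdv \<Omega> i (fst z) (snd z)} \<inter> fst -` L2_on \<Omega>"
    unfolding H10_graph_def
    by (intro closure_minimal closed_Int)
      (auto simp: test_jet_def has_weak_pdv_test_function test_function_in_L2_on)
  then show "fst z \<in> L2_on \<Omega>" "has_weak_pdv \<Omega> i (fst z) (snd z $ i)" using assms(2) by auto
qed

lemma H1_norm_eq:
  assumes "open \<Omega>" "\<And>i. has_weak_pdv \<Omega> i v (W $ i)"
  shows "H1_norm \<Omega> v = norm (v, W)"
proof -
  have "(norm W)\<^sup>2 = (\<Sum>i\<in>UNIV. (norm (W $ i))\<^sup>2)"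
    by (simp add: norm_vec_def L2_set_def sum_nonneg)
  then show ?thesis
    by (simp add: H1_norm_def norm_Pair weak_pdv_eq[OF assms])
qed

lemma H10_iff_graph:
  assumes "open \<Omega>"
  shows "v \<in> H10 \<Omega> \<longleftrightarrow> (\<exists>W. (v, W) \<in> H10_graph \<Omega>)"
proof -
  have m: "\<Omega> \<in> sets lebesgue" using assms by auto
  have eq: "H1_norm \<Omega> (abs_L2 \<phi> - v) = norm (test_jet \<phi> - (v, W))"
    if "\<phi> \<in> test_functions \<Omega>" "\<And>i. has_weak_pdv \<Omega> i v (W $ i)" for \<phi> W
  proof -
    have "has_weak_pdv \<Omega> i (abs_L2 \<phi> - v) (((\<chi> i. abs_L2 (pdv i \<phi>)) - W) $ i)" for i
      using has_weak_pdv_diff[OF has_weak_pdv_test_function[OF that(1)] that(2)] by simp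
    from H1_norm_eq[OF assms this] show ?thesis by (simp add: test_jet_def)
  qed
  show ?thesis
  proof
    assume "v \<in> H10 \<Omega>"
    then obtain \<phi> where v: "v \<in> H1 \<Omega>" and \<phi>: "\<And>k::nat. \<phi> k \<in> test_functions \<Omega>"
        "(\<lambda>k. H1_norm \<Omega> (abs_L2 (\<phi> k) - v)) \<longlonglongrightarrow> 0"
      unfolding H10_def by blast
    have "\<forall>i. \<exists>w. has_weak_pdv \<Omega> i v w" using v by (simp add: H1_def)
    then obtain w where w: "\<And>i. has_weak_pdv \<Omega> i v (w i)" by metis
    define W where "W = (\<chi> i. w i)"
    have "(\<lambda>k. norm (test_jet (\<phi> k) - (v, W))) \<longlonglongrightarrow> 0"
      using \<phi>(2) eq[OF \<phi>(1), of W] w by (simp add: W_def)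
    then have "(\<lambda>k. test_jet (\<phi> k)) \<longlonglongrightarrow> (v, W)" by (simp add: tendsto_norm_zero_iff LIM_zero_iff)
    then have "(v, W) \<in> H10_graph \<Omega>"
      unfolding H10_graph_def closure_sequential using \<phi>(1) by (intro exI[of _ "\<lambda>k. test_jet (\<phi> k)"]) auto
    then show "\<exists>W. (v, W) \<in> H10_graph \<Omega>" by blast
  next
    assume "\<exists>W. (v, W) \<in> H10_graph \<Omega>"
    then obtain W where W: "(v, W) \<in> H10_graph \<Omega>" by blast
    note h = H10_graph_has_weak_pdv[OF m W]
    obtain s where "\<And>n. s n \<in> test_jet ` test_functions \<Omega>" "s \<longlonglongrightarrow> (v, W)"
      using W unfolding H10_graph_def closure_sequential by blast
    then obtain \<phi> where \<phi>: "\<And>n. \<phi> n \<in> test_functions \<Omega>" "(\<lambda>n. test_jet (\<phi> n)) \<longlonglongrightarrow> (v, W)"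
      by (auto simp: image_iff) (metis (no_types, lifting) ext)
    have "(\<lambda>n. norm (test_jet (\<phi> n) - (v, W))) \<longlonglongrightarrow> 0"
      using \<phi>(2) by (simp add: tendsto_norm_zero_iff LIM_zero_iff)
    then have "(\<lambda>n. H1_norm \<Omega> (abs_L2 (\<phi> n) - v)) \<longlonglongrightarrow> 0"
      using eq[OF \<phi>(1), of W] h by simp
    moreover have "v \<in> H1 \<Omega>" using h by (auto simp: H1_def)
    ultimately show "v \<in> H10 \<Omega>" unfolding H10_def using \<phi>(1) by blast
  qed
qed

lemma subspace_H2_graph: "subspace (H2_graph \<Omega>)"
proof (rule subspaceI)
  have "has_weak_pdv \<Omega> i 0 0" for i by (simp add: has_weak_pdv_iff_inner L2_on_zero)
  then show "0 \<in> H2_graph \<Omega>"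
    using subspace_0[OF subspace_H10_graph, of \<Omega>] by (simp add: H2_graph_def zero_prod_def)
  show "x + y \<in> H2_graph \<Omega>" if "x \<in> H2_graph \<Omega>" "y \<in> H2_graph \<Omega>" for x y
    using that subspace_add[OF subspace_H10_graph, of "(fst x, fst (snd x))" \<Omega> "(fst y, fst (snd y))"]
    by (auto simp: H2_graph_def has_weak_pdv_add)
  show "r *\<^sub>R x \<in> H2_graph \<Omega>" if "x \<in> H2_graph \<Omega>" for r x
    using that subspace_scale[OF subspace_H10_graph, of "(fst x, fst (snd x))" \<Omega> r]
    by (auto simp: H2_graph_def has_weak_pdv_scaleR)
qed

lemma closed_H2_graph:
  assumes "\<Omega> \<in> sets lebesgue"
  shows "closed (H2_graph \<Omega>)"
proof -
  have "H2_graph \<Omega> = (\<lambda>z. (fst z, fst (snd z))) -` H10_graph \<Omega> \<inter>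
    (\<Inter>i. \<Inter>j. (\<lambda>z. (fst (snd z) $ j, snd (snd z) $ i $ j)) -` {z. has_weak_pdv \<Omega> i (fst z) (snd z)})"
    by (auto simp: H2_graph_def)
  moreover have "closed (H10_graph \<Omega>)" by (simp add: H10_graph_def)
  ultimately show ?thesis
    by (simp only:) (intro closed_Int closed_INT ballI closed_vimage closed_has_weak_pdv assms continuous_intros)
qed

lemma H2_H10_eq_graph:
  assumes "open \<Omega>"
  shows "H2 \<Omega> \<inter> H10 \<Omega> = fst ` H2_graph \<Omega>"
proof (intro equalityI subsetI)
  have m: "\<Omega> \<in> sets lebesgue" using assms by auto
  fix v assume v: "v \<in> H2 \<Omega> \<inter> H10 \<Omega>"
  then obtain W where W: "(v, W) \<in> H10_graph \<Omega>" using H10_iff_graph[OF assms] by blast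
  have "weak_pdv \<Omega> j v = W $ j" for j
    by (rule weak_pdv_eq[OF assms]) (use H10_graph_has_weak_pdv[OF m W] in simp)
  then have "\<forall>i j. \<exists>h. has_weak_pdv \<Omega> i (W $ j) h" using v by (auto simp: H2_def H1_def)
  then obtain h where "\<And>i j. has_weak_pdv \<Omega> i (W $ j) (h i j)" by metis
  then have "(v, (W, \<chi> i j. h i j)) \<in> H2_graph \<Omega>" using W by (simp add: H2_graph_def)
  then show "v \<in> fst ` H2_graph \<Omega>" by force
next
  have m: "\<Omega> \<in> sets lebesgue" using assms by auto
  fix v assume "v \<in> fst ` H2_graph \<Omega>"
  then obtain W H where z: "(v, (W, H)) \<in> H2_graph \<Omega>" by force
  then have W: "(v, W) \<in> H10_graph \<Omega>" and h: "\<And>i j. has_weak_pdv \<Omega> i (W $ j) (H $ i $ j)"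
    by (auto simp: H2_graph_def)
  note w = H10_graph_has_weak_pdv[OF m W]
  have eq: "weak_pdv \<Omega> j v = W $ j" for j
    by (rule weak_pdv_eq[OF assms]) (use w in simp)
  have "v \<in> H1 \<Omega>" using w by (auto simp: H1_def)
  moreover have "W $ j \<in> H1 \<Omega>" for j
    using h w by (auto simp: H1_def has_weak_pdv_iff_inner)
  ultimately show "v \<in> H2 \<Omega> \<inter> H10 \<Omega>"
    using W by (auto simp: H10_iff_graph[OF assms] H2_def eq)
qed

lemma H2_norm_eq_graph:
  assumes "open \<Omega>" "z \<in> H2_graph \<Omega>"
  shows "H2_norm \<Omega> (fst z) = norm z"
proof -
  obtain v W H where z: "z = (v, (W, H))" by (metis prod.collapse)
  have m: "\<Omega> \<in> sets lebesgue" using assms by auto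
  have W: "(v, W) \<in> H10_graph \<Omega>" and h: "\<And>i j. has_weak_pdv \<Omega> i (W $ j) (H $ i $ j)"
    using assms(2) z by (auto simp: H2_graph_def)
  note w = H10_graph_has_weak_pdv[OF m W]
  have eq: "weak_pdv \<Omega> j v = W $ j" "weak_pdv \<Omega> i (W $ j) = H $ i $ j" for i j
    by (rule weak_pdv_eq[OF assms(1)], use w h in simp)+
  have "(norm W)\<^sup>2 = (\<Sum>i\<in>UNIV. (norm (W $ i))\<^sup>2)"
    by (simp add: norm_vec_def L2_set_def sum_nonneg)
  moreover have "(norm H)\<^sup>2 = (\<Sum>i\<in>UNIV. \<Sum>j\<in>UNIV. (norm (H $ i $ j))\<^sup>2)"
    by (simp add: norm_vec_def L2_set_def sum_nonneg)
  ultimately show ?thesis by (simp add: z H2_norm_def norm_Pair eq add.assoc sum_nonneg)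
qed

section \<open>The elliptic operator on the graph\<close>

text \<open>The operator with the derivatives of \<open>a i j\<close> written out by the product rule. It makes sense, and is
  bounded, on the whole product space.\<close>

definition elliptic_jet ::
    "(real ^ 'n) set \<Rightarrow> ('n \<Rightarrow> 'n \<Rightarrow> real ^ 'n \<Rightarrow> real) \<Rightarrow> ('n \<Rightarrow> real ^ 'n \<Rightarrow> real) \<Rightarrow>
     (real ^ 'n \<Rightarrow> real) \<Rightarrow> 'n jet2 \<Rightarrow> (real ^ 'n) L2" where
  "elliptic_jet \<Omega> a b c z =
     - ((\<Sum>i\<in>UNIV. \<Sum>j\<in>UNIV. mult_on \<Omega> (a i j) (snd (snd z) $ i $ j) + mult_on \<Omega> (pdv i (a i j)) (fst (snd z) $ j))
        + (\<Sum>j\<in>UNIV. mult_on \<Omega> (b j) (fst (snd z) $ j))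
        + mult_on \<Omega> c (fst z))"

text \<open>The bilinear form of the operator: the outer derivative is moved to the second argument.\<close>

definition elliptic_form ::
    "(real ^ 'n) set \<Rightarrow> ('n \<Rightarrow> 'n \<Rightarrow> real ^ 'n \<Rightarrow> real) \<Rightarrow> ('n \<Rightarrow> real ^ 'n \<Rightarrow> real) \<Rightarrow>
     (real ^ 'n \<Rightarrow> real) \<Rightarrow> 'n jet1 \<Rightarrow> 'n jet1 \<Rightarrow> real" where
  "elliptic_form \<Omega> a b c y y' =
     (\<Sum>i\<in>UNIV. \<Sum>j\<in>UNIV. inner (mult_on \<Omega> (a i j) (snd y $ j)) (snd y' $ i))
     - (\<Sum>j\<in>UNIV. inner (mult_on \<Omega> (b j) (snd y $ j)) (fst y'))
     - inner (mult_on \<Omega> c (fst y)) (fst y')"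

locale elliptic_coefficients =
  fixes \<Omega> :: "(real ^ 'n) set"
    and a :: "'n \<Rightarrow> 'n \<Rightarrow> real ^ 'n \<Rightarrow> real"
    and b :: "'n \<Rightarrow> real ^ 'n \<Rightarrow> real"
    and c :: "real ^ 'n \<Rightarrow> real"
    and \<kappa> :: real
  assumes open_\<Omega>: "open \<Omega>" and bounded_\<Omega>: "bounded \<Omega>"
    and a_C1: "\<And>i j. C1_closure \<Omega> (a i j)"
    and b_C1: "\<And>j. C1_closure \<Omega> (b j)"
    and c_C1: "C1_closure \<Omega> c"
    and \<kappa>_pos: "\<kappa> > 0"
    and elliptic: "\<And>x \<xi>. x \<in> \<Omega> \<Longrightarrow>
      (\<Sum>i\<in>UNIV. \<Sum>j\<in>UNIV. a i j x * (\<xi> $ i) * (\<xi> $ j)) \<ge> \<kappa> * (\<Sum>j\<in>UNIV. \<bar>\<xi> $ j\<bar>\<^sup>2)"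
begin

lemma \<Omega>_meas: "\<Omega> \<in> sets lebesgue"
  using open_\<Omega> by auto

lemma bounded_linear_coeffs:
  "bounded_linear (mult_on \<Omega> (a i j))" "bounded_linear (mult_on \<Omega> (pdv k (a i j)))"
  "bounded_linear (mult_on \<Omega> (b j))" "bounded_linear (mult_on \<Omega> c)"
  using C1_closure_bounded_coeff[OF open_\<Omega> bounded_\<Omega>] a_C1 b_C1 c_C1 bounded_linear_mult_on
  by metis+

lemma coeffs_in_L2_on:
  "mult_on \<Omega> (a i j) v \<in> L2_on \<Omega>" "mult_on \<Omega> (pdv k (a i j)) v \<in> L2_on \<Omega>"
  "mult_on \<Omega> (b j) v \<in> L2_on \<Omega>" "mult_on \<Omega> c v \<in> L2_on \<Omega>"
  using C1_closure_bounded_coeff[OF open_\<Omega> bounded_\<Omega>] a_C1 b_C1 c_C1 mult_on_in_L2_on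
  by metis+

lemma elliptic_jet_in_L2_on: "elliptic_jet \<Omega> a b c z \<in> L2_on \<Omega>"
  unfolding elliptic_jet_def
  by (intro subspace_neg[OF subspace_L2_on] L2_on_add subspace_sum[OF subspace_L2_on] coeffs_in_L2_on)

lemma bounded_linear_elliptic_jet: "bounded_linear (elliptic_jet \<Omega> a b c)"
proof -
  have 1: "bounded_linear (\<lambda>z :: 'n jet2. fst (snd z) $ j)" for j
    by (intro bounded_linear_compose[OF bounded_linear_vec_nth] bounded_linear_compose[OF bounded_linear_fst] bounded_linear_snd)
  have 2: "bounded_linear (\<lambda>z :: 'n jet2. snd (snd z) $ i $ j)" for i j
    by (intro bounded_linear_compose[OF bounded_linear_vec_nth] bounded_linear_compose[OF bounded_linear_snd] bounded_linear_snd)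
  show ?thesis
    unfolding elliptic_jet_def
    by (intro bounded_linear_minus bounded_linear_add bounded_linear_sum
        bounded_linear_compose[OF bounded_linear_coeffs(1) 2] bounded_linear_compose[OF bounded_linear_coeffs(2) 1]
        bounded_linear_compose[OF bounded_linear_coeffs(3) 1] bounded_linear_compose[OF bounded_linear_coeffs(4) bounded_linear_fst])
qed

lemma elliptic_op_eq_jet:
  assumes "z \<in> H2_graph \<Omega>"
  shows "elliptic_op \<Omega> a b c (fst z) = elliptic_jet \<Omega> a b c z"
proof -
  have W: "has_weak_pdv \<Omega> j (fst z) (fst (snd z) $ j)" for j
    using assms H10_graph_has_weak_pdv(2)[OF \<Omega>_meas, of "(fst z, fst (snd z))"] by (simp add: H2_graph_def)
  have H: "has_weak_pdv \<Omega> i (fst (snd z) $ j) (snd (snd z) $ i $ j)" for i j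
    using assms by (simp add: H2_graph_def)
  show ?thesis
    unfolding elliptic_op_def elliptic_jet_def weak_pdv_eq[OF open_\<Omega> W]
      weak_pdv_eq[OF open_\<Omega> has_weak_pdv_mult_on[OF open_\<Omega> bounded_\<Omega> a_C1 H]] ..
qed

text \<open>Green's formula; it passes from test functions to \<open>H10\<close> because both sides are continuous in
  the first order jet.\<close>

lemma inner_elliptic_jet:
  assumes z: "z \<in> H2_graph \<Omega>" and y: "y \<in> H10_graph \<Omega>"
  shows "inner (elliptic_jet \<Omega> a b c z) (fst y) = elliptic_form \<Omega> a b c (fst z, fst (snd z)) y"
proof -
  have H: "has_weak_pdv \<Omega> i (fst (snd z) $ j) (snd (snd z) $ i $ j)" for i j
    using z by (simp add: H2_graph_def)
  have "test_jet ` test_functions \<Omega> \<subseteq> {y. inner (elliptic_jet \<Omega> a b c z) (fst y) = elliptic_form \<Omega> a b c (fst z, fst (snd z)) y}"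
  proof clarsimp
    fix \<phi> assume \<phi>: "\<phi> \<in> test_functions \<Omega>"
    have "inner (mult_on \<Omega> (a i j) (snd (snd z) $ i $ j) + mult_on \<Omega> (pdv i (a i j)) (fst (snd z) $ j)) (abs_L2 \<phi>)
       = - inner (mult_on \<Omega> (a i j) (fst (snd z) $ j)) (abs_L2 (pdv i \<phi>))" for i j
      using has_weak_pdv_mult_on[OF open_\<Omega> bounded_\<Omega> a_C1[of i j] H[of i j]] \<phi> by (simp add: has_weak_pdv_iff_inner)
    then show "inner (elliptic_jet \<Omega> a b c z) (fst (test_jet \<phi>)) = elliptic_form \<Omega> a b c (fst z, fst (snd z)) (test_jet \<phi>)"
      by (simp add: elliptic_jet_def elliptic_form_def test_jet_def inner_sum_left inner_add_left inner_diff_left sum_negf)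
  qed
  moreover have "closed {y. inner (elliptic_jet \<Omega> a b c z) (fst y) = elliptic_form \<Omega> a b c (fst z, fst (snd z)) y}"
    unfolding elliptic_form_def by (intro closed_Collect_eq continuous_intros)
  ultimately have "H10_graph \<Omega> \<subseteq> {y. inner (elliptic_jet \<Omega> a b c z) (fst y) = elliptic_form \<Omega> a b c (fst z, fst (snd z)) y}"
    unfolding H10_graph_def by (rule closure_minimal)
  then show ?thesis using y by auto
qed

text \<open>Pointwise ellipticity, integrated.\<close>

lemma principal_part_coercive:
  fixes W :: "(real ^ 'n) L2 ^ 'n"
  assumes W: "\<And>i. W $ i \<in> L2_on \<Omega>"
  shows "(\<Sum>i\<in>UNIV. \<Sum>j\<in>UNIV. inner (mult_on \<Omega> (a i j) (W $ j)) (W $ i)) \<ge> \<kappa> * (norm W)\<^sup>2"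
proof -
  have "\<exists>B. bounded_coeff \<Omega> (a i j) B" for i j
    using C1_closure_bounded_coeff[OF open_\<Omega> bounded_\<Omega> a_C1] by blast
  then obtain B where B: "\<And>i j. bounded_coeff \<Omega> (a i j) (B i j)" by metis
  define t where "t i j x = rep_L2 (W $ i) x * (indicator \<Omega> x * (a i j x * rep_L2 (W $ j) x))" for i j x
  have ti: "integrable lebesgue (t i j)" for i j
    unfolding t_def by (intro sq_integrable_mult rep_L2_sq_integrable bounded_coeff_sq_integrable[OF B])
  have si: "integrable lebesgue (\<lambda>x. (rep_L2 (W $ i) x)\<^sup>2)" for i
    using rep_L2_sq_integrable[of "W $ i"] by (simp add: sq_integrable_def)
  have "inner (mult_on \<Omega> (a i j) (W $ j)) (W $ i) = integral\<^sup>L lebesgue (t i j)" for i j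
    unfolding mult_on_def t_def
    by (subst inner_commute, rule inner_abs_L2, rule bounded_coeff_sq_integrable[OF B rep_L2_sq_integrable])
  then have "(\<Sum>i\<in>UNIV. \<Sum>j\<in>UNIV. inner (mult_on \<Omega> (a i j) (W $ j)) (W $ i))
     = (LINT x|lebesgue. (\<Sum>i\<in>UNIV. \<Sum>j\<in>UNIV. t i j x))"
    by (simp add: ti)
  moreover have "(LINT x|lebesgue. \<kappa> * (\<Sum>i\<in>UNIV. (rep_L2 (W $ i) x)\<^sup>2)) \<le> (LINT x|lebesgue. (\<Sum>i\<in>UNIV. \<Sum>j\<in>UNIV. t i j x))"
  proof (rule integral_mono_AE)
    show "integrable lebesgue (\<lambda>x. \<kappa> * (\<Sum>i\<in>UNIV. (rep_L2 (W $ i) x)\<^sup>2))" using si by auto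
    show "integrable lebesgue (\<lambda>x. \<Sum>i\<in>UNIV. \<Sum>j\<in>UNIV. t i j x)" using ti by auto
    have "AE x in lebesgue. \<forall>i. x \<notin> \<Omega> \<longrightarrow> rep_L2 (W $ i) x = 0"
    proof -
      have "AE x in lebesgue. \<forall>i\<in>UNIV. x \<notin> \<Omega> \<longrightarrow> rep_L2 (W $ i) x = 0"
        by (subst AE_ball_countable) (use W in \<open>auto simp: L2_on_def intro: countable_finite\<close>)
      then show ?thesis by simp
    qed
    then show "AE x in lebesgue. \<kappa> * (\<Sum>i\<in>UNIV. (rep_L2 (W $ i) x)\<^sup>2) \<le> (\<Sum>i\<in>UNIV. \<Sum>j\<in>UNIV. t i j x)"
    proof eventually_elim
      case (elim x)
      show ?case
      proof (cases "x \<in> \<Omega>")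
        case True
        then show ?thesis using elliptic[OF True, of "\<chi> i. rep_L2 (W $ i) x"]
          by (simp add: t_def mult_ac)
      qed (use elim in \<open>simp add: t_def\<close>)
    qed
  qed
  moreover have "(LINT x|lebesgue. \<kappa> * (\<Sum>i\<in>UNIV. (rep_L2 (W $ i) x)\<^sup>2)) = \<kappa> * (norm W)\<^sup>2"
  proof -
    have "(norm W)\<^sup>2 = (\<Sum>i\<in>UNIV. (norm (W $ i))\<^sup>2)"
      by (simp add: norm_vec_def L2_set_def sum_nonneg)
    then show ?thesis using si by (simp add: norm_L2_sq)
  qed
  ultimately show ?thesis by (simp only:)
qed

lemma norm_coeff_le:
  assumes "bounded_linear h"
  shows "\<exists>B\<ge>0. \<forall>v. norm (h v) \<le> B * norm v"
  using bounded_linear.nonneg_bounded[OF assms] by (metis mult.commute)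

text \<open>Garding's inequality: half of the principal part absorbs the first order terms, by the inequality
  between arithmetic and geometric mean.\<close>

lemma garding:
  "\<exists>C. \<forall>z\<in>H2_graph \<Omega>. (\<kappa> / 2) * (norm (fst (snd z)))\<^sup>2 \<le> inner (elliptic_jet \<Omega> a b c z) (fst z) + C * (norm (fst z))\<^sup>2"
proof -
  obtain Bc where Bc: "Bc \<ge> 0" "\<And>v. norm (mult_on \<Omega> c v) \<le> Bc * norm v"
    using norm_coeff_le[OF bounded_linear_coeffs(4)] by blast
  have "\<exists>B\<ge>0. \<forall>v. norm (mult_on \<Omega> (b j) v) \<le> B * norm v" for j
    by (rule norm_coeff_le[OF bounded_linear_coeffs(3)])
  then obtain Bb where Bb: "\<And>j. Bb j \<ge> 0" "\<And>j v. norm (mult_on \<Omega> (b j) v) \<le> Bb j * norm v" by metis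
  define S where "S = (\<Sum>j\<in>UNIV. Bb j)"
  show ?thesis
  proof (intro exI[of _ "Bc + S\<^sup>2 / (2 * \<kappa>)"] ballI)
    fix z assume z: "z \<in> H2_graph \<Omega>"
    define v where "v = fst z"
    define W where "W = fst (snd z)"
    have y: "(v, W) \<in> H10_graph \<Omega>" using z by (simp add: H2_graph_def v_def W_def)
    have W: "W $ i \<in> L2_on \<Omega>" for i
      using H10_graph_has_weak_pdv(2)[OF \<Omega>_meas y, of i] by (simp add: has_weak_pdv_iff_inner)
    have 1: "inner (elliptic_jet \<Omega> a b c z) v = elliptic_form \<Omega> a b c (v, W) (v, W)"
      using inner_elliptic_jet[OF z y] by (simp add: v_def W_def)
    have c: "inner (mult_on \<Omega> c v) v \<le> Bc * (norm v)\<^sup>2"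
      using norm_cauchy_schwarz[of "mult_on \<Omega> c v" v] mult_right_mono[OF Bc(2)[of v], of "norm v"]
      by (simp add: power2_eq_square mult.assoc)
    have "inner (mult_on \<Omega> (b j) (W $ j)) v \<le> Bb j * (norm W * norm v)" for j
    proof -
      have "inner (mult_on \<Omega> (b j) (W $ j)) v \<le> norm (mult_on \<Omega> (b j) (W $ j)) * norm v"
        by (rule norm_cauchy_schwarz)
      also have "\<dots> \<le> (Bb j * norm (W $ j)) * norm v" by (intro mult_right_mono Bb) auto
      also have "\<dots> \<le> (Bb j * norm W) * norm v"
        by (intro mult_right_mono mult_left_mono Bb Finite_Cartesian_Product.norm_nth_le) auto
      finally show ?thesis by (simp add: mult.assoc)
    qed
    then have "(\<Sum>j\<in>UNIV. inner (mult_on \<Omega> (b j) (W $ j)) v) \<le> (\<Sum>j\<in>UNIV. Bb j * (norm W * norm v))"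
      by (rule sum_mono)
    then have b: "(\<Sum>j\<in>UNIV. inner (mult_on \<Omega> (b j) (W $ j)) v) \<le> S * norm W * norm v"
      by (simp add: S_def sum_distrib_right mult.assoc)
    \<comment> \<open>the square is chosen so that expanding it leaves exactly half of the principal part\<close>
    have "0 \<le> (\<kappa> * norm W - S * norm v)\<^sup>2 / (2 * \<kappa>)" using \<kappa>_pos by simp
    also have "\<dots> = (\<kappa> / 2) * (norm W)\<^sup>2 - S * norm W * norm v + (S\<^sup>2 / (2 * \<kappa>)) * (norm v)\<^sup>2"
      using \<kappa>_pos by (simp add: power2_diff add_divide_distrib diff_divide_distrib power_mult_distrib)
        (simp add: power2_eq_square)
    finally have "S * norm W * norm v \<le> (\<kappa> / 2) * (norm W)\<^sup>2 + (S\<^sup>2 / (2 * \<kappa>)) * (norm v)\<^sup>2" by simp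
    then have "(\<kappa> / 2) * (norm W)\<^sup>2 \<le> inner (elliptic_jet \<Omega> a b c z) v + (Bc + S\<^sup>2 / (2 * \<kappa>)) * (norm v)\<^sup>2"
      using principal_part_coercive[OF W] b c unfolding 1 elliptic_form_def by (simp add: algebra_simps)
    then show "(\<kappa> / 2) * (norm (fst (snd z)))\<^sup>2 \<le> inner (elliptic_jet \<Omega> a b c z) (fst z) + (Bc + S\<^sup>2 / (2 * \<kappa>)) * (norm (fst z))\<^sup>2"
      by (simp add: v_def W_def)
  qed
qed

lemma test_function_pairing_bound:
  assumes \<phi>: "\<phi> \<in> test_functions \<Omega>"
  shows "\<exists>C. \<forall>z\<in>H2_graph \<Omega>. \<bar>inner (elliptic_jet \<Omega> a b c z) (abs_L2 \<phi>)\<bar> \<le> C * (norm (fst z) + norm (fst (snd z)))"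
proof -
  have tj: "test_jet \<phi> \<in> H10_graph \<Omega>"
    unfolding H10_graph_def by (rule subsetD[OF closure_subset imageI[OF \<phi>]])
  have eq: "inner (elliptic_jet \<Omega> a b c z) (abs_L2 \<phi>) = elliptic_form \<Omega> a b c (fst z, fst (snd z)) (test_jet \<phi>)"
    if "z \<in> H2_graph \<Omega>" for z
    using inner_elliptic_jet[OF that tj] by (simp add: test_jet_def)
  have 1: "bounded_linear (\<lambda>y :: 'n jet1. snd y $ j)" for j
    by (intro bounded_linear_compose[OF bounded_linear_vec_nth] bounded_linear_snd)
  have "bounded_linear (\<lambda>y. elliptic_form \<Omega> a b c y (test_jet \<phi>))"
    unfolding elliptic_form_def
    by (intro bounded_linear_sub bounded_linear_sum bounded_linear_compose[OF bounded_linear_inner_left]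
        bounded_linear_compose[OF bounded_linear_coeffs(1) 1] bounded_linear_compose[OF bounded_linear_coeffs(3) 1]
        bounded_linear_compose[OF bounded_linear_coeffs(4) bounded_linear_fst])
  then obtain C where C: "C \<ge> 0" "\<And>y. norm (elliptic_form \<Omega> a b c y (test_jet \<phi>)) \<le> C * norm y"
    using bounded_linear.nonneg_bounded by (metis mult.commute)
  show ?thesis
  proof (intro exI ballI)
    fix z assume z: "z \<in> H2_graph \<Omega>"
    have "\<bar>inner (elliptic_jet \<Omega> a b c z) (abs_L2 \<phi>)\<bar> \<le> C * norm (fst z, fst (snd z))"
      using C(2)[of "(fst z, fst (snd z))"] by (simp add: eq[OF z])
    also have "\<dots> \<le> C * (norm (fst z) + norm (fst (snd z)))"
      using C(1) norm_Pair_le[of "fst z" "fst (snd z)"] by (intro mult_left_mono)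
    finally show "\<bar>inner (elliptic_jet \<Omega> a b c z) (abs_L2 \<phi>)\<bar> \<le> C * (norm (fst z) + norm (fst (snd z)))" .
  qed
qed

text \<open>Put \<open>h = p z + A z\<close>. Testing with \<open>z\<close> and absorbing the lower order terms bounds \<open>z\<close> in \<open>L2\<close> by
  \<open>2 / p\<close> and its gradient by a multiple of \<open>1 / sqrt p\<close>, both times the norm of \<open>h\<close>. A test function pairs
  with \<open>A z\<close> through \<open>z\<close> and its gradient only, so its pairing tends to \<open>0\<close> relative to \<open>h\<close>; replacing \<open>\<theta>\<close> by a
  nearby test function costs only a small multiple of the norm of \<open>A z\<close>, which is at most three times
  that of \<open>h\<close>.\<close>

lemma elliptic_resolvent_bound:
  assumes \<theta>: "\<theta> \<in> L2_on \<Omega>" and e: "e > 0"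
  shows "\<exists>p0>0. \<forall>p\<ge>p0. \<forall>z\<in>H2_graph \<Omega>.
     \<bar>inner \<theta> (elliptic_jet \<Omega> a b c z)\<bar> \<le> e * norm (p *\<^sub>R fst z + elliptic_jet \<Omega> a b c z)"
proof -
  obtain C0 where C0: "\<And>z. z \<in> H2_graph \<Omega> \<Longrightarrow> (\<kappa> / 2) * (norm (fst (snd z)))\<^sup>2 \<le> inner (elliptic_jet \<Omega> a b c z) (fst z) + C0 * (norm (fst z))\<^sup>2"
    using garding by blast
  have "\<theta> \<in> closure (abs_L2 ` test_functions \<Omega>)" by (rule test_functions_dense[OF open_\<Omega> \<theta>])
  then obtain \<phi> where \<phi>: "\<phi> \<in> test_functions \<Omega>" "norm (\<theta> - abs_L2 \<phi>) < e / 6"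
    unfolding closure_approachable using e by (metis (no_types, lifting) dist_norm dist_commute image_iff divide_pos_pos zero_less_numeral)
  obtain C1 where C1: "\<And>z. z \<in> H2_graph \<Omega> \<Longrightarrow> \<bar>inner (elliptic_jet \<Omega> a b c z) (abs_L2 \<phi>)\<bar> \<le> C1 * (norm (fst z) + norm (fst (snd z)))"
    using test_function_pairing_bound[OF \<phi>(1)] by blast
  define C where "C = \<bar>C1\<bar>"
  have "((\<lambda>p. C * (2 / p + sqrt (4 / (\<kappa> * p)))) \<longlongrightarrow> C * (0 + sqrt 0)) at_top"
  proof (intro tendsto_intros)
    have "filterlim (\<lambda>p. \<kappa> * p) at_top at_top"
      by (rule filterlim_tendsto_pos_mult_at_top[OF tendsto_const \<kappa>_pos filterlim_ident])
    then show "((\<lambda>p. 4 / (\<kappa> * p)) \<longlongrightarrow> 0) at_top"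
      by (rule tendsto_divide_0[OF tendsto_const filterlim_at_top_imp_at_infinity])
    show "((\<lambda>p. 2 / p) \<longlongrightarrow> (0::real)) at_top"
      by (rule tendsto_divide_0[OF tendsto_const filterlim_at_top_imp_at_infinity[OF filterlim_ident]])
  qed
  then have "eventually (\<lambda>p. C * (2 / p + sqrt (4 / (\<kappa> * p))) < e / 2) at_top"
    using e by (intro order_tendstoD(2)) auto
  then obtain p1 where p1: "\<And>p. p \<ge> p1 \<Longrightarrow> C * (2 / p + sqrt (4 / (\<kappa> * p))) < e / 2"
    by (auto simp: eventually_at_top_linorder)
  define p0 where "p0 = max 1 (max (2 * C0) p1)"
  show ?thesis
  proof (intro exI[of _ p0] conjI allI impI ballI)
    show "0 < p0" by (simp add: p0_def)
    fix p z assume p: "p0 \<le> p" and z: "z \<in> H2_graph \<Omega>"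
    have pp: "p > 0" "p \<ge> 2 * C0" "p \<ge> p1" using p by (auto simp: p0_def)
    define v W y h where "v = fst z" and "W = fst (snd z)" and "y = elliptic_jet \<Omega> a b c z" and "h = p *\<^sub>R v + y"
    have "inner h v = p * (norm v)\<^sup>2 + inner y v"
      by (simp add: h_def inner_add_left power2_norm_eq_inner)
    moreover have "C0 * (norm v)\<^sup>2 \<le> (p / 2) * (norm v)\<^sup>2" using pp by (intro mult_right_mono) auto
    ultimately have energy: "(p / 2) * (norm v)\<^sup>2 + (\<kappa> / 2) * (norm W)\<^sup>2 \<le> norm h * norm v"
      using C0[OF z] norm_cauchy_schwarz[of h v] by (simp add: v_def W_def y_def)
    have nnW: "0 \<le> \<kappa> / 2 * (norm W)\<^sup>2" and nnv: "0 \<le> p / 2 * (norm v)\<^sup>2"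
      using \<kappa>_pos pp by simp_all
    have v: "norm v \<le> 2 / p * norm h"
    proof (cases "v = 0")
      case False
      have "(p / 2) * (norm v)\<^sup>2 \<le> norm h * norm v"
        using energy nnW by linarith
      then have "(p / 2) * norm v \<le> norm h" using False by (simp add: power2_eq_square)
      then show ?thesis using pp by (simp add: field_simps)
    qed (use pp in simp)
    have W: "norm W \<le> sqrt (4 / (\<kappa> * p)) * norm h"
    proof -
      have "(\<kappa> / 2) * (norm W)\<^sup>2 \<le> norm h * norm v"
        using energy nnv by linarith
      also have "\<dots> \<le> norm h * (2 / p * norm h)" by (intro mult_left_mono v) auto
      finally have "(norm W)\<^sup>2 \<le> 4 / (\<kappa> * p) * (norm h)\<^sup>2"
        using pp \<kappa>_pos by (simp add: field_simps power2_eq_square)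
      then have "norm W \<le> sqrt (4 / (\<kappa> * p) * (norm h)\<^sup>2)" by (rule real_le_rsqrt)
      also have "\<dots> = sqrt (4 / (\<kappa> * p)) * norm h"
        unfolding real_sqrt_mult[of "4 / (\<kappa> * p)"] by simp
      finally show ?thesis .
    qed
    have "norm y \<le> norm h + p * norm v"
      using norm_triangle_ineq4[of h "p *\<^sub>R v"] pp by (simp add: h_def)
    also have "\<dots> \<le> 3 * norm h" using mult_left_mono[OF v, of p] pp by simp
    finally have y: "norm y \<le> 3 * norm h" .
    have "\<bar>inner \<theta> y\<bar> \<le> \<bar>inner (\<theta> - abs_L2 \<phi>) y\<bar> + \<bar>inner y (abs_L2 \<phi>)\<bar>"
      by (simp add: inner_diff_left inner_commute[of y])
    also have "\<dots> \<le> (e / 6) * (3 * norm h) + C * (2 / p * norm h + sqrt (4 / (\<kappa> * p)) * norm h)"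
    proof (rule add_mono)
      show "\<bar>inner (\<theta> - abs_L2 \<phi>) y\<bar> \<le> (e / 6) * (3 * norm h)"
        using Cauchy_Schwarz_ineq2[of "\<theta> - abs_L2 \<phi>" y] mult_mono[OF less_imp_le[OF \<phi>(2)] y] e by simp
      have "\<bar>inner y (abs_L2 \<phi>)\<bar> \<le> C1 * (norm v + norm W)" using C1[OF z] by (simp add: v_def W_def y_def)
      also have "\<dots> \<le> C * (norm v + norm W)" unfolding C_def by (intro mult_right_mono) auto
      also have "\<dots> \<le> C * (2 / p * norm h + sqrt (4 / (\<kappa> * p)) * norm h)"
        using v W by (intro mult_left_mono add_mono) (auto simp: C_def)
      finally show "\<bar>inner y (abs_L2 \<phi>)\<bar> \<le> C * (2 / p * norm h + sqrt (4 / (\<kappa> * p)) * norm h)" .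
    qed
    also have "\<dots> = (e / 2 + C * (2 / p + sqrt (4 / (\<kappa> * p)))) * norm h" by (simp add: algebra_simps)
    also have "\<dots> \<le> e * norm h"
    proof (rule mult_right_mono)
      show "e / 2 + C * (2 / p + sqrt (4 / (\<kappa> * p))) \<le> e" using p1[OF pp(3)] by linarith
    qed simp
    finally show "\<bar>inner \<theta> (elliptic_jet \<Omega> a b c z)\<bar> \<le> e * norm (p *\<^sub>R fst z + elliptic_jet \<Omega> a b c z)"
      by (simp add: y_def h_def v_def)
  qed
qed

end

section \<open>Square integrable functions of time\<close>

lemma finite_measure_time: "finite_measure (time_measure T)"
  by (rule finite_measure_lebesgue_on) auto

lemma sigma_finite_time: "sigma_finite_measure (time_measure T)"
  using finite_measure.axioms(1)[OF finite_measure_time] .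

text \<open>Lebesgue measure on the time interval is complete. This is what allows functions that are only
  determined almost everywhere, such as values of \<open>frac_int_ext\<close>, to be measurable.\<close>

lemma measurable_time_AE_cong:
  assumes f: "f \<in> measurable (time_measure T) N" and eq: "AE t in time_measure T. f t = g t"
    and g: "\<And>t. g t \<in> space N"
  shows "g \<in> measurable (time_measure T) N"
proof (rule measurableI)
  interpret complete_measure "time_measure T"
  proof
    fix A B assume AB: "B \<subseteq> A" "A \<in> null_sets (time_measure T)"
    then have "A \<subseteq> {0<..<T} \<and> A \<in> null_sets lebesgue" by (subst (asm) null_sets_restrict_space) auto
    then have "B \<in> null_sets lebesgue" "B \<subseteq> {0<..<T}"
      using AB(1) completion.complete2[of B A lborel] by auto
    then show "B \<in> sets (time_measure T)"
      by (auto simp: sets_restrict_space null_sets_def)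
  qed
  fix A assume A: "A \<in> sets N"
  show "g -` A \<inter> space (time_measure T) \<in> sets (time_measure T)"
  proof (rule in_sets_AE[OF _ measurable_sets[OF f A]])
    show "AE x in time_measure T. x \<in> f -` A \<inter> space (time_measure T) \<longleftrightarrow> x \<in> g -` A \<inter> space (time_measure T)"
      using eq by eventually_elim auto
  qed auto
qed (use g in auto)

text \<open>Greedy choice of the nearest among the first points of a dense sequence that starts with \<open>0\<close>.\<close>

lemma simple_function_sequence_in_subspace:
  fixes z :: "'a \<Rightarrow> 'z::{real_normed_vector, second_countable_topology}"
  assumes z: "z \<in> borel_measurable M" and V: "0 \<in> V" "\<And>t. z t \<in> V"
  obtains s where "\<And>k::nat. simple_function M (s k)" "\<And>k t. s k t \<in> V"
    "\<And>t. (\<lambda>k. s k t) \<longlonglongrightarrow> z t" "\<And>k t. norm (s k t) \<le> 2 * norm (z t)"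
proof -
  obtain D where D: "countable D" "D \<subseteq> V" "V \<subseteq> closure D" by (rule separable)
  define d where "d n = (if D = {} then 0 else from_nat_into D n)" for n :: nat
  have dV: "d n \<in> V" for n using D(2) V(1) from_nat_into[of D n] by (auto simp: d_def)
  have dense: "\<exists>n. dist (d n) x < e" if x: "x \<in> V" "e > 0" for x e
  proof -
    have "x \<in> closure D" using D(3) x by auto
    then obtain y where y: "y \<in> D" "dist y x < e" using x(2) by (auto simp: closure_approachable)
    then obtain n where "from_nat_into D n = y" using from_nat_into_surj[OF D(1)] by metis
    then show ?thesis using y by (intro exI[of _ n]) (auto simp: d_def)
  qed
  define s where "s = rec_nat (\<lambda>t. 0) (\<lambda>k r t. if dist (d k) (z t) < dist (r t) (z t) then d k else r t)"
  have s0: "s 0 = (\<lambda>t. 0)" and sS: "s (Suc k) = (\<lambda>t. if dist (d k) (z t) < dist (s k t) (z t) then d k else s k t)" for k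
    unfolding s_def by simp_all
  have simple: "simple_function M (s k)" for k
  proof (induction k)
    case (Suc k)
    have [measurable]: "s k \<in> borel_measurable M" by (rule borel_measurable_simple_function[OF Suc])
    note z[measurable]
    have "{t \<in> space M. dist (d k) (z t) < dist (s k t) (z t)} \<in> sets M" by measurable
    then show ?case unfolding sS by (intro simple_function_If simple_function_const Suc)
  qed (simp add: s0)
  have sV: "s k t \<in> V" for k t by (induction k) (auto simp: s0 sS dV V(1))
  have step: "dist (s (Suc k) t) (z t) \<le> dist (s k t) (z t)" "dist (s (Suc k) t) (z t) \<le> dist (d k) (z t)" for k t
    by (auto simp: sS)
  have mono: "dist (s m t) (z t) \<le> dist (s k t) (z t)" if "k \<le> m" for k m t
    using that by (induction rule: dec_induct) (auto intro: order_trans[OF step(1)])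
  show ?thesis
  proof (rule that[of s])
    show "(\<lambda>k. s k t) \<longlonglongrightarrow> z t" for t
    proof (rule metric_LIMSEQ_I)
      fix e :: real assume "e > 0"
      then obtain n where n: "dist (d n) (z t) < e" using dense[OF V(2)] by blast
      show "\<exists>no. \<forall>m\<ge>no. dist (s m t) (z t) < e"
        using mono[of "Suc n" _ t] step(2)[of n t] n by (intro exI[of _ "Suc n"]) (auto intro: le_less_trans order_trans)
    qed
    show "norm (s k t) \<le> 2 * norm (z t)" for k t
    proof -
      have "dist (s k t) (z t) \<le> norm (z t)" using mono[of 0 k t] by (simp add: s0 dist_norm)
      then show ?thesis using norm_triangle_ineq[of "s k t - z t" "z t"] by (simp add: dist_norm)
    qed
  qed (use simple sV in auto)
qed

text \<open>Integrals of simple functions with values in the subspace are finite sums of its elements.\<close>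

lemma integral_in_closed_subspace:
  fixes f :: "'a \<Rightarrow> 'z::{banach, second_countable_topology}"
  assumes V: "subspace V" "closed V" and f: "integrable M f" "\<And>x. f x \<in> V"
  shows "integral\<^sup>L M f \<in> V"
proof -
  have fm: "f \<in> borel_measurable M" using f(1) by simp
  obtain s where s: "\<And>k::nat. simple_function M (s k)" "\<And>k t. s k t \<in> V"
    "\<And>t. (\<lambda>k. s k t) \<longlonglongrightarrow> f t" "\<And>k t. norm (s k t) \<le> 2 * norm (f t)"
    using simple_function_sequence_in_subspace[OF fm subspace_0[OF V(1)] f(2)] by metis
  have si: "integrable M (s k)" for k
    by (rule Bochner_Integration.integrable_bound[of M "\<lambda>t. 2 * norm (f t)"])
      (use f(1) s(4) in \<open>auto intro: borel_measurable_simple_function[OF s(1)]\<close>)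
  have "integral\<^sup>L M (s k) \<in> V" for k
  proof -
    have "Bochner_Integration.simple_bochner_integrable M (s k)"
      by (rule simple_bochner_integrableI_bounded[OF s(1)]) (use si[of k] in \<open>simp add: integrable_iff_bounded\<close>)
    then have "integral\<^sup>L M (s k) = Bochner_Integration.simple_bochner_integral M (s k)"
      by (rule has_bochner_integral_integral_eq[OF has_bochner_integral_simple_bochner_integrable])
    also have "\<dots> \<in> V"
      unfolding Bochner_Integration.simple_bochner_integral_def
      by (intro subspace_sum[OF V(1)] subspace_scale[OF V(1)]) (use s(2) in auto)
    finally show ?thesis .
  qed
  moreover have "(\<lambda>k. integral\<^sup>L M (s k)) \<longlonglongrightarrow> integral\<^sup>L M f"
    by (rule integral_dominated_convergence[where w="\<lambda>t. 2 * norm (f t)"])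
      (use f(1) s in \<open>auto intro: borel_measurable_simple_function\<close>)
  ultimately show ?thesis by (rule closed_sequentially[OF V(2)])
qed

section \<open>The square norm\<close>

definition sq_norm_integrable :: "real \<Rightarrow> (real \<Rightarrow> 'z::{banach, second_countable_topology}) \<Rightarrow> bool" where
  "sq_norm_integrable T w \<longleftrightarrow> w \<in> borel_measurable (time_measure T) \<and>
     integrable (time_measure T) (\<lambda>t. (norm (w t))\<^sup>2)"

text \<open>The square of the distance in \<open>L\<^sup>2(0,T)\<close>. With the constant 2 in \<open>sq_dist_triangle\<close> the square is as
  good as the distance itself for questions of convergence, and it is an integral.\<close>

definition sq_dist :: "real \<Rightarrow> (real \<Rightarrow> 'z::{banach, second_countable_topology}) \<Rightarrow> (real \<Rightarrow> 'z) \<Rightarrow> real" where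
  "sq_dist T v w = (LINT t|time_measure T. (norm (v t - w t))\<^sup>2)"

lemma norm_add_sq_le: "(norm (x + y))\<^sup>2 \<le> 2 * (norm x)\<^sup>2 + 2 * (norm (y::'z::real_normed_vector))\<^sup>2"
proof -
  have "(norm (x + y))\<^sup>2 \<le> (norm x + norm y)\<^sup>2" by (intro power_mono norm_triangle_ineq) auto
  also have "\<dots> \<le> 2 * (norm x)\<^sup>2 + 2 * (norm y)\<^sup>2"
    using sum_squares_bound[of "norm x" "norm y"] by (simp add: power2_sum)
  finally show ?thesis .
qed

lemma sq_norm_integrable_bound:
  assumes "sq_norm_integrable T v" "w \<in> borel_measurable (time_measure T)"
    "AE t in time_measure T. norm (w t) \<le> C * norm (v t)"
  shows "sq_norm_integrable T w"
  unfolding sq_norm_integrable_def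
proof (intro conjI assms(2))
  show "integrable (time_measure T) (\<lambda>t. (norm (w t))\<^sup>2)"
  proof (rule Bochner_Integration.integrable_bound)
    show "integrable (time_measure T) (\<lambda>t. C\<^sup>2 * (norm (v t))\<^sup>2)"
      using assms(1) by (simp add: sq_norm_integrable_def)
    show "(\<lambda>t. (norm (w t))\<^sup>2) \<in> borel_measurable (time_measure T)" using assms(2) by measurable
    show "AE t in time_measure T. norm ((norm (w t))\<^sup>2) \<le> norm (C\<^sup>2 * (norm (v t))\<^sup>2)"
      using assms(3)
    proof eventually_elim
      case (elim t)
      then have "(norm (w t))\<^sup>2 \<le> (C * norm (v t))\<^sup>2" by (intro power_mono) auto
      then show ?case by (simp add: power_mult_distrib)
    qed
  qed
qed

lemma sq_norm_integrable_zero: "sq_norm_integrable T (\<lambda>t. 0)"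
  by (simp add: sq_norm_integrable_def)

lemma sq_norm_integrable_add:
  assumes "sq_norm_integrable T v" "sq_norm_integrable T w"
  shows "sq_norm_integrable T (\<lambda>t. v t + w t)"
  unfolding sq_norm_integrable_def
proof
  have m: "v \<in> borel_measurable (time_measure T)" "w \<in> borel_measurable (time_measure T)"
    using assms by (auto simp: sq_norm_integrable_def)
  then show "(\<lambda>t. v t + w t) \<in> borel_measurable (time_measure T)" by measurable
  show "integrable (time_measure T) (\<lambda>t. (norm (v t + w t))\<^sup>2)"
  proof (rule Bochner_Integration.integrable_bound)
    show "integrable (time_measure T) (\<lambda>t. 2 * (norm (v t))\<^sup>2 + 2 * (norm (w t))\<^sup>2)"
      using assms by (simp add: sq_norm_integrable_def)
    show "(\<lambda>t. (norm (v t + w t))\<^sup>2) \<in> borel_measurable (time_measure T)" using m by measurable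
  qed (use norm_add_sq_le in auto)
qed

lemma sq_norm_integrable_scaleR: "sq_norm_integrable T v \<Longrightarrow> sq_norm_integrable T (\<lambda>t. r *\<^sub>R v t)"
  by (rule sq_norm_integrable_bound[of T v _ "\<bar>r\<bar>"]) (auto simp: sq_norm_integrable_def)

lemma sq_norm_integrable_diff:
  "sq_norm_integrable T v \<Longrightarrow> sq_norm_integrable T w \<Longrightarrow> sq_norm_integrable T (\<lambda>t. v t - w t)"
  using sq_norm_integrable_add[of T v "\<lambda>t. (-1) *\<^sub>R w t"] sq_norm_integrable_scaleR[of T w "-1"] by simp

lemma sq_norm_integrable_imp_integrable:
  assumes "sq_norm_integrable T w"
  shows "integrable (time_measure T) w"
proof (rule Bochner_Integration.integrable_bound)
  interpret finite_measure "time_measure T" by (rule finite_measure_time)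
  show "integrable (time_measure T) (\<lambda>t. 1 + (norm (w t))\<^sup>2)"
    using assms by (intro Bochner_Integration.integrable_add integrable_const) (auto simp: sq_norm_integrable_def)
  have "norm (w t) \<le> 1 + (norm (w t))\<^sup>2" for t
    using sum_squares_bound[of 1 "norm (w t)"] by (simp add: power2_eq_square) (use norm_ge_zero[of "w t"] in linarith)
  then show "AE t in time_measure T. norm (w t) \<le> norm (1 + (norm (w t))\<^sup>2)"
    by (auto intro: order_trans[OF _ abs_ge_self])
qed (use assms in \<open>simp add: sq_norm_integrable_def\<close>)

lemma bounded_sq_norm_integrable:
  assumes "w \<in> borel_measurable (time_measure T)" "\<And>t. t \<in> {0<..<T} \<Longrightarrow> norm (w t) \<le> C"
  shows "sq_norm_integrable T w"
  unfolding sq_norm_integrable_def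
proof (intro conjI assms(1))
  interpret finite_measure "time_measure T" by (rule finite_measure_time)
  show "integrable (time_measure T) (\<lambda>t. (norm (w t))\<^sup>2)"
  proof (rule integrable_const_bound[where B="C\<^sup>2"])
    show "AE t in time_measure T. norm ((norm (w t))\<^sup>2) \<le> C\<^sup>2"
      by (rule AE_I2) (use assms(2) in \<open>auto intro!: power_mono\<close>)
    show "(\<lambda>t. (norm (w t))\<^sup>2) \<in> borel_measurable (time_measure T)" using assms(1) by measurable
  qed
qed

lemma sq_dist_nonneg: "sq_dist T v w \<ge> 0"
  by (simp add: sq_dist_def)

lemma sq_dist_commute: "sq_dist T v w = sq_dist T w v"
  by (simp add: sq_dist_def norm_minus_commute)

lemma sq_dist_triangle:
  assumes "sq_norm_integrable T u" "sq_norm_integrable T v" "sq_norm_integrable T w"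
  shows "sq_dist T u w \<le> 2 * sq_dist T u v + 2 * sq_dist T v w"
proof -
  have i: "integrable (time_measure T) (\<lambda>t. (norm (x t - y t))\<^sup>2)"
    if "sq_norm_integrable T x" "sq_norm_integrable T y" for x y :: "real \<Rightarrow> 'a"
    using sq_norm_integrable_diff[OF that] by (simp add: sq_norm_integrable_def)
  have "sq_dist T u w \<le> (LINT t|time_measure T. 2 * (norm (u t - v t))\<^sup>2 + 2 * (norm (v t - w t))\<^sup>2)"
    unfolding sq_dist_def
  proof (rule integral_mono)
    show "(norm (u t - w t))\<^sup>2 \<le> 2 * (norm (u t - v t))\<^sup>2 + 2 * (norm (v t - w t))\<^sup>2" for t
      using norm_add_sq_le[of "u t - v t" "v t - w t"] by simp
  qed (use i assms in auto)
  then show ?thesis using i assms by (simp add: sq_dist_def)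
qed

lemma sq_dist_cong_AE:
  assumes "AE t in time_measure T. v t = v' t" "AE t in time_measure T. w t = w' t"
    "sq_norm_integrable T v" "sq_norm_integrable T v'" "sq_norm_integrable T w" "sq_norm_integrable T w'"
  shows "sq_dist T v w = sq_dist T v' w'"
  unfolding sq_dist_def
proof (rule integral_cong_AE)
  show "AE t in time_measure T. (norm (v t - w t))\<^sup>2 = (norm (v' t - w' t))\<^sup>2"
    using assms(1,2) by eventually_elim simp
qed (use assms(3-) in \<open>auto simp: sq_norm_integrable_def\<close>)

lemma sq_dist_eq_zero_iff:
  assumes "sq_norm_integrable T v" "sq_norm_integrable T w"
  shows "sq_dist T v w = 0 \<longleftrightarrow> (AE t in time_measure T. v t = w t)"
proof -
  have "integrable (time_measure T) (\<lambda>t. (norm (v t - w t))\<^sup>2)"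
    using sq_norm_integrable_diff[OF assms] by (simp add: sq_norm_integrable_def)
  then show ?thesis
    unfolding sq_dist_def by (subst integral_nonneg_eq_0_iff_AE) auto
qed

lemma sq_dist_dominated_convergence:
  assumes s: "\<And>n::nat. s n \<in> borel_measurable (time_measure T)" and z: "z \<in> borel_measurable (time_measure T)"
    and h: "sq_norm_integrable T (h :: real \<Rightarrow> real)"
    and lim: "AE t in time_measure T. (\<lambda>n. s n t) \<longlonglongrightarrow> z t"
    and bd: "\<And>n. AE t in time_measure T. norm (s n t - z t) \<le> h t"
  shows "(\<lambda>n. sq_dist T (s n) z) \<longlonglongrightarrow> 0"
proof -
  have "(\<lambda>n. LINT t|time_measure T. (norm (s n t - z t))\<^sup>2) \<longlonglongrightarrow> (LINT t|time_measure T. (0::real))"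
  proof (rule integral_dominated_convergence[where w="\<lambda>t. (h t)\<^sup>2"])
    show "integrable (time_measure T) (\<lambda>t. (h t)\<^sup>2)" using h by (simp add: sq_norm_integrable_def)
    show "AE t in time_measure T. (\<lambda>n. (norm (s n t - z t))\<^sup>2) \<longlonglongrightarrow> 0"
      using lim
    proof eventually_elim
      case (elim t)
      have "(\<lambda>n. (norm (s n t - z t))\<^sup>2) \<longlonglongrightarrow> (norm (z t - z t))\<^sup>2" by (intro tendsto_intros elim)
      then show ?case by simp
    qed
    show "AE t in time_measure T. norm ((norm (s n t - z t))\<^sup>2) \<le> (h t)\<^sup>2" for n
      using bd[of n] by eventually_elim (auto intro: power_mono)
    show "(\<lambda>t. (norm (s n t - z t))\<^sup>2) \<in> borel_measurable (time_measure T)" for n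
      using s z by measurable
  qed simp
  then show ?thesis by (simp add: sq_dist_def)
qed

section \<open>Completeness\<close>

text \<open>The values are required to lie in \<open>V\<close> at every time, not just at almost every time; changing a function on a
  null set achieves this.\<close>

definition valued_in :: "real \<Rightarrow> 'z::{banach, second_countable_topology} set \<Rightarrow> (real \<Rightarrow> 'z) set" where
  "valued_in T V = {z. sq_norm_integrable T z \<and> (\<forall>t. z t \<in> V)}"

text \<open>The argument of Riesz and Fischer: a subsequence with summable increments converges almost everywhere,
  and Fatou's lemma identifies its limit in the mean.\<close>

lemma sq_dist_complete:
  fixes w :: "nat \<Rightarrow> real \<Rightarrow> 'z::{banach, second_countable_topology}"
  assumes V: "closed V" "0 \<in> V" and w: "\<And>n. w n \<in> valued_in T V"
    and cauchy: "\<And>e. e > 0 \<Longrightarrow> \<exists>N. \<forall>m\<ge>N. \<forall>n\<ge>N. sq_dist T (w m) (w n) < e"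
  obtains z where "z \<in> valued_in T V" "(\<lambda>n. sq_dist T (w n) z) \<longlonglongrightarrow> 0"
proof -
  have sq: "sq_norm_integrable T (w n)" for n using w by (simp add: valued_in_def)
  have m[measurable]: "w n \<in> borel_measurable (time_measure T)" for n
    using sq by (simp add: sq_norm_integrable_def)
  have "\<exists>N. \<forall>m\<ge>N. \<forall>n\<ge>N. sq_dist T (w m) (w n) < (1/4) ^ k" for k :: nat
    by (rule cauchy) simp
  then obtain N where N: "\<And>k m n. m \<ge> N k \<Longrightarrow> n \<ge> N k \<Longrightarrow> sq_dist T (w m) (w n) < (1/4) ^ k" by metis
  define r where "r k = (\<Sum>i\<le>k. N i)" for k
  have r_ge: "N k \<le> r m" if "k \<le> m" for k m
    unfolding r_def by (rule member_le_sum) (use that in auto)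
  define d where "d k t = norm (w (r (Suc k)) t - w (r k) t)" for k t
  have dm[measurable]: "d k \<in> borel_measurable (time_measure T)" for k unfolding d_def by measurable
  interpret finite_measure "time_measure T" by (rule finite_measure_time)
  define \<tau> where "\<tau> = measure (time_measure T) (space (time_measure T))"
  have d_int: "integrable (time_measure T) (\<lambda>t. (d k t)\<^sup>2)" for k
    using sq_norm_integrable_diff[OF sq sq] unfolding d_def by (simp add: sq_norm_integrable_def)
  have nn: "(\<integral>\<^sup>+t. ennreal (d k t) \<partial>time_measure T) \<le> ennreal ((\<tau> + 1) * (1/2) ^ k)" for k
  proof -
    \<comment> \<open>trades the square of the increment, which is controlled in the mean, for the increment itself\<close>
    have le: "d k t \<le> (1/2) ^ k + 2 ^ k * (d k t)\<^sup>2" for t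
    proof -
      have "0 \<le> (d k t - (1/2) ^ k)\<^sup>2" by simp
      then have "2 * d k t * (1/2) ^ k \<le> (d k t)\<^sup>2 + ((1/2) ^ k)\<^sup>2" by (simp add: power2_diff)
      then have "2 ^ k * (2 * d k t * (1/2) ^ k) \<le> 2 ^ k * ((d k t)\<^sup>2 + ((1/2) ^ k)\<^sup>2)" by (intro mult_left_mono) auto
      moreover have "2 ^ k * (2 * d k t * (1/2) ^ k) = 2 * d k t" "2 ^ k * ((1/2) ^ k)\<^sup>2 = (1/2 :: real) ^ k"
        by (simp_all add: power_one_over power2_eq_square)
      moreover have "0 \<le> d k t" by (simp add: d_def)
      ultimately show ?thesis by (simp add: distrib_left)
    qed
    have "(\<integral>\<^sup>+t. ennreal (d k t) \<partial>time_measure T) \<le> (\<integral>\<^sup>+t. ennreal ((1/2) ^ k + 2 ^ k * (d k t)\<^sup>2) \<partial>time_measure T)"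
      by (intro nn_integral_mono ennreal_leI le)
    also have "\<dots> = ennreal (LINT t|time_measure T. (1/2) ^ k + 2 ^ k * (d k t)\<^sup>2)"
      by (rule nn_integral_eq_integral) (use d_int in auto)
    also have "(LINT t|time_measure T. (1/2) ^ k + 2 ^ k * (d k t)\<^sup>2) = \<tau> * (1/2) ^ k + 2 ^ k * sq_dist T (w (r (Suc k))) (w (r k))"
      using d_int by (simp add: sq_dist_def d_def \<tau>_def)
    also have "\<dots> \<le> \<tau> * (1/2) ^ k + 2 ^ k * (1/4) ^ k"
      using N[OF r_ge[of k "Suc k"] r_ge[of k k]] by (intro add_left_mono mult_left_mono) auto
    also have "\<dots> = (\<tau> + 1) * (1/2) ^ k"
      by (simp add: distrib_right power_mult_distrib[symmetric])
    finally show ?thesis by (simp add: ennreal_leI)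
  qed
  have "(\<integral>\<^sup>+t. (\<Sum>k. ennreal (d k t)) \<partial>time_measure T) = (\<Sum>k. \<integral>\<^sup>+t. ennreal (d k t) \<partial>time_measure T)"
    by (rule nn_integral_suminf) measurable
  also have "\<dots> \<le> (\<Sum>k. ennreal ((\<tau> + 1) * (1/2) ^ k))" by (intro suminf_le nn) auto
  also have "\<dots> < \<infinity>"
    by (subst suminf_ennreal2) (auto simp: \<tau>_def intro!: summable_mult summable_geometric)
  finally have "AE t in time_measure T. (\<Sum>k. ennreal (d k t)) \<noteq> \<infinity>"
    by (intro nn_integral_PInf_AE) auto
  then have conv: "AE t in time_measure T. (\<lambda>k. w (r k) t) \<longlonglongrightarrow> lim (\<lambda>k. w (r k) t)"
  proof eventually_elim
    case (elim t)
    have "summable (\<lambda>k. d k t)"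
      using elim by (intro summable_suminf_not_top) (auto simp: d_def)
    then have "summable (\<lambda>k. w (r (Suc k)) t - w (r k) t)"
      unfolding d_def by (rule summable_norm_cancel)
    then have "convergent (\<lambda>n. \<Sum>k<n. w (r (Suc k)) t - w (r k) t)" by (simp add: summable_iff_convergent)
    then have "convergent (\<lambda>n. w (r n) t - w (r 0) t)"
      using sum_lessThan_telescope[of "\<lambda>k. w (r k) t"] by simp
    then have "convergent (\<lambda>n. (w (r n) t - w (r 0) t) + w (r 0) t)"
      by (intro convergent_add convergent_const)
    then show ?case by (simp add: convergent_LIMSEQ_iff)
  qed
  define g where "g t = lim (\<lambda>k. w (r k) t)" for t
  have gm[measurable]: "g \<in> borel_measurable (time_measure T)" unfolding g_def by measurable
  define z where "z t = (if g t \<in> V then g t else 0)" for t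
  have zm[measurable]: "z \<in> borel_measurable (time_measure T)"
  proof -
    have "{t \<in> space (time_measure T). g t \<in> V} \<in> sets (time_measure T)"
      using measurable_sets[OF gm borel_closed[OF V(1)]] by (simp add: vimage_def Int_def conj_commute)
    then show ?thesis unfolding z_def by (intro measurable_If) auto
  qed
  have zlim: "AE t in time_measure T. (\<lambda>k. w (r k) t) \<longlonglongrightarrow> z t"
    using conv
  proof eventually_elim
    case (elim t)
    have "g t \<in> V" unfolding g_def
      by (rule closed_sequentially[OF V(1) _ elim]) (use w in \<open>auto simp: valued_in_def\<close>)
    then show ?case using elim by (simp add: z_def g_def)
  qed
  have fatou: "(\<integral>\<^sup>+t. ennreal ((norm (z t - w (r k) t))\<^sup>2) \<partial>time_measure T) \<le> ennreal ((1/4) ^ k)" for k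
  proof -
    have "(\<integral>\<^sup>+t. ennreal ((norm (z t - w (r k) t))\<^sup>2) \<partial>time_measure T)
        = (\<integral>\<^sup>+t. liminf (\<lambda>m. ennreal ((norm (w (r m) t - w (r k) t))\<^sup>2)) \<partial>time_measure T)"
    proof (rule nn_integral_cong_AE)
      show "AE t in time_measure T. ennreal ((norm (z t - w (r k) t))\<^sup>2) = liminf (\<lambda>m. ennreal ((norm (w (r m) t - w (r k) t))\<^sup>2))"
        using zlim
      proof eventually_elim
        case (elim t)
        then have "(\<lambda>m. ennreal ((norm (w (r m) t - w (r k) t))\<^sup>2)) \<longlonglongrightarrow> ennreal ((norm (z t - w (r k) t))\<^sup>2)"
          by (intro tendsto_intros)
        then show ?case by (intro lim_imp_Liminf[symmetric]) auto
      qed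
    qed
    also have "\<dots> \<le> liminf (\<lambda>m. \<integral>\<^sup>+t. ennreal ((norm (w (r m) t - w (r k) t))\<^sup>2) \<partial>time_measure T)"
      by (rule nn_integral_liminf) measurable
    also have "\<dots> \<le> ennreal ((1/4) ^ k)"
    proof (rule Liminf_le)
      have "(\<integral>\<^sup>+t. ennreal ((norm (w (r m) t - w (r k) t))\<^sup>2) \<partial>time_measure T) \<le> ennreal ((1/4) ^ k)" if "m \<ge> k" for m
      proof -
        have "(\<integral>\<^sup>+t. ennreal ((norm (w (r m) t - w (r k) t))\<^sup>2) \<partial>time_measure T) = ennreal (sq_dist T (w (r m)) (w (r k)))"
          unfolding sq_dist_def using sq_norm_integrable_diff[OF sq sq]
          by (intro nn_integral_eq_integral) (auto simp: sq_norm_integrable_def)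
        then show ?thesis using N[OF r_ge[OF that] r_ge[of k k]] by (simp add: ennreal_leI)
      qed
      then show "\<forall>\<^sub>F m in sequentially. (\<integral>\<^sup>+t. ennreal ((norm (w (r m) t - w (r k) t))\<^sup>2) \<partial>time_measure T) \<le> ennreal ((1/4) ^ k)"
        by (auto simp: eventually_sequentially)
    qed simp
    finally show ?thesis .
  qed
  have zw: "sq_norm_integrable T (\<lambda>t. z t - w (r k) t)" for k
    unfolding sq_norm_integrable_def using fatou[of k]
    by (auto intro!: integrableI_bounded intro: le_less_trans)
  have sz: "sq_norm_integrable T z" using sq_norm_integrable_add[OF zw[of 0] sq[of "r 0"]] by simp
  have est: "sq_dist T z (w (r k)) \<le> (1/4) ^ k" for k
  proof -
    have "ennreal (sq_dist T z (w (r k))) \<le> ennreal ((1/4) ^ k)"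
      unfolding sq_dist_def using zw[of k] fatou[of k]
      by (subst nn_integral_eq_integral[symmetric]) (auto simp: sq_norm_integrable_def)
    then show ?thesis by simp
  qed
  have "(\<lambda>n. sq_dist T (w n) z) \<longlonglongrightarrow> 0"
  proof (rule LIMSEQ_I)
    fix e :: real assume "e > 0"
    then obtain k where k: "(1/4 :: real) ^ k < e / 4"
      using real_arch_pow_inv[of "e / 4" "1/4"] by auto
    show "\<exists>no. \<forall>n\<ge>no. norm (sq_dist T (w n) z - 0) < e"
    proof (intro exI[of _ "N k"] allI impI)
      fix n assume n: "n \<ge> N k"
      have "sq_dist T (w n) z \<le> 2 * sq_dist T (w n) (w (r k)) + 2 * sq_dist T (w (r k)) z"
        by (intro sq_dist_triangle sq sz)
      also have "\<dots> < e" using N[OF n r_ge[of k k]] est[of k] k by (simp add: sq_dist_commute)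
      finally show "norm (sq_dist T (w n) z - 0) < e" by (simp add: sq_dist_nonneg)
    qed
  qed
  moreover have "z \<in> valued_in T V" using sz V(2) by (auto simp: valued_in_def z_def)
  ultimately show ?thesis using that by blast
qed

section \<open>The fractional integral\<close>

definition frac_kernel :: "real \<Rightarrow> real \<Rightarrow> real \<Rightarrow> real" where
  "frac_kernel \<alpha> t s = (if s < t then (t - s) powr (\<alpha> - 1) / Gamma \<alpha> else 0)"

lemma frac_kernel_nonneg: "\<alpha> > 0 \<Longrightarrow> frac_kernel \<alpha> t s \<ge> 0"
  by (simp add: frac_kernel_def Gamma_real_pos less_imp_le)

lemma frac_kernel_measurable2:
  "(\<lambda>(t, s). frac_kernel \<alpha> t s) \<in> borel_measurable (time_measure T \<Otimes>\<^sub>M time_measure T)"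
proof -
  have [measurable]: "(\<lambda>x::real. x) \<in> borel_measurable (time_measure T)"
    by (intro measurable_restrict_space1 measurable_completion) simp
  have [measurable]: "fst \<in> borel_measurable (time_measure T \<Otimes>\<^sub>M time_measure T)"
    "snd \<in> borel_measurable (time_measure T \<Otimes>\<^sub>M time_measure T)"
    using measurable_compose[OF measurable_fst[of "time_measure T" "time_measure T"], of "\<lambda>x. x" borel]
      measurable_compose[OF measurable_snd[of "time_measure T" "time_measure T"], of "\<lambda>x. x" borel] by simp_all
  show ?thesis unfolding frac_kernel_def split_beta' by measurable
qed

lemma frac_kernel_measurable:
  "frac_kernel \<alpha> t \<in> borel_measurable (time_measure T)" "(\<lambda>t. frac_kernel \<alpha> t s) \<in> borel_measurable (time_measure T)"
proof -
  have [measurable]: "(\<lambda>x::real. x) \<in> borel_measurable (time_measure T)"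
    by (intro measurable_restrict_space1 measurable_completion) simp
  show "frac_kernel \<alpha> t \<in> borel_measurable (time_measure T)" "(\<lambda>t. frac_kernel \<alpha> t s) \<in> borel_measurable (time_measure T)"
    unfolding frac_kernel_def by measurable
qed

definition frac_const :: "real \<Rightarrow> real \<Rightarrow> real" where
  "frac_const \<alpha> T = T powr \<alpha> / (\<alpha> * Gamma \<alpha>)"

lemma frac_const_nonneg: "\<alpha> > 0 \<Longrightarrow> frac_const \<alpha> T \<ge> 0"
  by (simp add: frac_const_def Gamma_real_pos less_imp_le)

lemma nn_integral_frac_kernel_le:
  assumes \<alpha>: "\<alpha> > 0"
  shows "t \<in> {0<..<T} \<Longrightarrow> (\<integral>\<^sup>+s. ennreal (frac_kernel \<alpha> t s) \<partial>time_measure T) \<le> ennreal (frac_const \<alpha> T)"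
    and "s \<in> {0<..<T} \<Longrightarrow> (\<integral>\<^sup>+t. ennreal (frac_kernel \<alpha> t s) \<partial>time_measure T) \<le> ennreal (frac_const \<alpha> T)"
proof -
  define g where "g x = ennreal (x powr (\<alpha> - 1) / Gamma \<alpha>) * indicator {0..T} x" for x
  have gm: "g \<in> borel_measurable borel" unfolding g_def by measurable
  have gi: "(\<integral>\<^sup>+x. g x \<partial>lborel) = ennreal (frac_const \<alpha> T)" if "T \<ge> 0"
  proof -
    have "((\<lambda>x. x powr (\<alpha> - 1) / Gamma \<alpha>) has_integral (T powr (\<alpha> - 1 + 1) / (\<alpha> - 1 + 1)) / Gamma \<alpha>) {0..T}"
      by (intro has_integral_divide has_integral_powr_from_0) (use \<alpha> that in auto)
    from nn_integral_has_integral_lebesgue'[OF _ this] show ?thesis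
      using \<alpha> by (simp add: g_def frac_const_def Gamma_real_pos less_imp_le)
  qed
  have sub: "(\<integral>\<^sup>+x. g (c + d * x) \<partial>lborel) = (\<integral>\<^sup>+x. g x \<partial>lborel)" if "d = 1 \<or> d = -1" for c d
    using nn_integral_real_affine[OF gm, of d c] that by auto
  have *: "(\<integral>\<^sup>+x. f x \<partial>time_measure T) \<le> ennreal (frac_const \<alpha> T)"
    if T: "T \<ge> 0" and f: "\<And>x. x \<in> {0<..<T} \<Longrightarrow> f x \<le> g (c + d * x)" and d: "d = 1 \<or> d = -1" for f c d
  proof -
    have "(\<integral>\<^sup>+x. f x \<partial>time_measure T) = (\<integral>\<^sup>+x. f x * indicator {0<..<T} x \<partial>lebesgue)"
      by (rule nn_integral_restrict_space) auto
    also have "\<dots> \<le> (\<integral>\<^sup>+x. g (c + d * x) \<partial>lebesgue)"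
      by (rule nn_integral_mono) (use f in \<open>auto simp: indicator_def\<close>)
    also have "\<dots> = ennreal (frac_const \<alpha> T)"
      using sub[OF d] gi[OF T] by (simp add: nn_integral_completion)
    finally show ?thesis .
  qed
  show "(\<integral>\<^sup>+s. ennreal (frac_kernel \<alpha> t s) \<partial>time_measure T) \<le> ennreal (frac_const \<alpha> T)" if "t \<in> {0<..<T}"
    by (rule *[where c=t and d="-1"]) (use that in \<open>auto simp: frac_kernel_def g_def\<close>)
  show "(\<integral>\<^sup>+t. ennreal (frac_kernel \<alpha> t s) \<partial>time_measure T) \<le> ennreal (frac_const \<alpha> T)" if "s \<in> {0<..<T}"
    by (rule *[where c="-s" and d=1]) (use that in \<open>auto simp: frac_kernel_def g_def\<close>)
qed

text \<open>The fractional integral as the integral operator on \<open>(0,T)\<close> with this kernel; the integrands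
  agree for \<open>s \<noteq> 0\<close>, also at \<open>s = t\<close>, as \<open>0 powr (\<alpha> - 1) = 0\<close>.\<close>

lemma frac_int_eq_kernel:
  fixes w :: "real \<Rightarrow> 'z::{banach, second_countable_topology}"
  assumes w: "w \<in> borel_measurable (time_measure T)" and t: "t \<in> {0<..<T}"
  shows "frac_int \<alpha> w t = (LINT s|time_measure T. frac_kernel \<alpha> t s *\<^sub>R w s)"
proof -
  define h where "h s = indicator {0<..<T} s *\<^sub>R (frac_kernel \<alpha> t s *\<^sub>R w s)" for s
  define l where "l s = indicator {0..t} s *\<^sub>R ((t - s) powr (\<alpha> - 1) *\<^sub>R w s)" for s
  have hm: "h \<in> borel_measurable lebesgue"
  proof -
    have "(\<lambda>s. frac_kernel \<alpha> t s *\<^sub>R w s) \<in> borel_measurable (time_measure T)"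
      using w frac_kernel_measurable(1)[of \<alpha> t T] by measurable
    then show ?thesis unfolding h_def by (subst (asm) borel_measurable_restrict_space_iff) auto
  qed
  have eq: "(1 / Gamma \<alpha>) *\<^sub>R l s = h s" if "s \<noteq> 0" for s
    using t that by (auto simp: l_def h_def frac_kernel_def indicator_def)
  have ae: "AE s in lebesgue. s \<noteq> (0::real)"
    using AE_not_in[of "{0::real}" lebesgue] by simp
  have "integral\<^sup>L lebesgue (\<lambda>s. (1 / Gamma \<alpha>) *\<^sub>R l s) = integral\<^sup>L lebesgue h"
  proof (rule integral_cong_AE[OF _ hm])
    have "(\<lambda>s. if s = 0 then (1 / Gamma \<alpha>) *\<^sub>R l 0 else h s) \<in> borel_measurable lebesgue"
      using hm by (intro measurable_If) auto
    also have "(\<lambda>s. if s = 0 then (1 / Gamma \<alpha>) *\<^sub>R l 0 else h s) = (\<lambda>s. (1 / Gamma \<alpha>) *\<^sub>R l s)"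
      using eq by auto
    finally show "(\<lambda>s. (1 / Gamma \<alpha>) *\<^sub>R l s) \<in> borel_measurable lebesgue" .
    show "AE s in lebesgue. (1 / Gamma \<alpha>) *\<^sub>R l s = h s" using ae by eventually_elim (rule eq)
  qed
  then show ?thesis
    unfolding frac_int_def set_lebesgue_integral_def l_def[symmetric]
    by (subst integral_restrict_space) (auto simp: h_def[abs_def])
qed

text \<open>Young's inequality for the convolution kernel: integrate over \<open>t\<close> first.\<close>

lemma frac_young:
  assumes \<alpha>: "\<alpha> > 0" and \<phi>[measurable]: "\<phi> \<in> borel_measurable (time_measure T)"
  shows "(\<integral>\<^sup>+t. \<integral>\<^sup>+s. ennreal (frac_kernel \<alpha> t s) * \<phi> s \<partial>time_measure T \<partial>time_measure T)
     \<le> ennreal (frac_const \<alpha> T) * (\<integral>\<^sup>+s. \<phi> s \<partial>time_measure T)"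
proof -
  interpret pair_sigma_finite "time_measure T" "time_measure T"
    by (simp add: pair_sigma_finite_def sigma_finite_time)
  note frac_kernel_measurable2[measurable] frac_kernel_measurable[measurable]
  have "(\<integral>\<^sup>+t. \<integral>\<^sup>+s. ennreal (frac_kernel \<alpha> t s) * \<phi> s \<partial>time_measure T \<partial>time_measure T)
     = (\<integral>\<^sup>+s. \<integral>\<^sup>+t. ennreal (frac_kernel \<alpha> t s) * \<phi> s \<partial>time_measure T \<partial>time_measure T)"
    by (rule Fubini'[symmetric]) measurable
  also have "\<dots> = (\<integral>\<^sup>+s. (\<integral>\<^sup>+t. ennreal (frac_kernel \<alpha> t s) \<partial>time_measure T) * \<phi> s \<partial>time_measure T)"
    by (intro nn_integral_cong nn_integral_multc) measurable
  also have "\<dots> \<le> (\<integral>\<^sup>+s. ennreal (frac_const \<alpha> T) * \<phi> s \<partial>time_measure T)"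
    by (intro nn_integral_mono mult_right_mono nn_integral_frac_kernel_le(2)[OF \<alpha>]) auto
  also have "\<dots> = ennreal (frac_const \<alpha> T) * (\<integral>\<^sup>+s. \<phi> s \<partial>time_measure T)"
    by (rule nn_integral_cmult) measurable
  finally show ?thesis .
qed

lemma AE_integrable_frac_kernel:
  assumes \<alpha>: "\<alpha> > 0" and w: "sq_norm_integrable T w"
  shows "AE t in time_measure T. integrable (time_measure T) (\<lambda>s. frac_kernel \<alpha> t s *\<^sub>R w s)"
proof -
  interpret M: sigma_finite_measure "time_measure T" by (rule sigma_finite_time)
  note frac_kernel_measurable2[measurable] frac_kernel_measurable[measurable]
  have wm[measurable]: "w \<in> borel_measurable (time_measure T)" using w by (simp add: sq_norm_integrable_def)
  have "(\<integral>\<^sup>+t. \<integral>\<^sup>+s. ennreal (frac_kernel \<alpha> t s) * ennreal (norm (w s)) \<partial>time_measure T \<partial>time_measure T)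
     \<le> ennreal (frac_const \<alpha> T) * (\<integral>\<^sup>+s. ennreal (norm (w s)) \<partial>time_measure T)"
    by (rule frac_young[OF \<alpha>]) measurable
  also have "\<dots> < \<infinity>"
    using sq_norm_integrable_imp_integrable[OF w] by (auto simp: integrable_iff_bounded ennreal_mult_less_top)
  finally have "AE t in time_measure T. (\<integral>\<^sup>+s. ennreal (frac_kernel \<alpha> t s) * ennreal (norm (w s)) \<partial>time_measure T) \<noteq> \<infinity>"
    by (intro nn_integral_PInf_AE) auto
  then show ?thesis
  proof eventually_elim
    case (elim t)
    show ?case
    proof (rule integrableI_bounded)
      have "(\<integral>\<^sup>+s. ennreal (norm (frac_kernel \<alpha> t s *\<^sub>R w s)) \<partial>time_measure T) = (\<integral>\<^sup>+s. ennreal (frac_kernel \<alpha> t s) * ennreal (norm (w s)) \<partial>time_measure T)"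
        using frac_kernel_nonneg[OF \<alpha>] by (simp add: ennreal_mult)
      then show "(\<integral>\<^sup>+s. ennreal (norm (frac_kernel \<alpha> t s *\<^sub>R w s)) \<partial>time_measure T) < \<infinity>"
        using elim by (simp add: less_top)
    qed measurable
  qed
qed

lemma frac_int_measurable:
  fixes w :: "real \<Rightarrow> 'z::{banach, second_countable_topology}"
  assumes wm[measurable]: "w \<in> borel_measurable (time_measure T)"
  shows "frac_int \<alpha> w \<in> borel_measurable (time_measure T)"
proof -
  interpret M: sigma_finite_measure "time_measure T" by (rule sigma_finite_time)
  note frac_kernel_measurable2[measurable]
  have "(\<lambda>t. LINT s|time_measure T. frac_kernel \<alpha> t s *\<^sub>R w s) \<in> borel_measurable (time_measure T)"
    by measurable
  then show ?thesis
    by (rule measurable_cong[THEN iffD1, rotated]) (simp add: frac_int_eq_kernel[OF wm])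
qed

text \<open>The Cauchy and Schwarz inequality with respect to the measure with density the kernel bounds the square of
  the integral by an integral of squares, to which Young's inequality applies.\<close>

lemma sq_norm_integrable_frac_int:
  fixes w :: "real \<Rightarrow> 'z::{banach, second_countable_topology}"
  assumes \<alpha>: "\<alpha> > 0" and w: "sq_norm_integrable T w"
  shows "sq_norm_integrable T (frac_int \<alpha> w)"
    and "sq_dist T (frac_int \<alpha> w) (\<lambda>t. 0) \<le> (frac_const \<alpha> T)\<^sup>2 * sq_dist T w (\<lambda>t. 0)"
proof -
  note frac_kernel_measurable2[measurable] frac_kernel_measurable[measurable]
  have wm[measurable]: "w \<in> borel_measurable (time_measure T)" using w by (simp add: sq_norm_integrable_def)
  let ?C = "frac_const \<alpha> T"
  have pt: "ennreal ((norm (frac_int \<alpha> w t))\<^sup>2) \<le> ennreal ?C * (\<integral>\<^sup>+s. ennreal (frac_kernel \<alpha> t s) * ennreal ((norm (w s))\<^sup>2) \<partial>time_measure T)"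
    if t: "t \<in> {0<..<T}" for t
  proof -
    \<comment> \<open>split the kernel evenly between the two factors of the Cauchy and Schwarz inequality\<close>
    define k where "k s = ennreal (sqrt (frac_kernel \<alpha> t s))" for s
    have k2: "k s ^ 2 = ennreal (frac_kernel \<alpha> t s)" for s
      using frac_kernel_nonneg[OF \<alpha>] by (simp add: k_def ennreal_power)
    have km[measurable]: "k \<in> borel_measurable (time_measure T)" unfolding k_def by measurable
    have "ennreal (norm (frac_int \<alpha> w t)) \<le> (\<integral>\<^sup>+s. ennreal (norm (frac_kernel \<alpha> t s *\<^sub>R w s)) \<partial>time_measure T)"
    proof (cases "integrable (time_measure T) (\<lambda>s. frac_kernel \<alpha> t s *\<^sub>R w s)")
      case True
      then show ?thesis unfolding frac_int_eq_kernel[OF wm t] by (rule integral_norm_bound_ennreal)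
    qed (simp add: frac_int_eq_kernel[OF wm t] not_integrable_integral_eq)
    also have "\<dots> = (\<integral>\<^sup>+s. k s * (k s * ennreal (norm (w s))) \<partial>time_measure T)"
      using frac_kernel_nonneg[OF \<alpha>]
      by (intro nn_integral_cong) (simp add: ennreal_mult k2[symmetric] power2_eq_square mult.assoc)
    finally have "(ennreal (norm (frac_int \<alpha> w t)))\<^sup>2 \<le> (\<integral>\<^sup>+s. k s * (k s * ennreal (norm (w s))) \<partial>time_measure T)\<^sup>2"
      by (rule power_mono) simp
    also have "\<dots> \<le> (\<integral>\<^sup>+s. (k s)\<^sup>2 \<partial>time_measure T) * (\<integral>\<^sup>+s. (k s * ennreal (norm (w s)))\<^sup>2 \<partial>time_measure T)"
      by (rule Cauchy_Schwarz_nn_integral) measurable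
    also have "\<dots> \<le> ennreal ?C * (\<integral>\<^sup>+s. ennreal (frac_kernel \<alpha> t s) * ennreal ((norm (w s))\<^sup>2) \<partial>time_measure T)"
      using nn_integral_frac_kernel_le(1)[OF \<alpha> t]
      by (intro mult_mono) (simp_all add: power_mult_distrib k2 ennreal_power)
    finally show ?thesis by (simp add: ennreal_power)
  qed
  have fin: "(\<integral>\<^sup>+t. ennreal ((norm (w t))\<^sup>2) \<partial>time_measure T) = ennreal (sq_dist T w (\<lambda>t. 0))"
    unfolding sq_dist_def using w by (subst nn_integral_eq_integral) (auto simp: sq_norm_integrable_def)
  have "(\<integral>\<^sup>+t. ennreal ((norm (frac_int \<alpha> w t))\<^sup>2) \<partial>time_measure T)
     \<le> (\<integral>\<^sup>+t. ennreal ?C * (\<integral>\<^sup>+s. ennreal (frac_kernel \<alpha> t s) * ennreal ((norm (w s))\<^sup>2) \<partial>time_measure T) \<partial>time_measure T)"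
    by (rule nn_integral_mono) (use pt in auto)
  also have "\<dots> = ennreal ?C * (\<integral>\<^sup>+t. \<integral>\<^sup>+s. ennreal (frac_kernel \<alpha> t s) * ennreal ((norm (w s))\<^sup>2) \<partial>time_measure T \<partial>time_measure T)"
  proof (rule nn_integral_cmult)
    interpret M: sigma_finite_measure "time_measure T" by (rule sigma_finite_time)
    show "(\<lambda>t. \<integral>\<^sup>+s. ennreal (frac_kernel \<alpha> t s) * ennreal ((norm (w s))\<^sup>2) \<partial>time_measure T) \<in> borel_measurable (time_measure T)"
      by measurable
  qed
  also have "\<dots> \<le> ennreal ?C * (ennreal ?C * (\<integral>\<^sup>+s. ennreal ((norm (w s))\<^sup>2) \<partial>time_measure T))"
    by (intro mult_left_mono frac_young[OF \<alpha>]) measurable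
  also have "\<dots> = ennreal (?C\<^sup>2 * sq_dist T w (\<lambda>t. 0))"
    unfolding fin using frac_const_nonneg[OF \<alpha>]
    by (simp add: ennreal_mult[symmetric] sq_dist_nonneg power2_eq_square mult.assoc)
  finally have bd: "(\<integral>\<^sup>+t. ennreal ((norm (frac_int \<alpha> w t))\<^sup>2) \<partial>time_measure T) \<le> ennreal (?C\<^sup>2 * sq_dist T w (\<lambda>t. 0))" .
  have fm[measurable]: "frac_int \<alpha> w \<in> borel_measurable (time_measure T)" by (rule frac_int_measurable[OF wm])
  show sq: "sq_norm_integrable T (frac_int \<alpha> w)"
    unfolding sq_norm_integrable_def
    by (intro conjI fm integrableI_bounded) (use bd in \<open>auto intro: le_less_trans\<close>)
  have "ennreal (sq_dist T (frac_int \<alpha> w) (\<lambda>t. 0)) \<le> ennreal (?C\<^sup>2 * sq_dist T w (\<lambda>t. 0))"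
    using bd sq unfolding sq_dist_def
    by (subst nn_integral_eq_integral[symmetric]) (auto simp: sq_norm_integrable_def)
  then show "sq_dist T (frac_int \<alpha> w) (\<lambda>t. 0) \<le> ?C\<^sup>2 * sq_dist T w (\<lambda>t. 0)"
    by (simp add: sq_dist_nonneg)
qed

lemma frac_int_add:
  assumes \<alpha>: "\<alpha> > 0" and v: "sq_norm_integrable T v" and w: "sq_norm_integrable T w"
  shows "AE t in time_measure T. frac_int \<alpha> (\<lambda>s. v s + w s) t = frac_int \<alpha> v t + frac_int \<alpha> w t"
  using AE_integrable_frac_kernel[OF \<alpha> v] AE_integrable_frac_kernel[OF \<alpha> w] AE_space
proof eventually_elim
  case (elim t)
  have "v \<in> borel_measurable (time_measure T)" "w \<in> borel_measurable (time_measure T)"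
    using v w by (auto simp: sq_norm_integrable_def)
  moreover from this have "(\<lambda>s. v s + w s) \<in> borel_measurable (time_measure T)" by measurable
  ultimately show ?case using elim by (simp add: frac_int_eq_kernel[of _ T] scaleR_add_right)
qed

lemma frac_int_scaleR:
  fixes w :: "real \<Rightarrow> 'z::{banach, second_countable_topology}"
  shows "frac_int \<alpha> (\<lambda>s. r *\<^sub>R w s) t = r *\<^sub>R frac_int \<alpha> w t"
proof -
  have "(LINT s:{0..t}|lebesgue. (t - s) powr (\<alpha> - 1) *\<^sub>R r *\<^sub>R w s) = r *\<^sub>R (LINT s:{0..t}|lebesgue. (t - s) powr (\<alpha> - 1) *\<^sub>R w s)"
    unfolding set_lebesgue_integral_def
    by (subst Bochner_Integration.integral_scaleR_right[symmetric]) (simp add: mult_ac)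
  then show ?thesis by (simp add: frac_int_def)
qed

lemma frac_int_diff:
  assumes \<alpha>: "\<alpha> > 0" and v: "sq_norm_integrable T v" and w: "sq_norm_integrable T w"
  shows "AE t in time_measure T. frac_int \<alpha> (\<lambda>s. v s - w s) t = frac_int \<alpha> v t - frac_int \<alpha> w t"
proof -
  have "(\<lambda>s. v s + (-1) *\<^sub>R w s) = (\<lambda>s. v s - w s)" by simp
  then show ?thesis
    using frac_int_add[OF \<alpha> v sq_norm_integrable_scaleR[OF w, of "-1"]]
    unfolding frac_int_scaleR by (simp only:) simp
qed

lemma frac_int_cong_AE:
  assumes "v \<in> borel_measurable (time_measure T)" "w \<in> borel_measurable (time_measure T)"
    "AE t in time_measure T. v t = w t" "t \<in> {0<..<T}"
  shows "frac_int \<alpha> v t = frac_int \<alpha> w t"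
  unfolding frac_int_eq_kernel[OF assms(1,4)] frac_int_eq_kernel[OF assms(2,4)]
proof (rule integral_cong_AE)
  show "AE s in time_measure T. frac_kernel \<alpha> t s *\<^sub>R v s = frac_kernel \<alpha> t s *\<^sub>R w s"
    using assms(3) by eventually_elim simp
qed (use assms frac_kernel_measurable(1) in \<open>auto intro!: borel_measurable_scaleR\<close>)

lemma frac_int_bounded_linear:
  assumes P: "bounded_linear P" and \<alpha>: "\<alpha> > 0" and w: "sq_norm_integrable T w"
  shows "AE t in time_measure T. frac_int \<alpha> (\<lambda>s. P (w s)) t = P (frac_int \<alpha> w t)"
  using AE_integrable_frac_kernel[OF \<alpha> w] AE_space
proof eventually_elim
  case (elim t)
  interpret P: bounded_linear P by (rule P)
  have wm: "w \<in> borel_measurable (time_measure T)" using w by (simp add: sq_norm_integrable_def)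
  have "P \<in> borel_measurable borel"
    by (intro borel_measurable_continuous_onI linear_continuous_on P)
  from measurable_compose[OF wm this] have Pm: "(\<lambda>s. P (w s)) \<in> borel_measurable (time_measure T)" .
  have t: "t \<in> {0<..<T}" using elim by simp
  show ?case
    unfolding frac_int_eq_kernel[OF Pm t] frac_int_eq_kernel[OF wm t]
    using integral_bounded_linear[OF P elim(1)] by (simp add: P.scaleR)
qed

lemma frac_int_in_subspace:
  assumes V: "subspace V" "closed V" and w: "w \<in> borel_measurable (time_measure T)" "\<And>s. w s \<in> V"
    and t: "t \<in> {0<..<T}"
  shows "frac_int \<alpha> w t \<in> V"
proof (cases "integrable (time_measure T) (\<lambda>s. frac_kernel \<alpha> t s *\<^sub>R w s)")
  case True
  show ?thesis unfolding frac_int_eq_kernel[OF w(1) t]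
    by (rule integral_in_closed_subspace[OF V True]) (intro subspace_scale[OF V(1)] w(2))
qed (simp add: frac_int_eq_kernel[OF w(1) t] not_integrable_integral_eq subspace_0[OF V(1)])

section \<open>The range of the fractional integral is dense\<close>

text \<open>Beta integral, after scaling \<open>s\<close> by \<open>t\<close>.\<close>

lemma frac_int_power:
  assumes \<alpha>: "\<alpha> > 0"
  obtains c where "c > 0" "\<And>t. t > 0 \<Longrightarrow> frac_int \<alpha> (\<lambda>s. s ^ m) t = c * (t powr \<alpha> * t ^ m)"
proof -
  define B where "B = Beta (real m + 1) \<alpha>"
  have B: "B > 0" unfolding B_def Beta_def using \<alpha> by (intro divide_pos_pos mult_pos_pos Gamma_real_pos) auto
  have G: "Gamma \<alpha> > 0" by (rule Gamma_real_pos[OF \<alpha>])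
  show ?thesis
  proof (rule that[of "B / Gamma \<alpha>"])
    show "B / Gamma \<alpha> > 0" using B G by simp
    fix t :: real assume t: "t > 0"
    define f where "f x = x powr (real m + 1 - 1) * (1 - x) powr (\<alpha> - 1)" for x :: real
    have "(f has_integral B) {0..1}"
      unfolding f_def B_def by (rule has_integral_Beta_real) (use \<alpha> in auto)
    from has_integral_stretch_real[OF this, of "1 / t"] t
    have "((\<lambda>s. f (1 / t * s)) has_integral t * B) ((\<lambda>x. x / (1 / t)) ` {0..1})" by simp
    also have "(\<lambda>x. x / (1 / t)) ` {0..1} = {0..t}"
      using t image_mult_atLeastAtMost[of t 0 1] by (simp add: mult.commute)
    finally have "((\<lambda>s. (t powr (\<alpha> - 1) * t ^ m) * f (1 / t * s)) has_integral (t powr (\<alpha> - 1) * t ^ m) * (t * B)) {0..t}"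
      by (rule has_integral_mult_right)
    then have I: "((\<lambda>s. (t - s) powr (\<alpha> - 1) * s ^ m) has_integral (t powr (\<alpha> - 1) * t ^ m) * (t * B)) {0..t}"
    proof (rule has_integral_spike_finite[where S="{0}", rotated -1])
      fix s assume s: "s \<in> {0..t} - {0}"
      then have "1 - 1 / t * s = (t - s) / t" using t by (simp add: field_simps)
      moreover have "(s / t) powr real m = s ^ m / t ^ m" using s t by (simp add: powr_realpow power_divide)
      ultimately show "(t - s) powr (\<alpha> - 1) * s ^ m = (t powr (\<alpha> - 1) * t ^ m) * f (1 / t * s)"
        using s t by (simp add: f_def powr_divide)
    qed simp
    have "(LINT s:{0..t}|lebesgue. (t - s) powr (\<alpha> - 1) * s ^ m) = (t powr (\<alpha> - 1) * t ^ m) * (t * B)"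
    proof -
      have "(\<lambda>s. (t - s) powr (\<alpha> - 1) * s ^ m) absolutely_integrable_on {0..t}"
        by (rule nonnegative_absolutely_integrable_1) (use I in \<open>auto simp: integrable_on_def\<close>)
      from set_lebesgue_integral_eq_integral(2)[OF this] integral_unique[OF I] show ?thesis by simp
    qed
    moreover have "t powr (\<alpha> - 1) * t = t powr \<alpha>" using t by (simp add: powr_diff)
    ultimately show "frac_int \<alpha> (\<lambda>s. s ^ m) t = B / Gamma \<alpha> * (t powr \<alpha> * t ^ m)"
      by (simp add: frac_int_def mult_ac)
  qed
qed

lemma time_identity_measurable: "(\<lambda>x::real. x) \<in> borel_measurable (time_measure T)"
  by (intro measurable_restrict_space1 measurable_completion) simp

lemma sq_norm_integrable_power: "sq_norm_integrable T (\<lambda>t::real. c * t ^ m)"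
proof (rule bounded_sq_norm_integrable)
  note time_identity_measurable[measurable]
  show "(\<lambda>t. c * t ^ m) \<in> borel_measurable (time_measure T)" by measurable
  show "norm (c * t ^ m) \<le> \<bar>c\<bar> * T ^ m" if "t \<in> {0<..<T}" for t
    using that by (auto simp: abs_mult power_abs intro!: mult_left_mono power_mono)
qed

text \<open>The fractional integral maps polynomials onto the multiples of \<open>t powr \<alpha>\<close> by polynomials, and those are
  dense.\<close>

lemma frac_int_polynomial:
  assumes \<alpha>: "\<alpha> > 0" and q: "real_polynomial_function q"
  shows "\<exists>p. sq_norm_integrable T p \<and> (AE t in time_measure T. frac_int \<alpha> p t = t powr \<alpha> * q t)"
proof -
  obtain a n where q: "q = (\<lambda>x. \<Sum>i\<le>n. a i * x ^ i)" using q unfolding real_polynomial_function_iff_sum by blast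
  have "\<exists>c>0. \<forall>t>0. frac_int \<alpha> (\<lambda>s. s ^ m) t = c * (t powr \<alpha> * t ^ m)" for m
    using frac_int_power[OF \<alpha>] by metis
  then obtain c where c: "\<And>m. c m > 0" "\<And>m t. t > 0 \<Longrightarrow> frac_int \<alpha> (\<lambda>s. s ^ m) t = c m * (t powr \<alpha> * t ^ m)" by metis
  have mono: "frac_int \<alpha> (\<lambda>s. a i / c i * s ^ i) t = t powr \<alpha> * (a i * t ^ i)" if "t > 0" for i t
    using frac_int_scaleR[of \<alpha> "a i / c i" "\<lambda>s. s ^ i" t] c(1)[of i] c(2)[OF that, of i] by simp
  have "sq_norm_integrable T (\<lambda>s. \<Sum>i\<le>k. a i / c i * s ^ i) \<and>
    (AE t in time_measure T. frac_int \<alpha> (\<lambda>s. \<Sum>i\<le>k. a i / c i * s ^ i) t = t powr \<alpha> * (\<Sum>i\<le>k. a i * t ^ i))" for k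
  proof (induction k)
    case 0
    show ?case
      using mono[of _ 0] sq_norm_integrable_power[of T "a 0 / c 0" 0] by (auto intro!: AE_I2)
  next
    case (Suc k)
    have s: "sq_norm_integrable T (\<lambda>s. a (Suc k) / c (Suc k) * s ^ Suc k)" by (rule sq_norm_integrable_power)
    have "AE t in time_measure T. frac_int \<alpha> (\<lambda>s. (\<Sum>i\<le>k. a i / c i * s ^ i) + a (Suc k) / c (Suc k) * s ^ Suc k) t
        = t powr \<alpha> * ((\<Sum>i\<le>k. a i * t ^ i) + a (Suc k) * t ^ Suc k)"
      using frac_int_add[OF \<alpha> conjunct1[OF Suc] s] conjunct2[OF Suc] AE_space
    proof eventually_elim
      case (elim t)
      have "t > 0" using elim by simp
      then show ?case unfolding elim(1) elim(2) mono[OF \<open>t > 0\<close>] by (simp add: distrib_left)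
    qed
    then show ?case using sq_norm_integrable_add[OF conjunct1[OF Suc] s] by simp
  qed
  then show ?thesis unfolding q by blast
qed

text \<open>Membership in the closure of the range of the fractional integral. Density is proved by showing that
  this property is preserved by sums and limits and holds for indicator functions times vectors.\<close>

definition frac_approximable ::
    "real \<Rightarrow> real \<Rightarrow> 'z::{banach, second_countable_topology} set \<Rightarrow> (real \<Rightarrow> 'z) \<Rightarrow> bool" where
  "frac_approximable \<alpha> T V z \<longleftrightarrow> sq_norm_integrable T z \<and>
     (\<forall>e>0. \<exists>y\<in>valued_in T V. sq_dist T (frac_int \<alpha> y) z < e)"

lemma frac_approximable_limit:
  assumes \<alpha>: "\<alpha> > 0" and s: "\<And>n::nat. frac_approximable \<alpha> T V (s n)" and z: "sq_norm_integrable T z"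
    and lim: "(\<lambda>n. sq_dist T (s n) z) \<longlonglongrightarrow> 0"
  shows "frac_approximable \<alpha> T V z"
  unfolding frac_approximable_def
proof (intro conjI z allI impI)
  fix e :: real assume e: "e > 0"
  have "\<forall>\<^sub>F n in sequentially. sq_dist T (s n) z < e / 4" using lim e by (intro order_tendstoD) auto
  then obtain n where n: "sq_dist T (s n) z < e / 4" by (auto simp: eventually_sequentially)
  have "e / 4 > 0" using e by simp
  then obtain y where y: "y \<in> valued_in T V" "sq_dist T (frac_int \<alpha> y) (s n) < e / 4"
    using s[of n] unfolding frac_approximable_def by blast
  have "sq_dist T (frac_int \<alpha> y) z \<le> 2 * sq_dist T (frac_int \<alpha> y) (s n) + 2 * sq_dist T (s n) z"
    using y(1) s[of n] z
    by (intro sq_dist_triangle sq_norm_integrable_frac_int[OF \<alpha>]) (auto simp: valued_in_def frac_approximable_def)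
  also have "\<dots> < e" using n y by simp
  finally show "\<exists>y\<in>valued_in T V. sq_dist T (frac_int \<alpha> y) z < e" using y(1) by blast
qed

lemma sq_dist_add_le:
  assumes "sq_norm_integrable T u" "sq_norm_integrable T u'" "sq_norm_integrable T v" "sq_norm_integrable T v'"
  shows "sq_dist T (\<lambda>t. u t + v t) (\<lambda>t. u' t + v' t) \<le> 2 * sq_dist T u u' + 2 * sq_dist T v v'"
proof -
  have i: "integrable (time_measure T) (\<lambda>t. (norm (x t - y t))\<^sup>2)"
    if "sq_norm_integrable T x" "sq_norm_integrable T y" for x y :: "real \<Rightarrow> 'a"
    using sq_norm_integrable_diff[OF that] by (simp add: sq_norm_integrable_def)
  have "sq_dist T (\<lambda>t. u t + v t) (\<lambda>t. u' t + v' t)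
    \<le> (LINT t|time_measure T. 2 * (norm (u t - u' t))\<^sup>2 + 2 * (norm (v t - v' t))\<^sup>2)"
    unfolding sq_dist_def
  proof (rule integral_mono)
    show "(norm (u t + v t - (u' t + v' t)))\<^sup>2 \<le> 2 * (norm (u t - u' t))\<^sup>2 + 2 * (norm (v t - v' t))\<^sup>2" for t
      using norm_add_sq_le[of "u t - u' t" "v t - v' t"] by (simp add: algebra_simps)
    show "integrable (time_measure T) (\<lambda>t. (norm (u t + v t - (u' t + v' t)))\<^sup>2)"
      by (intro i sq_norm_integrable_add assms)
    show "integrable (time_measure T) (\<lambda>t. 2 * (norm (u t - u' t))\<^sup>2 + 2 * (norm (v t - v' t))\<^sup>2)"
      using i assms by auto
  qed
  also have "\<dots> = 2 * sq_dist T u u' + 2 * sq_dist T v v'" using i assms by (simp add: sq_dist_def)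
  finally show ?thesis .
qed

lemma valued_in_add:
  "subspace V \<Longrightarrow> v \<in> valued_in T V \<Longrightarrow> w \<in> valued_in T V \<Longrightarrow> (\<lambda>t. v t + w t) \<in> valued_in T V"
  by (simp add: valued_in_def sq_norm_integrable_add subspace_add)

lemma frac_approximable_add:
  assumes \<alpha>: "\<alpha> > 0" and V: "subspace V" and v: "frac_approximable \<alpha> T V v" and w: "frac_approximable \<alpha> T V w"
  shows "frac_approximable \<alpha> T V (\<lambda>t. v t + w t)"
  unfolding frac_approximable_def
proof (intro conjI allI impI)
  have sq: "sq_norm_integrable T v" "sq_norm_integrable T w" using v w by (auto simp: frac_approximable_def)
  then show "sq_norm_integrable T (\<lambda>t. v t + w t)" by (rule sq_norm_integrable_add)
  fix e :: real assume "e > 0"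
  then have e4: "e / 4 > 0" by simp
  obtain x where x: "x \<in> valued_in T V" "sq_dist T (frac_int \<alpha> x) v < e / 4"
    using v e4 unfolding frac_approximable_def by blast
  obtain y where y: "y \<in> valued_in T V" "sq_dist T (frac_int \<alpha> y) w < e / 4"
    using w e4 unfolding frac_approximable_def by blast
  have sx: "sq_norm_integrable T x" "sq_norm_integrable T y" using x y by (auto simp: valued_in_def)
  note J = sq_norm_integrable_frac_int(1)[OF \<alpha>]
  have "sq_dist T (frac_int \<alpha> (\<lambda>t. x t + y t)) (\<lambda>t. v t + w t)
      = sq_dist T (\<lambda>t. frac_int \<alpha> x t + frac_int \<alpha> y t) (\<lambda>t. v t + w t)"
    by (rule sq_dist_cong_AE[OF frac_int_add[OF \<alpha> sx]])
      (auto intro!: J sq_norm_integrable_add sx sq)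
  also have "\<dots> \<le> 2 * sq_dist T (frac_int \<alpha> x) v + 2 * sq_dist T (frac_int \<alpha> y) w"
    by (intro sq_dist_add_le J sx sq)
  also have "\<dots> < e" using x y by simp
  finally show "\<exists>y\<in>valued_in T V. sq_dist T (frac_int \<alpha> y) (\<lambda>t. v t + w t) < e"
    using valued_in_add[OF V x(1) y(1)] by blast
qed

lemma frac_approximable_zero:
  assumes "subspace V"
  shows "frac_approximable \<alpha> T V (\<lambda>t. 0)"
proof -
  have "sq_dist T (frac_int \<alpha> (\<lambda>t. 0)) (\<lambda>t. 0 :: 'a) = 0"
    by (simp add: sq_dist_def frac_int_def set_lebesgue_integral_def)
  then show ?thesis
    unfolding frac_approximable_def
    by (intro conjI allI impI bexI[of _ "\<lambda>t. 0"])
      (auto simp: sq_norm_integrable_zero valued_in_def subspace_0[OF assms])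
qed

lemma frac_approximable_scaled_vector:
  fixes g :: "real \<Rightarrow> real" and d :: "'z::{banach, second_countable_topology}"
  assumes \<alpha>: "\<alpha> > 0" and V: "subspace V" "d \<in> V" and g: "frac_approximable \<alpha> T UNIV g"
  shows "frac_approximable \<alpha> T V (\<lambda>t. g t *\<^sub>R d)"
  unfolding frac_approximable_def
proof (intro conjI allI impI)
  have bl: "bounded_linear (\<lambda>r::real. r *\<^sub>R d)" by (rule bounded_linear_scaleR_left)
  have sq: "sq_norm_integrable T (\<lambda>t. p t *\<^sub>R d)" if "sq_norm_integrable T p" for p :: "real \<Rightarrow> real"
    unfolding sq_norm_integrable_def using that by (auto simp: sq_norm_integrable_def power_mult_distrib)
  have sg: "sq_norm_integrable T g" using g by (simp add: frac_approximable_def)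
  then show "sq_norm_integrable T (\<lambda>t. g t *\<^sub>R d)" by (rule sq)
  fix e :: real assume e: "e > 0"
  have "e / ((norm d)\<^sup>2 + 1) > 0" using e by (simp add: add_nonneg_pos)
  then obtain p where p: "p \<in> valued_in T UNIV" "sq_dist T (frac_int \<alpha> p) g < e / ((norm d)\<^sup>2 + 1)"
    using g unfolding frac_approximable_def by blast
  have sp: "sq_norm_integrable T p" using p by (simp add: valued_in_def)
  note J = sq_norm_integrable_frac_int(1)[OF \<alpha>]
  have "sq_dist T (frac_int \<alpha> (\<lambda>t. p t *\<^sub>R d)) (\<lambda>t. g t *\<^sub>R d) = sq_dist T (\<lambda>t. frac_int \<alpha> p t *\<^sub>R d) (\<lambda>t. g t *\<^sub>R d)"
    by (rule sq_dist_cong_AE[OF frac_int_bounded_linear[OF bl \<alpha> sp]]) (auto intro!: J sq sp sg)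
  also have "\<dots> = (norm d)\<^sup>2 * sq_dist T (frac_int \<alpha> p) g"
    by (simp add: sq_dist_def scaleR_diff_left[symmetric] power_mult_distrib mult.commute)
  also have "\<dots> \<le> ((norm d)\<^sup>2 + 1) * sq_dist T (frac_int \<alpha> p) g"
    by (intro mult_right_mono sq_dist_nonneg) simp
  also have "\<dots> < e" using p(2) by (simp add: pos_less_divide_eq add_nonneg_pos mult.commute)
  finally show "\<exists>y\<in>valued_in T V. sq_dist T (frac_int \<alpha> y) (\<lambda>t. g t *\<^sub>R d) < e"
    using sq[OF sp] V by (intro bexI[of _ "\<lambda>t. p t *\<^sub>R d"]) (auto simp: valued_in_def subspace_scale)
qed

text \<open>Away from \<open>0\<close> one may divide by \<open>t powr \<alpha>\<close> and approximate the quotient by polynomials.\<close>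

lemma frac_approximable_away_from_zero:
  fixes f :: "real \<Rightarrow> real"
  assumes \<alpha>: "\<alpha> > 0" and f: "f \<in> borel_measurable lebesgue" "\<And>t. \<bar>f t\<bar> \<le> 1" "\<And>t. t < \<delta> \<Longrightarrow> f t = 0" and \<delta>: "\<delta> > 0"
    and T: "T > 0"
  shows "frac_approximable \<alpha> T UNIV f"
proof -
  have [measurable]: "(\<lambda>x::real. x) \<in> borel_measurable lebesgue" by (intro measurable_completion) simp
  define g where "g t = f t / t powr \<alpha>" for t
  define D where "D = 1 / \<delta> powr \<alpha>"
  have gB: "\<bar>g t\<bar> \<le> D" for t
  proof (cases "t < \<delta>")
    case False
    then have "\<delta> powr \<alpha> \<le> t powr \<alpha>" using \<delta> \<alpha> by (intro powr_mono2) auto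
    then have "\<bar>f t\<bar> / t powr \<alpha> \<le> 1 / \<delta> powr \<alpha>" using f(2)[of t] \<delta> by (intro frac_le) auto
    then show ?thesis by (simp add: g_def D_def)
  qed (simp add: g_def D_def f(3))
  have gm: "g \<in> borel_measurable lebesgue" unfolding g_def using f(1) by measurable
  obtain q where q: "\<And>n::nat. real_polynomial_function (q n)"
    "\<And>n x. x \<in> {0..T} \<Longrightarrow> \<bar>q n x\<bar> \<le> D + 1"
    "AE x in lebesgue. x \<in> {0..T} \<longrightarrow> (\<lambda>n. q n x) \<longlonglongrightarrow> g x"
    by (rule bounded_measurable_polynomial_approx[OF gm gB compact_Icc[of 0 T]]) (rule that)
  have "\<exists>p. sq_norm_integrable T p \<and> (AE t in time_measure T. frac_int \<alpha> p t = t powr \<alpha> * q n t)" for n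
    by (rule frac_int_polynomial[OF \<alpha> q(1)])
  then obtain p where p: "\<And>n. sq_norm_integrable T (p n)"
    "\<And>n. AE t in time_measure T. frac_int \<alpha> (p n) t = t powr \<alpha> * q n t" by metis
  have fm: "f \<in> borel_measurable (time_measure T)" using f(1) by (rule measurable_restrict_space1)
  note J = sq_norm_integrable_frac_int(1)[OF \<alpha> p(1)]
  have lim: "(\<lambda>n. sq_dist T (frac_int \<alpha> (p n)) f) \<longlonglongrightarrow> 0"
  proof (rule sq_dist_dominated_convergence[where h="\<lambda>t. T powr \<alpha> * (D + 1) + 1"])
    show "frac_int \<alpha> (p n) \<in> borel_measurable (time_measure T)" for n using J by (simp add: sq_norm_integrable_def)
    show "sq_norm_integrable T (\<lambda>t. T powr \<alpha> * (D + 1) + 1 :: real)" by (rule bounded_sq_norm_integrable) auto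
    have "AE t in time_measure T. (\<lambda>n. q n t) \<longlonglongrightarrow> g t"
      using q(3) by (subst AE_restrict_space_iff) auto
    moreover have "AE t in time_measure T. \<forall>n. frac_int \<alpha> (p n) t = t powr \<alpha> * q n t"
      using p(2) by (simp add: AE_all_countable)
    ultimately show "AE t in time_measure T. (\<lambda>n. frac_int \<alpha> (p n) t) \<longlonglongrightarrow> f t"
      using AE_space
    proof eventually_elim
      case (elim t)
      have t: "t > 0" "t < T" using elim(3) by simp_all
      have "(\<lambda>n. t powr \<alpha> * q n t) \<longlonglongrightarrow> t powr \<alpha> * g t" by (intro tendsto_intros elim(1))
      then show ?case using t elim(2) by (simp add: g_def)
    qed
    show "AE t in time_measure T. norm (frac_int \<alpha> (p n) t - f t) \<le> T powr \<alpha> * (D + 1) + 1" for n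
      using p(2)[of n] AE_space
    proof eventually_elim
      case (elim t)
      have t: "t > 0" "t < T" using elim(2) by simp_all
      have "\<bar>q n t\<bar> \<le> D + 1" using q(2)[of t n] t by simp
      then have "\<bar>t powr \<alpha> * q n t\<bar> \<le> T powr \<alpha> * (D + 1)"
        unfolding abs_mult using t \<alpha> by (intro mult_mono) (auto intro!: powr_mono2)
      then show ?case using f(2)[of t] elim(1) by simp
    qed
  qed (rule fm)
  show ?thesis
    unfolding frac_approximable_def
  proof (intro conjI allI impI)
    show "sq_norm_integrable T f" by (rule bounded_sq_norm_integrable[OF fm, of 1]) (use f(2) in auto)
    fix e :: real assume "e > 0"
    then have "\<forall>\<^sub>F n in sequentially. sq_dist T (frac_int \<alpha> (p n)) f < e" using lim by (intro order_tendstoD) auto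
    then show "\<exists>y\<in>valued_in T UNIV. sq_dist T (frac_int \<alpha> y) f < e"
      using p(1) by (auto simp: eventually_sequentially valued_in_def)
  qed
qed

lemma frac_approximable_indicator:
  assumes \<alpha>: "\<alpha> > 0" and T: "T > 0" and E: "E \<in> sets (time_measure T)"
  shows "frac_approximable \<alpha> T UNIV (indicator E :: real \<Rightarrow> real)"
proof (rule frac_approximable_limit[OF \<alpha>])
  have El: "E \<in> sets lebesgue" "E \<subseteq> {0<..<T}" using E by (auto simp: sets_restrict_space)
  define s :: "nat \<Rightarrow> real \<Rightarrow> real" where "s n = indicator (E \<inter> {1 / real (Suc n)..})" for n
  have sm: "E \<inter> {1 / real (Suc n)..} \<in> sets lebesgue" for n using El(1) by auto
  show "frac_approximable \<alpha> T UNIV (s n)" for n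
    by (rule frac_approximable_away_from_zero[OF \<alpha>, of _ "1 / real (Suc n)"])
      (use sm T in \<open>auto simp: s_def indicator_def\<close>)
  have im: "(indicator E :: real \<Rightarrow> real) \<in> borel_measurable (time_measure T)" using E by measurable
  show "sq_norm_integrable T (indicator E :: real \<Rightarrow> real)"
    by (rule bounded_sq_norm_integrable[OF im, of 1]) (auto simp: indicator_def)
  show "(\<lambda>n. sq_dist T (s n) (indicator E)) \<longlonglongrightarrow> 0"
  proof (rule sq_dist_dominated_convergence[where h="\<lambda>t. 1"])
    show "s n \<in> borel_measurable (time_measure T)" for n
      unfolding s_def by (intro measurable_restrict_space1 borel_measurable_indicator sm)
    show "sq_norm_integrable T (\<lambda>t. 1 :: real)" by (rule bounded_sq_norm_integrable) auto
    show "AE t in time_measure T. norm (s n t - indicator E t) \<le> 1" for n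
      by (auto simp: s_def indicator_def)
    show "AE t in time_measure T. (\<lambda>n. s n t) \<longlonglongrightarrow> indicator E t"
    proof (rule AE_I2)
      fix t assume "t \<in> space (time_measure T)"
      then have "t > 0" by simp
      then obtain n where n: "1 / real (Suc n) < t" using nat_approx_posE by blast
      have "s m t = indicator E t" if "m \<ge> n" for m
      proof -
        have "1 / real (Suc m) \<le> 1 / real (Suc n)" using that by (intro frac_le) auto
        then show ?thesis using n by (auto simp: s_def indicator_def)
      qed
      then show "(\<lambda>n. s n t) \<longlonglongrightarrow> indicator E t"
        by (intro tendsto_eventually eventually_sequentiallyI)
    qed
  qed (rule im)
qed

text \<open>Simple functions are finite sums of indicator functions times vectors.\<close>

theorem frac_int_range_dense:
  assumes \<alpha>: "\<alpha> > 0" and T: "T > 0" and V: "subspace V" and z: "z \<in> valued_in T V"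
  shows "frac_approximable \<alpha> T V z"
proof -
  have zm: "z \<in> borel_measurable (time_measure T)" and sz: "sq_norm_integrable T z" and zV: "\<And>t. z t \<in> V"
    using z by (auto simp: valued_in_def sq_norm_integrable_def)
  obtain s where s: "\<And>k::nat. simple_function (time_measure T) (s k)" "\<And>k t. s k t \<in> V"
    "\<And>t. (\<lambda>k. s k t) \<longlonglongrightarrow> z t" "\<And>k t. norm (s k t) \<le> 2 * norm (z t)"
    using simple_function_sequence_in_subspace[OF zm subspace_0[OF V] zV] by metis
  have sm: "s k \<in> borel_measurable (time_measure T)" for k by (rule borel_measurable_simple_function[OF s(1)])
  have simple: "frac_approximable \<alpha> T V (s k)" for k
  proof -
    define Y where "Y = s k ` space (time_measure T)"
    define E where "E y = s k -` {y} \<inter> space (time_measure T)" for y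
    have Y: "finite Y" "Y \<subseteq> V" using s(1)[of k] s(2) by (auto simp: Y_def simple_function_def)
    have Em: "E y \<in> sets (time_measure T)" if "y \<in> Y" for y
      using s(1)[of k] that unfolding E_def Y_def by (auto simp: simple_function_def)
    have fa: "frac_approximable \<alpha> T V (\<lambda>t. \<Sum>y\<in>Z. indicator (E y) t *\<^sub>R y)" if "finite Z" "Z \<subseteq> Y" for Z
      using that
    proof (induction Z rule: finite_induct)
      case empty
      then show ?case by (simp add: frac_approximable_zero[OF V])
    next
      case (insert y Z)
      have "frac_approximable \<alpha> T V (\<lambda>t. indicator (E y) t *\<^sub>R y)"
        using insert Y(2) by (intro frac_approximable_scaled_vector[OF \<alpha> V] frac_approximable_indicator[OF \<alpha> T] Em) auto
      moreover have "frac_approximable \<alpha> T V (\<lambda>t. \<Sum>y\<in>Z. indicator (E y) t *\<^sub>R y)"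
        using insert by blast
      ultimately show ?case unfolding sum.insert[OF insert(1,2)] by (rule frac_approximable_add[OF \<alpha> V])
    qed
    have eq: "s k t = (\<Sum>y\<in>Y. indicator (E y) t *\<^sub>R y)" if "t \<in> space (time_measure T)" for t
    proof -
      have "(\<Sum>y\<in>Y. indicator (E y) t *\<^sub>R y) = (\<Sum>y\<in>Y. if s k t = y then y else 0)"
        using that by (intro sum.cong) (auto simp: E_def indicator_def)
      also have "\<dots> = s k t" using Y(1) that by (auto simp: Y_def)
      finally show ?thesis by simp
    qed
    show ?thesis
    proof (rule frac_approximable_limit[OF \<alpha> fa[OF Y(1) subset_refl]])
      show "sq_norm_integrable T (s k)" by (rule sq_norm_integrable_bound[OF sz sm, of _ 2]) (use s(4) in auto)
      have "sq_dist T (\<lambda>t. \<Sum>y\<in>Y. indicator (E y) t *\<^sub>R y) (s k) = (LINT t|time_measure T. 0)"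
        unfolding sq_dist_def by (rule Bochner_Integration.integral_cong) (simp_all add: eq)
      then show "(\<lambda>n. sq_dist T (\<lambda>t. \<Sum>y\<in>Y. indicator (E y) t *\<^sub>R y) (s k)) \<longlonglongrightarrow> 0" by simp
    qed
  qed
  show ?thesis
  proof (rule frac_approximable_limit[OF \<alpha> simple sz])
    show "(\<lambda>n. sq_dist T (s n) z) \<longlonglongrightarrow> 0"
    proof (rule sq_dist_dominated_convergence[OF sm zm, where h="\<lambda>t. 3 * norm (z t)"])
      show "sq_norm_integrable T (\<lambda>t. 3 * norm (z t))"
        using sz by (auto simp: sq_norm_integrable_def power_mult_distrib)
      have "norm (s n t - z t) \<le> 3 * norm (z t)" for n t
        using norm_triangle_ineq4[of "s n t" "z t"] s(4)[of n t] by linarith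
      then show "AE t in time_measure T. norm (s n t - z t) \<le> 3 * norm (z t)" for n by simp
    qed (use s(3) in auto)
  qed
qed

section \<open>The spaces of negative order\<close>

text \<open>A space \<open>X\<close> of values is modelled by a closed subspace \<open>V\<close> of a Banach space and a bounded linear map \<open>P\<close>
  that maps \<open>V\<close> isometrically onto \<open>X\<close>. Strong measurability and completeness in the norm of \<open>X\<close>, which may
  differ from that of the ambient type, thereby reduce to the Bochner integral in the model.\<close>

locale hspace_model =
  fixes X :: "'h::{banach, second_countable_topology} hspace"
    and V :: "'z::{banach, second_countable_topology} set"
    and P :: "'z \<Rightarrow> 'h" and T \<alpha> :: real
  assumes V_subspace: "subspace V" and V_closed: "closed V" and P_linear: "bounded_linear P"
    and carrier_eq: "hcarrier X = P ` V" and norm_eq: "\<And>z. z \<in> V \<Longrightarrow> hnorm X (P z) = norm z"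
    and T_pos: "T > 0" and \<alpha>_pos: "\<alpha> > 0"
begin

lemmas P_zero = linear_0[OF bounded_linear.linear[OF P_linear]]
  and P_add = linear_add[OF bounded_linear.linear[OF P_linear]]
  and P_diff = linear_diff[OF bounded_linear.linear[OF P_linear]]

lemma zero_in_V: "0 \<in> V" by (rule subspace_0[OF V_subspace])

lemma P_eqD: "z \<in> V \<Longrightarrow> y \<in> V \<Longrightarrow> P z = P y \<Longrightarrow> z = y"
proof -
  assume zy: "z \<in> V" "y \<in> V" "P z = P y"
  have "norm (z - y) = hnorm X (P (z - y))"
    by (rule norm_eq[symmetric]) (intro subspace_diff V_subspace zy)
  also have "P (z - y) = P 0" using zy(3) by (simp add: P_diff P_zero)
  also have "hnorm X (P 0) = norm (0::'z)" by (rule norm_eq[OF zero_in_V])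
  finally show "z = y" by simp
qed

lemma hnorm_diff: "z \<in> V \<Longrightarrow> y \<in> V \<Longrightarrow> hnorm X (P z - P y) = norm (z - y)"
  using norm_eq[of "z - y"] by (simp add: P_diff subspace_diff V_subspace)

lemma P_measurable: "P \<in> borel_measurable borel"
  by (intro borel_measurable_continuous_onI linear_continuous_on P_linear)

text \<open>The lift \<open>z\<close> is square integrable, so this contains the membership of \<open>w\<close> in \<open>L2T\<close>.\<close>

definition repr :: "(real \<Rightarrow> 'h) \<Rightarrow> (real \<Rightarrow> 'z) \<Rightarrow> bool" where
  "repr w z \<longleftrightarrow> z \<in> valued_in T V \<and> (AE t in time_measure T. w t = P (z t))"

lemma repr_measurable:
  assumes "repr w z"
  shows "w \<in> borel_measurable (time_measure T)"
proof (rule measurable_time_AE_cong)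
  show "(\<lambda>t. P (z t)) \<in> borel_measurable (time_measure T)"
    using assms P_measurable by (auto simp: repr_def valued_in_def sq_norm_integrable_def intro: measurable_compose)
  show "AE t in time_measure T. P (z t) = w t" using assms unfolding repr_def by (auto elim: AE_mp)
qed simp

lemma repr_unique: "repr w z \<Longrightarrow> repr w y \<Longrightarrow> AE t in time_measure T. z t = y t"
proof -
  assume a: "repr w z" "repr w y"
  then have "AE t in time_measure T. w t = P (z t)" "AE t in time_measure T. w t = P (y t)" by (auto simp: repr_def)
  then show ?thesis
  proof eventually_elim
    case (elim t)
    then show ?case using a P_eqD[of "z t" "y t"] by (auto simp: repr_def valued_in_def)
  qed
qed

lemma repr_norm:
  assumes "repr w z"
  shows "integrable (time_measure T) (\<lambda>t. (hnorm X (w t))\<^sup>2)"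
    and "L2T_norm T X w = sqrt (LINT t|time_measure T. (norm (z t))\<^sup>2)"
proof -
  have ae: "AE t in time_measure T. (norm (z t))\<^sup>2 = (hnorm X (w t))\<^sup>2"
  proof -
    have "AE t in time_measure T. w t = P (z t)" using assms by (simp add: repr_def)
    then show ?thesis
      by eventually_elim (use assms norm_eq in \<open>simp add: repr_def valued_in_def\<close>)
  qed
  have i: "integrable (time_measure T) (\<lambda>t. (norm (z t))\<^sup>2)"
    using assms by (simp add: repr_def valued_in_def sq_norm_integrable_def)
  have m: "(\<lambda>t. (hnorm X (w t))\<^sup>2) \<in> borel_measurable (time_measure T)"
    by (rule measurable_time_AE_cong[OF _ ae]) (use i in auto)
  show "integrable (time_measure T) (\<lambda>t. (hnorm X (w t))\<^sup>2)"
    using integrable_cong_AE[OF _ m ae] i by auto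
  show "L2T_norm T X w = sqrt (LINT t|time_measure T. (norm (z t))\<^sup>2)"
    unfolding L2T_norm_def using integral_cong_AE[OF _ m ae] i by auto
qed

text \<open>Approximation by simple functions with values in \<open>V\<close> is needed here: strong measurability in \<open>X\<close> asks for
  simple functions with values in the carrier, converging in the norm of \<open>X\<close>.\<close>

lemma repr_imp_L2T:
  assumes "repr w z"
  shows "w \<in> L2T T X"
  unfolding L2T_def
proof (intro CollectI conjI)
  have z: "sq_norm_integrable T z" "\<And>t. z t \<in> V" and ae: "AE t in time_measure T. w t = P (z t)"
    using assms by (auto simp: repr_def valued_in_def)
  show "AE t in time_measure T. w t \<in> hcarrier X"
    using ae by eventually_elim (use z(2) carrier_eq in auto)
  show "integrable (time_measure T) (\<lambda>t. (hnorm X (w t))\<^sup>2)" by (rule repr_norm[OF assms])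
  have zm: "z \<in> borel_measurable (time_measure T)" using z(1) by (simp add: sq_norm_integrable_def)
  obtain s where s: "\<And>k::nat. simple_function (time_measure T) (s k)" "\<And>k t. s k t \<in> V"
    "\<And>t. (\<lambda>k. s k t) \<longlonglongrightarrow> z t"
    using simple_function_sequence_in_subspace[OF zm zero_in_V z(2)] by metis
  show "strongly_measurable T X w"
    unfolding strongly_measurable_def
  proof (intro exI[of _ "\<lambda>k t. P (s k t)"] conjI allI ballI)
    show "simple_function (time_measure T) (\<lambda>t. P (s k t))" for k
      using simple_function_compose1[OF s(1), of P] .
    show "P (s k t) \<in> hcarrier X" for k t using s(2) carrier_eq by auto
    show "AE t in time_measure T. (\<lambda>k. hnorm X (P (s k t) - w t)) \<longlonglongrightarrow> 0"
      using ae
    proof eventually_elim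
      case (elim t)
      have "(\<lambda>k. norm (s k t - z t)) \<longlonglongrightarrow> 0" using s(3)[of t] by (simp add: tendsto_norm_zero_iff LIM_zero_iff)
      then show ?case using elim s(2) z(2) by (simp add: hnorm_diff)
    qed
  qed
qed

text \<open>The lifts of the simple functions converge almost everywhere in the model, so their limit is
  measurable there.\<close>

lemma L2T_imp_repr:
  assumes "w \<in> L2T T X"
  obtains z where "repr w z"
proof -
  define E where "E = inv_into V P"
  have E: "E x \<in> V" "P (E x) = x" if "x \<in> hcarrier X" for x
    using that carrier_eq unfolding E_def by (auto intro: inv_into_into f_inv_into_f)
  have car: "AE t in time_measure T. w t \<in> hcarrier X" and int: "integrable (time_measure T) (\<lambda>t. (hnorm X (w t))\<^sup>2)"
    using assms by (auto simp: L2T_def)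
  obtain s where s: "\<And>k::nat. simple_function (time_measure T) (s k)" "\<And>k t. t \<in> {0<..<T} \<Longrightarrow> s k t \<in> hcarrier X"
    "AE t in time_measure T. (\<lambda>k. hnorm X (s k t - w t)) \<longlonglongrightarrow> 0"
    using assms unfolding L2T_def strongly_measurable_def by blast
  have sm: "(\<lambda>t. E (s k t)) \<in> borel_measurable (time_measure T)" for k
    by (rule borel_measurable_simple_function) (rule simple_function_compose1[OF s(1)])
  define g where "g t = lim (\<lambda>k. E (s k t))" for t
  have gm: "g \<in> borel_measurable (time_measure T)" unfolding g_def using sm by measurable
  have gE: "AE t in time_measure T. g t = E (w t)"
    using car s(3) AE_space
  proof eventually_elim
    case (elim t)
    have "hnorm X (s k t - w t) = norm (E (s k t) - E (w t))" for k
      using hnorm_diff[of "E (s k t)" "E (w t)"] E elim s(2)[of t k] by simp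
    then have "(\<lambda>k. E (s k t)) \<longlonglongrightarrow> E (w t)" using elim(2) by (simp add: tendsto_norm_zero_iff LIM_zero_iff)
    then show ?case unfolding g_def by (rule limI)
  qed
  define z where "z t = (if g t \<in> V then g t else 0)" for t
  have "{t \<in> space (time_measure T). g t \<in> V} \<in> sets (time_measure T)"
    using measurable_sets[OF gm borel_closed[OF V_closed]] by (simp add: vimage_def Int_def conj_commute)
  then have zm: "z \<in> borel_measurable (time_measure T)"
    unfolding z_def using gm by (intro measurable_If) auto
  have zE: "AE t in time_measure T. z t = E (w t)"
    using gE car by eventually_elim (simp add: z_def E)
  have ae: "AE t in time_measure T. w t = P (z t)" using zE car by eventually_elim (simp add: E)
  have "integrable (time_measure T) (\<lambda>t. (norm (z t))\<^sup>2)"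
  proof (rule integrable_cong_AE[THEN iffD1, OF _ _ _ int])
    show "AE t in time_measure T. (hnorm X (w t))\<^sup>2 = (norm (z t))\<^sup>2"
      using zE car
    proof eventually_elim
      case (elim t)
      then show ?case using norm_eq[of "E (w t)"] E[of "w t"] by simp
    qed
  qed (use int zm in auto)
  then have "z \<in> valued_in T V" using zm zero_in_V by (auto simp: valued_in_def sq_norm_integrable_def z_def)
  then show ?thesis using that ae by (auto simp: repr_def)
qed

text \<open>The fractional integral in the model, cut off so that its values always lie in \<open>V\<close>.\<close>

definition J :: "(real \<Rightarrow> 'z) \<Rightarrow> real \<Rightarrow> 'z" where
  "J z t = (if t \<in> {0<..<T} then frac_int \<alpha> z t else 0)"

lemma J_AE: "AE t in time_measure T. frac_int \<alpha> z t = J z t"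
  by (rule AE_I2) (simp add: J_def)

lemma J_valued_in:
  assumes "z \<in> valued_in T V"
  shows "J z \<in> valued_in T V"
proof -
  have z: "sq_norm_integrable T z" "\<And>t. z t \<in> V" "z \<in> borel_measurable (time_measure T)"
    using assms by (auto simp: valued_in_def sq_norm_integrable_def)
  have s: "sq_norm_integrable T (frac_int \<alpha> z)" by (rule sq_norm_integrable_frac_int[OF \<alpha>_pos z(1)])
  have "J z \<in> borel_measurable (time_measure T)"
    by (rule measurable_time_AE_cong[OF _ J_AE]) (use s in \<open>auto simp: sq_norm_integrable_def\<close>)
  then have "sq_norm_integrable T (J z)"
    by (rule sq_norm_integrable_bound[OF s, of _ 1]) (auto simp: J_def)
  moreover have "J z t \<in> V" for t
    using frac_int_in_subspace[OF V_subspace V_closed z(3,2)] zero_in_V by (simp add: J_def)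
  ultimately show ?thesis by (simp add: valued_in_def)
qed

lemma repr_frac_int:
  assumes "repr w z"
  shows "repr (frac_int \<alpha> w) (J z)"
proof -
  have z: "z \<in> valued_in T V" and ae: "AE t in time_measure T. w t = P (z t)" using assms by (auto simp: repr_def)
  have sz: "sq_norm_integrable T z" using z by (simp add: valued_in_def)
  have Pz: "(\<lambda>t. P (z t)) \<in> borel_measurable (time_measure T)"
    using sz P_measurable by (auto simp: sq_norm_integrable_def intro: measurable_compose)
  have "AE t in time_measure T. frac_int \<alpha> w t = P (J z t)"
    using frac_int_bounded_linear[OF P_linear \<alpha>_pos sz] AE_space
  proof eventually_elim
    case (elim t)
    have t: "t \<in> {0<..<T}" using elim(2) by simp
    show ?case using elim(1) frac_int_cong_AE[OF repr_measurable[OF assms] Pz ae t] t by (simp add: J_def)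
  qed
  then show ?thesis using J_valued_in[OF z] by (simp add: repr_def)
qed

lemma repr_diff: "repr v z \<Longrightarrow> repr w y \<Longrightarrow> repr (\<lambda>t. v t - w t) (\<lambda>t. z t - y t)"
proof -
  assume a: "repr v z" "repr w y"
  then have "AE t in time_measure T. v t = P (z t)" "AE t in time_measure T. w t = P (y t)" by (auto simp: repr_def)
  then have "AE t in time_measure T. v t - w t = P (z t - y t)" by eventually_elim (simp add: P_diff)
  then show ?thesis
    using a by (auto simp: repr_def valued_in_def sq_norm_integrable_diff subspace_diff[OF V_subspace])
qed

lemma repr_add: "repr v z \<Longrightarrow> repr w y \<Longrightarrow> repr (\<lambda>t. v t + w t) (\<lambda>t. z t + y t)"
proof -
  assume a: "repr v z" "repr w y"
  then have "AE t in time_measure T. v t = P (z t)" "AE t in time_measure T. w t = P (y t)" by (auto simp: repr_def)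
  then have "AE t in time_measure T. v t + w t = P (z t + y t)" by eventually_elim (simp add: P_add)
  then show ?thesis
    using a by (auto simp: repr_def valued_in_def sq_norm_integrable_add subspace_add[OF V_subspace])
qed

lemma valued_in_sq: "z \<in> valued_in T V \<Longrightarrow> sq_norm_integrable T z" by (simp add: valued_in_def)

lemma J_diff:
  assumes "z \<in> valued_in T V" "y \<in> valued_in T V"
  shows "AE t in time_measure T. J (\<lambda>t. z t - y t) t = J z t - J y t"
  using frac_int_diff[OF \<alpha>_pos valued_in_sq[OF assms(1)] valued_in_sq[OF assms(2)]]
  by eventually_elim (simp add: J_def)

lemma J_add:
  assumes "z \<in> valued_in T V" "y \<in> valued_in T V"
  shows "AE t in time_measure T. J (\<lambda>t. z t + y t) t = J z t + J y t"
  using frac_int_add[OF \<alpha>_pos valued_in_sq[OF assms(1)] valued_in_sq[OF assms(2)]]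
  by eventually_elim (simp add: J_def)

lemma L2T_norm_diff:
  assumes "repr v z" "repr w y"
  shows "L2T_norm T X (\<lambda>t. v t - w t) = sqrt (sq_dist T z y)"
  using repr_norm(2)[OF repr_diff[OF assms]] by (simp add: sq_dist_def)

lemma negH_norm_diff:
  assumes "repr v z" "repr w y"
  shows "negH_norm \<alpha> T X (\<lambda>t. v t - w t) = sqrt (sq_dist T (J z) (J y))"
proof -
  have zy: "z \<in> valued_in T V" "y \<in> valued_in T V" using assms by (auto simp: repr_def)
  have d: "(\<lambda>t. J z t - J y t) \<in> valued_in T V"
    using J_valued_in[OF zy(1)] J_valued_in[OF zy(2)]
    by (auto simp: valued_in_def sq_norm_integrable_diff subspace_diff[OF V_subspace])
  have "AE t in time_measure T. frac_int \<alpha> (\<lambda>t. v t - w t) t = P (J (\<lambda>t. z t - y t) t)"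
    using repr_frac_int[OF repr_diff[OF assms]] by (simp add: repr_def)
  then have "AE t in time_measure T. frac_int \<alpha> (\<lambda>t. v t - w t) t = P (J z t - J y t)"
    using J_diff[OF zy] by eventually_elim simp
  then have "repr (frac_int \<alpha> (\<lambda>t. v t - w t)) (\<lambda>t. J z t - J y t)" using d by (simp add: repr_def)
  from repr_norm(2)[OF this] show ?thesis by (simp add: negH_norm_def sq_dist_def)
qed

text \<open>The sequences of fractional integrals converge in the model; \<open>x\<close> is the lift of the value of \<open>J\<^sub>\<alpha>'\<close>.\<close>

definition has_limit :: "(nat \<Rightarrow> real \<Rightarrow> 'h) \<Rightarrow> (real \<Rightarrow> 'z) \<Rightarrow> bool" where
  "has_limit v x \<longleftrightarrow> x \<in> valued_in T V \<and>
     (\<exists>z. (\<forall>n. repr (v n) (z n)) \<and> (\<lambda>n. sq_dist T (J (z n)) x) \<longlonglongrightarrow> 0)"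

lemma has_limit_imp_cauchy:
  assumes "has_limit v x"
  shows "v \<in> negH_cauchy \<alpha> T X"
proof -
  obtain z where z: "\<And>n. repr (v n) (z n)" "(\<lambda>n. sq_dist T (J (z n)) x) \<longlonglongrightarrow> 0" and x: "x \<in> valued_in T V"
    using assms unfolding has_limit_def by blast
  have sJ: "sq_norm_integrable T (J (z n))" for n
    using z(1)[of n] J_valued_in by (auto simp: repr_def valued_in_def)
  show ?thesis
    unfolding negH_cauchy_def
  proof (intro CollectI conjI allI impI)
    show "v n \<in> L2T T X" for n by (rule repr_imp_L2T[OF z(1)])
    fix e :: real assume e: "e > 0"
    have "\<forall>\<^sub>F n in sequentially. sq_dist T (J (z n)) x < e\<^sup>2 / 4"
      using z(2) e by (intro order_tendstoD) auto
    then obtain N where N: "\<And>n. n \<ge> N \<Longrightarrow> sq_dist T (J (z n)) x < e\<^sup>2 / 4" by (auto simp: eventually_sequentially)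
    show "\<exists>N. \<forall>m\<ge>N. \<forall>n\<ge>N. negH_norm \<alpha> T X (\<lambda>t. v m t - v n t) < e"
    proof (intro exI[of _ N] allI impI)
      fix m n assume mn: "m \<ge> N" "n \<ge> N"
      have "sq_dist T (J (z m)) (J (z n)) \<le> 2 * sq_dist T (J (z m)) x + 2 * sq_dist T x (J (z n))"
        by (intro sq_dist_triangle sJ valued_in_sq x)
      also have "\<dots> < e\<^sup>2" using N[OF mn(1)] N[OF mn(2)] by (simp add: sq_dist_commute)
      finally show "negH_norm \<alpha> T X (\<lambda>t. v m t - v n t) < e"
        unfolding negH_norm_diff[OF z(1) z(1)] using e real_sqrt_less_mono by fastforce
    qed
  qed
qed

lemma cauchy_imp_has_limit:
  assumes "v \<in> negH_cauchy \<alpha> T X"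
  obtains x where "has_limit v x"
proof -
  have "v n \<in> L2T T X" for n using assms by (simp add: negH_cauchy_def)
  then have "\<exists>z. repr (v n) z" for n using L2T_imp_repr[of "v n"] by blast
  then obtain z where z: "\<And>n. repr (v n) (z n)" by metis
  have Jv: "J (z n) \<in> valued_in T V" for n using z[of n] by (auto simp: repr_def intro: J_valued_in)
  have "\<exists>N. \<forall>m\<ge>N. \<forall>n\<ge>N. sq_dist T (J (z m)) (J (z n)) < e" if e: "e > 0" for e
  proof -
    have "sqrt e > 0" using e by simp
    then obtain N where "\<forall>m\<ge>N. \<forall>n\<ge>N. negH_norm \<alpha> T X (\<lambda>t. v m t - v n t) < sqrt e"
      using assms unfolding negH_cauchy_def by blast
    then show ?thesis unfolding negH_norm_diff[OF z z] by auto
  qed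
  from sq_dist_complete[OF V_closed zero_in_V Jv this]
  obtain x where "x \<in> valued_in T V" "(\<lambda>n. sq_dist T (J (z n)) x) \<longlonglongrightarrow> 0" by blast
  then have "has_limit v x" using z by (auto simp: has_limit_def)
  then show ?thesis by (rule that)
qed

lemma sqrt_tendsto_0_iff:
  assumes "\<And>n. f n \<ge> 0"
  shows "(\<lambda>n. sqrt (f n)) \<longlonglongrightarrow> 0 \<longleftrightarrow> f \<longlonglongrightarrow> 0"
proof
  assume "(\<lambda>n. sqrt (f n)) \<longlonglongrightarrow> 0"
  then have "(\<lambda>n. (sqrt (f n))\<^sup>2) \<longlonglongrightarrow> 0\<^sup>2" by (rule tendsto_power)
  then show "f \<longlonglongrightarrow> 0" using assms by simp
next
  assume "f \<longlonglongrightarrow> 0"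
  from tendsto_real_sqrt[OF this] show "(\<lambda>n. sqrt (f n)) \<longlonglongrightarrow> 0" by simp
qed

text \<open>Both sides say that the limits have distance zero.\<close>

lemma rel_iff_limits:
  assumes v: "has_limit v x" and w: "has_limit w y"
  shows "(v, w) \<in> negH_rel \<alpha> T X \<longleftrightarrow> (AE t in time_measure T. x t = y t)"
proof -
  obtain z where z: "\<And>n. repr (v n) (z n)" "(\<lambda>n. sq_dist T (J (z n)) x) \<longlonglongrightarrow> 0" and x: "x \<in> valued_in T V"
    using v unfolding has_limit_def by blast
  obtain z' where z': "\<And>n. repr (w n) (z' n)" "(\<lambda>n. sq_dist T (J (z' n)) y) \<longlonglongrightarrow> 0" and y: "y \<in> valued_in T V"
    using w unfolding has_limit_def by blast
  have sJ: "sq_norm_integrable T (J (z n))" "sq_norm_integrable T (J (z' n))" for n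
    using z(1)[of n] z'(1)[of n] J_valued_in by (auto simp: repr_def valued_in_def)
  note sxy = valued_in_sq[OF x] valued_in_sq[OF y]
  have "(v, w) \<in> negH_rel \<alpha> T X \<longleftrightarrow> (\<lambda>n. sq_dist T (J (z n)) (J (z' n))) \<longlonglongrightarrow> 0"
    using has_limit_imp_cauchy[OF v] has_limit_imp_cauchy[OF w]
    by (simp add: negH_rel_def negH_norm_diff[OF z(1) z'(1)] sqrt_tendsto_0_iff sq_dist_nonneg)
  also have "\<dots> \<longleftrightarrow> sq_dist T x y = 0"
  proof
    assume l: "(\<lambda>n. sq_dist T (J (z n)) (J (z' n))) \<longlonglongrightarrow> 0"
    have "(\<lambda>n. 2 * sq_dist T (J (z n)) x + 2 * (2 * sq_dist T (J (z n)) (J (z' n)) + 2 * sq_dist T (J (z' n)) y)) \<longlonglongrightarrow> 2 * 0 + 2 * (2 * 0 + 2 * 0)"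
      by (intro tendsto_intros z z' l)
    moreover have "sq_dist T x y \<le> 2 * sq_dist T (J (z n)) x + 2 * (2 * sq_dist T (J (z n)) (J (z' n)) + 2 * sq_dist T (J (z' n)) y)" for n
      using sq_dist_triangle[OF sxy(1) sJ(1)[of n] sxy(2)] sq_dist_triangle[OF sJ(1)[of n] sJ(2)[of n] sxy(2)]
      by (simp add: sq_dist_commute[of T x])
    ultimately have "sq_dist T x y \<le> 0" by (intro LIMSEQ_le_const) auto
    then show "sq_dist T x y = 0" using sq_dist_nonneg[of T x y] by simp
  next
    assume 0: "sq_dist T x y = 0"
    have "(\<lambda>n. 2 * sq_dist T (J (z n)) x + 2 * (2 * sq_dist T x y + 2 * sq_dist T (J (z' n)) y)) \<longlonglongrightarrow> 2 * 0 + 2 * (2 * 0 + 2 * 0)"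
      unfolding 0 by (intro tendsto_intros z z')
    then have l: "(\<lambda>n. 2 * sq_dist T (J (z n)) x + 2 * (2 * sq_dist T x y + 2 * sq_dist T (J (z' n)) y)) \<longlonglongrightarrow> 0" by simp
    show "(\<lambda>n. sq_dist T (J (z n)) (J (z' n))) \<longlonglongrightarrow> 0"
    proof (rule Lim_null_comparison[OF always_eventually l], rule allI)
      show "norm (sq_dist T (J (z n)) (J (z' n))) \<le> 2 * sq_dist T (J (z n)) x + 2 * (2 * sq_dist T x y + 2 * sq_dist T (J (z' n)) y)" for n
        using sq_dist_triangle[OF sJ(1)[of n] sxy(1) sJ(2)[of n]] sq_dist_triangle[OF sxy sJ(2)[of n]]
        by (simp add: sq_dist_nonneg sq_dist_commute[of T y])
    qed
  qed
  also have "\<dots> \<longleftrightarrow> (AE t in time_measure T. x t = y t)" by (rule sq_dist_eq_zero_iff[OF sxy])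
  finally show ?thesis .
qed

lemma has_limit_cong:
  assumes "has_limit v x" "AE t in time_measure T. x t = y t" "y \<in> valued_in T V"
  shows "has_limit v y"
proof -
  obtain z where z: "\<And>n. repr (v n) (z n)" "(\<lambda>n. sq_dist T (J (z n)) x) \<longlonglongrightarrow> 0" and x: "x \<in> valued_in T V"
    using assms(1) unfolding has_limit_def by blast
  have sJ: "sq_norm_integrable T (J (z n))" for n
    using z(1)[of n] J_valued_in by (auto simp: repr_def valued_in_def)
  have "sq_dist T (J (z n)) x = sq_dist T (J (z n)) y" for n
    by (rule sq_dist_cong_AE) (use assms(2) sJ valued_in_sq[OF x] valued_in_sq[OF assms(3)] in auto)
  then show ?thesis using z assms(3) by (auto simp: has_limit_def)
qed

text \<open>An equivalence class is the set of all sequences whose image under \<open>J\<close> has a given limit; that limit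
  is the value of the extended integral.\<close>

definition limit_class :: "(real \<Rightarrow> 'z) \<Rightarrow> 'h negH" where
  "limit_class x = {v. has_limit v x}"

lemma rel_image_eq_limit_class:
  assumes "has_limit v x"
  shows "negH_rel \<alpha> T X `` {v} = limit_class x"
proof (intro equalityI subsetI)
  fix w assume "w \<in> negH_rel \<alpha> T X `` {v}"
  then have r: "(v, w) \<in> negH_rel \<alpha> T X" by auto
  then have "w \<in> negH_cauchy \<alpha> T X" by (simp add: negH_rel_def)
  then obtain y where y: "has_limit w y" by (rule cauchy_imp_has_limit)
  have "AE t in time_measure T. x t = y t" using rel_iff_limits[OF assms y] r by simp
  then have "AE t in time_measure T. y t = x t" by (auto elim: AE_mp)
  then have "has_limit w x" using has_limit_cong[OF y] assms by (auto simp: has_limit_def)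
  then show "w \<in> limit_class x" by (simp add: limit_class_def)
next
  fix w assume "w \<in> limit_class x"
  then have "has_limit w x" by (simp add: limit_class_def)
  then show "w \<in> negH_rel \<alpha> T X `` {v}" using rel_iff_limits[OF assms] by auto
qed

lemma negH_eq_limit_class:
  assumes "W \<in> negH \<alpha> T X"
  obtains x where "x \<in> valued_in T V" "W = limit_class x" "W \<noteq> {}"
proof -
  obtain v where v: "v \<in> negH_cauchy \<alpha> T X" "W = negH_rel \<alpha> T X `` {v}"
    using assms by (auto simp: negH_def quotient_def)
  obtain x where x: "has_limit v x" using v(1) by (rule cauchy_imp_has_limit)
  have "W = limit_class x" using v(2) rel_image_eq_limit_class[OF x] by simp
  moreover from this have "v \<in> W" using x by (simp add: limit_class_def)
  ultimately show ?thesis using that x by (auto simp: has_limit_def)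
qed

text \<open>Surjectivity of the extended integral: density of its range makes every element of the model a limit.\<close>

lemma limit_class_nonempty:
  assumes "x \<in> valued_in T V"
  obtains v where "has_limit v x"
proof -
  have "frac_approximable \<alpha> T V x" by (rule frac_int_range_dense[OF \<alpha>_pos T_pos V_subspace assms])
  then have "\<exists>y\<in>valued_in T V. sq_dist T (frac_int \<alpha> y) x < 1 / real (Suc n)" for n
    unfolding frac_approximable_def by (metis of_nat_0_less_iff zero_less_Suc zero_less_divide_1_iff)
  then obtain y where y: "\<And>n. y n \<in> valued_in T V" "\<And>n. sq_dist T (frac_int \<alpha> (y n)) x < 1 / real (Suc n)" by metis
  have "sq_dist T (frac_int \<alpha> (y n)) x = sq_dist T (J (y n)) x" for n
    by (rule sq_dist_cong_AE[OF J_AE])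
      (auto intro: sq_norm_integrable_frac_int \<alpha>_pos valued_in_sq y assms J_valued_in)
  then have "(\<lambda>n. sq_dist T (J (y n)) x) \<longlonglongrightarrow> 0"
    using y(2) by (intro Lim_null_comparison[OF always_eventually LIMSEQ_inverse_real_of_nat])
      (auto simp: inverse_eq_divide sq_dist_nonneg intro: less_imp_le)
  moreover have "repr (\<lambda>t. P (y n t)) (y n)" for n using y(1) by (simp add: repr_def)
  ultimately have "has_limit (\<lambda>n t. P (y n t)) x" unfolding has_limit_def using assms by blast
  then show ?thesis by (rule that)
qed

lemma limit_class_in_negH:
  assumes "x \<in> valued_in T V"
  shows "limit_class x \<in> negH \<alpha> T X"
proof -
  obtain v where v: "has_limit v x" using limit_class_nonempty[OF assms] .
  show ?thesis
    unfolding rel_image_eq_limit_class[OF v, symmetric] negH_def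
    by (rule quotientI[OF has_limit_imp_cauchy[OF v]])
qed

lemma limit_class_eq_iff:
  assumes "x \<in> valued_in T V" "y \<in> valued_in T V"
  shows "limit_class x = limit_class y \<longleftrightarrow> (AE t in time_measure T. x t = y t)"
proof
  assume eq: "limit_class x = limit_class y"
  obtain v where v: "has_limit v x" using limit_class_nonempty[OF assms(1)] .
  then have "has_limit v y" using eq by (auto simp: limit_class_def)
  moreover have "(v, v) \<in> negH_rel \<alpha> T X" using rel_iff_limits[OF v v] by simp
  ultimately show "AE t in time_measure T. x t = y t" using rel_iff_limits[OF v] by blast
next
  assume ae: "AE t in time_measure T. x t = y t"
  then have "AE t in time_measure T. y t = x t" by (auto elim: AE_mp)
  then show "limit_class x = limit_class y"
    using has_limit_cong ae assms unfolding limit_class_def by blast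
qed

text \<open>The function chosen in the definition of \<open>frac_int_ext\<close> is determined almost everywhere.\<close>

lemma repr_frac_int_ext:
  assumes x: "x \<in> valued_in T V"
  shows "repr (frac_int_ext \<alpha> T X (limit_class x)) x"
proof -
  let ?Q = "\<lambda>w. w \<in> L2T T X \<and> (\<forall>v\<in>limit_class x. (\<lambda>n. L2T_norm T X (\<lambda>t. frac_int \<alpha> (v n) t - w t)) \<longlonglongrightarrow> 0)"
  have lim: "(\<lambda>n. L2T_norm T X (\<lambda>t. frac_int \<alpha> (v n) t - w t)) \<longlonglongrightarrow> 0 \<longleftrightarrow> (\<lambda>n. sq_dist T (J (z n)) y) \<longlonglongrightarrow> 0"
    if "\<And>n. repr (v n) (z n)" "repr w y" for v z w y
    using L2T_norm_diff[OF repr_frac_int[OF that(1)] that(2)] by (simp add: sqrt_tendsto_0_iff sq_dist_nonneg)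
  have Px: "repr (\<lambda>t. P (x t)) x" using x by (simp add: repr_def)
  have "?Q (\<lambda>t. P (x t))"
  proof (intro conjI ballI repr_imp_L2T[OF Px])
    fix v assume "v \<in> limit_class x"
    then obtain z where "\<And>n. repr (v n) (z n)" "(\<lambda>n. sq_dist T (J (z n)) x) \<longlonglongrightarrow> 0"
      unfolding limit_class_def has_limit_def by blast
    then show "(\<lambda>n. L2T_norm T X (\<lambda>t. frac_int \<alpha> (v n) t - P (x t))) \<longlonglongrightarrow> 0" using lim[OF _ Px] by blast
  qed
  then have Q: "?Q (frac_int_ext \<alpha> T X (limit_class x))"
    unfolding frac_int_ext_def by (rule someI[where P="?Q"])
  then obtain y where y: "repr (frac_int_ext \<alpha> T X (limit_class x)) y" using L2T_imp_repr by blast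
  obtain v where v: "has_limit v x" using limit_class_nonempty[OF x] .
  then obtain z where z: "\<And>n. repr (v n) (z n)" unfolding has_limit_def by blast
  have "(\<lambda>n. L2T_norm T X (\<lambda>t. frac_int \<alpha> (v n) t - frac_int_ext \<alpha> T X (limit_class x) t)) \<longlonglongrightarrow> 0"
    using Q v by (auto simp: limit_class_def)
  then have "(\<lambda>n. sq_dist T (J (z n)) y) \<longlonglongrightarrow> 0" using lim[of v z, OF z y] by simp
  then have vy: "has_limit v y" using y z by (auto simp: has_limit_def repr_def)
  have "(v, v) \<in> negH_rel \<alpha> T X" using rel_iff_limits[OF v v] by simp
  then have "AE t in time_measure T. x t = y t" using rel_iff_limits[OF v vy] by simp
  moreover have "AE t in time_measure T. frac_int_ext \<alpha> T X (limit_class x) t = P (y t)" using y by (simp add: repr_def)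
  ultimately have "AE t in time_measure T. frac_int_ext \<alpha> T X (limit_class x) t = P (x t)" by eventually_elim simp
  then show ?thesis using x by (simp add: repr_def)
qed

lemma frac_int_ext_inv_eq:
  assumes "repr w x"
  shows "frac_int_ext_inv \<alpha> T X w = limit_class x"
  unfolding frac_int_ext_inv_def
proof (rule the_equality)
  have x: "x \<in> valued_in T V" and ae: "AE t in time_measure T. w t = P (x t)" using assms by (auto simp: repr_def)
  have "AE t in time_measure T. frac_int_ext \<alpha> T X (limit_class x) t = P (x t)"
    using repr_frac_int_ext[OF x] by (simp add: repr_def)
  then show "limit_class x \<in> negH \<alpha> T X \<and> (AE t in time_measure T. frac_int_ext \<alpha> T X (limit_class x) t = w t)"
    using ae limit_class_in_negH[OF x] by (auto elim: AE_mp)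
  fix W assume W: "W \<in> negH \<alpha> T X \<and> (AE t in time_measure T. frac_int_ext \<alpha> T X W t = w t)"
  then obtain y where y: "y \<in> valued_in T V" "W = limit_class y" using negH_eq_limit_class by blast
  have "AE t in time_measure T. frac_int_ext \<alpha> T X W t = P (y t)"
    using repr_frac_int_ext[OF y(1)] y(2) by (simp add: repr_def)
  with conjunct2[OF W] have "AE t in time_measure T. w t = P (y t)" by eventually_elim simp
  then have "repr w y" using y(1) by (simp add: repr_def)
  then have "AE t in time_measure T. y t = x t" using repr_unique assms by blast
  then show "W = limit_class x" using limit_class_eq_iff[OF y(1) x] y(2) by simp
qed

lemma negH_add_limit_class:
  assumes x: "x \<in> valued_in T V" and y: "y \<in> valued_in T V"
  shows "negH_add \<alpha> T X (limit_class x) (limit_class y) = limit_class (\<lambda>t. x t + y t)"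
proof -
  have xy: "(\<lambda>t. x t + y t) \<in> valued_in T V" by (rule valued_in_add[OF V_subspace x y])
  have sum: "has_limit (\<lambda>n t. v n t + w n t) (\<lambda>t. x t + y t)" if v: "has_limit v x" and w: "has_limit w y" for v w
  proof -
    obtain z where z: "\<And>n. repr (v n) (z n)" "(\<lambda>n. sq_dist T (J (z n)) x) \<longlonglongrightarrow> 0"
      using v unfolding has_limit_def by blast
    obtain z' where z': "\<And>n. repr (w n) (z' n)" "(\<lambda>n. sq_dist T (J (z' n)) y) \<longlonglongrightarrow> 0"
      using w unfolding has_limit_def by blast
    have zv: "z n \<in> valued_in T V" "z' n \<in> valued_in T V" for n using z(1) z'(1) by (auto simp: repr_def)
    have "(\<lambda>n. sq_dist T (J (\<lambda>t. z n t + z' n t)) (\<lambda>t. x t + y t)) \<longlonglongrightarrow> 0"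
    proof (rule Lim_null_comparison[OF always_eventually], rule allI)
      fix n
      have "sq_dist T (J (\<lambda>t. z n t + z' n t)) (\<lambda>t. x t + y t) = sq_dist T (\<lambda>t. J (z n) t + J (z' n) t) (\<lambda>t. x t + y t)"
        by (rule sq_dist_cong_AE[OF J_add[OF zv]])
          (auto intro!: valued_in_sq J_valued_in valued_in_add[OF V_subspace] zv x y)
      also have "\<dots> \<le> 2 * sq_dist T (J (z n)) x + 2 * sq_dist T (J (z' n)) y"
        by (intro sq_dist_add_le valued_in_sq J_valued_in zv x y)
      finally show "norm (sq_dist T (J (\<lambda>t. z n t + z' n t)) (\<lambda>t. x t + y t)) \<le> 2 * sq_dist T (J (z n)) x + 2 * sq_dist T (J (z' n)) y"
        by (simp add: sq_dist_nonneg)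
    next
      have "(\<lambda>n. 2 * sq_dist T (J (z n)) x + 2 * sq_dist T (J (z' n)) y) \<longlonglongrightarrow> 2 * 0 + 2 * 0"
        by (intro tendsto_intros z z')
      then show "(\<lambda>n. 2 * sq_dist T (J (z n)) x + 2 * sq_dist T (J (z' n)) y) \<longlonglongrightarrow> 0" by simp
    qed
    then show ?thesis unfolding has_limit_def using xy repr_add[OF z(1) z'(1)] by (intro conjI exI[of _ "\<lambda>n t. z n t + z' n t"]) auto
  qed
  obtain v where v: "has_limit v x" using limit_class_nonempty[OF x] .
  obtain w where w: "has_limit w y" using limit_class_nonempty[OF y] .
  have "negH_add \<alpha> T X (limit_class x) (limit_class y)
    = (\<Union>s\<in>{(\<lambda>n t. v n t + w n t) | v w. v \<in> limit_class x \<and> w \<in> limit_class y}. negH_rel \<alpha> T X `` {s})"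
    unfolding negH_add_def by blast
  also have "\<dots> = limit_class (\<lambda>t. x t + y t)"
  proof (intro equalityI subsetI)
    fix s assume "s \<in> (\<Union>s\<in>{(\<lambda>n t. v n t + w n t) | v w. v \<in> limit_class x \<and> w \<in> limit_class y}. negH_rel \<alpha> T X `` {s})"
    then obtain v w where "has_limit v x" "has_limit w y" "s \<in> negH_rel \<alpha> T X `` {\<lambda>n t. v n t + w n t}"
      by (auto simp: limit_class_def)
    then show "s \<in> limit_class (\<lambda>t. x t + y t)" using rel_image_eq_limit_class[OF sum] by blast
  next
    fix s assume "s \<in> limit_class (\<lambda>t. x t + y t)"
    then have "s \<in> negH_rel \<alpha> T X `` {\<lambda>n t. v n t + w n t}" using rel_image_eq_limit_class[OF sum[OF v w]] by simp
    then show "s \<in> (\<Union>s\<in>{(\<lambda>n t. v n t + w n t) | v w. v \<in> limit_class x \<and> w \<in> limit_class y}. negH_rel \<alpha> T X `` {s})"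
      using v w by (auto simp: limit_class_def)
  qed
  finally show ?thesis .
qed

lemma has_limit_const:
  assumes "repr w z"
  shows "has_limit (\<lambda>n. w) (J z)"
  unfolding has_limit_def
proof (intro conjI exI[of _ "\<lambda>n. z"] allI assms)
  show "J z \<in> valued_in T V" using assms by (auto simp: repr_def intro: J_valued_in)
qed (simp add: sq_dist_def)

lemma negH_zero_eq: "negH_zero \<alpha> T X = limit_class (\<lambda>t. 0)"
proof -
  have z: "(\<lambda>t. 0) \<in> valued_in T V" by (simp add: valued_in_def sq_norm_integrable_zero zero_in_V)
  then have "repr (\<lambda>t. 0) (\<lambda>t. 0)" by (simp add: repr_def P_zero)
  from rel_image_eq_limit_class[OF has_limit_const[OF this]]
  have "negH_zero \<alpha> T X = limit_class (J (\<lambda>t. 0))" by (simp add: negH_zero_def negH_of_def)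
  also have "J (\<lambda>t. 0) = (\<lambda>t. 0)" by (auto simp: J_def frac_int_def set_lebesgue_integral_def)
  finally show ?thesis .
qed

end

section \<open>Finite Laplace transforms\<close>

lemma integrable_mult_bounded_time:
  fixes g :: "real \<Rightarrow> 'z::{banach, second_countable_topology}"
  assumes "integrable (time_measure T) g" "\<phi> \<in> borel_measurable (time_measure T)"
    "\<And>t. t \<in> {0<..<T} \<Longrightarrow> \<bar>\<phi> t\<bar> \<le> B"
  shows "integrable (time_measure T) (\<lambda>t. \<phi> t *\<^sub>R g t)"
proof (rule Bochner_Integration.integrable_bound[where f="\<lambda>t. B *\<^sub>R g t"])
  show "AE t in time_measure T. norm (\<phi> t *\<^sub>R g t) \<le> norm (B *\<^sub>R g t)"
  proof (rule AE_I2)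
    fix t assume "t \<in> space (time_measure T)"
    then have "\<bar>\<phi> t\<bar> \<le> B" using assms(3) by simp
    then show "norm (\<phi> t *\<^sub>R g t) \<le> norm (B *\<^sub>R g t)" by (auto intro!: mult_right_mono)
  qed
qed (use assms in \<open>auto intro: borel_measurable_scaleR\<close>)

lemma time_continuous_measurable:
  assumes "continuous_on UNIV (\<phi> :: real \<Rightarrow> real)"
  shows "\<phi> \<in> borel_measurable (time_measure T)"
  by (intro measurable_restrict_space1 measurable_completion) (simp add: borel_measurable_continuous_onI[OF assms])

lemma exp_partial_sum_bound:
  fixes x :: real
  assumes "x \<ge> 0"
  shows "\<bar>\<Sum>k<K. (- x) ^ Suc k / fact (Suc k)\<bar> \<le> exp x" "(\<Sum>k<K. x ^ Suc k / fact (Suc k)) \<le> exp x - 1"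
proof -
  have s: "(\<lambda>k. x ^ k / fact k) sums exp x"
    using exp_converges[of x] by (simp add: scaleR_conv_of_real divide_inverse mult.commute)
  then have "(\<lambda>k. x ^ Suc k / fact (Suc k)) sums (exp x - 1)" by (subst sums_Suc_iff) simp
  then show 2: "(\<Sum>k<K. x ^ Suc k / fact (Suc k)) \<le> exp x - 1"
    using sum_le_suminf[of "\<lambda>k. x ^ Suc k / fact (Suc k)" "{..<K}"] assms by (auto simp: sums_iff)
  have "\<bar>\<Sum>k<K. (- x) ^ Suc k / fact (Suc k)\<bar> \<le> (\<Sum>k<K. \<bar>(- x) ^ Suc k / fact (Suc k)\<bar>)" by (rule sum_abs)
  also have "\<dots> = (\<Sum>k<K. x ^ Suc k / fact (Suc k))" using assms by (simp add: power_abs abs_mult)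
  finally show "\<bar>\<Sum>k<K. (- x) ^ Suc k / fact (Suc k)\<bar> \<le> exp x" using 2 by simp
qed

text \<open>Mikusinski's argument: \<open>1 - exp (- exp (n (y - t)))\<close> tends to the indicator function of \<open>t < y\<close> as \<open>n\<close>
  grows. Expanded in powers of \<open>exp (n (y - t))\<close>, its integral against \<open>g\<close> becomes a series of exponential
  moments, and the factor \<open>exp (- k n (T - y))\<close> of the moment of order \<open>k n\<close> makes the series tend to \<open>0\<close>.\<close>

lemma exp_moments_bounded_imp_zero_integral:
  fixes g :: "real \<Rightarrow> real"
  assumes g: "integrable (time_measure T) g" and C: "\<And>l. l \<ge> l0 \<Longrightarrow> \<bar>LINT t|time_measure T. exp (l * (T - t)) * g t\<bar> \<le> C"
    and y: "y < T"
  shows "(LINT t|time_measure T. indicator {..<y} t * g t) = 0"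
proof -
  have gm[measurable]: "g \<in> borel_measurable (time_measure T)" using g by simp
  define \<delta> where "\<delta> = T - y"
  have \<delta>: "\<delta> > 0" using y by (simp add: \<delta>_def)
  define S where "S n = (LINT t|time_measure T. (1 - exp (- exp (real n * (y - t)))) * g t)" for n :: nat
  have C0: "C \<ge> 0" using C[of l0] by (auto intro: order_trans[OF abs_ge_zero])
  have bound: "\<bar>S n\<bar> \<le> C * (exp (exp (- (real n * \<delta>))) - 1)" if n: "real n \<ge> l0" "n > 0" for n
  proof -
    define E where "E K t = (\<Sum>k<K. (- exp (real n * (y - t))) ^ Suc k / fact (Suc k))" for K t
    have Em[measurable]: "E K \<in> borel_measurable (time_measure T)" for K
      unfolding E_def by (intro time_continuous_measurable continuous_intros) simp
    have "(\<lambda>K. LINT t|time_measure T. (- E K t) * g t) \<longlonglongrightarrow> S n"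
      unfolding S_def
    proof (rule integral_dominated_convergence[where w="\<lambda>t. exp (exp (real n * \<bar>y\<bar>)) * \<bar>g t\<bar>"])
      show "integrable (time_measure T) (\<lambda>t. exp (exp (real n * \<bar>y\<bar>)) * \<bar>g t\<bar>)" using g by auto
      show "AE t in time_measure T. norm (- E K t * g t) \<le> exp (exp (real n * \<bar>y\<bar>)) * \<bar>g t\<bar>" for K
      proof (rule AE_I2)
        fix t assume "t \<in> space (time_measure T)"
        then have t: "t > 0" by simp
        have "\<bar>E K t\<bar> \<le> exp (exp (real n * (y - t)))" unfolding E_def by (rule exp_partial_sum_bound) simp
        also have "\<dots> \<le> exp (exp (real n * \<bar>y\<bar>))" using t by (auto intro!: mult_left_mono)
        finally show "norm (- E K t * g t) \<le> exp (exp (real n * \<bar>y\<bar>)) * \<bar>g t\<bar>"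
          by (simp add: abs_mult mult_right_mono)
      qed
      show "AE t in time_measure T. (\<lambda>K. - E K t * g t) \<longlonglongrightarrow> (1 - exp (- exp (real n * (y - t)))) * g t"
      proof (rule AE_I2)
        fix t
        define x where "x = - exp (real n * (y - t))"
        have "(\<lambda>k. x ^ k / fact k) sums exp x"
          using exp_converges[of x] by (simp add: scaleR_conv_of_real divide_inverse mult.commute)
        then have "(\<lambda>k. x ^ Suc k / fact (Suc k)) sums (exp x - 1)" by (subst sums_Suc_iff) simp
        then have "(\<lambda>K. E K t) \<longlonglongrightarrow> exp x - 1" unfolding E_def x_def[symmetric] sums_def .
        then have "(\<lambda>K. - E K t * g t) \<longlonglongrightarrow> - (exp x - 1) * g t" by (intro tendsto_intros)
        then show "(\<lambda>K. - E K t * g t) \<longlonglongrightarrow> (1 - exp (- exp (real n * (y - t)))) * g t" by (simp add: x_def)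
      qed
      show "(\<lambda>t. (1 - exp (- exp (real n * (y - t)))) * g t) \<in> borel_measurable (time_measure T)"
        by (intro borel_measurable_times gm time_continuous_measurable continuous_intros)
    qed measurable
    moreover have "\<bar>LINT t|time_measure T. (- E K t) * g t\<bar> \<le> C * (exp (exp (- (real n * \<delta>))) - 1)" for K
    proof -
      define c where "c k = - ((-1) ^ Suc k * exp (- (real n * \<delta>)) ^ Suc k / fact (Suc k))" for k
      have split: "exp (real n * (y - t)) = exp (- (real n * \<delta>)) * exp (real n * (T - t))" for t
        by (simp add: \<delta>_def exp_add[symmetric] algebra_simps)
      have term_eq: "- ((- exp (real n * (y - t))) ^ Suc k / fact (Suc k)) = c k * exp (real (Suc k) * real n * (T - t))" for k t
      proof -
        have "exp (real n * (T - t)) ^ Suc k = exp (real (Suc k) * real n * (T - t))"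
          by (metis exp_of_nat_mult mult.assoc)
        moreover have "(- exp (real n * (y - t))) ^ Suc k = (-1) ^ Suc k * exp (- (real n * \<delta>)) ^ Suc k * exp (real n * (T - t)) ^ Suc k"
          unfolding split power_mult_distrib[symmetric] by simp
        ultimately show ?thesis by (simp add: c_def)
      qed
      have ig: "integrable (time_measure T) (\<lambda>t. exp (l * (T - t)) * g t)" for l
      proof -
        have "\<bar>exp (l * (T - t))\<bar> \<le> exp (\<bar>l\<bar> * T)" if "t \<in> {0<..<T}" for t
        proof -
          have "l * (T - t) \<le> \<bar>l\<bar> * (T - t)" using that by (intro mult_right_mono) auto
          also have "\<dots> \<le> \<bar>l\<bar> * T" using that by (intro mult_left_mono) auto
          finally show ?thesis by simp
        qed
        from integrable_mult_bounded_time[OF g _ this] show ?thesis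
          by (simp add: time_continuous_measurable continuous_intros)
      qed
      have "(LINT t|time_measure T. (- E K t) * g t) = (LINT t|time_measure T. (\<Sum>k<K. c k * (exp (real (Suc k) * real n * (T - t)) * g t)))"
        by (rule Bochner_Integration.integral_cong)
          (simp_all only: E_def sum_negf[symmetric] term_eq sum_distrib_right mult.assoc)
      also have "\<dots> = (\<Sum>k<K. c k * (LINT t|time_measure T. exp (real (Suc k) * real n * (T - t)) * g t))"
        using ig by (subst Bochner_Integration.integral_sum) auto
      finally have "\<bar>LINT t|time_measure T. (- E K t) * g t\<bar> \<le> (\<Sum>k<K. \<bar>c k * (LINT t|time_measure T. exp (real (Suc k) * real n * (T - t)) * g t)\<bar>)"
        by (simp only: sum_abs)
      also have "\<dots> \<le> (\<Sum>k<K. C * (exp (- (real n * \<delta>)) ^ Suc k / fact (Suc k)))"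
      proof (rule sum_mono)
        fix k
        have "real n \<le> real (Suc k) * real n"
          using mult_right_mono[of 1 "real (Suc k)" "real n"] by simp
        then have "l0 \<le> real (Suc k) * real n" using n(1) by linarith
        from C[OF this] have "\<bar>c k\<bar> * \<bar>LINT t|time_measure T. exp (real (Suc k) * real n * (T - t)) * g t\<bar> \<le> \<bar>c k\<bar> * C"
          by (intro mult_left_mono) auto
        moreover have "\<bar>c k\<bar> = exp (- (real n * \<delta>)) ^ Suc k / fact (Suc k)"
          by (simp add: c_def abs_mult power_abs)
        ultimately show "\<bar>c k * (LINT t|time_measure T. exp (real (Suc k) * real n * (T - t)) * g t)\<bar> \<le> C * (exp (- (real n * \<delta>)) ^ Suc k / fact (Suc k))"
          by (simp only: abs_mult mult.commute)
      qed
      also have "\<dots> = C * (\<Sum>k<K. exp (- (real n * \<delta>)) ^ Suc k / fact (Suc k))" by (simp only: sum_distrib_left)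
      also have "\<dots> \<le> C * (exp (exp (- (real n * \<delta>))) - 1)"
        by (intro mult_left_mono exp_partial_sum_bound(2) C0) simp
      finally show ?thesis .
    qed
    ultimately show ?thesis by (intro LIMSEQ_le_const2[OF tendsto_rabs]) auto
  qed
  have "S \<longlonglongrightarrow> 0"
  proof (rule Lim_null_comparison)
    obtain n0 :: nat where "real n0 \<ge> l0" using real_arch_simple by blast
    then show "\<forall>\<^sub>F n in sequentially. norm (S n) \<le> C * (exp (exp (- (real n * \<delta>))) - 1)"
      using bound by (intro eventually_sequentiallyI[of "max 1 n0"]) auto
    have "filterlim (\<lambda>n. real n * \<delta>) at_top sequentially"
      by (rule filterlim_at_top_mult_tendsto_pos[OF tendsto_const \<delta> filterlim_real_sequentially])
    then have "(\<lambda>n. exp (- (real n * \<delta>))) \<longlonglongrightarrow> 0"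
      by (intro filterlim_compose[OF exp_at_bot] filterlim_compose[OF filterlim_uminus_at_bot_at_top])
    then have "(\<lambda>n. C * (exp (exp (- (real n * \<delta>))) - 1)) \<longlonglongrightarrow> C * (exp 0 - 1)" by (intro tendsto_intros)
    then show "(\<lambda>n. C * (exp (exp (- (real n * \<delta>))) - 1)) \<longlonglongrightarrow> 0" by simp
  qed
  moreover have "S \<longlonglongrightarrow> (LINT t|time_measure T. indicator {..<y} t * g t)"
    unfolding S_def
  proof (rule integral_dominated_convergence[where w="\<lambda>t. \<bar>g t\<bar>"])
    show "integrable (time_measure T) (\<lambda>t. \<bar>g t\<bar>)" using g by auto
    show "AE t in time_measure T. norm ((1 - exp (- exp (real n * (y - t)))) * g t) \<le> \<bar>g t\<bar>" for n
    proof (rule AE_I2)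
      fix t
      have "\<bar>1 - exp (- exp (real n * (y - t)))\<bar> \<le> 1" by simp
      then show "norm ((1 - exp (- exp (real n * (y - t)))) * g t) \<le> \<bar>g t\<bar>"
        unfolding real_norm_def abs_mult by (rule mult_left_le_one_le[OF abs_ge_zero abs_ge_zero])
    qed
    show "(\<lambda>t. (1 - exp (- exp (real n * (y - t)))) * g t) \<in> borel_measurable (time_measure T)" for n
      by (intro borel_measurable_times gm time_continuous_measurable continuous_intros)
    have "{..<y} \<in> sets lebesgue" by simp
    then show "(\<lambda>t. indicator {..<y} t * g t) \<in> borel_measurable (time_measure T)"
      by (intro borel_measurable_times gm measurable_restrict_space1 borel_measurable_indicator)
    have "AE t in lebesgue. t \<notin> {y}" by (rule AE_not_in) simp
    then have "AE t in time_measure T. t \<notin> {y}" by (subst AE_restrict_space_iff) auto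
    then show "AE t in time_measure T. (\<lambda>n. (1 - exp (- exp (real n * (y - t)))) * g t) \<longlonglongrightarrow> indicator {..<y} t * g t"
    proof eventually_elim
      case (elim t)
      consider "t < y" | "t > y" using elim by fastforce
      then have "(\<lambda>n. 1 - exp (- exp (real n * (y - t)))) \<longlonglongrightarrow> indicator {..<y} t"
      proof cases
        case 1
        then have "filterlim (\<lambda>n. real n * (y - t)) at_top sequentially"
          by (intro filterlim_at_top_mult_tendsto_pos[OF tendsto_const _ filterlim_real_sequentially]) auto
        then have "(\<lambda>n. exp (- exp (real n * (y - t)))) \<longlonglongrightarrow> 0"
          by (intro filterlim_compose[OF exp_at_bot] filterlim_compose[OF filterlim_uminus_at_bot_at_top] filterlim_compose[OF exp_at_top])
        then have "(\<lambda>n. 1 - exp (- exp (real n * (y - t)))) \<longlonglongrightarrow> 1 - 0" by (intro tendsto_intros)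
        then show ?thesis using 1 by simp
      next
        case 2
        have "filterlim (\<lambda>n. real n * (t - y)) at_top sequentially"
          using 2 by (intro filterlim_at_top_mult_tendsto_pos[OF tendsto_const _ filterlim_real_sequentially]) auto
        then have "(\<lambda>n. exp (- (real n * (t - y)))) \<longlonglongrightarrow> 0"
          by (intro filterlim_compose[OF exp_at_bot] filterlim_compose[OF filterlim_uminus_at_bot_at_top])
        moreover have "- (real n * (t - y)) = real n * (y - t)" for n by (simp add: algebra_simps)
        ultimately have "(\<lambda>n. exp (real n * (y - t))) \<longlonglongrightarrow> 0" by simp
        then have "(\<lambda>n. 1 - exp (- exp (real n * (y - t)))) \<longlonglongrightarrow> 1 - exp (- 0)" by (intro tendsto_intros)
        then show ?thesis using 2 by simp
      qed
      then show ?case by (intro tendsto_intros)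
    qed
  qed
  ultimately show ?thesis by (rule LIMSEQ_unique[symmetric])
qed

text \<open>Half-lines generate the Borel sets and are stable under intersection.\<close>

lemma zero_integrals_imp_AE_zero:
  fixes g :: "real \<Rightarrow> real"
  assumes g: "integrable (time_measure T) g" and T: "T > 0"
    and z: "\<And>y. y < T \<Longrightarrow> (LINT t|time_measure T. indicator {..<y} t * g t) = 0"
  shows "AE t in time_measure T. g t = 0"
proof (rule sigma_finite_measure.density_zero[OF sigma_finite_time g])
  have gm[measurable]: "g \<in> borel_measurable (time_measure T)" using g by simp
  have im: "A \<in> sets lebesgue \<Longrightarrow> indicator A \<in> borel_measurable (time_measure T)" for A :: "real set"
    by (intro measurable_restrict_space1 borel_measurable_indicator)
  have ig: "integrable (time_measure T) (\<lambda>t. indicator A t * g t)" if "A \<in> sets lebesgue" for A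
    using integrable_mult_bounded_time[OF g im[OF that], of 1] by (simp add: indicator_def)
  define I where "I A = (LINT t|time_measure T. indicator A t * g t)" for A
  have total: "I UNIV = 0"
  proof -
    have lim: "(\<lambda>n. I {..<T - 1 / real (Suc n)}) \<longlonglongrightarrow> I UNIV"
      unfolding I_def
    proof (rule integral_dominated_convergence[where w="\<lambda>t. \<bar>g t\<bar>"])
      show "AE t in time_measure T. (\<lambda>n. indicator {..<T - 1 / real (Suc n)} t * g t) \<longlonglongrightarrow> indicator UNIV t * g t"
      proof (rule AE_I2)
        fix t assume "t \<in> space (time_measure T)"
        then have "T - t > 0" by simp
        then obtain n where n: "1 / real (Suc n) < T - t" using nat_approx_posE by blast
        have "indicator {..<T - 1 / real (Suc m)} t * g t = indicator UNIV t * g t" if "m \<ge> n" for m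
        proof -
          have "1 / real (Suc m) \<le> 1 / real (Suc n)" using that by (intro frac_le) auto
          then show ?thesis using n by (simp add: indicator_def)
        qed
        then show "(\<lambda>n. indicator {..<T - 1 / real (Suc n)} t * g t) \<longlonglongrightarrow> indicator UNIV t * g t"
          by (intro tendsto_eventually eventually_sequentiallyI)
      qed
      show "(\<lambda>t. indicator {..<T - 1 / real (Suc n)} t * g t) \<in> borel_measurable (time_measure T)" for n
        by (intro borel_measurable_times gm im) simp
      show "AE t in time_measure T. norm (indicator {..<T - 1 / real (Suc n)} t * g t) \<le> \<bar>g t\<bar>" for n
        by (simp add: indicator_def)
    qed (use g in auto)
    have z': "I {..<T - 1 / real (Suc n)} = 0" for n unfolding I_def by (rule z) simp
    have "(\<lambda>n. 0) \<longlonglongrightarrow> I UNIV" using lim unfolding z' .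
    then show ?thesis by (simp add: LIMSEQ_const_iff)
  qed
  have borel: "I A = 0" if "A \<in> sets borel" for A
  proof -
    have A: "A \<in> sigma_sets UNIV (range lessThan)" using that by (simp add: borel_Iio)
    have st: "Int_stable (range lessThan :: real set set)"
    proof (rule Int_stableI)
      fix A B :: "real set" assume "A \<in> range lessThan" "B \<in> range lessThan"
      then obtain a b where "A = {..<a}" "B = {..<b}" by auto
      then have "A \<inter> B = {..<min a b}" by auto
      then show "A \<inter> B \<in> range lessThan" by blast
    qed
    have sub: "range lessThan \<subseteq> Pow (UNIV :: real set)" by simp
    from st sub A have "A \<in> sets lebesgue \<and> I A = 0"
    proof (induction rule: sigma_sets_induct_disjoint)
      case (basic A)
      then obtain y where y: "A = {..<y}" by auto
      show ?case
      proof (cases "y < T")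
        case True
        then show ?thesis using z[OF True] y by (simp add: I_def)
      next
        case False
        have "I A = I UNIV"
          unfolding I_def y by (rule Bochner_Integration.integral_cong) (use False in \<open>auto simp: indicator_def\<close>)
        then show ?thesis using total y by simp
      qed
    next
      case empty
      show ?case by (simp add: I_def)
    next
      case (compl A)
      have "I (UNIV - A) = I UNIV - I A"
      proof -
        have "indicator (UNIV - A) t * g t = indicator UNIV t * g t - indicator A t * g t" for t
          by (simp add: indicator_def)
        moreover have "integrable (time_measure T) (\<lambda>t. indicator UNIV t * g t)" by (rule ig) simp
        ultimately show ?thesis
          unfolding I_def using ig[of A] compl by (simp only: Bochner_Integration.integral_diff)
      qed
      then show ?case using compl total by (auto simp: Compl_eq_Diff_UNIV[symmetric] Compl_in_sets_lebesgue)
    next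
      case (union F)
      have F: "F i \<in> sets lebesgue" "I (F i) = 0" for i using union by auto
      have U: "(\<Union>i. F i) \<in> sets lebesgue" using F(1) by auto
      have part: "I (\<Union>i<n. F i) = 0" for n
      proof (induction n)
        case 0
        then show ?case by (simp add: I_def)
      next
        case (Suc n)
        have "F i \<inter> F n = {}" if "i < n" for i using union(1) that by (auto simp: disjoint_family_on_def)
        then have d: "(\<Union>i<n. F i) \<inter> F n = {}" by auto
        have Un: "(\<Union>i<n. F i) \<in> sets lebesgue" using F(1) by auto
        have "indicator (\<Union>i<Suc n. F i) t * g t = indicator (\<Union>i<n. F i) t * g t + indicator (F n) t * g t" for t
        proof -
          have "(\<Union>i<Suc n. F i) = (\<Union>i<n. F i) \<union> F n" by (auto simp: lessThan_Suc)
          then show ?thesis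
            using d by (cases "t \<in> F n"; cases "t \<in> (\<Union>i<n. F i)") (auto simp: indicator_def)
        qed
        then have "I (\<Union>i<Suc n. F i) = I (\<Union>i<n. F i) + I (F n)"
          unfolding I_def using ig[OF Un] ig[OF F(1)] by simp
        then show ?case using Suc F(2) by simp
      qed
      have "(\<lambda>n. I (\<Union>i<n. F i)) \<longlonglongrightarrow> I (\<Union>i. F i)"
        unfolding I_def
      proof (rule integral_dominated_convergence[where w="\<lambda>t. \<bar>g t\<bar>"])
        show "AE t in time_measure T. (\<lambda>n. indicator (\<Union>i<n. F i) t * g t) \<longlonglongrightarrow> indicator (\<Union>i. F i) t * g t"
        proof (rule AE_I2, intro tendsto_intros)
          fix t
          show "(\<lambda>n. indicator (\<Union>i<n. F i) t :: real) \<longlonglongrightarrow> indicator (\<Union>i. F i) t"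
            by (rule LIMSEQ_indicator_UN)
        qed
        show "(\<lambda>t. indicator (\<Union>i<n. F i) t * g t) \<in> borel_measurable (time_measure T)" for n
          by (intro borel_measurable_times gm im) (use F(1) in auto)
        show "(\<lambda>t. indicator (\<Union>i. F i) t * g t) \<in> borel_measurable (time_measure T)"
          by (intro borel_measurable_times gm im U)
      qed (use g in \<open>auto simp: indicator_def\<close>)
      then have "I (\<Union>i. F i) = 0" unfolding part by (simp add: LIMSEQ_const_iff)
      then show ?case using U by simp
    qed
    then show ?thesis by simp
  qed
  fix A assume "A \<in> sets (time_measure T)"
  then have A: "A \<in> sets lebesgue" by (auto simp: sets_restrict_space)
  obtain B N where BN: "B \<in> sets borel" "N \<in> null_sets lebesgue" "A = B \<union> N" "B \<inter> N = {}"
  proof -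
    have "main_part lborel A \<in> sets borel" "main_part lborel A \<union> null_part lborel A = A" "main_part lborel A \<inter> null_part lborel A = {}"
      using main_part_sets[OF A] main_part_null_part_Un[OF A] main_part_null_part_Int[OF A] by auto
    moreover have "null_part lborel A \<in> null_sets lebesgue"
      using null_part[OF A] by (auto intro: completion.complete2 null_sets_completionI)
    ultimately show ?thesis using that by metis
  qed
  have "AE t in lebesgue. t \<notin> N" using BN(2) by (rule AE_not_in)
  then have N: "AE t in time_measure T. t \<notin> N" by (subst AE_restrict_space_iff) auto
  have Bl: "B \<in> sets lebesgue" using BN(1) by auto
  have "I A = I B"
    unfolding I_def
  proof (rule integral_cong_AE)
    show "AE t in time_measure T. indicator A t * g t = indicator B t * g t"
      using N by eventually_elim (simp add: BN(3) indicator_def)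
  qed (intro borel_measurable_times gm im A Bl)+
  then have "I A = 0" using borel[OF BN(1)] by simp
  then show "set_lebesgue_integral (time_measure T) A g = 0" by (simp add: I_def set_lebesgue_integral_def)
qed

text \<open>Multiplied by \<open>exp (l * T)\<close>, the finite Laplace transform of \<open>g\<close> is the moment below; that it is
  bounded says that the transform is as small as if \<open>g\<close> were supported at the end point \<open>T\<close>.\<close>

theorem bounded_exp_moments_imp_AE_zero:
  fixes g :: "real \<Rightarrow> real"
  assumes "integrable (time_measure T) g" "T > 0"
    "\<And>l. l \<ge> l0 \<Longrightarrow> \<bar>LINT t|time_measure T. exp (l * (T - t)) * g t\<bar> \<le> C"
  shows "AE t in time_measure T. g t = 0"
  by (rule zero_integrals_imp_AE_zero[OF assms(1,2) exp_moments_bounded_imp_zero_integral[OF assms(1,3)]])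

section \<open>The Laplace transform of a fractional integral\<close>

text \<open>The kernel of the fractional integral times the exponential, on the whole line.\<close>

definition laplace_kernel :: "real \<Rightarrow> real \<Rightarrow> real \<Rightarrow> real" where
  "laplace_kernel \<alpha> l r = (if r > 0 then exp (- (l * r)) * (r powr (\<alpha> - 1) / Gamma \<alpha>) else 0)"

lemma laplace_kernel_nonneg: "\<alpha> > 0 \<Longrightarrow> laplace_kernel \<alpha> l r \<ge> 0"
  by (simp add: laplace_kernel_def Gamma_real_pos less_imp_le)

text \<open>Euler's integral for \<open>Gamma \<alpha>\<close>, after scaling by \<open>l\<close>.\<close>

lemma has_bochner_integral_laplace_kernel:
  assumes \<alpha>: "\<alpha> > 0" and l: "l > 0"
  shows "has_bochner_integral lborel (laplace_kernel \<alpha> l) (l powr (- \<alpha>))"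
proof -
  have G: "Gamma \<alpha> > 0" by (rule Gamma_real_pos[OF \<alpha>])
  define f where "f t = t powr (\<alpha> - 1) / exp t" for t :: real
  define h where "h t = ennreal (f t) * indicator {0..} t" for t :: real
  have hm: "h \<in> borel_measurable borel" unfolding h_def f_def by measurable
  have nn: "(\<integral>\<^sup>+t. h t \<partial>lborel) = ennreal (Gamma \<alpha>)"
    unfolding h_def f_def by (rule nn_integral_has_integral_lebesgue'[OF _ Gamma_integral_real[OF \<alpha>]]) simp
  have "ennreal l * (\<integral>\<^sup>+r. h (l * r) \<partial>lborel) = ennreal (Gamma \<alpha>)"
    using nn_integral_real_affine[OF hm, of l 0] nn l by simp
  moreover have "(\<integral>\<^sup>+r. h (l * r) \<partial>lborel) = (\<integral>\<^sup>+r. ennreal (l powr (\<alpha> - 1) * Gamma \<alpha>) * ennreal (laplace_kernel \<alpha> l r) \<partial>lborel)"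
  proof (rule nn_integral_cong)
    fix r :: real
    show "h (l * r) = ennreal (l powr (\<alpha> - 1) * Gamma \<alpha>) * ennreal (laplace_kernel \<alpha> l r)"
    proof (cases "r > 0")
      case True
      then have "f (l * r) = (l powr (\<alpha> - 1) * Gamma \<alpha>) * laplace_kernel \<alpha> l r"
        using l G by (simp add: f_def laplace_kernel_def powr_mult exp_minus field_simps)
      then show ?thesis using True l G laplace_kernel_nonneg[OF \<alpha>] by (simp add: h_def ennreal_mult)
    next
      case False
      then show ?thesis using l by (cases "r = 0") (auto simp: h_def f_def laplace_kernel_def indicator_def zero_le_mult_iff)
    qed
  qed
  moreover have lm: "laplace_kernel \<alpha> l \<in> borel_measurable borel" unfolding laplace_kernel_def by measurable
  ultimately have "ennreal l * (ennreal (l powr (\<alpha> - 1) * Gamma \<alpha>) * (\<integral>\<^sup>+r. ennreal (laplace_kernel \<alpha> l r) \<partial>lborel)) = ennreal (Gamma \<alpha>)"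
    by (simp add: nn_integral_cmult)
  moreover have "l * l powr (\<alpha> - 1) = l powr \<alpha>" using l by (simp add: powr_diff)
  ultimately have eq: "ennreal (l powr \<alpha> * Gamma \<alpha>) * (\<integral>\<^sup>+r. ennreal (laplace_kernel \<alpha> l r) \<partial>lborel) = ennreal (Gamma \<alpha>)"
    using l G by (simp add: mult.assoc[symmetric] ennreal_mult[symmetric])
  have pos: "l powr \<alpha> * Gamma \<alpha> > 0" using l G by simp
  have "(\<integral>\<^sup>+r. ennreal (laplace_kernel \<alpha> l r) \<partial>lborel) = ennreal (1 / (l powr \<alpha> * Gamma \<alpha>)) * (ennreal (l powr \<alpha> * Gamma \<alpha>) * (\<integral>\<^sup>+r. ennreal (laplace_kernel \<alpha> l r) \<partial>lborel))"
    using pos l G by (simp add: mult.assoc[symmetric] ennreal_mult[symmetric])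
  also have "\<dots> = ennreal (1 / (l powr \<alpha> * Gamma \<alpha>)) * ennreal (Gamma \<alpha>)" unfolding eq ..
  also have "\<dots> = ennreal (1 / (l powr \<alpha> * Gamma \<alpha>) * Gamma \<alpha>)"
    by (rule ennreal_mult[symmetric]) (use pos G in auto)
  also have "1 / (l powr \<alpha> * Gamma \<alpha>) * Gamma \<alpha> = l powr (- \<alpha>)"
    using G by (simp add: powr_minus_divide)
  finally show ?thesis
    by (intro has_bochner_integral_nn_integral) (use lm laplace_kernel_nonneg[OF \<alpha>] in auto)
qed

lemma laplace_kernel_shift:
  assumes \<alpha>: "\<alpha> > 0" and l: "l > 0"
  shows "has_bochner_integral lborel (\<lambda>t. laplace_kernel \<alpha> l (t - s)) (l powr (- \<alpha>))"
  using has_bochner_integral_laplace_kernel[OF assms]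
  by (subst (asm) lborel_has_bochner_integral_real_affine_iff[of 1 _ _ "- s"]) simp_all

text \<open>Cutting the Laplace integral of the kernel at \<open>T\<close> loses at most \<open>exp (- l * T)\<close> times the full
  integral: the kernel decreases, so past \<open>T\<close> it lies below its translate that starts at \<open>T\<close>.\<close>

lemma truncated_laplace_kernel:
  assumes \<alpha>: "0 < \<alpha>" "\<alpha> < 1" and l: "l > 0" and s: "s \<in> {0<..<T}"
  shows "\<bar>exp (- (l * s)) * l powr (- \<alpha>) - (LINT t|time_measure T. exp (- (l * t)) * frac_kernel \<alpha> t s)\<bar>
     \<le> exp (- (l * T)) * l powr (- \<alpha>)"
proof -
  have G: "Gamma \<alpha> > 0" by (rule Gamma_real_pos[OF \<alpha>(1)])
  define k where "k t = exp (- (l * s)) * laplace_kernel \<alpha> l (t - s)" for t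
  define k' where "k' t = exp (- (l * T)) * laplace_kernel \<alpha> l (t - T)" for t
  have k: "has_bochner_integral lborel k (exp (- (l * s)) * l powr (- \<alpha>))"
    unfolding k_def by (rule has_bochner_integral_mult_right[OF laplace_kernel_shift[OF \<alpha>(1) l]])
  have k': "has_bochner_integral lborel k' (exp (- (l * T)) * l powr (- \<alpha>))"
    unfolding k'_def by (rule has_bochner_integral_mult_right[OF laplace_kernel_shift[OF \<alpha>(1) l]])
  have ik: "integrable lborel k" "integrable lborel k'" using k k' by (auto simp: has_bochner_integral_iff)
  have keq: "k t = exp (- (l * t)) * frac_kernel \<alpha> t s" for t
    by (simp add: k_def laplace_kernel_def frac_kernel_def exp_add[symmetric] algebra_simps)
  have k'eq: "k' t = exp (- (l * t)) * frac_kernel \<alpha> t T" for t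
    by (simp add: k'_def laplace_kernel_def frac_kernel_def exp_add[symmetric] algebra_simps)
  have "(LINT t|time_measure T. exp (- (l * t)) * frac_kernel \<alpha> t s) = (LINT t|lebesgue. indicator {0<..<T} t * k t)"
    by (subst integral_restrict_space) (auto simp: keq)
  also have "\<dots> = (LINT t|lborel. indicator {0<..<T} t * k t)"
    by (rule integral_completion) (use ik in measurable)
  finally have 1: "(LINT t|time_measure T. exp (- (l * t)) * frac_kernel \<alpha> t s) = (LINT t|lborel. indicator {0<..<T} t * k t)" .
  have i1: "integrable lborel (\<lambda>t. indicator {0<..<T} t * k t)"
    using integrable_mult_indicator[OF _ ik(1), of "{0<..<T}"] by simp
  have knn: "k t \<ge> 0" "k' t \<ge> 0" for t using laplace_kernel_nonneg[OF \<alpha>(1)] by (simp_all add: k_def k'_def)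
  have "exp (- (l * s)) * l powr (- \<alpha>) - (LINT t|lborel. indicator {0<..<T} t * k t) = (LINT t|lborel. k t - indicator {0<..<T} t * k t)"
    using k i1 ik by (simp add: has_bochner_integral_iff)
  moreover have "0 \<le> (LINT t|lborel. k t - indicator {0<..<T} t * k t)"
    by (rule integral_nonneg_AE) (use knn in \<open>auto simp: indicator_def\<close>)
  moreover have "(LINT t|lborel. k t - indicator {0<..<T} t * k t) \<le> (LINT t|lborel. k' t)"
  proof (rule integral_mono_AE)
    have "AE t in lborel. t \<noteq> T" by (rule AE_lborel_singleton)
    then show "AE t in lborel. k t - indicator {0<..<T} t * k t \<le> k' t"
    proof eventually_elim
      case (elim t)
      consider "t \<le> 0" | "0 < t" "t < T" | "t > T" using elim by linarith
      then show ?case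
      proof cases
        case 1
        then show ?thesis using s knn(2)[of t] by (simp add: k_def laplace_kernel_def)
      next
        case 2
        then show ?thesis using knn(2)[of t] by simp
      next
        case 3
        \<comment> \<open>the exponent \<open>\<alpha> - 1\<close> is negative\<close>
        have "(t - s) powr (\<alpha> - 1) \<le> (t - T) powr (\<alpha> - 1)"
          using 3 s \<alpha> by (intro powr_mono2') auto
        then have "frac_kernel \<alpha> t s \<le> frac_kernel \<alpha> t T"
          using 3 s G by (auto simp: frac_kernel_def intro!: divide_right_mono)
        then show ?thesis using 3 by (simp add: keq k'eq)
      qed
    qed
  qed (use ik i1 in auto)
  moreover have "(LINT t|lborel. k' t) = exp (- (l * T)) * l powr (- \<alpha>)" using k' by (simp add: has_bochner_integral_iff)
  ultimately show ?thesis unfolding 1 by linarith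
qed

text \<open>By Fubini's theorem both integrals are integrals of \<open>w\<close>, against the full and the truncated Laplace
  transform of the kernel.\<close>

lemma laplace_frac_int:
  fixes w :: "real \<Rightarrow> real"
  assumes \<alpha>: "0 < \<alpha>" "\<alpha> < 1" and l: "l > 0" and w: "sq_norm_integrable T w"
  shows "\<bar>l powr (- \<alpha>) * (LINT s|time_measure T. exp (- (l * s)) * w s) - (LINT t|time_measure T. exp (- (l * t)) * frac_int \<alpha> w t)\<bar>
     \<le> exp (- (l * T)) * l powr (- \<alpha>) * (LINT s|time_measure T. \<bar>w s\<bar>)"
proof -
  interpret pair_sigma_finite "time_measure T" "time_measure T"
    by (simp add: pair_sigma_finite_def sigma_finite_time)
  note frac_kernel_measurable2[measurable] frac_kernel_measurable[measurable]
  have wm[measurable]: "w \<in> borel_measurable (time_measure T)" using w by (simp add: sq_norm_integrable_def)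
  have wi: "integrable (time_measure T) w" by (rule sq_norm_integrable_imp_integrable[OF w])
  have em[measurable]: "(\<lambda>t. exp (- (l * t))) \<in> borel_measurable (time_measure T)"
    by (intro time_continuous_measurable continuous_intros)
  have wi2: "integrable (time_measure T) (\<lambda>s. exp (- (l * s)) * w s)"
    using integrable_mult_bounded_time[OF wi em, of 1] l by simp
  define F where "F t s = exp (- (l * t)) * (frac_kernel \<alpha> t s * w s)" for t s
  have Fm[measurable]: "case_prod F \<in> borel_measurable (time_measure T \<Otimes>\<^sub>M time_measure T)"
    unfolding F_def[abs_def] by measurable
  have Fi: "integrable (time_measure T \<Otimes>\<^sub>M time_measure T) (case_prod F)"
  proof (rule integrableI_bounded[OF Fm])
    have "(\<integral>\<^sup>+p. ennreal (norm (case_prod F p)) \<partial>(time_measure T \<Otimes>\<^sub>M time_measure T))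
       = (\<integral>\<^sup>+t. \<integral>\<^sup>+s. ennreal (norm (F t s)) \<partial>time_measure T \<partial>time_measure T)"
      by (subst M1.nn_integral_fst[symmetric]) (auto simp: case_prod_beta')
    also have "\<dots> \<le> (\<integral>\<^sup>+t. \<integral>\<^sup>+s. ennreal (frac_kernel \<alpha> t s) * ennreal \<bar>w s\<bar> \<partial>time_measure T \<partial>time_measure T)"
    proof (intro nn_integral_mono)
      fix t s assume "t \<in> space (time_measure T)"
      then have "exp (- (l * t)) \<le> 1" using l by simp
      then have "exp (- (l * t)) * (frac_kernel \<alpha> t s * \<bar>w s\<bar>) \<le> frac_kernel \<alpha> t s * \<bar>w s\<bar>"
        using frac_kernel_nonneg[OF \<alpha>(1), of t s] by (intro mult_left_le_one_le) auto
      then have "norm (F t s) \<le> frac_kernel \<alpha> t s * \<bar>w s\<bar>"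
        using frac_kernel_nonneg[OF \<alpha>(1), of t s] unfolding F_def by (simp add: abs_mult)
      then show "ennreal (norm (F t s)) \<le> ennreal (frac_kernel \<alpha> t s) * ennreal \<bar>w s\<bar>"
        using frac_kernel_nonneg[OF \<alpha>(1), of t s] by (simp add: ennreal_mult[symmetric] ennreal_leI)
    qed
    also have "\<dots> \<le> ennreal (frac_const \<alpha> T) * (\<integral>\<^sup>+s. ennreal \<bar>w s\<bar> \<partial>time_measure T)"
      by (rule frac_young[OF \<alpha>(1)]) measurable
    also have "\<dots> < \<infinity>" using wi by (auto simp: integrable_iff_bounded ennreal_mult_less_top)
    finally show "(\<integral>\<^sup>+p. ennreal (norm (case_prod F p)) \<partial>(time_measure T \<Otimes>\<^sub>M time_measure T)) < \<infinity>" .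
  qed
  define g where "g s = (LINT t|time_measure T. exp (- (l * t)) * frac_kernel \<alpha> t s)" for s
  have gw: "(LINT t|time_measure T. F t s) = g s * w s" for s
    unfolding F_def g_def by (subst Bochner_Integration.integral_mult_left_zero[symmetric]) (simp add: mult.assoc)
  have gi: "integrable (time_measure T) (\<lambda>s. g s * w s)"
    using integrable_snd[OF Fi] by (simp add: gw)
  have "(LINT t|time_measure T. exp (- (l * t)) * frac_int \<alpha> w t) = (LINT t|time_measure T. LINT s|time_measure T. F t s)"
    by (rule Bochner_Integration.integral_cong) (simp_all add: F_def frac_int_eq_kernel[OF wm])
  also have "\<dots> = (LINT s|time_measure T. LINT t|time_measure T. F t s)"
    by (rule Fubini_integral[symmetric, OF Fi])
  also have "\<dots> = (LINT s|time_measure T. g s * w s)" by (simp add: gw)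
  finally have "l powr (- \<alpha>) * (LINT s|time_measure T. exp (- (l * s)) * w s) - (LINT t|time_measure T. exp (- (l * t)) * frac_int \<alpha> w t)
     = (LINT s|time_measure T. l powr (- \<alpha>) * (exp (- (l * s)) * w s) - g s * w s)"
    using wi2 gi by simp
  also have "\<bar>\<dots>\<bar> \<le> (LINT s|time_measure T. exp (- (l * T)) * l powr (- \<alpha>) * \<bar>w s\<bar>)"
  proof (rule order_trans[OF integral_abs_bound integral_mono_AE])
    show "AE s in time_measure T. \<bar>l powr (- \<alpha>) * (exp (- (l * s)) * w s) - g s * w s\<bar> \<le> exp (- (l * T)) * l powr (- \<alpha>) * \<bar>w s\<bar>"
    proof (rule AE_I2)
      fix s assume "s \<in> space (time_measure T)"
      then have "s \<in> {0<..<T}" by simp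
      from mult_right_mono[OF truncated_laplace_kernel[OF \<alpha> l this], of "\<bar>w s\<bar>"]
      show "\<bar>l powr (- \<alpha>) * (exp (- (l * s)) * w s) - g s * w s\<bar> \<le> exp (- (l * T)) * l powr (- \<alpha>) * \<bar>w s\<bar>"
        by (simp add: g_def abs_mult[symmetric] algebra_simps)
    qed
  qed (use wi wi2 gi in auto)
  finally show ?thesis by simp
qed

section \<open>Vanishing of the source\<close>

lemma hspace_model_real:
  assumes "T > 0" "\<alpha> > 0"
  shows "hspace_model real_space UNIV (\<lambda>x. x) T \<alpha>"
  by (rule hspace_model.intro) (use assms in \<open>simp_all add: real_space_def bounded_linear_ident\<close>)

lemma hspace_model_L2:
  assumes "T > 0" "\<alpha> > 0" "open \<Omega>"
  shows "hspace_model (L2_space \<Omega>) (L2_on \<Omega>) (\<lambda>x. x) T \<alpha>"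
proof -
  have "\<Omega> \<in> sets lebesgue" using assms(3) by auto
  then show ?thesis
    using assms(1,2)
    by (intro hspace_model.intro) (simp_all add: L2_space_def bounded_linear_ident subspace_L2_on closed_L2_on)
qed

lemma hspace_model_H2_H10:
  assumes "T > 0" "\<alpha> > 0" "open \<Omega>"
  shows "hspace_model (H2_H10_space \<Omega>) (H2_graph \<Omega>) fst T \<alpha>"
proof -
  have "\<Omega> \<in> sets lebesgue" using assms(3) by auto
  then show ?thesis
    using assms
    by (intro hspace_model.intro)
      (simp_all add: H2_H10_space_def bounded_linear_fst subspace_H2_graph closed_H2_graph H2_H10_eq_graph H2_norm_eq_graph)
qed

lemma valued_in_bounded_linear:
  assumes A: "bounded_linear A" and z: "z \<in> valued_in T V" and V': "\<And>v. v \<in> V \<Longrightarrow> A v \<in> V'"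
  shows "(\<lambda>t. A (z t)) \<in> valued_in T V'"
proof -
  interpret A: bounded_linear A by (rule A)
  obtain K where K: "\<And>v. norm (A v) \<le> norm v * K" using A.bounded by blast
  have zs: "sq_norm_integrable T z" using z by (simp add: valued_in_def)
  have "A \<in> borel_measurable borel"
    by (intro borel_measurable_continuous_onI linear_continuous_on A)
  then have "(\<lambda>t. A (z t)) \<in> borel_measurable (time_measure T)"
    using zs by (auto simp: sq_norm_integrable_def intro: measurable_compose)
  then have "sq_norm_integrable T (\<lambda>t. A (z t))"
    by (rule sq_norm_integrable_bound[OF zs, of _ K]) (use K in \<open>simp add: mult.commute\<close>)
  then show ?thesis using z V' by (simp add: valued_in_def)
qed

lemma exp_time_bound:
  assumes "l \<ge> (0::real)" "t \<in> {0<..<T}"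
  shows "\<bar>exp (- (l * t))\<bar> \<le> 1"
  using mult_nonneg_nonneg[of l t] assms by simp

lemma exp_time_measurable: "(\<lambda>t. exp (- (l * t))) \<in> borel_measurable (time_measure T)"
  by (intro time_continuous_measurable continuous_intros)

lemma integrable_laplace:
  assumes "l \<ge> 0" "sq_norm_integrable T w"
  shows "integrable (time_measure T) (\<lambda>t. exp (- (l * t)) *\<^sub>R w t)"
  by (rule integrable_mult_bounded_time[OF sq_norm_integrable_imp_integrable[OF assms(2)] exp_time_measurable exp_time_bound[OF assms(1)]])

text \<open>The scalar product of the truncation error with a vector is the truncation error of a scalar
  function; the vector to take is the error itself.\<close>

lemma laplace_frac_int_vector:
  fixes w v :: "real \<Rightarrow> 'a::{real_inner, banach, second_countable_topology}"
  assumes \<alpha>: "0 < \<alpha>" "\<alpha> < 1" and l: "l > 0" and w: "sq_norm_integrable T w" and v: "sq_norm_integrable T v"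
    and vw: "AE t in time_measure T. v t = frac_int \<alpha> w t"
  shows "norm (l powr (- \<alpha>) *\<^sub>R (LINT s|time_measure T. exp (- (l * s)) *\<^sub>R w s) - (LINT t|time_measure T. exp (- (l * t)) *\<^sub>R v t))
     \<le> exp (- (l * T)) * l powr (- \<alpha>) * (LINT s|time_measure T. norm (w s))"
    (is "norm ?R \<le> ?B")
proof (cases "?R = 0")
  case True
  have "0 \<le> ?B" by (intro mult_nonneg_nonneg integral_nonneg_AE) auto
  then show ?thesis using True by simp
next
  case False
  have bl: "bounded_linear (\<lambda>x. inner x \<xi>)" for \<xi> :: 'a by (rule bounded_linear_inner_left)
  have l0: "l \<ge> 0" using l by simp
  have wi: "integrable (time_measure T) w" by (rule sq_norm_integrable_imp_integrable[OF w])
  define \<xi> where "\<xi> = ?R"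
  define y where "y t = inner (w t) \<xi>" for t
  have ys: "sq_norm_integrable T y"
    using valued_in_bounded_linear[OF bl[of \<xi>], of w T UNIV UNIV] w by (simp add: valued_in_def y_def[abs_def])
  have wm: "w \<in> borel_measurable (time_measure T)" using w by (simp add: sq_norm_integrable_def)
  have vm: "v \<in> borel_measurable (time_measure T)" using v by (simp add: sq_norm_integrable_def)
  have Jm: "frac_int \<alpha> y \<in> borel_measurable (time_measure T)"
    using sq_norm_integrable_frac_int(1)[OF \<alpha>(1) ys] by (simp add: sq_norm_integrable_def)
  have 1: "inner (LINT s|time_measure T. exp (- (l * s)) *\<^sub>R w s) \<xi> = (LINT s|time_measure T. exp (- (l * s)) * y s)"
    by (subst integral_bounded_linear[OF bl integrable_laplace[OF l0 w], symmetric]) (simp add: y_def)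
  have "inner (LINT t|time_measure T. exp (- (l * t)) *\<^sub>R v t) \<xi> = (LINT t|time_measure T. exp (- (l * t)) * inner (v t) \<xi>)"
    by (subst integral_bounded_linear[OF bl integrable_laplace[OF l0 v], symmetric]) simp
  also have "\<dots> = (LINT t|time_measure T. exp (- (l * t)) * frac_int \<alpha> y t)"
  proof (rule integral_cong_AE)
    show "AE t in time_measure T. exp (- (l * t)) * inner (v t) \<xi> = exp (- (l * t)) * frac_int \<alpha> y t"
      using vw frac_int_bounded_linear[OF bl \<alpha>(1) w, of \<xi>] by eventually_elim (simp add: y_def[abs_def])
    show "(\<lambda>t. exp (- (l * t)) * inner (v t) \<xi>) \<in> borel_measurable (time_measure T)"
      by (intro borel_measurable_times exp_time_measurable borel_measurable_inner vm) simp
    show "(\<lambda>t. exp (- (l * t)) * frac_int \<alpha> y t) \<in> borel_measurable (time_measure T)"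
      by (intro borel_measurable_times exp_time_measurable Jm)
  qed
  finally have 2: "inner (LINT t|time_measure T. exp (- (l * t)) *\<^sub>R v t) \<xi> = (LINT t|time_measure T. exp (- (l * t)) * frac_int \<alpha> y t)" .
  have "norm \<xi> * norm \<xi> = \<bar>inner ?R \<xi>\<bar>" by (simp add: \<xi>_def power2_norm_eq_inner[symmetric] power2_eq_square)
  also have "inner ?R \<xi> = l powr (- \<alpha>) * (LINT s|time_measure T. exp (- (l * s)) * y s) - (LINT t|time_measure T. exp (- (l * t)) * frac_int \<alpha> y t)"
    by (simp only: inner_diff_left inner_scaleR_left 1 2)
  also have "\<bar>\<dots>\<bar> \<le> exp (- (l * T)) * l powr (- \<alpha>) * (LINT s|time_measure T. \<bar>y s\<bar>)"
    by (rule laplace_frac_int[OF \<alpha> l ys])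
  also have "\<dots> \<le> exp (- (l * T)) * l powr (- \<alpha>) * (LINT s|time_measure T. norm (w s) * norm \<xi>)"
  proof (intro mult_left_mono integral_mono_AE)
    show "integrable (time_measure T) (\<lambda>s. \<bar>y s\<bar>)" using sq_norm_integrable_imp_integrable[OF ys] by auto
    show "integrable (time_measure T) (\<lambda>s. norm (w s) * norm \<xi>)" using wi by auto
    show "AE s in time_measure T. \<bar>y s\<bar> \<le> norm (w s) * norm \<xi>" by (simp add: y_def Cauchy_Schwarz_ineq2)
  qed auto
  also have "\<dots> = ?B * norm \<xi>" using wi by (simp add: mult.assoc)
  finally have "norm \<xi> * norm \<xi> \<le> ?B * norm \<xi>" .
  moreover have "norm \<xi> > 0" using False by (simp add: \<xi>_def)
  ultimately have "norm \<xi> \<le> ?B" by (rule mult_right_le_imp_le)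
  then show ?thesis by (simp add: \<xi>_def)
qed

context elliptic_coefficients
begin

text \<open>The argument with Laplace transforms, for functions of time. The constant \<open>e\<close> is chosen such that the
  contribution of \<open>f\<close> to the right-hand side of the resolvent bound is half of the left-hand side.\<close>

lemma source_eq_zero:
  assumes T: "T > 0" and \<alpha>: "0 < \<alpha>" "\<alpha> < 1" and \<theta>: "\<theta> \<in> L2_on \<Omega>" and \<theta>f: "inner \<theta> f \<noteq> 0"
    and z: "z \<in> valued_in T (H2_graph \<Omega>)" and w: "sq_norm_integrable T w"
    and g: "sq_norm_integrable T (g :: real \<Rightarrow> real)"
    and zw: "AE t in time_measure T. fst (z t) = frac_int \<alpha> w t"
    and eq: "AE t in time_measure T. w t + elliptic_jet \<Omega> a b c (z t) = g t *\<^sub>R f"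
    and obs: "AE t in time_measure T. inner \<theta> (w t) = 0"
  shows "AE t in time_measure T. g t = 0"
proof -
  let ?A = "elliptic_jet \<Omega> a b c"
  have zs: "sq_norm_integrable T z" using z by (simp add: valued_in_def)
  have As: "sq_norm_integrable T (\<lambda>t. ?A (z t))"
    using valued_in_bounded_linear[OF bounded_linear_elliptic_jet z, of UNIV] by (simp add: valued_in_def)
  have vs: "sq_norm_integrable T (\<lambda>t. fst (z t))"
    using valued_in_bounded_linear[OF bounded_linear_fst z, of UNIV] by (simp add: valued_in_def)
  have fm: "norm f > 0" using \<theta>f by auto
  define e where "e = \<bar>inner \<theta> f\<bar> / (2 * norm f)"
  have e: "e > 0" using fm \<theta>f by (simp add: e_def)
  obtain p0 where p0: "p0 > 0" "\<And>p z. p \<ge> p0 \<Longrightarrow> z \<in> H2_graph \<Omega> \<Longrightarrow> \<bar>inner \<theta> (?A z)\<bar> \<le> e * norm (p *\<^sub>R fst z + ?A z)"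
    using elliptic_resolvent_bound[OF \<theta> e] by blast
  define l0 where "l0 = max 1 (p0 powr (1 / \<alpha>))"
  define N where "N = (LINT s|time_measure T. norm (w s))"
  show ?thesis
  proof (rule bounded_exp_moments_imp_AE_zero[OF sq_norm_integrable_imp_integrable[OF g] T])
    fix l assume l: "l \<ge> l0"
    have l1: "l > 0" "l \<ge> 0" using l by (auto simp: l0_def)
    define p where "p = l powr \<alpha>"
    have pp: "p \<ge> p0"
    proof -
      have "(p0 powr (1 / \<alpha>)) powr \<alpha> \<le> l powr \<alpha>" using l \<alpha> by (intro powr_mono2) (auto simp: l0_def)
      then show ?thesis using p0(1) \<alpha> by (simp add: p_def powr_powr)
    qed
    have p_pos: "p > 0" using pp p0(1) by linarith
    have pinv: "l powr (- \<alpha>) = 1 / p" by (simp add: p_def powr_minus_divide)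
    define zh where "zh = (LINT t|time_measure T. exp (- (l * t)) *\<^sub>R z t)"
    define wh where "wh = (LINT t|time_measure T. exp (- (l * t)) *\<^sub>R w t)"
    define gh where "gh = (LINT t|time_measure T. exp (- (l * t)) * g t)"
    define R where "R = (1 / p) *\<^sub>R wh - fst zh"
    \<comment> \<open>the graph is a closed subspace, so the transform stays in the domain of the operator\<close>
    have zh: "zh \<in> H2_graph \<Omega>"
      unfolding zh_def
      by (rule integral_in_closed_subspace[OF subspace_H2_graph closed_H2_graph[OF \<Omega>_meas] integrable_laplace[OF l1(2) zs]])
        (use z in \<open>simp add: valued_in_def subspace_scale[OF subspace_H2_graph]\<close>)
    have fz: "fst zh = (LINT t|time_measure T. exp (- (l * t)) *\<^sub>R fst (z t))"
      unfolding zh_def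
      by (subst integral_bounded_linear[OF bounded_linear_fst integrable_laplace[OF l1(2) zs], symmetric]) simp
    have Az: "?A zh = (LINT t|time_measure T. exp (- (l * t)) *\<^sub>R ?A (z t))"
      unfolding zh_def
      by (subst integral_bounded_linear[OF bounded_linear_elliptic_jet integrable_laplace[OF l1(2) zs], symmetric])
        (simp add: linear_scale[OF bounded_linear.linear[OF bounded_linear_elliptic_jet]])
    have gi: "integrable (time_measure T) (\<lambda>t. exp (- (l * t)) * g t)"
      using integrable_laplace[OF l1(2) g] by simp
    have "wh + ?A zh = (LINT t|time_measure T. exp (- (l * t)) *\<^sub>R w t + exp (- (l * t)) *\<^sub>R ?A (z t))"
      unfolding Az wh_def
      by (rule Bochner_Integration.integral_add[symmetric]) (intro integrable_laplace l1 w As)+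
    also have "\<dots> = (LINT t|time_measure T. (exp (- (l * t)) * g t) *\<^sub>R f)"
    proof (rule integral_cong_AE)
      show "AE t in time_measure T. exp (- (l * t)) *\<^sub>R w t + exp (- (l * t)) *\<^sub>R ?A (z t) = (exp (- (l * t)) * g t) *\<^sub>R f"
        using eq by eventually_elim (simp flip: scaleR_add_right scaleR_scaleR)
      show "(\<lambda>t. exp (- (l * t)) *\<^sub>R w t + exp (- (l * t)) *\<^sub>R ?A (z t)) \<in> borel_measurable (time_measure T)"
        by (intro borel_measurable_add borel_measurable_integrable integrable_laplace l1 w As)
      show "(\<lambda>t. (exp (- (l * t)) * g t) *\<^sub>R f) \<in> borel_measurable (time_measure T)"
        by (intro borel_measurable_integrable integrable_scaleR_left gi)
    qed
    also have "\<dots> = gh *\<^sub>R f" unfolding gh_def using gi by (intro integral_scaleR_left)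
    finally have sum: "wh + ?A zh = gh *\<^sub>R f" .
    have "inner wh \<theta> = (LINT t|time_measure T. inner (exp (- (l * t)) *\<^sub>R w t) \<theta>)"
      unfolding wh_def
      by (rule integral_bounded_linear[OF bounded_linear_inner_left integrable_laplace[OF l1(2) w], symmetric])
    also have "\<dots> = 0"
      by (rule integral_eq_zero_AE) (use obs in \<open>eventually_elim, simp add: inner_commute\<close>)
    finally have "inner \<theta> wh = 0" by (simp add: inner_commute)
    then have thA: "inner \<theta> (?A zh) = gh * inner \<theta> f"
      using arg_cong[OF sum, of "inner \<theta>"] by (simp add: inner_add_right)
    have R: "norm R \<le> exp (- (l * T)) * (1 / p) * N"
      using laplace_frac_int_vector[OF \<alpha> l1(1) w vs zw] by (simp add: R_def wh_def fz pinv N_def)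
    have "p *\<^sub>R fst zh + ?A zh = gh *\<^sub>R f - p *\<^sub>R R"
      using p_pos by (simp add: R_def scaleR_diff_right flip: sum)
    then have "\<bar>gh * inner \<theta> f\<bar> \<le> e * norm (gh *\<^sub>R f - p *\<^sub>R R)"
      using p0(2)[OF pp zh] thA by simp
    also have "\<dots> \<le> e * (\<bar>gh\<bar> * norm f + p * norm R)"
      using e p_pos norm_triangle_ineq4[of "gh *\<^sub>R f" "p *\<^sub>R R"] by (intro mult_left_mono) auto
    also have "\<dots> \<le> e * (\<bar>gh\<bar> * norm f + exp (- (l * T)) * N)"
    proof -
      have "p * norm R \<le> p * (exp (- (l * T)) * (1 / p) * N)" using R p_pos by (intro mult_left_mono) auto
      also have "\<dots> = exp (- (l * T)) * N" using p_pos by simp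
      finally show ?thesis using e by (intro mult_left_mono add_left_mono) auto
    qed
    also have "\<dots> = \<bar>gh\<bar> * \<bar>inner \<theta> f\<bar> / 2 + e * (exp (- (l * T)) * N)"
      using fm by (simp add: e_def distrib_left)
    finally have "\<bar>gh\<bar> * (\<bar>inner \<theta> f\<bar> / 2) \<le> e * (exp (- (l * T)) * N)" by (simp add: abs_mult)
    then have "\<bar>gh\<bar> \<le> (2 * e * N / \<bar>inner \<theta> f\<bar>) * exp (- (l * T))"
      using \<theta>f by (simp add: field_simps)
    from mult_left_mono[OF this, of "exp (l * T)"]
    have "exp (l * T) * \<bar>gh\<bar> \<le> (2 * e * N / \<bar>inner \<theta> f\<bar>) * (exp (l * T) * exp (- (l * T)))" by (simp add: mult_ac)
    then have "exp (l * T) * \<bar>gh\<bar> \<le> 2 * e * N / \<bar>inner \<theta> f\<bar>" unfolding exp_add[symmetric] by simp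
    moreover have "(LINT t|time_measure T. exp (l * (T - t)) * g t) = exp (l * T) * gh"
    proof -
      have "exp (l * (T - t)) = exp (l * T) * exp (- (l * t))" for t
        by (simp add: exp_add[symmetric] right_diff_distrib)
      then show ?thesis by (simp add: gh_def mult.assoc)
    qed
    ultimately show "\<bar>LINT t|time_measure T. exp (l * (T - t)) * g t\<bar> \<le> 2 * e * N / \<bar>inner \<theta> f\<bar>"
      by (simp add: abs_mult)
  qed
qed

end

lemma set_integral_eq_inner_L2_on:
  assumes "\<theta> \<in> L2_on \<Omega>" "\<Omega> \<in> sets lebesgue"
  shows "(LINT x:\<Omega>|lebesgue. rep_L2 \<theta> x * rep_L2 v x) = inner \<theta> v"
  unfolding inner_L2_eq set_lebesgue_integral_def
proof (rule integral_cong_AE)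
  show "AE x in lebesgue. indicator \<Omega> x *\<^sub>R (rep_L2 \<theta> x * rep_L2 v x) = rep_L2 \<theta> x * rep_L2 v x"
    using assms(1) unfolding L2_on_def mem_Collect_eq by eventually_elim (auto simp: indicator_def)
qed (intro borel_measurable_scaleR borel_measurable_indicator assms(2) borel_measurable_times rep_L2_measurable)+

theorem theorem7p1:
  fixes \<Omega> :: "(real ^ 'n) set"
    and a :: "'n \<Rightarrow> 'n \<Rightarrow> real ^ 'n \<Rightarrow> real"
    and b :: "'n \<Rightarrow> real ^ 'n \<Rightarrow> real"
    and c :: "real ^ 'n \<Rightarrow> real"
    and \<kappa> T \<alpha> :: real
    and \<mu> :: "real negH"
    and f \<theta> :: "(real ^ 'n) L2"
    and u :: "real \<Rightarrow> (real ^ 'n) L2"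
    and U :: "(real ^ 'n) L2 negH"
  assumes T: "T > 0"
    and \<Omega>: "bounded_smooth_domain \<Omega>"
    and a_C1: "\<And>i j. C1_closure \<Omega> (a i j)"
    and a_sym: "\<And>i j x. x \<in> \<Omega> \<Longrightarrow> a i j x = a j i x"
    and b_C1: "\<And>j. C1_closure \<Omega> (b j)"
    and c_C1: "C1_closure \<Omega> c"
    and c_nonpos: "\<And>x. x \<in> \<Omega> \<Longrightarrow> c x \<le> 0"
    and \<kappa>: "\<kappa> > 0"
    and elliptic: "\<And>x \<xi>. x \<in> \<Omega> \<Longrightarrow>
      (\<Sum>i\<in>UNIV. \<Sum>j\<in>UNIV. a i j x * (\<xi> $ i) * (\<xi> $ j)) \<ge> \<kappa> * (\<Sum>j\<in>UNIV. \<bar>\<xi> $ j\<bar>\<^sup>2)"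
    and \<alpha>: "0 < \<alpha>" "\<alpha> < 1"
    and \<mu>: "\<mu> \<in> negH \<alpha> T real_space"
    and f: "f \<in> L2_on \<Omega>"
    and \<theta>: "\<theta> \<in> L2_on \<Omega>"
    and \<theta>_f: "(LINT x:\<Omega>|lebesgue. rep_L2 \<theta> x * rep_L2 f x) \<noteq> 0"
    \<comment> \<open>\<open>u\<close> lies in the intersection of the two spaces; \<open>U\<close> is \<open>u\<close> as an element of the second\<close>
    and u_L2: "u \<in> L2T T (L2_space \<Omega>)"
    and U_negH: "U \<in> negH \<alpha> T (H2_H10_space \<Omega>)"
    and u_U: "negH_of \<alpha> T (L2_space \<Omega>) u = negH_incl \<alpha> T (L2_space \<Omega>) U"
    and equation: "negH_add \<alpha> T (L2_space \<Omega>)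
        (frac_deriv \<alpha> T (L2_space \<Omega>) u)
        (negH_apply \<alpha> T (H2_H10_space \<Omega>) (L2_space \<Omega>) (elliptic_op \<Omega> a b c) U)
      = negH_tensor \<alpha> T (L2_space \<Omega>) \<mu> f"
    and observation: "AE t in time_measure T. (LINT x:\<Omega>|lebesgue. rep_L2 \<theta> x * rep_L2 (u t) x) = 0"
  shows "\<mu> = negH_zero \<alpha> T real_space"
proof -
  have o: "open \<Omega>" and bd: "bounded \<Omega>" using \<Omega> by (auto simp: bounded_smooth_domain_def)
  have m: "\<Omega> \<in> sets lebesgue" using o by auto
  interpret E: elliptic_coefficients \<Omega> a b c \<kappa>
    by unfold_locales (fact o bd a_C1 b_C1 c_C1 \<kappa> elliptic)+
  \<comment> \<open>models for the scalar functions, for \<open>L2\<close> and for the graph of the derivatives\<close>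
  interpret R: hspace_model real_space UNIV "\<lambda>x. x" T \<alpha> by (rule hspace_model_real[OF T \<alpha>(1)])
  interpret L: hspace_model "L2_space \<Omega>" "L2_on \<Omega>" "\<lambda>x. x" T \<alpha> by (rule hspace_model_L2[OF T \<alpha>(1) o])
  interpret H: hspace_model "H2_H10_space \<Omega>" "H2_graph \<Omega>" fst T \<alpha> by (rule hspace_model_H2_H10[OF T \<alpha>(1) o])
  let ?A = "elliptic_jet \<Omega> a b c"
  obtain g where g: "g \<in> valued_in T UNIV" "\<mu> = R.limit_class g" using R.negH_eq_limit_class[OF \<mu>] by metis
  obtain z where z: "z \<in> valued_in T (H2_graph \<Omega>)" "U = H.limit_class z" using H.negH_eq_limit_class[OF U_negH] by metis
  obtain w where w: "L.repr u w" using L.L2T_imp_repr[OF u_L2] by blast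
  have wV: "w \<in> valued_in T (L2_on \<Omega>)" and uw: "AE t in time_measure T. u t = w t" using w by (auto simp: L.repr_def)
  have gs: "sq_norm_integrable T g" and ws: "sq_norm_integrable T w" using g(1) wV by (auto simp: valued_in_def)
  have fst_graph: "fst y \<in> L2_on \<Omega>" if "y \<in> H2_graph \<Omega>" for y
    using H10_graph_has_weak_pdv(1)[OF m, of "(fst y, fst (snd y))"] that by (simp add: H2_graph_def)
  have fz: "(\<lambda>t. fst (z t)) \<in> valued_in T (L2_on \<Omega>)"
    by (rule valued_in_bounded_linear[OF bounded_linear_fst z(1)])
      (rule fst_graph)
  have Az: "(\<lambda>t. ?A (z t)) \<in> valued_in T (L2_on \<Omega>)"
    by (rule valued_in_bounded_linear[OF E.bounded_linear_elliptic_jet z(1) E.elliptic_jet_in_L2_on])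
  have gf: "(\<lambda>t. g t *\<^sub>R f) \<in> valued_in T (L2_on \<Omega>)"
    by (rule valued_in_bounded_linear[OF bounded_linear_scaleR_left g(1)]) (intro L2_on_scaleR f)

  have "AE t in time_measure T. w t + ?A (z t) = g t *\<^sub>R f"
  proof -
    have "frac_deriv \<alpha> T (L2_space \<Omega>) u = L.limit_class w"
      unfolding frac_deriv_def by (rule L.frac_int_ext_inv_eq[OF w])
    moreover have "negH_apply \<alpha> T (H2_H10_space \<Omega>) (L2_space \<Omega>) (elliptic_op \<Omega> a b c) U = L.limit_class (\<lambda>t. ?A (z t))"
      unfolding negH_apply_def
    proof (rule L.frac_int_ext_inv_eq)
      have "AE t in time_measure T. frac_int_ext \<alpha> T (H2_H10_space \<Omega>) U t = fst (z t)"
        using H.repr_frac_int_ext[OF z(1)] z(2) by (simp add: H.repr_def)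
      then have "AE t in time_measure T. elliptic_op \<Omega> a b c (frac_int_ext \<alpha> T (H2_H10_space \<Omega>) U t) = ?A (z t)"
        by eventually_elim (use z(1) in \<open>simp add: valued_in_def E.elliptic_op_eq_jet\<close>)
      then show "L.repr (\<lambda>t. elliptic_op \<Omega> a b c (frac_int_ext \<alpha> T (H2_H10_space \<Omega>) U t)) (\<lambda>t. ?A (z t))"
        unfolding L.repr_def using Az by (intro conjI)
    qed
    moreover have "negH_tensor \<alpha> T (L2_space \<Omega>) \<mu> f = L.limit_class (\<lambda>t. g t *\<^sub>R f)"
      unfolding negH_tensor_def
    proof (rule L.frac_int_ext_inv_eq)
      have "AE t in time_measure T. frac_int_ext \<alpha> T real_space \<mu> t = g t"
        using R.repr_frac_int_ext[OF g(1)] g(2) by (simp add: R.repr_def)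
      then have "AE t in time_measure T. frac_int_ext \<alpha> T real_space \<mu> t *\<^sub>R f = g t *\<^sub>R f" by eventually_elim simp
      then show "L.repr (\<lambda>t. frac_int_ext \<alpha> T real_space \<mu> t *\<^sub>R f) (\<lambda>t. g t *\<^sub>R f)"
        unfolding L.repr_def using gf by (intro conjI)
    qed
    ultimately have "L.limit_class (\<lambda>t. w t + ?A (z t)) = L.limit_class (\<lambda>t. g t *\<^sub>R f)"
      using equation L.negH_add_limit_class[OF wV Az] by simp
    then show ?thesis
      using L.limit_class_eq_iff[OF valued_in_add[OF subspace_L2_on wV Az] gf] by simp
  qed
  moreover have "AE t in time_measure T. fst (z t) = frac_int \<alpha> w t"
  proof -
    \<comment> \<open>the approximating sequences of \<open>U\<close> and the constant sequence \<open>u\<close> have the same limit in \<open>L2\<close>\<close>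
    have const: "L.has_limit (\<lambda>n. u) (L.J w)" by (rule L.has_limit_const[OF w])
    have "negH_of \<alpha> T (L2_space \<Omega>) u = L.limit_class (L.J w)"
      unfolding negH_of_def by (rule L.rel_image_eq_limit_class[OF const])
    then have "(\<lambda>n. u) \<in> negH_of \<alpha> T (L2_space \<Omega>) u" using const by (simp add: L.limit_class_def)
    then obtain v where v: "H.has_limit v z" and rel: "(v, \<lambda>n. u) \<in> negH_rel \<alpha> T (L2_space \<Omega>)"
      using u_U z(2) by (auto simp: negH_incl_def H.limit_class_def)
    obtain y where y: "\<And>n. H.repr (v n) (y n)" "(\<lambda>n. sq_dist T (H.J (y n)) z) \<longlonglongrightarrow> 0"
      using v unfolding H.has_limit_def by blast
    have yV: "y n \<in> valued_in T (H2_graph \<Omega>)" for n using y(1) by (simp add: H.repr_def)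
    have fy: "(\<lambda>t. fst (y n t)) \<in> valued_in T (L2_on \<Omega>)" for n
      by (rule valued_in_bounded_linear[OF bounded_linear_fst yV])
        (rule fst_graph)
    have Lv: "L.repr (v n) (\<lambda>t. fst (y n t))" for n
      using y(1)[of n] fy by (simp add: L.repr_def H.repr_def)
    have "L.has_limit v (\<lambda>t. fst (z t))"
      unfolding L.has_limit_def
    proof (intro conjI fz exI[of _ "\<lambda>n t. fst (y n t)"] allI Lv)
      show "(\<lambda>n. sq_dist T (L.J (\<lambda>t. fst (y n t))) (\<lambda>t. fst (z t))) \<longlonglongrightarrow> 0"
      proof (rule Lim_null_comparison[OF always_eventually y(2)], rule allI)
        fix n
        have ys: "sq_norm_integrable T (y n)" and Js: "sq_norm_integrable T (H.J (y n))" and zs: "sq_norm_integrable T z"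
          using yV H.J_valued_in z(1) by (auto simp: valued_in_def)
        have Ls: "sq_norm_integrable T (L.J (\<lambda>t. fst (y n t)))" and fzs: "sq_norm_integrable T (\<lambda>t. fst (z t))"
          using L.J_valued_in[OF fy] fz by (auto simp: valued_in_def)
        have ae: "AE t in time_measure T. L.J (\<lambda>t. fst (y n t)) t = fst (H.J (y n) t)"
          using frac_int_bounded_linear[OF bounded_linear_fst \<alpha>(1) ys]
        proof eventually_elim
          case (elim t)
          then show ?case
            by (cases "t \<in> {0<..<T}") (simp_all only: L.J_def H.J_def if_True if_False fst_zero)
        qed
        have "sq_dist T (L.J (\<lambda>t. fst (y n t))) (\<lambda>t. fst (z t)) \<le> sq_dist T (H.J (y n)) z"
          unfolding sq_dist_def
        proof (rule integral_mono_AE)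
          show "AE t in time_measure T. (norm (L.J (\<lambda>t. fst (y n t)) t - fst (z t)))\<^sup>2 \<le> (norm (H.J (y n) t - z t))\<^sup>2"
            using ae
          proof eventually_elim
            case (elim t)
            have "norm (fst (H.J (y n) t - z t)) \<le> norm (H.J (y n) t - z t)"
              using norm_fst_le[of "fst (H.J (y n) t - z t)" "snd (H.J (y n) t - z t)"]
              unfolding prod.collapse .
            then have "norm (L.J (\<lambda>t. fst (y n t)) t - fst (z t)) \<le> norm (H.J (y n) t - z t)"
              by (simp only: elim fst_diff)
            then show ?case by (rule power_mono) (rule norm_ge_zero)
          qed
          show "integrable (time_measure T) (\<lambda>t. (norm (L.J (\<lambda>t. fst (y n t)) t - fst (z t)))\<^sup>2)"
            using sq_norm_integrable_diff[OF Ls fzs] unfolding sq_norm_integrable_def by (rule conjunct2)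
          show "integrable (time_measure T) (\<lambda>t. (norm (H.J (y n) t - z t))\<^sup>2)"
            using sq_norm_integrable_diff[OF Js zs] unfolding sq_norm_integrable_def by (rule conjunct2)
        qed
        then show "norm (sq_dist T (L.J (\<lambda>t. fst (y n t))) (\<lambda>t. fst (z t))) \<le> sq_dist T (H.J (y n)) z"
          unfolding real_norm_def abs_of_nonneg[OF sq_dist_nonneg] .
      qed
    qed
    from L.rel_iff_limits[OF this const] rel have "AE t in time_measure T. fst (z t) = L.J w t" by simp
    then show ?thesis using L.J_AE[of w]
    proof eventually_elim
      case (elim t)
      show ?case by (rule trans[OF elim(1) elim(2)[symmetric]])
    qed
  qed
  moreover have "AE t in time_measure T. inner \<theta> (w t) = 0"
    using observation uw by eventually_elim (simp add: set_integral_eq_inner_L2_on[OF \<theta> m])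
  moreover have "inner \<theta> f \<noteq> 0" using \<theta>_f by (simp add: set_integral_eq_inner_L2_on[OF \<theta> m])
  ultimately have "AE t in time_measure T. g t = 0"
    by (intro E.source_eq_zero[OF T \<alpha> \<theta> _ z(1) ws gs])
  then have "R.limit_class g = R.limit_class (\<lambda>t. 0)"
    by (subst R.limit_class_eq_iff[OF g(1)]) (simp_all add: valued_in_def sq_norm_integrable_zero)
  then show "\<mu> = negH_zero \<alpha> T real_space" by (simp add: g(2) R.negH_zero_eq)
qed

end
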